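(* Let $\mathbb F$ be an algebraically closed field, $\mathrm{char}\,\mathbb F\ne2$. Let $n\ge3$ if $\mathrm{char}\,\mathbb F\ne3$ and $n\ge4$ if $\mathrm{char}\,\mathbb F=3$. Let $T$ be a finite abelian group with a nondegenerate alternating bicharacter $\beta\colon T\times T\to\mathbb F^\times$, and let $k\ge1$ be an integer with $k\sqrt{|T|}=n$, where $k\ge3$ if $T$ is an elementary $2$-group. Consider the fine grading $\Gamma=\Gamma_A^{\mathrm{(I)}}(T,k)$ on $\mathfrak{psl}_n(\mathbb F)$ defined in the context. Then its Weyl group is $$W(\Gamma)\cong T^{k-1}\rtimes\big(\mathrm{Sym}(k)\times\overline{\mathrm{Aut}}(T,\beta)\big),$$ with $\mathrm{Sym}(k)$ and $\overline{\mathrm{Aut}}(T,\beta)$ acting on $T^{k-1}$ through their natural action on $T^k$ and identification of $T^{k-1}$ with $T^k/T$, where $T$ is imbedded into $T^k$ diagonally.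
   Context: Gradings. All grading groups are abelian. For a grading $\Gamma$ on an algebra $\mathcal A$, $\mathrm{Aut}(\Gamma)$ is the group of automorphisms of $\mathcal A$ that permute the components of $\Gamma$, $\mathrm{Stab}(\Gamma)$ is the subgroup of automorphisms mapping each component to itself, and the Weyl group is $W(\Gamma)=\mathrm{Aut}(\Gamma)/\mathrm{Stab}(\Gamma)$. A grading is fine if it admits no proper refinement among gradings by abelian groups. The algebra $\mathcal D$. Choose a symplectic basis of $T$ with respect to $\beta$: $T=(H_1'\times H_1'')\times\cdots\times(H_r'\times H_r'')$ with $H_i'=\langle a_i\rangle$, $H_i''=\langle b_i\rangle$ cyclic of the same order $\ell_i$, $\varepsilon_i=\beta(a_i,b_i)$ a primitive $\ell_i$-th root of unity, and all other values of $\beta$ on pairs of the elements $a_1,b_1,\ldots,a_r,b_r$ (up to order) equal to $1$. Let $\mathcal D=M_{\ell_1}(\mathbb F)\otimes\cdots\otimes M_{\ell_r}(\mathbb F)=M_\ell(\mathbb F)$, $\ell=\sqrt{|T|}$ (Kronecker product). Let $X_{a_i}$ (respectively $X_{b_i}$) be the tensor with $\mathrm{diag}(\varepsilon_i^{\ell_i-1},\varepsilon_i^{\ell_i-2},\ldots,\varepsilon_i,1)$ (respectively the cyclic permutation matrix $E_{12}+E_{23}+\cdots+E_{\ell_i-1,\ell_i}+E_{\ell_i,1}$) in the $i$-th factor and identities elsewhere, and for $t=a_1^{i_1}b_1^{j_1}\cdots a_r^{i_r}b_r^{j_r}$ set $X_t=X_{a_1}^{i_1}X_{b_1}^{j_1}\cdots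 X_{a_r}^{i_r}X_{b_r}^{j_r}$. Then $\mathcal D=\bigoplus_{t\in T}\mathbb FX_t$ is a $T$-grading with all nonzero homogeneous elements invertible and $X_uX_v=\beta(u,v)X_vX_u$. The grading. Let $\widetilde G(T,k)$ be the abelian group freely generated by $T$ and symbols $\widetilde g_1,\ldots,\widetilde g_k$ (so $\widetilde G(T,k)\cong T\times\mathbb Z^k$). Identify $\mathcal R=M_n(\mathbb F)$ with $M_k(\mathcal D)=M_k(\mathbb F)\otimes\mathcal D$ and let $\Gamma_{\mathcal M}(T,k)$ be the grading on $\mathcal R$ with $\deg(E_{ij}\otimes X_t)=\widetilde g_i\,t\,\widetilde g_j^{-1}$. Its support generates a subgroup $\widetilde G(T,k)^0\cong T\times\mathbb Z^{k-1}$. Let $\mathcal L=\mathfrak{psl}_n(\mathbb F)=[\mathcal R,\mathcal R]/(Z(\mathcal R)\cap[\mathcal R,\mathcal R])$. $\Gamma_A^{\mathrm{(I)}}(T,k)$ is the $\widetilde G(T,k)^0$-grading on $\mathcal L$ obtained from $\Gamma_{\mathcal M}(T,k)$ by restriction to $[\mathcal R,\mathcal R]$ and passing modulo the center. Groups. $\mathrm{Sym}(k)$ is the symmetric group, $\mathrm{Aut}(T,\beta)$ is the group of automorphisms of $T$ preserving $\beta$, and $\overline{\mathrm{Aut}}(T,\beta)=\mathrm{Aut}(T,\beta)\rtimes\langle\sigma\rangle$, where $\sigma$ is an element of order $2$ acting on $T$ as the automorphism sending $a_i\mapsto a_i^{-1}$, $b_i\mapsto b_i$ for all $i$, and acting on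 $\mathrm{Aut}(T,\beta)$ by $(\sigma\cdot\alpha)(t)=\sigma\cdot\alpha(\sigma\cdot t)$ (if $T$ is an elementary $2$-group then $\sigma$ acts trivially but still has order $2$). $\mathrm{Sym}(k)$ acts on $T^k$ by permuting components and $\overline{\mathrm{Aut}}(T,\beta)$ acts on $T^k$ componentwise. *)

theory Defs
  imports
    "HOL-Algebra.Bij"
    "HOL-Algebra.Sym_Groups"
    "HOL-Algebra.Product_Groups"
    "HOL-Algebra.Free_Abelian_Groups"
    "HOL-Algebra.Multiplicative_Group"
    "Jordan_Normal_Form.VS_Connect"
begin

section \<open>Weyl groups of gradings\<close>

text \<open>
  A possibly nonassociative algebra over \<open>'f\<close> is a \<open>module\<close> record whose \<open>mult\<close> field is the
  product (for a Lie algebra: the bracket); the field \<open>one\<close> is irrelevant.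
\<close>

definition alg_automorphisms :: "('f, 'v) module \<Rightarrow> ('v \<Rightarrow> 'v) set" where
  "alg_automorphisms L = {f \<in> Bij (carrier L).
     (\<forall>x\<in>carrier L. \<forall>y\<in>carrier L. f (x \<oplus>\<^bsub>L\<^esub> y) = f x \<oplus>\<^bsub>L\<^esub> f y) \<and>
     (\<forall>c. \<forall>x\<in>carrier L. f (c \<odot>\<^bsub>L\<^esub> x) = c \<odot>\<^bsub>L\<^esub> f x) \<and>
     (\<forall>x\<in>carrier L. \<forall>y\<in>carrier L. f (x \<otimes>\<^bsub>L\<^esub> y) = f x \<otimes>\<^bsub>L\<^esub> f y)}"

text \<open>
  A \<open>G\<close>-grading on \<open>L\<close> is given by the family of its subspaces \<open>\<Gamma> g\<close> for \<open>g \<in> carrier G\<close>; its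
  components are the nonzero ones among these.
\<close>

definition grading_components ::
    "('f, 'v) module \<Rightarrow> ('g, 'c) monoid_scheme \<Rightarrow> ('g \<Rightarrow> 'v set) \<Rightarrow> 'v set set" where
  "grading_components L G \<Gamma> = {\<Gamma> g | g. g \<in> carrier G \<and> \<Gamma> g \<noteq> {\<zero>\<^bsub>L\<^esub>}}"

definition grading_aut_group ::
    "('f, 'v) module \<Rightarrow> ('g, 'c) monoid_scheme \<Rightarrow> ('g \<Rightarrow> 'v set) \<Rightarrow> ('v \<Rightarrow> 'v) monoid" where
  "grading_aut_group L G \<Gamma> = (BijGroup (carrier L))
     \<lparr>carrier := {f \<in> alg_automorphisms L.
        (\<lambda>C. f ` C) ` grading_components L G \<Gamma> = grading_components L G \<Gamma>}\<rparr>"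

definition grading_stab ::
    "('f, 'v) module \<Rightarrow> ('g, 'c) monoid_scheme \<Rightarrow> ('g \<Rightarrow> 'v set) \<Rightarrow> ('v \<Rightarrow> 'v) set" where
  "grading_stab L G \<Gamma> =
     {f \<in> alg_automorphisms L. \<forall>C\<in>grading_components L G \<Gamma>. f ` C = C}"

definition weyl_group ::
    "('f, 'v) module \<Rightarrow> ('g, 'c) monoid_scheme \<Rightarrow> ('g \<Rightarrow> 'v set) \<Rightarrow> ('v \<Rightarrow> 'v) set monoid" where
  "weyl_group L G \<Gamma> = grading_aut_group L G \<Gamma> Mod grading_stab L G \<Gamma>"


section \<open>The Lie algebra \<open>psl\<close>\<close>

definition commutator_space :: "'f::field itself \<Rightarrow> nat \<Rightarrow> 'f mat set" where
  "commutator_space ty n = LinearCombinations.module.span class_ring (module_mat TYPE('f) n n)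
     {A * B - B * A | A B. A \<in> carrier_mat n n \<and> B \<in> carrier_mat n n}"

definition mat_center :: "'f::field itself \<Rightarrow> nat \<Rightarrow> 'f mat set" where
  "mat_center ty n = {A \<in> carrier_mat n n. \<forall>B\<in>carrier_mat n n. A * B = B * A}"

definition psl_kernel :: "'f::field itself \<Rightarrow> nat \<Rightarrow> 'f mat set" where
  "psl_kernel ty n = mat_center ty n \<inter> commutator_space ty n"

definition psl_class :: "nat \<Rightarrow> 'f::field mat \<Rightarrow> 'f mat set" where
  "psl_class n A = psl_kernel TYPE('f) n +>\<^bsub>module_mat TYPE('f) n n\<^esub> A"

text \<open>
  The quotient Lie algebra, with cosets as elements and operations on cosets in the style of the
  quotient rings of \<open>HOL-Algebra\<close>.
\<close>

definition psl :: "'f::field itself \<Rightarrow> nat \<Rightarrow> ('f, 'f mat set) module" where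
  "psl ty n = \<lparr>
     carrier = psl_class n ` commutator_space ty n,
     monoid.mult = (\<lambda>P Q. \<Union>A\<in>P. \<Union>B\<in>Q. psl_class n (A * B - B * A)),
     one = undefined,
     zero = psl_kernel ty n,
     add = (\<lambda>P Q. P <+>\<^bsub>module_mat TYPE('f) n n\<^esub> Q),
     module.smult = (\<lambda>c P. \<Union>A\<in>P. psl_class n (c \<cdot>\<^sub>m A))\<rparr>"


section \<open>Bicharacters and symplectic bases\<close>

definition nondegenerate_alternating_bicharacter ::
    "('a, 'c) monoid_scheme \<Rightarrow> ('a \<Rightarrow> 'a \<Rightarrow> 'f::field) \<Rightarrow> bool" where
  "nondegenerate_alternating_bicharacter T \<beta> \<longleftrightarrow>
     (\<forall>u\<in>carrier T. \<forall>v\<in>carrier T. \<beta> u v \<noteq> 0) \<and>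
     (\<forall>u\<in>carrier T. \<forall>v\<in>carrier T. \<forall>w\<in>carrier T. \<beta> (u \<otimes>\<^bsub>T\<^esub> v) w = \<beta> u w * \<beta> v w) \<and>
     (\<forall>u\<in>carrier T. \<forall>v\<in>carrier T. \<forall>w\<in>carrier T. \<beta> u (v \<otimes>\<^bsub>T\<^esub> w) = \<beta> u v * \<beta> u w) \<and>
     (\<forall>u\<in>carrier T. \<beta> u u = 1) \<and>
     (\<forall>u\<in>carrier T. (\<forall>v\<in>carrier T. \<beta> u v = 1) \<longrightarrow> u = \<one>\<^bsub>T\<^esub>)"

definition elementary_2_group :: "('a, 'c) monoid_scheme \<Rightarrow> bool" where
  "elementary_2_group T \<longleftrightarrow> (\<forall>t\<in>carrier T. t \<otimes>\<^bsub>T\<^esub> t = \<one>\<^bsub>T\<^esub>)"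

definition primitive_root_of_unity :: "nat \<Rightarrow> 'f::field \<Rightarrow> bool" where
  "primitive_root_of_unity m z \<longleftrightarrow> z ^ m = 1 \<and> (\<forall>j. 0 < j \<and> j < m \<longrightarrow> z ^ j \<noteq> 1)"

definition basis_exponents ::
    "('a, 'c) monoid_scheme \<Rightarrow> nat \<Rightarrow> (nat \<Rightarrow> 'a) \<Rightarrow> (nat \<Rightarrow> 'a) \<Rightarrow> ((nat \<Rightarrow> nat) \<times> (nat \<Rightarrow> nat)) set" where
  "basis_exponents T r a b =
     (\<Pi>\<^sub>E i\<in>{..<r}. {..<group.ord T (a i)}) \<times> (\<Pi>\<^sub>E i\<in>{..<r}. {..<group.ord T (b i)})"

definition basis_word ::
    "('a, 'c) monoid_scheme \<Rightarrow> nat \<Rightarrow> (nat \<Rightarrow> 'a) \<Rightarrow> (nat \<Rightarrow> 'a) \<Rightarrow> (nat \<Rightarrow> nat) \<times> (nat \<Rightarrow> nat) \<Rightarrow> 'a" where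
  "basis_word T r a b = (\<lambda>(e, f). \<Otimes>\<^bsub>T\<^esub>i\<in>{..<r}. a i [^]\<^bsub>T\<^esub> e i \<otimes>\<^bsub>T\<^esub> b i [^]\<^bsub>T\<^esub> f i)"

text \<open>
  The bijectivity condition says that \<open>T\<close> is the internal direct product of the cyclic groups
  generated by the \<open>a i\<close> and \<open>b i\<close>. The pairs of basis elements are indexed by \<open>{..<r}\<close>.
\<close>

definition symplectic_basis ::
    "('a, 'c) monoid_scheme \<Rightarrow> ('a \<Rightarrow> 'a \<Rightarrow> 'f::field) \<Rightarrow> nat \<Rightarrow> (nat \<Rightarrow> 'a) \<Rightarrow> (nat \<Rightarrow> 'a) \<Rightarrow> bool" where
  "symplectic_basis T \<beta> r a b \<longleftrightarrow>
     (\<forall>i<r. a i \<in> carrier T \<and> b i \<in> carrier T \<and> group.ord T (a i) = group.ord T (b i)) \<and>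
     bij_betw (basis_word T r a b) (basis_exponents T r a b) (carrier T) \<and>
     (\<forall>i<r. primitive_root_of_unity (group.ord T (a i)) (\<beta> (a i) (b i))) \<and>
     (\<forall>i<r. \<forall>j<r. \<beta> (a i) (a j) = 1 \<and> \<beta> (b i) (b j) = 1) \<and>
     (\<forall>i<r. \<forall>j<r. i \<noteq> j \<longrightarrow> \<beta> (a i) (b j) = 1 \<and> \<beta> (b j) (a i) = 1)"


section \<open>The graded division algebra \<open>D\<close>\<close>

definition kronecker :: "'f::semiring_1 mat \<Rightarrow> 'f mat \<Rightarrow> 'f mat" where
  "kronecker A B = mat (dim_row A * dim_row B) (dim_col A * dim_col B)
     (\<lambda>(i, j). A $$ (i div dim_row B, j div dim_col B) * B $$ (i mod dim_row B, j mod dim_col B))"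

text \<open>The Kronecker product with factor \<open>M\<close> in position \<open>i\<close> and identity matrices elsewhere.\<close>

definition tensor_factor ::
    "('a, 'c) monoid_scheme \<Rightarrow> nat \<Rightarrow> (nat \<Rightarrow> 'a) \<Rightarrow> nat \<Rightarrow> 'f::semiring_1 mat \<Rightarrow> 'f mat" where
  "tensor_factor T r a i M =
     foldr kronecker (map (\<lambda>j. if j = i then M else 1\<^sub>m (group.ord T (a j))) [0..<r]) (1\<^sub>m 1)"

definition clock_mat :: "nat \<Rightarrow> 'f::field \<Rightarrow> 'f mat" where
  "clock_mat l \<epsilon> = mat_diag l (\<lambda>i. \<epsilon> ^ (l - 1 - i))"

definition shift_mat :: "nat \<Rightarrow> 'f::field mat" where
  "shift_mat l = mat l l (\<lambda>(i, j). if j = (i + 1) mod l then 1 else 0)"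

definition X_word ::
    "('a, 'c) monoid_scheme \<Rightarrow> ('a \<Rightarrow> 'a \<Rightarrow> 'f::field) \<Rightarrow> nat \<Rightarrow> (nat \<Rightarrow> 'a) \<Rightarrow> (nat \<Rightarrow> 'a) \<Rightarrow>
     (nat \<Rightarrow> nat) \<times> (nat \<Rightarrow> nat) \<Rightarrow> 'f mat" where
  "X_word T \<beta> r a b = (\<lambda>(e, f). foldr (*)
     (map (\<lambda>i. tensor_factor T r a i (clock_mat (group.ord T (a i)) (\<beta> (a i) (b i))) ^\<^sub>m e i *
               tensor_factor T r a i (shift_mat (group.ord T (b i))) ^\<^sub>m f i) [0..<r])
     (1\<^sub>m (\<Prod>i<r. group.ord T (a i))))"

definition X_elem ::
    "('a, 'c) monoid_scheme \<Rightarrow> ('a \<Rightarrow> 'a \<Rightarrow> 'f::field) \<Rightarrow> nat \<Rightarrow> (nat \<Rightarrow> 'a) \<Rightarrow> (nat \<Rightarrow> 'a) \<Rightarrow> 'a \<Rightarrow> 'f mat" where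
  "X_elem T \<beta> r a b t =
     X_word T \<beta> r a b (inv_into (basis_exponents T r a b) (basis_word T r a b) t)"


section \<open>The grading\<close>

text \<open>
  The generator \<open>g\<^sub>i\<close> is \<open>(\<one>\<^bsub>T\<^esub>, frag_of i)\<close>; the indices \<open>i\<close> run over \<open>{..<k}\<close>, matching the row and
  column indices of matrices.
\<close>

definition G_tilde :: "('a, 'c) monoid_scheme \<Rightarrow> nat \<Rightarrow> ('a \<times> (nat \<Rightarrow>\<^sub>0 int)) monoid" where
  "G_tilde T k = T \<times>\<times> free_Abelian_group {..<k}"

definition unit_degree ::
    "('a, 'c) monoid_scheme \<Rightarrow> nat \<Rightarrow> nat \<Rightarrow> 'a \<Rightarrow> nat \<Rightarrow> 'a \<times> (nat \<Rightarrow>\<^sub>0 int)" where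
  "unit_degree T k i t j =
     (\<one>\<^bsub>T\<^esub>, frag_of i) \<otimes>\<^bsub>G_tilde T k\<^esub> (t, 0) \<otimes>\<^bsub>G_tilde T k\<^esub> inv\<^bsub>G_tilde T k\<^esub> (\<one>\<^bsub>T\<^esub>, frag_of j)"

definition G_tilde_0 :: "('a, 'c) monoid_scheme \<Rightarrow> nat \<Rightarrow> ('a \<times> (nat \<Rightarrow>\<^sub>0 int)) monoid" where
  "G_tilde_0 T k = subgroup_generated (G_tilde T k)
     {unit_degree T k i t j | i t j. i < k \<and> j < k \<and> t \<in> carrier T}"

definition matrix_unit :: "nat \<Rightarrow> nat \<Rightarrow> nat \<Rightarrow> 'f::field mat" where
  "matrix_unit k i j = mat k k (\<lambda>p. if p = (i, j) then 1 else 0)"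

definition total_size :: "('a, 'c) monoid_scheme \<Rightarrow> nat \<Rightarrow> nat \<Rightarrow> (nat \<Rightarrow> 'a) \<Rightarrow> nat" where
  "total_size T k r a = k * (\<Prod>i<r. group.ord T (a i))"

definition Gamma_M ::
    "('a, 'c) monoid_scheme \<Rightarrow> ('a \<Rightarrow> 'a \<Rightarrow> 'f::field) \<Rightarrow> nat \<Rightarrow> nat \<Rightarrow> (nat \<Rightarrow> 'a) \<Rightarrow> (nat \<Rightarrow> 'a) \<Rightarrow>
     'a \<times> (nat \<Rightarrow>\<^sub>0 int) \<Rightarrow> 'f mat set" where
  "Gamma_M T \<beta> k r a b g = LinearCombinations.module.span class_ring
     (module_mat TYPE('f) (total_size T k r a) (total_size T k r a))
     {kronecker (matrix_unit k i j) (X_elem T \<beta> r a b t) | i t j.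
        i < k \<and> j < k \<and> t \<in> carrier T \<and> unit_degree T k i t j = g}"

definition Gamma_A_I ::
    "('a, 'c) monoid_scheme \<Rightarrow> ('a \<Rightarrow> 'a \<Rightarrow> 'f::field) \<Rightarrow> nat \<Rightarrow> nat \<Rightarrow> (nat \<Rightarrow> 'a) \<Rightarrow> (nat \<Rightarrow> 'a) \<Rightarrow>
     'a \<times> (nat \<Rightarrow>\<^sub>0 int) \<Rightarrow> 'f mat set set" where
  "Gamma_A_I T \<beta> k r a b g = psl_class (total_size T k r a) `
     (Gamma_M T \<beta> k r a b g \<inter> commutator_space TYPE('f) (total_size T k r a))"


section \<open>The groups in the description of the Weyl group\<close>

text \<open>\<open>\<phi>\<close> is a left action of \<open>H\<close> on \<open>N\<close> by automorphisms.\<close>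

definition semidirect ::
    "('n, 'c) monoid_scheme \<Rightarrow> ('h, 'd) monoid_scheme \<Rightarrow> ('h \<Rightarrow> 'n \<Rightarrow> 'n) \<Rightarrow> ('n \<times> 'h) monoid" where
  "semidirect N H \<phi> = \<lparr>
     carrier = carrier N \<times> carrier H,
     monoid.mult = (\<lambda>(x, h) (y, h'). (x \<otimes>\<^bsub>N\<^esub> \<phi> h y, h \<otimes>\<^bsub>H\<^esub> h')),
     one = (\<one>\<^bsub>N\<^esub>, \<one>\<^bsub>H\<^esub>)\<rparr>"

definition Aut_form :: "('a, 'c) monoid_scheme \<Rightarrow> ('a \<Rightarrow> 'a \<Rightarrow> 'f::field) \<Rightarrow> ('a \<Rightarrow> 'a) monoid" where
  "Aut_form T \<beta> = (AutoGroup T)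
     \<lparr>carrier := {\<alpha> \<in> auto T. \<forall>u\<in>carrier T. \<forall>v\<in>carrier T. \<beta> (\<alpha> u) (\<alpha> v) = \<beta> u v}\<rparr>"

definition sigma_aut ::
    "('a, 'c) monoid_scheme \<Rightarrow> nat \<Rightarrow> (nat \<Rightarrow> 'a) \<Rightarrow> (nat \<Rightarrow> 'a) \<Rightarrow> 'a \<Rightarrow> 'a" where
  "sigma_aut T r a b =
     (THE \<tau>. \<tau> \<in> auto T \<and> (\<forall>i<r. \<tau> (a i) = inv\<^bsub>T\<^esub> (a i) \<and> \<tau> (b i) = b i))"

text \<open>
  The group \<open>\<langle>\<sigma>\<rangle>\<close> is the abstract group \<open>integer_mod_group 2\<close> with \<open>\<sigma> = 1\<close>, so \<open>\<sigma>\<close> has order 2 even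
  when it acts trivially.
\<close>

definition sigma_act ::
    "('a, 'c) monoid_scheme \<Rightarrow> nat \<Rightarrow> (nat \<Rightarrow> 'a) \<Rightarrow> (nat \<Rightarrow> 'a) \<Rightarrow> int \<Rightarrow> 'a \<Rightarrow> 'a" where
  "sigma_act T r a b s t = (if s = 0 then t else sigma_aut T r a b t)"

definition Aut_bar ::
    "('a, 'c) monoid_scheme \<Rightarrow> ('a \<Rightarrow> 'a \<Rightarrow> 'f::field) \<Rightarrow> nat \<Rightarrow> (nat \<Rightarrow> 'a) \<Rightarrow> (nat \<Rightarrow> 'a) \<Rightarrow>
     (('a \<Rightarrow> 'a) \<times> int) monoid" where
  "Aut_bar T \<beta> r a b = semidirect (Aut_form T \<beta>) (integer_mod_group 2)
     (\<lambda>s \<alpha>. \<lambda>t\<in>carrier T. sigma_act T r a b s (\<alpha> (sigma_act T r a b s t)))"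

definition Aut_bar_act ::
    "('a, 'c) monoid_scheme \<Rightarrow> nat \<Rightarrow> (nat \<Rightarrow> 'a) \<Rightarrow> (nat \<Rightarrow> 'a) \<Rightarrow> ('a \<Rightarrow> 'a) \<times> int \<Rightarrow> 'a \<Rightarrow> 'a" where
  "Aut_bar_act T r a b = (\<lambda>(\<alpha>, s) t. \<alpha> (sigma_act T r a b s t))"

definition group_power :: "('a, 'c) monoid_scheme \<Rightarrow> nat \<Rightarrow> (nat \<Rightarrow> 'a) monoid" where
  "group_power T k = product_group {1..k} (\<lambda>_. T)"

definition power_act ::
    "('a, 'c) monoid_scheme \<Rightarrow> nat \<Rightarrow> nat \<Rightarrow> (nat \<Rightarrow> 'a) \<Rightarrow> (nat \<Rightarrow> 'a) \<Rightarrow>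
     (nat \<Rightarrow> nat) \<times> ('a \<Rightarrow> 'a) \<times> int \<Rightarrow> (nat \<Rightarrow> 'a) \<Rightarrow> nat \<Rightarrow> 'a" where
  "power_act T k r a b = (\<lambda>(\<pi>, h) x. \<lambda>i\<in>{1..k}. Aut_bar_act T r a b h (x (inv_into UNIV \<pi> i)))"

definition diagonal :: "('a, 'c) monoid_scheme \<Rightarrow> nat \<Rightarrow> (nat \<Rightarrow> 'a) set" where
  "diagonal T k = (\<lambda>t. \<lambda>i\<in>{1..k}. t) ` carrier T"

text \<open>
  The identification of \<open>T\<^sup>k\<^sup>-\<^sup>1\<close> with \<open>T\<^sup>k/T\<close>, sending \<open>(t\<^sub>1,\<dots>,t\<^sub>k\<^sub>-\<^sub>1)\<close> to the class of
  \<open>(t\<^sub>1,\<dots>,t\<^sub>k\<^sub>-\<^sub>1,1)\<close>, and the action of the group acting on \<open>T\<^sup>k\<close> transported along it.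
\<close>

definition power_identification ::
    "('a, 'c) monoid_scheme \<Rightarrow> nat \<Rightarrow> (nat \<Rightarrow> 'a) \<Rightarrow> (nat \<Rightarrow> 'a) set" where
  "power_identification T k x =
     diagonal T k #>\<^bsub>group_power T k\<^esub> (\<lambda>i\<in>{1..k}. if i < k then x i else \<one>\<^bsub>T\<^esub>)"

definition reduced_power_act ::
    "('a, 'c) monoid_scheme \<Rightarrow> nat \<Rightarrow> nat \<Rightarrow> (nat \<Rightarrow> 'a) \<Rightarrow> (nat \<Rightarrow> 'a) \<Rightarrow>
     (nat \<Rightarrow> nat) \<times> ('a \<Rightarrow> 'a) \<times> int \<Rightarrow> (nat \<Rightarrow> 'a) \<Rightarrow> nat \<Rightarrow> 'a" where
  "reduced_power_act T k r a b h x =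
     inv_into (carrier (group_power T (k - 1))) (power_identification T k)
       (power_act T k r a b h ` power_identification T k x)"

end

theory Submission
  imports Defs
begin

text \<open>
  The matrices \<open>E i j t\<close>, the Kronecker products of matrix units and the basis \<open>X\<close> of the graded
  division algebra, form a homogeneous basis, so automorphisms permuting the components are studied
  through their effect on the labels \<open>(i, j, t)\<close>. Every element of
  \<open>T\<^sup>k\<^sup>-\<^sup>1 \<rtimes> (Sym k \<times> \<langle>Aut, \<sigma>\<rangle>)\<close> is realised: conjugation by monomial matrices with
  entries in \<open>F X\<^sub>t\<close> gives \<open>T\<^sup>k\<^sup>-\<^sup>1\<close> and the permutations, an automorphism of \<open>D\<close> rescaling
  the \<open>X\<^sub>t\<close> gives an isometry of \<open>\<beta>\<close>, and minus the transpose gives \<open>\<sigma>\<close>. Conversely let \<open>f\<close>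
  permute the components. For \<open>k \<ge> 2\<close> the components with \<open>i \<noteq> j\<close> consist of elements whose adjoint
  map has vanishing cube, which singles them out. For \<open>k \<ge> 3\<close> the vanishing of brackets
  between them determines a permutation of the indices up to a simultaneous swap, which is removed by
  composing with minus the transpose; after composing with a diagonal conjugation, the products
  \<open>E i j t * E j h s\<close> yield an isometry of \<open>\<beta>\<close>. For \<open>k \<le> 2\<close> brackets only give a map preserving \<open>\<beta>\<close> up
  to inversion of each value; a group is not the union of two proper subgroups, so the choice of
  sign is global, and inversion is again accounted for by minus the transpose.
\<close>

text \<open>Automorphisms of \<open>psl\<close> are not lifted to matrices beforehand; everything is
  read off from brackets of components. The obstacle is the centre: in general a class determines
  the coordinate at \<open>(i, j, t)\<close> only if \<open>i \<noteq> j\<close> or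
  \<open>t \<noteq> \<one>\<close>, and the identity component may vanish. So a bracket that could
  be scalar needs care, and there characteristic different from 2 enters. With three distinct
  indices only one term of a commutator survives, which makes the structure constants of products
  visible. For \<open>k \<le> 2\<close> one sees only expressions symmetric under inversion, such as
  \<open>z + inverse z\<close> with \<open>z = \<beta> u v\<close>, whence the separate treatment.
  In the other direction an isometry of \<beta> lifts to the division algebra because two cocycles
  differ by a symmetric one, which splits over an algebraically closed field. The condition on
  \<open>k\<close> for elementary 2-groups concerns faithfulness: there \<sigma> acts trivially on
  \<open>T\<close>, and for \<open>k \<le> 2\<close> minus the transpose would permute the
  components as the identity or as a permutation of indices does, so \<sigma> could not be
  recovered.\<close>

text \<open>If the characteristic p divided \<open>m\<close>, then \<open>z ^ (m / p)\<close> would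
  be a p-th root of 1, and Frobenius leaves only 1 as such a root, against primitivity. Through this
  the size \<open>N\<close> is invertible in the field, so trace pairings can be normalised.\<close>

lemma of_nat_primitive_root_order:
  fixes z :: "'f::field"
  assumes "primitive_root_of_unity m z" "m > 0"
  shows "of_nat m \<noteq> (0::'f)"
proof
  assume "of_nat m = (0::'f)"
  hence dvd: "CHAR('f) dvd m" by (simp add: of_nat_eq_0_iff_char_dvd)
  with assms(2) have p: "prime CHAR('f)"
    by (metis CHAR_pos_iff dvd_0_left_iff prime_CHAR_semidom gr0I)
  obtain d where d: "m = CHAR('f) * d" using dvd by (auto simp: dvd_def)
  have "(z ^ d + (-1)) ^ CHAR('f) = (z ^ d) ^ CHAR('f) + (-1) ^ CHAR('f)"
    using p by (rule freshmans_dream[OF _ refl])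
  also have "(z ^ d) ^ CHAR('f) = 1"
    using assms(1) d by (simp add: primitive_root_of_unity_def mult.commute flip: power_mult)
  \<comment> \<open>Frobenius applied to \<open>1 + (-1)\<close> evaluates the sign without
    splitting on the parity of the characteristic.\<close>
  also have "1 + (-1) ^ CHAR('f) = (1 + (-1) :: 'f) ^ CHAR('f)"
    using freshmans_dream[OF p refl, of "1 :: 'f" "-1"] by (simp only: power_one)
  finally have "z ^ d = 1" using prime_gt_0_nat[OF p] by (simp add: power_0_left)
  moreover have "0 < d" "d < m" using d assms(2) prime_gt_1_nat[OF p] by auto
  ultimately show False using assms(1) by (auto simp: primitive_root_of_unity_def)
qed

section \<open>Words in a symplectic basis and the bicharacter\<close>

lemma (in comm_group) basis_word_closed:
  assumes "\<And>i. i < r \<Longrightarrow> a i \<in> carrier G" "\<And>i. i < r \<Longrightarrow> b i \<in> carrier G"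
  shows "basis_word G r a b p \<in> carrier G"
  using assms by (auto simp: basis_word_def split_beta)

lemma (in comm_group) basis_word_mult:
  assumes "\<And>i. i < r \<Longrightarrow> a i \<in> carrier G" "\<And>i. i < r \<Longrightarrow> b i \<in> carrier G"
  shows "basis_word G r a b (e, f) \<otimes> basis_word G r a b (e', f') =
    basis_word G r a b (\<lambda>i. e i + e' i, \<lambda>i. f i + f' i)"
proof -
  have "(\<Otimes>i\<in>{..<r}. a i [^] (e i + e' i) \<otimes> b i [^] (f i + f' i)) =
     (\<Otimes>i\<in>{..<r}. (a i [^] e i \<otimes> b i [^] f i) \<otimes> (a i [^] e' i \<otimes> b i [^] f' i))"
    by (rule finprod_cong') (use assms in \<open>auto simp: nat_pow_mult[symmetric] m_ac\<close>)
  also have "\<dots> = (\<Otimes>i\<in>{..<r}. a i [^] e i \<otimes> b i [^] f i) \<otimes> (\<Otimes>i\<in>{..<r}. a i [^] e' i \<otimes> b i [^] f' i)"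
    by (rule finprod_multf) (use assms in auto)
  finally show ?thesis by (simp add: basis_word_def)
qed

lemma (in comm_group) basis_word_cong:
  assumes "\<And>i. i < r \<Longrightarrow> a i \<in> carrier G" "\<And>i. i < r \<Longrightarrow> b i \<in> carrier G"
    and "\<And>i. i < r \<Longrightarrow> a i [^] e i = a i [^] e' i" "\<And>i. i < r \<Longrightarrow> b i [^] f i = b i [^] f' i"
  shows "basis_word G r a b (e, f) = basis_word G r a b (e', f')"
  unfolding basis_word_def split by (rule finprod_cong') (use assms in auto)

lemma (in comm_group) basis_word_0:
  assumes "\<And>i. i < r \<Longrightarrow> e i = 0" "\<And>i. i < r \<Longrightarrow> f i = 0"
  shows "basis_word G r a b (e, f) = \<one>"
  unfolding basis_word_def split by (rule finprod_one_eqI) (use assms in auto)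

lemma (in comm_group) basis_word_left:
  assumes "\<And>i. i < r \<Longrightarrow> a i \<in> carrier G" "\<And>i. i < r \<Longrightarrow> b i \<in> carrier G" "i < r"
  shows "basis_word G r a b (\<lambda>j. if j = i then 1 else 0, \<lambda>_. 0) = a i"
proof -
  have "basis_word G r a b (\<lambda>j. if j = i then 1 else 0, \<lambda>_. 0) =
      (\<Otimes>j\<in>{..<r}. if i = j then a j else \<one>)"
    unfolding basis_word_def split by (rule finprod_cong') (use assms in \<open>auto simp: Pi_def\<close>)
  also have "\<dots> = a i" by (rule finprod_singleton) (use assms in auto)
  finally show ?thesis .
qed

lemma (in comm_group) basis_word_right:
  assumes "\<And>i. i < r \<Longrightarrow> a i \<in> carrier G" "\<And>i. i < r \<Longrightarrow> b i \<in> carrier G" "i < r"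
  shows "basis_word G r a b (\<lambda>_. 0, \<lambda>j. if j = i then 1 else 0) = b i"
proof -
  have "basis_word G r a b (\<lambda>_. 0, \<lambda>j. if j = i then 1 else 0) =
      (\<Otimes>j\<in>{..<r}. if i = j then b j else \<one>)"
    unfolding basis_word_def split by (rule finprod_cong') (use assms in \<open>auto simp: Pi_def\<close>)
  also have "\<dots> = b i" by (rule finprod_singleton) (use assms in auto)
  finally show ?thesis .
qed

lemma (in group) nat_pow_mod_eq:
  assumes "x \<in> carrier G" "x [^] (m::nat) = \<one>"
  shows "x [^] (j mod m) = x [^] (j::nat)"
proof -
  have "x [^] j = x [^] (m * (j div m) + j mod m)" by simp
  also have "\<dots> = (x [^] m) [^] (j div m) \<otimes> x [^] (j mod m)"
    using assms(1) by (simp only: nat_pow_mult[symmetric] nat_pow_pow nat_pow_closed)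
  also have "\<dots> = x [^] (j mod m)" using assms by simp
  finally show ?thesis by simp
qed

locale symplectic_group = T: comm_group T for T :: "('a, 'c) monoid_scheme" (structure) +
  fixes \<beta> :: "'a \<Rightarrow> 'a \<Rightarrow> 'f::alg_closed_field" and r :: nat and a b :: "nat \<Rightarrow> 'a"
  assumes finite_T: "finite (carrier T)"
    and bichar: "nondegenerate_alternating_bicharacter T \<beta>"
    and basis: "symplectic_basis T \<beta> r a b"
begin

lemma a_closed [simp]: "i < r \<Longrightarrow> a i \<in> carrier T"
  and b_closed [simp]: "i < r \<Longrightarrow> b i \<in> carrier T"
  and ord_b: "i < r \<Longrightarrow> T.ord (b i) = T.ord (a i)"
  and word_bij: "bij_betw (basis_word T r a b) (basis_exponents T r a b) (carrier T)"
  and root: "i < r \<Longrightarrow> primitive_root_of_unity (T.ord (a i)) (\<beta> (a i) (b i))"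
  and beta_aa: "i < r \<Longrightarrow> j < r \<Longrightarrow> \<beta> (a i) (a j) = 1"
  and beta_bb: "i < r \<Longrightarrow> j < r \<Longrightarrow> \<beta> (b i) (b j) = 1"
  and beta_ab: "i < r \<Longrightarrow> j < r \<Longrightarrow> i \<noteq> j \<Longrightarrow> \<beta> (a i) (b j) = 1"
  and beta_ba: "i < r \<Longrightarrow> j < r \<Longrightarrow> i \<noteq> j \<Longrightarrow> \<beta> (b j) (a i) = 1"
  using basis by (auto simp: symplectic_basis_def)

lemma beta_nz [simp]: "u \<in> carrier T \<Longrightarrow> v \<in> carrier T \<Longrightarrow> \<beta> u v \<noteq> 0"
  and beta_mult1: "u \<in> carrier T \<Longrightarrow> v \<in> carrier T \<Longrightarrow> w \<in> carrier T \<Longrightarrow> \<beta> (u \<otimes> v) w = \<beta> u w * \<beta> v w"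
  and beta_mult2: "u \<in> carrier T \<Longrightarrow> v \<in> carrier T \<Longrightarrow> w \<in> carrier T \<Longrightarrow> \<beta> u (v \<otimes> w) = \<beta> u v * \<beta> u w"
  and beta_self [simp]: "u \<in> carrier T \<Longrightarrow> \<beta> u u = 1"
  and beta_nondeg: "u \<in> carrier T \<Longrightarrow> (\<And>v. v \<in> carrier T \<Longrightarrow> \<beta> u v = 1) \<Longrightarrow> u = \<one>"
  using bichar by (auto simp: nondegenerate_alternating_bicharacter_def)

lemma beta_one1 [simp]: assumes "v \<in> carrier T" shows "\<beta> \<one> v = 1"
  using beta_mult1[of \<one> \<one> v] beta_nz[of \<one> v] assms by simp

lemma beta_one2 [simp]: assumes "v \<in> carrier T" shows "\<beta> v \<one> = 1"
  using beta_mult2[of v \<one> \<one>] beta_nz[of v \<one>] assms by simp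

lemma beta_skew: assumes "u \<in> carrier T" "v \<in> carrier T" shows "\<beta> u v * \<beta> v u = 1"
proof -
  have "\<beta> (u \<otimes> v) (u \<otimes> v) = \<beta> u v * \<beta> v u"
    using assms by (subst beta_mult1) (auto simp: beta_mult2)
  thus ?thesis using assms by simp
qed

lemma beta_swap: assumes "u \<in> carrier T" "v \<in> carrier T" shows "\<beta> v u = inverse (\<beta> u v)"
  using beta_skew[OF assms] by (simp add: inverse_unique)

lemma beta_inv1: assumes "u \<in> carrier T" "v \<in> carrier T" shows "\<beta> (inv u) v = inverse (\<beta> u v)"
  using beta_mult1[of u "inv u" v] assms by (simp add: inverse_unique)

lemma beta_inv2: assumes "u \<in> carrier T" "v \<in> carrier T" shows "\<beta> u (inv v) = inverse (\<beta> u v)"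
  using beta_mult2[of u v "inv v"] assms by (simp add: inverse_unique)

lemma beta_eq_1_sym: assumes "u \<in> carrier T" "v \<in> carrier T" shows "\<beta> v u = 1 \<longleftrightarrow> \<beta> u v = 1"
  using beta_skew[OF assms] by auto

lemma beta_witness:
  assumes "u \<in> carrier T" "u \<noteq> \<one>" obtains v where "v \<in> carrier T" "\<beta> u v \<noteq> 1"
  using assms beta_nondeg by blast

text \<open>Nondegeneracy applied to \<open>u \<otimes> inv v\<close>; equations in \<open>T\<close>
  can thus be checked on values of \<beta>.\<close>

lemma beta_determines:
  assumes "u \<in> carrier T" "v \<in> carrier T" "\<And>w. w \<in> carrier T \<Longrightarrow> \<beta> u w = \<beta> v w"
  shows "u = v"
proof -
  have "u \<otimes> inv v = \<one>"
    by (rule beta_nondeg) (use assms in \<open>auto simp: beta_mult1 beta_inv1\<close>)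
  thus ?thesis using assms by (metis T.inv_closed T.inv_equality T.inv_inv)
qed

lemma ord_pos: "x \<in> carrier T \<Longrightarrow> T.ord x > 0"
  using T.ord_ge_1[OF finite_T] by force

definition exps where "exps t = inv_into (basis_exponents T r a b) (basis_word T r a b) t"

lemma word_exps: "t \<in> carrier T \<Longrightarrow> basis_word T r a b (exps t) = t"
  unfolding exps_def using word_bij by (metis bij_betw_def f_inv_into_f)

definition red where
  "red p = (\<lambda>i\<in>{..<r}. fst p i mod T.ord (a i), \<lambda>i\<in>{..<r}. snd p i mod T.ord (b i))"

text \<open>Reduction of exponents leaves the word unchanged, and bijectivity makes the reduced pair
  unique. Arbitrary exponents are allowed because products of words produce sums of
  exponents.\<close>

lemma exps_word: "exps (basis_word T r a b p) = red p"
proof -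
  have mem: "red p \<in> basis_exponents T r a b"
    by (auto simp: red_def basis_exponents_def ord_pos)
  obtain e f where p: "p = (e, f)" by (cases p)
  have "basis_word T r a b (red p) = basis_word T r a b p"
    unfolding red_def p fst_conv snd_conv
    by (rule T.basis_word_cong) (auto simp: T.nat_pow_mod_eq)
  thus ?thesis unfolding exps_def using word_bij mem
    by (metis bij_betw_def inv_into_f_f)
qed

lemma exps_one: "exps \<one> = (\<lambda>i\<in>{..<r}. 0, \<lambda>i\<in>{..<r}. 0)"
proof -
  have "\<one> = basis_word T r a b (\<lambda>_. 0, \<lambda>_. 0)" by (simp add: T.basis_word_0)
  thus ?thesis by (simp only: exps_word) (simp add: red_def)
qed

text \<open>In a direct product of cyclic groups the generators may be sent anywhere subject to
  their orders. The target is any abelian group because the lemma serves both for \<sigma> and for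
  sections of an extension of \<open>T\<close> by scalars.\<close>

lemma basis_hom:
  fixes E (structure)
  assumes "comm_group E"
    and A: "\<And>i. i < r \<Longrightarrow> A i \<in> carrier E" "\<And>i. i < r \<Longrightarrow> A i [^]\<^bsub>E\<^esub> T.ord (a i) = \<one>\<^bsub>E\<^esub>"
    and B: "\<And>i. i < r \<Longrightarrow> B i \<in> carrier E" "\<And>i. i < r \<Longrightarrow> B i [^]\<^bsub>E\<^esub> T.ord (b i) = \<one>\<^bsub>E\<^esub>"
  shows "\<exists>\<phi>\<in>hom T E. \<forall>i<r. \<phi> (a i) = A i \<and> \<phi> (b i) = B i"
proof -
  interpret E: comm_group E by fact
  define \<phi> where "\<phi> t = basis_word E r A B (exps t)" for t
  \<comment> \<open>The order conditions make the value insensitive to reduction of exponents, so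
    the definition through \<open>exps\<close> extends to all words.\<close>
  have w: "\<phi> (basis_word T r a b p) = basis_word E r A B p" for p
  proof -
    obtain e f where p: "p = (e, f)" by (cases p)
    show ?thesis unfolding \<phi>_def exps_word unfolding red_def p fst_conv snd_conv
      by (rule E.basis_word_cong) (use A B in \<open>auto simp: E.nat_pow_mod_eq\<close>)
  qed
  have "\<phi> \<in> hom T E"
  proof (rule homI)
    show "\<phi> x \<in> carrier E" for x
      unfolding \<phi>_def by (rule E.basis_word_closed) (use A B in auto)
    fix x y assume xy: "x \<in> carrier T" "y \<in> carrier T"
    obtain e f where x: "x = basis_word T r a b (e, f)" by (metis xy(1) word_exps surj_pair)
    obtain e' f' where y: "y = basis_word T r a b (e', f')" by (metis xy(2) word_exps surj_pair)
    have "x \<otimes>\<^bsub>T\<^esub> y = basis_word T r a b (\<lambda>i. e i + e' i, \<lambda>i. f i + f' i)"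
      unfolding x y by (rule T.basis_word_mult) auto
    hence "\<phi> (x \<otimes>\<^bsub>T\<^esub> y) = basis_word E r A B (\<lambda>i. e i + e' i, \<lambda>i. f i + f' i)" by (simp only: w)
    also have "\<dots> = \<phi> x \<otimes>\<^bsub>E\<^esub> \<phi> y" unfolding x y w
      by (rule E.basis_word_mult[symmetric]) (use A B in auto)
    finally show "\<phi> (x \<otimes>\<^bsub>T\<^esub> y) = \<phi> x \<otimes>\<^bsub>E\<^esub> \<phi> y" .
  qed
  moreover have "\<phi> (a i) = A i \<and> \<phi> (b i) = B i" if "i < r" for i
  proof -
    have "a i = basis_word T r a b (\<lambda>j. if j = i then 1 else 0, \<lambda>_. 0)"
      "b i = basis_word T r a b (\<lambda>_. 0, \<lambda>j. if j = i then 1 else 0)"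
      using T.basis_word_left[of r a b i] T.basis_word_right[of r a b i] that by auto
    thus ?thesis
      using w E.basis_word_left[of r A B i] E.basis_word_right[of r A B i] that A B by metis
  qed
  ultimately show ?thesis by blast
qed

text \<open>Words have natural exponents, so closure under products suffices to pass from the
  generators to all of \<open>T\<close>.\<close>

lemma basis_induct:
  assumes "t \<in> carrier T" "P \<one>" "\<And>i. i < r \<Longrightarrow> P (a i)" "\<And>i. i < r \<Longrightarrow> P (b i)"
    "\<And>u v. u \<in> carrier T \<Longrightarrow> v \<in> carrier T \<Longrightarrow> P u \<Longrightarrow> P v \<Longrightarrow> P (u \<otimes> v)"
  shows "P t"
proof -
  have pow: "P (x [^] (m::nat))" if "x \<in> carrier T" "P x" for x m
    by (induct m) (use that assms in auto)
  obtain e f where t: "t = basis_word T r a b (e, f)" by (metis assms(1) word_exps surj_pair)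
  have "P (\<Otimes>i\<in>I. a i [^] e i \<otimes> b i [^] f i)" if "finite I" "I \<subseteq> {..<r}" for I
    using that
  proof (induct I rule: finite_induct)
    case empty thus ?case using assms by simp
  next
    case (insert i I)
    have eq: "(\<Otimes>i\<in>insert i I. a i [^] e i \<otimes> b i [^] f i) =
       (a i [^] e i \<otimes> b i [^] f i) \<otimes> (\<Otimes>i\<in>I. a i [^] e i \<otimes> b i [^] f i)"
      using insert by (intro T.finprod_insert) (auto simp: subset_iff)
    show ?case unfolding eq using insert pow assms
      by (intro assms(5) T.m_closed T.nat_pow_closed T.finprod_closed pow)
         (auto simp: subset_iff)
  qed
  from this[of "{..<r}"] show ?thesis unfolding t basis_word_def split by (simp only: finite_lessThan subset_refl)
qed

text \<open>Inverting the \<open>a i\<close> respects their orders, and the resulting endomorphism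
  squares to the identity on generators, hence is bijective. The restriction to the carrier is
  required by \<open>auto\<close>.\<close>

lemma sigma_exists: "\<exists>\<tau>. \<tau> \<in> auto T \<and> (\<forall>i<r. \<tau> (a i) = inv (a i) \<and> \<tau> (b i) = b i)"
proof -
  have "\<exists>\<phi>\<in>hom T T. \<forall>i<r. \<phi> (a i) = inv (a i) \<and> \<phi> (b i) = b i"
    by (rule basis_hom) (auto simp: T.is_group T.nat_pow_inv T.comm_group_axioms)
  then obtain \<phi> where \<phi>: "\<phi> \<in> hom T T" "\<forall>i<r. \<phi> (a i) = inv (a i) \<and> \<phi> (b i) = b i" by blast
  interpret \<phi>: group_hom T T \<phi> by unfold_locales (rule \<phi>(1))
  have inv: "\<phi> (\<phi> t) = t" if "t \<in> carrier T" for t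
    using that by (rule basis_induct) (use \<phi>(2) in auto)
  have "bij_betw \<phi> (carrier T) (carrier T)"
    by (rule bij_betw_byWitness[where f' = \<phi>]) (use inv in auto)
  hence "restrict \<phi> (carrier T) \<in> Bij (carrier T)"
    by (simp add: Bij_def cong: bij_betw_cong)
  moreover have "restrict \<phi> (carrier T) \<in> hom T T"
    by (rule homI) auto
  ultimately have "restrict \<phi> (carrier T) \<in> auto T"
    by (simp add: auto_def)
  thus ?thesis using \<phi>(2) by (intro exI[of _ "restrict \<phi> (carrier T)"]) auto
qed

abbreviation \<sigma> where "\<sigma> \<equiv> sigma_aut T r a b"

lemma hom_ext_basis:
  assumes "f \<in> hom T T" "g \<in> hom T T" "\<And>i. i < r \<Longrightarrow> f (a i) = g (a i)" "\<And>i. i < r \<Longrightarrow> f (b i) = g (b i)"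
    "t \<in> carrier T"
  shows "f t = g t"
proof -
  interpret f: group_hom T T f by unfold_locales fact
  interpret g: group_hom T T g by unfold_locales fact
  show ?thesis using assms(5) by (rule basis_induct) (use assms in auto)
qed

lemma sigma_props: "\<sigma> \<in> auto T \<and> (\<forall>i<r. \<sigma> (a i) = inv (a i) \<and> \<sigma> (b i) = b i)"
  unfolding sigma_aut_def
proof (rule theI'[where P = "\<lambda>\<tau>. \<tau> \<in> auto T \<and> (\<forall>i<r. \<tau> (a i) = inv (a i) \<and> \<tau> (b i) = b i)"])
  show "\<exists>!\<tau>. \<tau> \<in> auto T \<and> (\<forall>i<r. \<tau> (a i) = inv (a i) \<and> \<tau> (b i) = b i)"
  proof (rule ex_ex1I[OF sigma_exists])
    fix f g assume fg: "f \<in> auto T \<and> (\<forall>i<r. f (a i) = inv (a i) \<and> f (b i) = b i)"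
      "g \<in> auto T \<and> (\<forall>i<r. g (a i) = inv (a i) \<and> g (b i) = b i)"
    show "f = g"
    proof (rule extensionalityI[where A = "carrier T"])
      show "f t = g t" if "t \<in> carrier T" for t
        by (rule hom_ext_basis) (use fg that in \<open>auto simp: auto_def\<close>)
    qed (use fg in \<open>auto simp: auto_def Bij_def\<close>)
  qed
qed

sublocale sg: group_hom T T \<sigma>
  by unfold_locales (use sigma_props in \<open>simp add: auto_def\<close>)

lemma sigma_a [simp]: "i < r \<Longrightarrow> \<sigma> (a i) = inv (a i)"
  and sigma_b [simp]: "i < r \<Longrightarrow> \<sigma> (b i) = b i"
  using sigma_props by auto

lemma sigma_sigma [simp]: "t \<in> carrier T \<Longrightarrow> \<sigma> (\<sigma> t) = t"
  by (rule basis_induct) auto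

text \<open>On generators only the values at \<open>a i\<close> and \<open>b i\<close> with the same
  \<open>i\<close> can be nontrivial, and inverting \<open>a i\<close> inverts them, which amounts
  to exchanging the arguments. So \<sigma> behaves like an antiautomorphism, as transposition
  does.\<close>

lemma beta_sigma:
  assumes "u \<in> carrier T" "v \<in> carrier T" shows "\<beta> (\<sigma> u) (\<sigma> v) = \<beta> v u"
proof -
  have ab: "\<beta> (\<sigma> x) (\<sigma> v) = \<beta> v x" if "x \<in> carrier T" and
      x: "\<And>j. j < r \<Longrightarrow> \<beta> (\<sigma> x) (\<sigma> (a j)) = \<beta> (a j) x" "\<And>j. j < r \<Longrightarrow> \<beta> (\<sigma> x) (\<sigma> (b j)) = \<beta> (b j) x" for x
    using assms(2) by (rule basis_induct) (use that in \<open>auto simp: beta_mult1 beta_mult2\<close>)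
  have gen: "\<beta> (\<sigma> (a i)) (\<sigma> (a j)) = \<beta> (a j) (a i)" "\<beta> (\<sigma> (b i)) (\<sigma> (b j)) = \<beta> (b j) (b i)"
     "\<beta> (\<sigma> (a i)) (\<sigma> (b j)) = \<beta> (b j) (a i)" "\<beta> (\<sigma> (b i)) (\<sigma> (a j)) = \<beta> (a j) (b i)"
    if "i < r" "j < r" for i j
    using that by (auto simp: beta_inv1 beta_inv2 beta_aa beta_bb beta_swap[of "a i" "b j"] beta_swap[of "b i" "a j"])
  show ?thesis
    using assms(1)
  proof (rule basis_induct)
    show "\<beta> (\<sigma> (a i)) (\<sigma> v) = \<beta> v (a i)" if "i < r" for i
      by (rule ab) (use that gen in auto)
    show "\<beta> (\<sigma> (b i)) (\<sigma> v) = \<beta> v (b i)" if "i < r" for i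
      by (rule ab) (use that gen in auto)
  qed (use assms in \<open>auto simp: beta_mult1 beta_mult2\<close>)
qed

end

text \<open>
  The Baer sum argument in disguise: a symmetric cocycle defines an abelian extension of \<open>T\<close> by the
  divisible group of nonzero scalars, so the generators of \<open>T\<close> have lifts of the same orders.
\<close>

lemma (in symplectic_group) symmetric_cocycle_splits:
  fixes d :: "'a \<Rightarrow> 'a \<Rightarrow> 'f"
  assumes nz: "\<And>u v. u \<in> carrier T \<Longrightarrow> v \<in> carrier T \<Longrightarrow> d u v \<noteq> 0"
    and sym: "\<And>u v. u \<in> carrier T \<Longrightarrow> v \<in> carrier T \<Longrightarrow> d u v = d v u"
    and coc: "\<And>u v w. u \<in> carrier T \<Longrightarrow> v \<in> carrier T \<Longrightarrow> w \<in> carrier T \<Longrightarrow>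
      d u v * d (u \<otimes> v) w = d v w * d u (v \<otimes> w)"
  obtains c where "\<And>u. u \<in> carrier T \<Longrightarrow> c u \<noteq> 0"
    "\<And>u v. u \<in> carrier T \<Longrightarrow> v \<in> carrier T \<Longrightarrow> c (u \<otimes> v) = d u v * c u * c v"
proof -
  \<comment> \<open>Twisted multiplication on scalars times \<open>T\<close>. The unit carries
    \<open>inverse (d \<one> \<one>)\<close> because the cocycle need not be normalised.\<close>
  define E :: "('f \<times> 'a) monoid" where "E = \<lparr>carrier = (- {0}) \<times> carrier T,
     monoid.mult = (\<lambda>(x, u) (y, v). (x * y * d u v, u \<otimes> v)), one = (inverse (d \<one> \<one>), \<one>)\<rparr>"
  have d1: "d \<one> v = d \<one> \<one>" if "v \<in> carrier T" for v
    using coc[of \<one> \<one> v] nz[of \<one> v] that by simp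
  interpret E: comm_group E
  proof (rule comm_groupI)
    fix x y z assume "x \<in> carrier E" "y \<in> carrier E" "z \<in> carrier E"
    thus "x \<otimes>\<^bsub>E\<^esub> y \<otimes>\<^bsub>E\<^esub> z = x \<otimes>\<^bsub>E\<^esub> (y \<otimes>\<^bsub>E\<^esub> z)"
      using coc by (auto simp: E_def T.m_assoc mult.assoc mult.left_commute)
  next
    fix x assume "x \<in> carrier E"
    then obtain c u where x: "x = (c, u)" "c \<noteq> 0" "u \<in> carrier T" by (auto simp: E_def)
    have "(inverse (c * d (inv u) u * d \<one> \<one>), inv u) \<otimes>\<^bsub>E\<^esub> x = \<one>\<^bsub>E\<^esub>"
      using x nz[of "inv u" u] nz[of \<one> \<one>] by (simp add: E_def field_simps)
    moreover have "(inverse (c * d (inv u) u * d \<one> \<one>), inv u) \<in> carrier E"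
      using x nz[of "inv u" u] nz[of \<one> \<one>] by (simp add: E_def)
    ultimately show "\<exists>y\<in>carrier E. y \<otimes>\<^bsub>E\<^esub> x = \<one>\<^bsub>E\<^esub>" by blast
  next
    fix x y assume "x \<in> carrier E" "y \<in> carrier E"
    thus "x \<otimes>\<^bsub>E\<^esub> y = y \<otimes>\<^bsub>E\<^esub> x"
      using sym[of "snd x" "snd y"] by (auto simp: E_def T.m_comm)
  next
    fix x assume "x \<in> carrier E"
    thus "\<one>\<^bsub>E\<^esub> \<otimes>\<^bsub>E\<^esub> x = x"
      using d1[of "snd x"] nz[of \<one> \<one>] by (auto simp: E_def)
  qed (use nz in \<open>auto simp: E_def\<close>)
  \<comment> \<open>Changing the scalar in \<open>(c, t)\<close> changes its power of exponent
    \<open>T.ord t\<close> by the corresponding power of that scalar, so a root of the right order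
    corrects it to the unit. This is where the field has to contain roots.\<close>
  have lift: "\<exists>y\<in>carrier E. snd y = t \<and> y [^]\<^bsub>E\<^esub> T.ord t = \<one>\<^bsub>E\<^esub>" if t: "t \<in> carrier T" for t
  proof -
    have pow: "\<exists>w. w \<noteq> 0 \<and> (\<forall>c. c \<noteq> 0 \<longrightarrow> (c, t) [^]\<^bsub>E\<^esub> m = (c ^ m * w, t [^] m))" for m :: nat
    proof (induct m)
      case 0 thus ?case using nz[of \<one> \<one>] by (intro exI[of _ "inverse (d \<one> \<one>)"]) (simp add: E_def)
    next
      case (Suc m)
      then obtain w where "w \<noteq> 0" "\<And>c. c \<noteq> 0 \<Longrightarrow> (c, t) [^]\<^bsub>E\<^esub> m = (c ^ m * w, t [^] m)" by blast
      thus ?case using t nz[of "t [^] m" t]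
        by (intro exI[of _ "w * d (t [^] m) t"]) (auto simp: E_def)
    qed
    obtain w where w: "w \<noteq> 0" "\<And>c. c \<noteq> 0 \<Longrightarrow> (c, t) [^]\<^bsub>E\<^esub> T.ord t = (c ^ T.ord t * w, \<one>)"
      using pow[of "T.ord t"] unfolding T.pow_ord_eq_1[OF t] by blast
    obtain c where c: "c ^ T.ord t = inverse (d \<one> \<one> * w)"
      using nth_root_exists[of "T.ord t" "inverse (d \<one> \<one> * w)"] ord_pos[OF t] by auto
    hence "c \<noteq> 0" using w nz[of \<one> \<one>] ord_pos[OF t] by (auto simp: power_0_left)
    with w c t nz[of \<one> \<one>] show ?thesis
      by (intro bexI[of _ "(c, t)"]) (auto simp: E_def field_simps)
  qed
  then obtain h where h: "\<And>t. t \<in> carrier T \<Longrightarrow> h t \<in> carrier E \<and> snd (h t) = t \<and> h t [^]\<^bsub>E\<^esub> T.ord t = \<one>\<^bsub>E\<^esub>"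
    by metis
  obtain \<phi> where \<phi>: "\<phi> \<in> hom T E" "\<And>i. i < r \<Longrightarrow> \<phi> (a i) = h (a i)" "\<And>i. i < r \<Longrightarrow> \<phi> (b i) = h (b i)"
  proof -
    have "\<exists>\<phi>\<in>hom T E. \<forall>i<r. \<phi> (a i) = h (a i) \<and> \<phi> (b i) = h (b i)"
      using h[OF a_closed] h[OF b_closed] by (intro basis_hom[OF E.comm_group_axioms]) blast+
    thus ?thesis using that by blast
  qed
  interpret \<phi>: group_hom T E \<phi>
    using \<phi>(1) T.group_axioms E.group_axioms by (simp add: group_hom_def group_hom_axioms_def)
  \<comment> \<open>Hence \<open>\<phi>\<close> is a section of the extension, and its scalar part
    is the required function.\<close>
  have snd: "snd (\<phi> t) = t" if "t \<in> carrier T" for t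
    using that
  proof (rule basis_induct)
    show "snd (\<phi> \<one>) = \<one>" unfolding \<phi>.hom_one by (simp add: E_def)
  next
    fix u v assume "u \<in> carrier T" "v \<in> carrier T" "snd (\<phi> u) = u" "snd (\<phi> v) = v"
    thus "snd (\<phi> (u \<otimes> v)) = u \<otimes> v" by (simp add: E_def split_beta)
  qed (use \<phi> h in auto)
  show ?thesis
  proof (rule that[of "\<lambda>t. fst (\<phi> t)"])
    show "fst (\<phi> u) \<noteq> 0" if "u \<in> carrier T" for u
      using \<phi>.hom_closed[OF that] by (auto simp: E_def)
    show "fst (\<phi> (u \<otimes> v)) = d u v * fst (\<phi> u) * fst (\<phi> v)" if "u \<in> carrier T" "v \<in> carrier T" for u v
      using that snd[of u] snd[of v] by (simp add: E_def split_beta mult_ac)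
  qed
qed

subsection \<open>Kronecker products\<close>

lemma index_mult_mat_sum:
  assumes "A \<in> carrier_mat n m" "B \<in> carrier_mat m p" "i < n" "j < p"
  shows "(A * B) $$ (i, j) = (\<Sum>k<m. A $$ (i, k) * B $$ (k, j))"
  using assms by (auto simp: scalar_prod_def lessThan_atLeast0 intro!: sum.cong)

lemma sum_div_mod:
  fixes f :: "nat \<Rightarrow> nat \<Rightarrow> 'x::comm_monoid_add"
  shows "(\<Sum>q<m * n. f (q div n) (q mod n)) = (\<Sum>i<m. \<Sum>j<n. f i j)"
proof -
  have "(\<Sum>q<m * n. f (q div n) (q mod n)) = (\<Sum>i<m. \<Sum>q\<in>{i * n..<i * n + n}. f (q div n) (q mod n))"
    by (rule sum.nat_group[symmetric])
  also have "\<dots> = (\<Sum>i<m. \<Sum>j<n. f i j)"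
  proof (rule sum.cong[OF refl])
    fix i
    have "(\<Sum>q\<in>{i * n..<i * n + n}. f (q div n) (q mod n)) =
        (\<Sum>j\<in>{0..<n}. f ((j + i * n) div n) ((j + i * n) mod n))"
      using sum.shift_bounds_nat_ivl[of "\<lambda>q. f (q div n) (q mod n)" 0 "i * n" n] by (simp add: add.commute)
    also have "\<dots> = (\<Sum>j<n. f i j)"
      by (rule sum.cong) auto
    finally show "(\<Sum>q\<in>{i * n..<i * n + n}. f (q div n) (q mod n)) = (\<Sum>j<n. f i j)" .
  qed
  finally show ?thesis .
qed

lemma mult_add_less: "i < (m::nat) \<Longrightarrow> u < n \<Longrightarrow> i * n + u < m * n"
proof -
  assume "i < m" "u < n"
  hence "i * n + u < i * n + n" "Suc i * n \<le> m * n" by (auto simp del: mult_Suc intro: mult_le_mono1)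
  thus ?thesis by simp
qed

lemma div_mod_bounds:
  assumes "p < m * (n::nat)" shows "p div n < m" "p mod n < n"
  using assms by (auto simp: less_mult_imp_div_less) (metis mult_0_right gr0I mod_less_divisor not_less_zero)

lemma kronecker_carrier [simp]:
  assumes "A \<in> carrier_mat m1 n1" "B \<in> carrier_mat m2 n2"
  shows "kronecker A B \<in> carrier_mat (m1 * m2) (n1 * n2)"
  using assms by (auto simp: kronecker_def)

lemma index_kronecker:
  assumes "A \<in> carrier_mat m1 n1" "B \<in> carrier_mat m2 n2" "p < m1 * m2" "q < n1 * n2"
  shows "kronecker A B $$ (p, q) = A $$ (p div m2, q div n2) * B $$ (p mod m2, q mod n2)"
  using assms by (auto simp: kronecker_def)

text \<open>Mixed product rule: writing the summation index as \<open>i * n2 + j\<close> separates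
  the sum into two matrix products.\<close>

lemma kronecker_mult:
  fixes A :: "'f::comm_semiring_1 mat"
  assumes "A \<in> carrier_mat m1 n1" "B \<in> carrier_mat m2 n2" "C \<in> carrier_mat n1 p1" "D \<in> carrier_mat n2 p2"
  shows "kronecker A B * kronecker C D = kronecker (A * C) (B * D)"
proof (rule eq_matI)
  have 1: "kronecker A B \<in> carrier_mat (m1 * m2) (n1 * n2)" "kronecker C D \<in> carrier_mat (n1 * n2) (p1 * p2)"
    "A * C \<in> carrier_mat m1 p1" "B * D \<in> carrier_mat m2 p2"
    "kronecker (A * C) (B * D) \<in> carrier_mat (m1 * m2) (p1 * p2)"
    using assms by auto
  fix p q assume "p < dim_row (kronecker (A * C) (B * D))" "q < dim_col (kronecker (A * C) (B * D))"
  hence pq: "p < m1 * m2" "q < p1 * p2" using 1 by auto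
  note b = div_mod_bounds[OF pq(1)] div_mod_bounds[OF pq(2)]
  have "(kronecker A B * kronecker C D) $$ (p, q) =
      (\<Sum>s<n1 * n2. kronecker A B $$ (p, s) * kronecker C D $$ (s, q))"
    using 1 pq by (intro index_mult_mat_sum)
  also have "\<dots> = (\<Sum>s<n1 * n2. (A $$ (p div m2, s div n2) * C $$ (s div n2, q div p2)) *
      (B $$ (p mod m2, s mod n2) * D $$ (s mod n2, q mod p2)))"
    by (rule sum.cong) (use pq in \<open>auto simp: index_kronecker[OF assms(1,2)] index_kronecker[OF assms(3,4)] mult_ac\<close>)
  also have "\<dots> = (\<Sum>i<n1. \<Sum>j<n2. (A $$ (p div m2, i) * C $$ (i, q div p2)) *
      (B $$ (p mod m2, j) * D $$ (j, q mod p2)))"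
    by (rule sum_div_mod[of "\<lambda>i j. (A $$ (p div m2, i) * C $$ (i, q div p2)) *
      (B $$ (p mod m2, j) * D $$ (j, q mod p2))"])
  also have "\<dots> = (A * C) $$ (p div m2, q div p2) * (B * D) $$ (p mod m2, q mod p2)"
    using b by (simp add: index_mult_mat_sum[OF assms(1,3)] index_mult_mat_sum[OF assms(2,4)] sum_product)
  also have "\<dots> = kronecker (A * C) (B * D) $$ (p, q)"
    using index_kronecker[OF 1(3,4) pq] by simp
  finally show "(kronecker A B * kronecker C D) $$ (p, q) = kronecker (A * C) (B * D) $$ (p, q)" .
qed (use assms in \<open>auto simp: kronecker_def\<close>)

lemma kronecker_transpose:
  assumes "A \<in> carrier_mat m1 n1" "B \<in> carrier_mat m2 n2"
  shows "transpose_mat (kronecker A B) = kronecker (transpose_mat A) (transpose_mat B)"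
proof (rule eq_matI)
  fix p q assume "p < dim_row (kronecker (transpose_mat A) (transpose_mat B))"
    "q < dim_col (kronecker (transpose_mat A) (transpose_mat B))"
  hence "p < n1 * n2" "q < m1 * m2" using assms by (auto simp: kronecker_def)
  thus "transpose_mat (kronecker A B) $$ (p, q) = kronecker (transpose_mat A) (transpose_mat B) $$ (p, q)"
    using assms div_mod_bounds[of p n1 n2] div_mod_bounds[of q m1 m2] by (auto simp: kronecker_def)
qed (use assms in \<open>auto simp: kronecker_def\<close>)

lemma kronecker_one: "kronecker (1\<^sub>m m) (1\<^sub>m n) = 1\<^sub>m (m * n)"
proof (rule eq_matI)
  fix p q assume "p < dim_row (1\<^sub>m (m * n))" "q < dim_col (1\<^sub>m (m * n))"
  hence "p < m * n" "q < m * n" by auto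
  moreover have "p div n = q div n \<and> p mod n = q mod n \<longleftrightarrow> p = q" by (metis div_mult_mod_eq)
  ultimately show "kronecker (1\<^sub>m m) (1\<^sub>m n) $$ (p, q) = 1\<^sub>m (m * n) $$ (p, q)"
    using div_mod_bounds[of p m n] div_mod_bounds[of q m n] by (auto simp: kronecker_def)
qed (auto simp: kronecker_def)

lemma kronecker_smult_right: "kronecker A (c \<cdot>\<^sub>m B) = c \<cdot>\<^sub>m kronecker A (B :: 'f::comm_semiring_1 mat)"
proof (rule eq_matI)
  fix p q assume "p < dim_row (c \<cdot>\<^sub>m kronecker A B)" "q < dim_col (c \<cdot>\<^sub>m kronecker A B)"
  hence "p < dim_row A * dim_row B" "q < dim_col A * dim_col B" by (auto simp: kronecker_def)
  thus "kronecker A (c \<cdot>\<^sub>m B) $$ (p, q) = (c \<cdot>\<^sub>m kronecker A B) $$ (p, q)"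
    using div_mod_bounds[of p] div_mod_bounds[of q] by (auto simp: kronecker_def mult.left_commute)
qed (auto simp: kronecker_def)

lemma kronecker_smult_left: "kronecker (c \<cdot>\<^sub>m A) B = c \<cdot>\<^sub>m kronecker A (B :: 'f::comm_semiring_1 mat)"
proof (rule eq_matI)
  fix p q assume "p < dim_row (c \<cdot>\<^sub>m kronecker A B)" "q < dim_col (c \<cdot>\<^sub>m kronecker A B)"
  hence "p < dim_row A * dim_row B" "q < dim_col A * dim_col B" by (auto simp: kronecker_def)
  thus "kronecker (c \<cdot>\<^sub>m A) B $$ (p, q) = (c \<cdot>\<^sub>m kronecker A B) $$ (p, q)"
    using div_mod_bounds[of p] div_mod_bounds[of q] by (auto simp: kronecker_def mult.assoc)
qed (auto simp: kronecker_def)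

lemma foldr_kronecker_carrier:
  assumes "\<And>i. i \<in> set js \<Longrightarrow> f i \<in> carrier_mat (d i) (d i)"
  shows "foldr kronecker (map f js) (1\<^sub>m 1) \<in> carrier_mat (prod_list (map d js)) (prod_list (map d js))"
  using assms by (induct js) auto

lemma foldr_kronecker_mult:
  fixes f :: "nat \<Rightarrow> 'f::comm_semiring_1 mat"
  assumes "\<And>i. i \<in> set js \<Longrightarrow> f i \<in> carrier_mat (d i) (d i)" "\<And>i. i \<in> set js \<Longrightarrow> g i \<in> carrier_mat (d i) (d i)"
  shows "foldr kronecker (map f js) (1\<^sub>m 1) * foldr kronecker (map g js) (1\<^sub>m 1) =
    foldr kronecker (map (\<lambda>i. f i * g i) js) (1\<^sub>m 1)"
  using assms
proof (induct js)
  case (Cons j js)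
  have "foldr kronecker (map f js) (1\<^sub>m 1) \<in> carrier_mat (prod_list (map d js)) (prod_list (map d js))"
    "foldr kronecker (map g js) (1\<^sub>m 1) \<in> carrier_mat (prod_list (map d js)) (prod_list (map d js))"
    by (rule foldr_kronecker_carrier, simp add: Cons)+
  from kronecker_mult[OF Cons(2) this(1) Cons(3) this(2)] show ?case using Cons by auto
qed auto

lemma foldr_kronecker_transpose:
  fixes f :: "nat \<Rightarrow> 'f::comm_semiring_1 mat"
  assumes "\<And>i. i \<in> set js \<Longrightarrow> f i \<in> carrier_mat (d i) (d i)"
  shows "transpose_mat (foldr kronecker (map f js) (1\<^sub>m 1)) =
    foldr kronecker (map (\<lambda>i. transpose_mat (f i)) js) (1\<^sub>m 1)"
  using assms
proof (induct js)
  case (Cons j js)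
  have "foldr kronecker (map f js) (1\<^sub>m 1) \<in> carrier_mat (prod_list (map d js)) (prod_list (map d js))"
    by (rule foldr_kronecker_carrier, simp add: Cons)+
  from kronecker_transpose[OF Cons(2) this] show ?case using Cons by auto
qed auto

lemma foldr_kronecker_one:
  "foldr kronecker (map (\<lambda>i. 1\<^sub>m (d i)) js) (1\<^sub>m 1) = 1\<^sub>m (prod_list (map d js))"
  by (induct js) (auto simp: kronecker_one)

text \<open>The scalar sits in one factor only, so bilinearity moves it out exactly once;
  distinctness excludes a second occurrence of \<open>i\<close>.\<close>

lemma foldr_kronecker_smult:
  fixes c :: "'f::comm_semiring_1"
  assumes "i \<in> set js" "distinct js" "g i = c \<cdot>\<^sub>m f i" "\<And>j. j \<noteq> i \<Longrightarrow> g j = f j"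
  shows "foldr kronecker (map g js) (1\<^sub>m 1) = c \<cdot>\<^sub>m foldr kronecker (map f js) (1\<^sub>m 1)"
  using assms
proof (induct js)
  case (Cons j js)
  show ?case
  proof (cases "j = i")
    case True
    have "map g js = map f js" using Cons(3,5) True by (intro map_cong refl) (metis distinct.simps(2))
    thus ?thesis using Cons(4) True by (simp add: kronecker_smult_left del: map_eq_conv)
  next
    case False
    thus ?thesis using Cons by (simp add: kronecker_smult_right)
  qed
qed simp

subsection \<open>Clock and shift matrices\<close>

lemma clock_carrier [simp]: "clock_mat l \<epsilon> \<in> carrier_mat l l"
  by (simp add: clock_mat_def)

lemma shift_carrier [simp]: "shift_mat l \<in> carrier_mat l l"
  by (simp add: shift_mat_def)

lemma clock_transpose: "transpose_mat (clock_mat l \<epsilon>) = clock_mat l \<epsilon>"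
  by (rule eq_matI) (auto simp: clock_mat_def mat_diag_def)

text \<open>Moving one place along the shift lowers the clock exponent by one. At the wrap-around
  from the last row to column 0 the comparison is between 1 and
  \<open>\<epsilon> ^ l\<close>.\<close>

lemma clock_shift:
  assumes "\<epsilon> ^ l = 1" "\<epsilon> \<noteq> (0::'f::field)"
  shows "clock_mat l \<epsilon> * shift_mat l = \<epsilon> \<cdot>\<^sub>m (shift_mat l * clock_mat l \<epsilon>)"
proof (rule eq_matI)
  fix p q assume "p < dim_row (\<epsilon> \<cdot>\<^sub>m (shift_mat l * clock_mat l \<epsilon>))" "q < dim_col (\<epsilon> \<cdot>\<^sub>m (shift_mat l * clock_mat l \<epsilon>))"
  hence pq: "p < l" "q < l" by (auto simp: shift_mat_def clock_mat_def mat_diag_def)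
  have L: "(clock_mat l \<epsilon> * shift_mat l) $$ (p, q) = \<epsilon> ^ (l - 1 - p) * shift_mat l $$ (p, q)"
    unfolding clock_mat_def by (subst mat_diag_mult_left[of _ _ l]) (use pq in auto)
  have R: "(shift_mat l * clock_mat l \<epsilon>) $$ (p, q) = shift_mat l $$ (p, q) * \<epsilon> ^ (l - 1 - q)"
    unfolding clock_mat_def by (subst mat_diag_mult_right[of _ l]) (use pq in auto)
  have "\<epsilon> ^ (l - 1 - p) = \<epsilon> * \<epsilon> ^ (l - 1 - q)" if "q = (p + 1) mod l"
  proof (cases "p + 1 < l")
    case True
    hence "l - 1 - p = Suc (l - 1 - q)" using that by auto
    thus ?thesis by (metis power_Suc)
  next
    case False
    hence p: "p + 1 = l" using pq by simp
    hence "p = l - 1" "q = 0" using that by simp_all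
    thus ?thesis using pq assms(1) power_Suc[of \<epsilon> "l - 1"] by simp
  qed
  thus "(clock_mat l \<epsilon> * shift_mat l) $$ (p, q) = (\<epsilon> \<cdot>\<^sub>m (shift_mat l * clock_mat l \<epsilon>)) $$ (p, q)"
    using pq L R by (auto simp: shift_mat_def clock_mat_def mat_diag_def)
qed (auto simp: shift_mat_def clock_mat_def mat_diag_def)

lemma clock_inverse:
  assumes "\<epsilon> \<noteq> (0::'f::field)"
  shows "\<exists>B\<in>carrier_mat l l. clock_mat l \<epsilon> * B = 1\<^sub>m l \<and> B * clock_mat l \<epsilon> = 1\<^sub>m l"
  by (rule bexI[of _ "mat_diag l (\<lambda>i. inverse (\<epsilon> ^ (l - 1 - i)))"]) (use assms in \<open>auto simp: clock_mat_def\<close>)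

lemma shift_orthogonal: "transpose_mat (shift_mat l) * shift_mat l = (1\<^sub>m l :: 'f::field mat)"
proof (rule eq_matI)
  fix p q assume "p < dim_row (1\<^sub>m l :: 'f mat)" "q < dim_col (1\<^sub>m l :: 'f mat)"
  hence pq: "p < l" "q < l" by auto
  have inj: "(s + 1) mod l = (s' + 1) mod l \<longleftrightarrow> s = s'" if "s < l" "s' < l" for s s'
    using that by (auto simp: mod_Suc split: if_splits)
  have ex: "\<exists>s<l. p = (s + 1) mod l"
  proof (cases "p = 0")
    case True thus ?thesis using pq by (intro exI[of _ "l - 1"]) auto
  next
    case False thus ?thesis using pq by (intro exI[of _ "p - 1"]) auto
  qed
  then obtain s where s: "s < l" "p = (s + 1) mod l" by blast
  have "(transpose_mat (shift_mat l) * shift_mat l :: 'f mat) $$ (p, q) =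
      (\<Sum>u<l. if p = (u + 1) mod l \<and> q = (u + 1) mod l then 1 else 0)"
    by (subst index_mult_mat_sum[of _ l l _ l]) (use pq in \<open>auto simp: shift_mat_def intro!: sum.cong\<close>)
  also have "\<dots> = (\<Sum>u<l. if u = s then (if p = q then 1 else 0) else 0)"
    by (rule sum.cong) (use s inj in auto)
  also have "\<dots> = (1\<^sub>m l :: 'f mat) $$ (p, q)" using s pq by simp
  finally show "(transpose_mat (shift_mat l) * shift_mat l) $$ (p, q) = (1\<^sub>m l :: 'f mat) $$ (p, q)" .
qed (auto simp: shift_mat_def)

lemma shift_orthogonal': "shift_mat l * transpose_mat (shift_mat l) = (1\<^sub>m l :: 'f::field mat)"
  by (rule mat_mult_left_right_inverse[OF _ _ shift_orthogonal]) auto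

subsection \<open>Commutants and dual bases\<close>

text \<open>A one-sided inverse of a square matrix is two-sided; enumerations of \<open>I\<close>
  and \<open>J\<close> turn the families into square matrices. It converts orthogonality relations
  into completeness relations.\<close>

lemma dual_basis:
  fixes P :: "'j \<Rightarrow> 'i \<Rightarrow> 'f::field"
  assumes "finite I" "finite J" "card I = card J"
    and "\<And>i i'. i \<in> I \<Longrightarrow> i' \<in> I \<Longrightarrow> (\<Sum>j\<in>J. Q i j * P j i') = (if i = i' then 1 else 0)"
    and "j \<in> J" "j' \<in> J"
  shows "(\<Sum>i\<in>I. P j i * Q i j') = (if j = j' then 1 else 0)"
proof -
  define m where "m = card I"
  obtain f where f: "bij_betw f {..<m} I"
    using ex_bij_betw_nat_finite[OF assms(1)] by (auto simp: m_def lessThan_atLeast0)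
  obtain g where g: "bij_betw g {..<m} J"
    using ex_bij_betw_nat_finite[OF assms(2)] assms(3) by (auto simp: m_def lessThan_atLeast0)
  define A where "A = mat m m (\<lambda>(x, y). Q (f x) (g y))"
  define B where "B = mat m m (\<lambda>(x, y). P (g x) (f y))"
  have fg: "f x \<in> I" "g x \<in> J" if "x < m" for x using f g that by (auto simp: bij_betw_def)
  have inj: "f x = f y \<longleftrightarrow> x = y" "g x = g y \<longleftrightarrow> x = y" if "x < m" "y < m" for x y
    using f g that by (auto simp: bij_betw_def inj_on_def)
  have "A * B = 1\<^sub>m m"
  proof (rule eq_matI)
    fix x y assume "x < dim_row (1\<^sub>m m :: 'f mat)" "y < dim_col (1\<^sub>m m :: 'f mat)"
    hence xy: "x < m" "y < m" by auto
    hence "(A * B) $$ (x, y) = (\<Sum>z<m. Q (f x) (g z) * P (g z) (f y))"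
      by (subst index_mult_mat_sum[of A m m B m]) (auto simp: A_def B_def intro!: sum.cong)
    also have "\<dots> = (\<Sum>j\<in>J. Q (f x) j * P j (f y))" by (rule sum.reindex_bij_betw[OF g])
    finally show "(A * B) $$ (x, y) = 1\<^sub>m m $$ (x, y)" using assms(4) fg inj xy by simp
  qed (auto simp: A_def B_def)
  hence BA: "B * A = 1\<^sub>m m" by (rule mat_mult_left_right_inverse[rotated 2]) (auto simp: A_def B_def)
  obtain x y where xy: "x < m" "y < m" "j = g x" "j' = g y" using assms(5,6) g by (auto simp: bij_betw_def)
  have "(B * A) $$ (x, y) = (\<Sum>z<m. P (g x) (f z) * Q (f z) (g y))"
    using xy by (subst index_mult_mat_sum[of B m m A m]) (auto simp: A_def B_def intro!: sum.cong)
  also have "\<dots> = (\<Sum>i\<in>I. P (g x) i * Q i (g y))" by (rule sum.reindex_bij_betw[OF f])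
  finally show ?thesis using BA xy inj by auto
qed

text \<open>The hypothesis says entrywise that \<open>M\<close> commutes with the matrix unit at
  \<open>(p, q)\<close>. In this form it can also be supplied by relations obtained from summation
  over \<open>T\<close>.\<close>

lemma scalar_mat_from_units:
  assumes "M \<in> carrier_mat m m"
    and "\<And>u p v q. u < m \<Longrightarrow> p < m \<Longrightarrow> v < m \<Longrightarrow> q < m \<Longrightarrow>
      (if v = q then M $$ (u, p) else 0) = (if u = p then M $$ (q, v) else (0::'f::field))"
  shows "\<exists>c. M = c \<cdot>\<^sub>m 1\<^sub>m m"
proof (intro exI eq_matI)
  fix i j assume "i < dim_row (M $$ (0, 0) \<cdot>\<^sub>m 1\<^sub>m m)" "j < dim_col (M $$ (0, 0) \<cdot>\<^sub>m 1\<^sub>m m)"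
  hence ij: "i < m" "j < m" "0 < m" by auto
  show "M $$ (i, j) = (M $$ (0, 0) \<cdot>\<^sub>m 1\<^sub>m m) $$ (i, j)"
    using assms(2)[of i j 0 0] assms(2)[of i i 0 0] ij by auto
qed (use assms in auto)

definition mtrace :: "'f::comm_ring_1 mat \<Rightarrow> 'f" where
  "mtrace A = (\<Sum>i<dim_row A. A $$ (i, i))"

lemma mtrace_mult_sum:
  assumes "A \<in> carrier_mat n m" "B \<in> carrier_mat m n"
  shows "mtrace (A * B) = (\<Sum>i<n. \<Sum>j<m. A $$ (i, j) * B $$ (j, i))"
  unfolding mtrace_def using assms by (auto intro!: sum.cong simp: index_mult_mat_sum[OF assms] simp del: index_mult_mat(1))

lemma mtrace_comm:
  assumes "A \<in> carrier_mat n m" "B \<in> carrier_mat m n"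
  shows "mtrace (A * B) = mtrace (B * A)"
  unfolding mtrace_mult_sum[OF assms] mtrace_mult_sum[OF assms(2,1)]
  by (subst sum.swap) (simp add: mult.commute)

lemma mtrace_smult: "mtrace (c \<cdot>\<^sub>m A) = c * mtrace A"
  if "A \<in> carrier_mat n n" using that by (auto simp: mtrace_def sum_distrib_left)

lemma mtrace_one: "mtrace (1\<^sub>m n) = of_nat n"
  by (simp add: mtrace_def)

subsection \<open>The graded division algebra\<close>

lemma square_assoc:
  fixes A :: "'x::comm_ring_1 mat"
  assumes "A \<in> carrier_mat n n" "B \<in> carrier_mat n n" "C \<in> carrier_mat n n"
  shows "A * B * C = A * (B * C)"
  using assms by (rule assoc_mult_mat)

lemma square_smult:
  fixes A :: "'x::comm_ring_1 mat"
  assumes "A \<in> carrier_mat n n" "B \<in> carrier_mat n n"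
  shows "(c \<cdot>\<^sub>m A) * B = c \<cdot>\<^sub>m (A * B)" "A * (c \<cdot>\<^sub>m B) = c \<cdot>\<^sub>m (A * B)"
  using assms by (rule mult_smult_assoc_mat, rule mult_smult_distrib)

lemma one_smult_mat_eq [simp]: "1 \<cdot>\<^sub>m A = (A :: 'x::comm_ring_1 mat)"
  by auto

lemma smult_smult_times [simp]: "c \<cdot>\<^sub>m (d \<cdot>\<^sub>m A) = (c * d) \<cdot>\<^sub>m (A :: 'x::comm_ring_1 mat)"
  by (auto simp: mult.assoc)

lemma transpose_smult_mat: "transpose_mat (c \<cdot>\<^sub>m A) = c \<cdot>\<^sub>m transpose_mat A"
  by auto

context symplectic_group begin

abbreviation l where "l i \<equiv> T.ord (a i)"

definition N where "N = (\<Prod>i<r. l i)"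

lemma N_pos: "N > 0"
  unfolding N_def by (intro prod_pos) (auto simp: ord_pos)

lemma of_nat_N: "of_nat N \<noteq> (0::'f)"
  unfolding N_def of_nat_prod using of_nat_primitive_root_order[OF root ord_pos[OF a_closed]] by auto

lemma prod_list_l: "prod_list (map l [0..<r]) = N"
  using prod.distinct_set_conv_list[of "[0..<r]" l] by (simp add: N_def lessThan_atLeast0)

text \<open>There are as many \<open>X t\<close> as entries of a matrix of size \<open>N\<close>,
  which makes \<open>dual_basis\<close> applicable to them.\<close>

lemma card_T: "card (carrier T) = N * N"
proof -
  have "card (carrier T) = card (basis_exponents T r a b)" using word_bij by (simp add: bij_betw_same_card)
  also have "\<dots> = N * N"
    unfolding basis_exponents_def by (simp add: card_cartesian_product card_PiE ord_b N_def)
  finally show ?thesis .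
qed

definition A where "A i = tensor_factor T r a i (clock_mat (l i) (\<beta> (a i) (b i)))"
definition B where "B i = tensor_factor T r a i (shift_mat (T.ord (b i)) :: 'f mat)"

lemma tensor_factor_carrier [simp]:
  assumes "M \<in> carrier_mat (l i) (l i)" shows "tensor_factor T r a i M \<in> carrier_mat N N"
  unfolding tensor_factor_def prod_list_l[symmetric] by (rule foldr_kronecker_carrier) (use assms in auto)

lemma tensor_factor_mult:
  fixes M M' :: "'f mat"
  assumes "M \<in> carrier_mat (l i) (l i)" "M' \<in> carrier_mat (l i) (l i)"
  shows "tensor_factor T r a i M * tensor_factor T r a i M' = tensor_factor T r a i (M * M')"
  unfolding tensor_factor_def
  by (subst foldr_kronecker_mult[where d = l]) (use assms in \<open>auto intro!: arg_cong[where f = "\<lambda>xs. foldr kronecker xs _"]\<close>)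

lemma tensor_factor_commute:
  fixes M M' :: "'f mat"
  assumes "M \<in> carrier_mat (l i) (l i)" "M' \<in> carrier_mat (l j) (l j)" "i \<noteq> j"
  shows "tensor_factor T r a i M * tensor_factor T r a j M' = tensor_factor T r a j M' * tensor_factor T r a i M"
  unfolding tensor_factor_def
  by (subst (1 2) foldr_kronecker_mult[where d = l]) (use assms in \<open>auto intro!: arg_cong[where f = "\<lambda>xs. foldr kronecker xs _"]\<close>)

lemma tensor_factor_one: "tensor_factor T r a i (1\<^sub>m (l i)) = (1\<^sub>m N :: 'f mat)"
proof -
  have "(\<lambda>j. if j = i then 1\<^sub>m (l i) else 1\<^sub>m (l j)) = (\<lambda>j. 1\<^sub>m (l j) :: 'f mat)" by auto
  thus ?thesis unfolding tensor_factor_def prod_list_l[symmetric] by (simp only: foldr_kronecker_one)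
qed

lemma tensor_factor_smult:
  assumes "i < r" shows "tensor_factor T r a i (c \<cdot>\<^sub>m M) = c \<cdot>\<^sub>m tensor_factor T r a i (M :: 'f mat)"
  unfolding tensor_factor_def by (rule foldr_kronecker_smult[where i = i]) (use assms in auto)

lemma tensor_factor_transpose:
  assumes "M \<in> carrier_mat (l i) (l i)"
  shows "transpose_mat (tensor_factor T r a i M) = tensor_factor T r a i (transpose_mat (M :: 'f mat))"
proof -
  have "(\<lambda>j. transpose_mat (if j = i then M else 1\<^sub>m (l j))) = (\<lambda>j. if j = i then transpose_mat M else 1\<^sub>m (l j))"
    by auto
  thus ?thesis unfolding tensor_factor_def
    by (subst foldr_kronecker_transpose[where d = l]) (use assms in auto)
qed

lemma A_carrier [simp]: "A i \<in> carrier_mat N N"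
  by (simp add: A_def)

lemma B_carrier [simp]: "i < r \<Longrightarrow> B i \<in> carrier_mat N N"
  by (simp add: B_def ord_b)

lemma AA: assumes "i < r" "j < r" shows "A i * A j = A j * A i"
  by (cases "i = j") (auto simp: A_def tensor_factor_commute)

lemma BB: assumes "i < r" "j < r" shows "B i * B j = B j * B i"
  using assms by (cases "i = j") (auto simp: B_def tensor_factor_commute ord_b)

lemma AB: assumes "i < r" "j < r" shows "A i * B j = \<beta> (a i) (b j) \<cdot>\<^sub>m (B j * A i)"
proof (cases "i = j")
  case True
  have "clock_mat (l i) (\<beta> (a i) (b i)) * shift_mat (l i) =
      \<beta> (a i) (b i) \<cdot>\<^sub>m (shift_mat (l i) * clock_mat (l i) (\<beta> (a i) (b i)))"
    by (rule clock_shift) (use root[OF assms(1)] assms in \<open>auto simp: primitive_root_of_unity_def\<close>)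
  thus ?thesis using assms True
    by (simp add: A_def B_def tensor_factor_mult ord_b tensor_factor_smult)
next
  case False
  thus ?thesis using assms by (auto simp: A_def B_def tensor_factor_commute beta_ab ord_b)
qed

lemma A_transpose: "transpose_mat (A i) = A i"
  by (simp add: A_def tensor_factor_transpose clock_transpose)

lemma B_orthogonal:
  assumes "i < r" shows "transpose_mat (B i) * B i = 1\<^sub>m N" "B i * transpose_mat (B i) = 1\<^sub>m N"
  using assms by (simp_all add: B_def tensor_factor_transpose ord_b tensor_factor_mult
      shift_orthogonal shift_orthogonal' tensor_factor_one)

lemma A_inverse:
  assumes "i < r" shows "\<exists>M\<in>carrier_mat N N. A i * M = 1\<^sub>m N \<and> M * A i = 1\<^sub>m N"
proof -
  obtain M where "M \<in> carrier_mat (l i) (l i)" "clock_mat (l i) (\<beta> (a i) (b i)) * M = 1\<^sub>m (l i)"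
     "M * clock_mat (l i) (\<beta> (a i) (b i)) = 1\<^sub>m (l i)"
    using clock_inverse[of "\<beta> (a i) (b i)" "l i"] assms by auto
  thus ?thesis unfolding A_def
    by (intro bexI[of _ "tensor_factor T r a i M"]) (auto simp: tensor_factor_mult tensor_factor_one)
qed

abbreviation X where "X \<equiv> X_elem T \<beta> r a b"

text \<open>\<open>X t\<close> and \<open>t\<close> are parallel words in generators, so a
  multiplicative relation between matrices and degrees need only be checked on the unit, on
  \<open>A i\<close> and on \<open>B i\<close>.\<close>

lemma X_induct [consumes 1, case_names one A B mult]:
  assumes "t \<in> carrier T" "R (1\<^sub>m N) \<one>" "\<And>i. i < r \<Longrightarrow> R (A i) (a i)" "\<And>i. i < r \<Longrightarrow> R (B i) (b i)"
    and mult: "\<And>P Q u v. P \<in> carrier_mat N N \<Longrightarrow> Q \<in> carrier_mat N N \<Longrightarrow> u \<in> carrier T \<Longrightarrow> v \<in> carrier T \<Longrightarrow>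
      R P u \<Longrightarrow> R Q v \<Longrightarrow> R (P * Q) (u \<otimes> v)"
  shows "X t \<in> carrier_mat N N \<and> R (X t) t"
proof -
  obtain e f where ef: "exps t = (e, f)" by (cases "exps t")
  define S where "S P u \<longleftrightarrow> P \<in> carrier_mat N N \<and> u \<in> carrier T \<and> R P u" for P u
  have S_mult: "S (P * Q) (u \<otimes> v)" if "S P u" "S Q v" for P Q u v
    using that mult by (auto simp: S_def)
  have S_one: "S (1\<^sub>m N) \<one>" using assms by (auto simp: S_def)
  have S_pow: "S (P ^\<^sub>m m) (u [^] m)" if "S P u" for P u m
  proof (induct m)
    case 0 thus ?case using that S_one by (auto simp: S_def)
  next
    case (Suc m) thus ?case using that S_mult by simp
  qed
  have S_AB: "S (A i ^\<^sub>m e i * B i ^\<^sub>m f i) (a i [^] e i \<otimes> b i [^] f i)" if "i < r" for i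
    using assms that by (intro S_mult S_pow) (auto simp: S_def)
  have "S (foldr (*) (map (\<lambda>i. A i ^\<^sub>m e i * B i ^\<^sub>m f i) js) (1\<^sub>m N)) (\<Otimes>i\<in>set js. a i [^] e i \<otimes> b i [^] f i)"
    if "distinct js" "set js \<subseteq> {..<r}" for js
    using that
  proof (induct js)
    case Nil thus ?case using S_one by simp
  next
    case (Cons j js)
    have eq: "(\<Otimes>i\<in>set (j # js). a i [^] e i \<otimes> b i [^] f i) =
        (a j [^] e j \<otimes> b j [^] f j) \<otimes> (\<Otimes>i\<in>set js. a i [^] e i \<otimes> b i [^] f i)"
      unfolding list.set using Cons(2,3) by (intro T.finprod_insert) (auto simp: subset_iff)
    show ?case unfolding eq list.map foldr.simps comp_def
      by (rule S_mult[OF S_AB]) (use Cons in auto)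
  qed
  from this[of "[0..<r]"] have "S (X_word T \<beta> r a b (e, f)) (basis_word T r a b (e, f))"
    by (simp add: X_word_def basis_word_def A_def B_def N_def atLeast0LessThan)
  moreover have "X_word T \<beta> r a b (e, f) = X t" by (simp add: X_elem_def flip: ef exps_def)
  moreover have "basis_word T r a b (e, f) = t" using word_exps[OF assms(1)] ef by simp
  ultimately show ?thesis by (simp add: S_def)
qed

lemma X_carrier [simp]: "t \<in> carrier T \<Longrightarrow> X t \<in> carrier_mat N N"
  using X_induct[of t "\<lambda>_ _. True"] by simp

lemma X_one: "X \<one> = 1\<^sub>m N"
proof -
  have "foldr (*) (map (\<lambda>i. 1\<^sub>m N) js) (1\<^sub>m N) = (1\<^sub>m N :: 'f mat)" for js :: "nat list"
    by (induct js) auto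
  moreover have eq: "map (\<lambda>i. A i ^\<^sub>m (if i < r then 0 else undefined) * B i ^\<^sub>m (if i < r then 0 else undefined)) [0..<r] =
      map (\<lambda>i. 1\<^sub>m N) [0..<r]"
    by (rule map_cong) (auto simp: carrier_matD[OF A_carrier] carrier_matD[OF B_carrier])
  ultimately show ?thesis
    unfolding X_elem_def exps_def[symmetric] exps_one X_word_def restrict_def split
      A_def[symmetric] B_def[symmetric] N_def[symmetric] lessThan_iff eq by blast
qed

text \<open>Homogeneity expressed by commutation with the generators instead of membership in a
  span. By nondegeneracy the commutation factors determine the degree, and invertibility excludes
  the zero matrix.\<close>

definition has_degree :: "'f mat \<Rightarrow> 'a \<Rightarrow> bool" where
  "has_degree P w \<longleftrightarrow> P \<in> carrier_mat N N \<and>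
     (\<forall>i<r. A i * P = \<beta> (a i) w \<cdot>\<^sub>m (P * A i) \<and> B i * P = \<beta> (b i) w \<cdot>\<^sub>m (P * B i)) \<and>
     (\<exists>P'\<in>carrier_mat N N. P * P' = 1\<^sub>m N \<and> P' * P = 1\<^sub>m N)"

lemma scaled_commute_mult:
  assumes "M \<in> carrier_mat n n" "P \<in> carrier_mat n n" "Q \<in> carrier_mat n n"
    "M * P = c \<cdot>\<^sub>m (P * M)" "M * Q = d \<cdot>\<^sub>m (Q * (M :: 'f mat))"
  shows "M * (P * Q) = (c * d) \<cdot>\<^sub>m ((P * Q) * M)"
proof -
  have "M * (P * Q) = (M * P) * Q" using assms(1-3) by simp
  also have "\<dots> = c \<cdot>\<^sub>m (P * (M * Q))" unfolding assms(4) using assms(1-3)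
    by (simp add: square_smult[of _ n])
  also have "\<dots> = (c * d) \<cdot>\<^sub>m ((P * Q) * M)" unfolding assms(5) using assms(1-3)
    by (simp add: square_smult[of _ n])
  finally show ?thesis .
qed

lemma has_degree_mult:
  assumes "has_degree P u" "has_degree Q v" "u \<in> carrier T" "v \<in> carrier T"
  shows "has_degree (P * Q) (u \<otimes> v)"
proof -
  note P = assms(1)[unfolded has_degree_def] and Q = assms(2)[unfolded has_degree_def]
  obtain P' Q' where P': "P' \<in> carrier_mat N N" "P * P' = 1\<^sub>m N" "P' * P = 1\<^sub>m N"
    and Q': "Q' \<in> carrier_mat N N" "Q * Q' = 1\<^sub>m N" "Q' * Q = 1\<^sub>m N" using P Q by blast
  have PQ: "P \<in> carrier_mat N N" "Q \<in> carrier_mat N N" using P Q by auto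
  have "P * Q * (Q' * P') = P * (Q * Q') * P'" using PQ P'(1) Q'(1)
    by (simp add: square_assoc[of _ N])
  hence 1: "P * Q * (Q' * P') = 1\<^sub>m N" using PQ P' Q' by simp
  have "Q' * P' * (P * Q) = Q' * (P' * P) * Q" using PQ P'(1) Q'(1)
    by (simp add: square_assoc[of _ N])
  hence 2: "Q' * P' * (P * Q) = 1\<^sub>m N" using PQ P' Q' by simp
  show ?thesis unfolding has_degree_def
  proof (intro conjI allI impI)
    fix i assume i: "i < r"
    show "A i * (P * Q) = \<beta> (a i) (u \<otimes> v) \<cdot>\<^sub>m (P * Q * A i)"
      using scaled_commute_mult[of "A i" N P Q] P Q i assms by (simp add: beta_mult2)
    show "B i * (P * Q) = \<beta> (b i) (u \<otimes> v) \<cdot>\<^sub>m (P * Q * B i)"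
      using scaled_commute_mult[of "B i" N P Q] P Q i assms by (simp add: beta_mult2)
  next
    show "\<exists>P'\<in>carrier_mat N N. P * Q * P' = 1\<^sub>m N \<and> P' * (P * Q) = 1\<^sub>m N"
      using 1 2 P' Q' by (intro bexI[of _ "Q' * P'"]) auto
  qed (use PQ in auto)
qed

lemma BA: assumes "i < r" "j < r" shows "B i * A j = \<beta> (b i) (a j) \<cdot>\<^sub>m (A j * B i)"
  using AB[OF assms(2,1)] assms beta_skew[of "b i" "a j"] by (simp)

lemma has_degree_A: "i < r \<Longrightarrow> has_degree (A i) (a i)"
  unfolding has_degree_def using A_inverse[of i] BA by (auto simp: beta_aa AA)

lemma has_degree_B: "i < r \<Longrightarrow> has_degree (B i) (b i)"
  unfolding has_degree_def using B_orthogonal[of i] AB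
  by (auto simp: beta_bb BB intro!: bexI[of _ "transpose_mat (B i)"])

lemma has_degree_one: "has_degree (1\<^sub>m N) \<one>"
  unfolding has_degree_def by (auto intro!: bexI[of _ "1\<^sub>m N"] simp: left_mult_one_mat[OF A_carrier]
    right_mult_one_mat[OF A_carrier] left_mult_one_mat[OF B_carrier] right_mult_one_mat[OF B_carrier])

lemma has_degree_X: "t \<in> carrier T \<Longrightarrow> has_degree (X t) t"
  using X_induct[of t has_degree] has_degree_A has_degree_B has_degree_one has_degree_mult by blast

lemma X_commute_degree:
  assumes "has_degree P w" "w \<in> carrier T" "t \<in> carrier T"
  shows "X t * P = \<beta> t w \<cdot>\<^sub>m (P * X t)"
proof -
  have P: "P \<in> carrier_mat N N" using assms by (simp add: has_degree_def)
  have "X t \<in> carrier_mat N N \<and> X t * P = \<beta> t w \<cdot>\<^sub>m (P * X t)"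
    using assms(3)
  proof (induct rule: X_induct)
    case (mult M Q u v)
    have "M * Q * P = M * (Q * P)" using mult P by (simp add: square_assoc[of _ N])
    also have "\<dots> = \<beta> v w \<cdot>\<^sub>m (M * P * Q)" unfolding mult(6) using mult(1-4) P
      by (simp add: square_assoc[of _ N] square_smult[of _ N])
    also have "\<dots> = \<beta> (u \<otimes> v) w \<cdot>\<^sub>m (P * (M * Q))" unfolding mult(5) using mult(1-4) P assms(2)
      by (simp add: square_assoc[of _ N] square_smult[of _ N] beta_mult1 mult.commute)
    finally show ?case .
  qed (use assms P in \<open>auto simp: has_degree_def\<close>)
  thus ?thesis by blast
qed

lemma X_commute: "u \<in> carrier T \<Longrightarrow> v \<in> carrier T \<Longrightarrow> X u * X v = \<beta> u v \<cdot>\<^sub>m (X v * X u)"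
  by (rule X_commute_degree[OF has_degree_X])

definition Xi where "Xi t = (SOME P. P \<in> carrier_mat N N \<and> X t * P = 1\<^sub>m N \<and> P * X t = 1\<^sub>m N)"

lemma Xi: assumes "t \<in> carrier T"
  shows "Xi t \<in> carrier_mat N N" "X t * Xi t = 1\<^sub>m N" "Xi t * X t = 1\<^sub>m N"
proof -
  have "Xi t \<in> carrier_mat N N \<and> X t * Xi t = 1\<^sub>m N \<and> Xi t * X t = 1\<^sub>m N"
    unfolding Xi_def by (rule someI_ex) (use has_degree_X[OF assms] in \<open>auto simp: has_degree_def\<close>)
  thus "Xi t \<in> carrier_mat N N" "X t * Xi t = 1\<^sub>m N" "Xi t * X t = 1\<^sub>m N" by auto
qed

lemma commute_inverse:
  assumes c: "M \<in> carrier_mat n n" "P \<in> carrier_mat n n" "P' \<in> carrier_mat n n"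
    and inv: "P * P' = 1\<^sub>m n" "P' * P = 1\<^sub>m n" and "M * P = d \<cdot>\<^sub>m (P * M)" "d \<noteq> (0::'f)"
  shows "M * P' = inverse d \<cdot>\<^sub>m (P' * M)"
proof -
  have "P' * (M * P) * P' = P' * M * (P * P')" using c by (simp add: square_assoc[of _ n])
  also have "\<dots> = P' * M" using c inv by simp
  finally have "P' * M = P' * (d \<cdot>\<^sub>m (P * M)) * P'" unfolding assms(6) by simp
  also have "\<dots> = d \<cdot>\<^sub>m ((P' * P) * M * P')" using c
    by (simp add: square_assoc[of _ n] square_smult[of _ n])
  also have "\<dots> = d \<cdot>\<^sub>m (M * P')" using c inv by simp
  finally show ?thesis using assms(7) c by (metis left_inverse one_smult_mat_eq smult_smult_times)
qed

text \<open>A homogeneous matrix of nontrivial degree is conjugate to a multiple of itself by a scalar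
  other than 1, so its trace vanishes.\<close>

lemma mtrace_X_Xi:
  assumes "s \<in> carrier T" "t \<in> carrier T"
  shows "mtrace (X s * Xi t) = (if s = t then of_nat N else 0)"
proof (cases "s = t")
  case True thus ?thesis using assms Xi by (simp add: mtrace_one)
next
  case False
  then obtain w where w: "w \<in> carrier T" "\<beta> w s \<noteq> \<beta> w t"
    using beta_determines[OF assms] beta_swap assms by (metis inverse_inverse_eq)
  note c = Xi[OF assms(2)] Xi[OF w(1)] X_carrier[OF assms(1)] X_carrier[OF assms(2)] X_carrier[OF w(1)]
  have "X w * Xi t = inverse (\<beta> w t) \<cdot>\<^sub>m (Xi t * X w)"
    by (rule commute_inverse[of _ N]) (use c w assms X_commute in auto)
  hence *: "X w * (X s * Xi t) = (\<beta> w s * inverse (\<beta> w t)) \<cdot>\<^sub>m ((X s * Xi t) * X w)"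
    by (intro scaled_commute_mult[of _ N] X_commute c w assms)
  define M where "M = X s * Xi t"
  have M: "M \<in> carrier_mat N N" using c by (simp add: M_def)
  have "mtrace M = mtrace (M * X w * Xi w)" using M c by (simp add: square_assoc[of _ N])
  also have "\<dots> = mtrace (Xi w * (M * X w))" by (rule mtrace_comm[of _ N N]) (use M c in auto)
  also have "(\<beta> w s * inverse (\<beta> w t)) * \<dots> = mtrace (Xi w * (X w * M))"
    unfolding *[folded M_def] using M c by (simp add: mtrace_smult[of _ N] square_smult[of _ N])
  also have "Xi w * (X w * M) = M" using M c by (simp add: square_assoc[of _ N, symmetric])
  finally have "mtrace M = 0 \<or> \<beta> w s * inverse (\<beta> w t) = 1" by simp
  thus ?thesis using w assms False by (auto simp: M_def field_simps)
qed

lemma X_dual: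
  assumes "s \<in> carrier T" "t \<in> carrier T"
  shows "(\<Sum>(u, v)\<in>{..<N} \<times> {..<N}. X s $$ (u, v) * Xi t $$ (v, u)) = (if s = t then of_nat N else 0)"
  using mtrace_X_Xi[OF assms] mtrace_mult_sum[OF X_carrier Xi(1)] assms
  by (simp add: sum.cartesian_product)

text \<open>\<open>X_dual\<close> is the orthogonality relation for the trace form; since there are
  as many degrees as positions, the dual relation holds too. In particular the \<open>X t\<close>
  span all matrices.\<close>

lemma X_complete:
  assumes "u < N" "v < N" "p < N" "q < N"
  shows "(\<Sum>t\<in>carrier T. X t $$ (u, v) * Xi t $$ (q, p)) = (if u = p \<and> v = q then of_nat N else 0)"
proof -
  have "(\<Sum>t\<in>carrier T. X t $$ (u, v) * (Xi t $$ (q, p) / of_nat N)) = (if (u, v) = (p, q) then 1 else 0)"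
    using dual_basis[of "carrier T" "{..<N} \<times> {..<N}" "\<lambda>t (p, q). Xi t $$ (q, p) / of_nat N"
        "\<lambda>(u, v) t. X t $$ (u, v)" "(u, v)" "(p, q)"]
      finite_T card_T assms X_dual of_nat_N
    by (simp add: card_cartesian_product split_beta mult.commute flip: sum_divide_distrib)
  thus ?thesis using of_nat_N by (simp add: divide_simps flip: sum_divide_distrib split: if_splits)
qed

text \<open>Commuting with generators gives commuting with every \<open>X t\<close>. Weighting these
  relations by entries of \<open>Xi t\<close> and summing with \<open>X_complete\<close> produces
  commutation with every matrix unit.\<close>

lemma commutant_scalar:
  assumes M: "M \<in> carrier_mat N N" and "\<And>i. i < r \<Longrightarrow> A i * M = M * A i" "\<And>i. i < r \<Longrightarrow> B i * M = M * B i"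
  shows "\<exists>c. M = c \<cdot>\<^sub>m 1\<^sub>m N"
proof (rule scalar_mat_from_units[OF M])
  have comm: "X t * M = M * X t" if "t \<in> carrier T" for t
  proof -
    have "X t \<in> carrier_mat N N \<and> X t * M = M * X t" using that
    proof (induct rule: X_induct)
      case (mult P Q u v)
      have "P * Q * M = P * (Q * M)" using mult M by (simp add: square_assoc[of _ N])
      also have "\<dots> = (P * M) * Q" unfolding mult(6) using mult(1-4) M by (simp add: square_assoc[of _ N])
      also have "\<dots> = M * (P * Q)" unfolding mult(5) using mult(1-4) M by (simp add: square_assoc[of _ N])
      finally show ?case .
    qed (use assms in auto)
    thus ?thesis by blast
  qed
  fix u p v q assume b: "u < N" "p < N" "v < N" "q < N"
  have "(\<Sum>t\<in>carrier T. (X t * M) $$ (u, v) * Xi t $$ (q, p)) = (\<Sum>t\<in>carrier T. (M * X t) $$ (u, v) * Xi t $$ (q, p))"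
    by (rule sum.cong) (simp_all add: comm)
  also have "(\<Sum>t\<in>carrier T. (X t * M) $$ (u, v) * Xi t $$ (q, p)) =
      (\<Sum>t\<in>carrier T. \<Sum>w<N. M $$ (w, v) * (X t $$ (u, w) * Xi t $$ (q, p)))"
    by (rule sum.cong) (use M b in \<open>auto simp: index_mult_mat_sum[of _ N N _ N] sum_distrib_left sum_distrib_right mult_ac simp del: index_mult_mat(1)\<close>)
  also have "\<dots> = (\<Sum>w<N. M $$ (w, v) * (\<Sum>t\<in>carrier T. X t $$ (u, w) * Xi t $$ (q, p)))"
    by (subst sum.swap) (simp add: sum_distrib_left)
  also have "\<dots> = (\<Sum>w<N. if w = q then (if u = p then M $$ (q, v) * of_nat N else 0) else 0)"
    by (rule sum.cong) (use b in \<open>auto simp: X_complete\<close>)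
  also have "\<dots> = (if u = p then M $$ (q, v) * of_nat N else 0)" using b by simp
  also have "(\<Sum>t\<in>carrier T. (M * X t) $$ (u, v) * Xi t $$ (q, p)) =
      (\<Sum>t\<in>carrier T. \<Sum>w<N. M $$ (u, w) * (X t $$ (w, v) * Xi t $$ (q, p)))"
    by (rule sum.cong) (use M b in \<open>auto simp: index_mult_mat_sum[of _ N N _ N] sum_distrib_left sum_distrib_right mult_ac simp del: index_mult_mat(1)\<close>)
  also have "\<dots> = (\<Sum>w<N. M $$ (u, w) * (\<Sum>t\<in>carrier T. X t $$ (w, v) * Xi t $$ (q, p)))"
    by (subst sum.swap) (simp add: sum_distrib_left)
  also have "\<dots> = (\<Sum>w<N. if w = p then (if v = q then M $$ (u, p) * of_nat N else 0) else 0)"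
    by (rule sum.cong) (use b in \<open>auto simp: X_complete\<close>)
  also have "\<dots> = (if v = q then M $$ (u, p) * of_nat N else 0)" using b by simp
  finally show "(if v = q then M $$ (u, p) else 0) = (if u = p then M $$ (q, v) else 0)"
    using of_nat_N by (auto split: if_splits)
qed

text \<open>The commutation factors of \<open>P\<close> and of \<open>X w\<close> cancel in
  \<open>P * Xi w\<close>, which therefore commutes with all generators and is a scalar.\<close>

lemma degree_unique:
  assumes "has_degree P w" "w \<in> carrier T" shows "\<exists>c. c \<noteq> 0 \<and> P = c \<cdot>\<^sub>m X w"
proof -
  note c = Xi[OF assms(2)] X_carrier[OF assms(2)]
  obtain P' where P: "P \<in> carrier_mat N N" and P': "P' \<in> carrier_mat N N" "P * P' = 1\<^sub>m N" "P' * P = 1\<^sub>m N"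
    using assms by (auto simp: has_degree_def)
  have com: "M * (P * Xi w) = P * Xi w * M"
    if "M \<in> carrier_mat N N" "v \<in> carrier T" "M * P = \<beta> v w \<cdot>\<^sub>m (P * M)" "M * X w = \<beta> v w \<cdot>\<^sub>m (X w * M)" for M v
  proof -
    have "M * Xi w = inverse (\<beta> v w) \<cdot>\<^sub>m (Xi w * M)"
      by (rule commute_inverse[of M N "X w"]) (use c that assms in auto)
    from scaled_commute_mult[OF that(1) P c(1) that(3) this] show ?thesis
      using that assms beta_nz[of v w] by simp
  qed
  have "\<exists>c. P * Xi w = c \<cdot>\<^sub>m 1\<^sub>m N"
  proof (rule commutant_scalar)
    show "A i * (P * Xi w) = P * Xi w * A i" if "i < r" for i
      using that assms has_degree_X[OF assms(2)] by (intro com[of "A i" "a i"]) (auto simp: has_degree_def)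
    show "B i * (P * Xi w) = P * Xi w * B i" if "i < r" for i
      using that assms has_degree_X[OF assms(2)] by (intro com[of "B i" "b i"]) (auto simp: has_degree_def)
  qed (use P c in auto)
  then obtain d where d: "P * Xi w = d \<cdot>\<^sub>m 1\<^sub>m N" by blast
  have "P = P * Xi w * X w" using P c by (simp add: square_assoc[of _ N])
  also have "\<dots> = d \<cdot>\<^sub>m X w" unfolding d using c by (simp add: square_smult[of _ N])
  finally have P_eq: "P = d \<cdot>\<^sub>m X w" .
  have "d \<noteq> 0"
  proof
    assume "d = 0"
    hence "P = 0\<^sub>m N N" using P_eq c by auto
    hence "1\<^sub>m N = (0\<^sub>m N N :: 'f mat)" using P' by simp
    hence "(1\<^sub>m N :: 'f mat) $$ (0, 0) = (0\<^sub>m N N) $$ (0, 0)" by simp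
    thus False using N_pos by simp
  qed
  thus ?thesis using P_eq by blast
qed

text \<open>The 2-cocycle of the twisted group algebra realised by the \<open>X t\<close>. By
  \<open>bc_swap\<close> the ratio of its values at \<open>(u, v)\<close> and \<open>(v, u)\<close>
  is \<beta>.\<close>

definition bc :: "'a \<Rightarrow> 'a \<Rightarrow> 'f" where
  "bc u v = (SOME c. c \<noteq> 0 \<and> X u * X v = c \<cdot>\<^sub>m X (u \<otimes> v))"

lemma bc: assumes "u \<in> carrier T" "v \<in> carrier T"
  shows "bc u v \<noteq> 0" "X u * X v = bc u v \<cdot>\<^sub>m X (u \<otimes> v)"
proof -
  have "bc u v \<noteq> 0 \<and> X u * X v = bc u v \<cdot>\<^sub>m X (u \<otimes> v)" unfolding bc_def
    by (rule someI_ex, rule degree_unique[OF has_degree_mult[OF has_degree_X has_degree_X]]) (use assms in auto)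
  thus "bc u v \<noteq> 0" "X u * X v = bc u v \<cdot>\<^sub>m X (u \<otimes> v)" by auto
qed

lemma X_smult_cancel:
  assumes "t \<in> carrier T" "c \<cdot>\<^sub>m X t = d \<cdot>\<^sub>m X t" shows "c = d"
proof -
  have "mtrace (c \<cdot>\<^sub>m X t * Xi t) = mtrace (d \<cdot>\<^sub>m X t * Xi t)" using assms by simp
  thus ?thesis using Xi[OF assms(1)] assms(1) N_pos of_nat_N
    by (simp add: square_smult[of _ N] mtrace_smult[of _ N] mtrace_one)
qed

lemma bc_swap: assumes "u \<in> carrier T" "v \<in> carrier T" shows "bc u v = \<beta> u v * bc v u"
  by (rule X_smult_cancel[of "u \<otimes> v"]) (use assms X_commute[OF assms] bc(2)[OF assms] bc(2)[OF assms(2,1)] in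
    \<open>auto simp: T.m_comm\<close>)

lemma bc_one1: assumes "u \<in> carrier T" shows "bc \<one> u = 1"
  by (rule X_smult_cancel[of u]) (use assms bc(2)[of \<one> u] in \<open>auto simp: X_one left_mult_one_mat[OF X_carrier]\<close>)

lemma bc_one2: assumes "u \<in> carrier T" shows "bc u \<one> = 1"
  by (rule X_smult_cancel[of u]) (use assms bc(2)[of u \<one>] in \<open>auto simp: X_one right_mult_one_mat[OF X_carrier]\<close>)

lemma bc_cocycle: assumes "u \<in> carrier T" "v \<in> carrier T" "w \<in> carrier T"
  shows "bc u v * bc (u \<otimes> v) w = bc v w * bc u (v \<otimes> w)"
proof (rule X_smult_cancel[of "u \<otimes> v \<otimes> w"])
  have "X u * X v * X w = X u * (X v * X w)" using assms by (simp add: square_assoc[of _ N])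
  thus "bc u v * bc (u \<otimes> v) w \<cdot>\<^sub>m X (u \<otimes> v \<otimes> w) = bc v w * bc u (v \<otimes> w) \<cdot>\<^sub>m X (u \<otimes> v \<otimes> w)"
    using assms bc(2)[of u v] bc(2)[of v w] bc(2)[of "u \<otimes> v" w] bc(2)[of u "v \<otimes> w"]
    by (simp add: square_smult[of _ N] T.m_assoc)
qed (use assms in auto)

text \<open>\<open>A i\<close> is symmetric and \<open>B i\<close> is orthogonal, so transposing the
  commutation relations of \<open>X t\<close> inverts the factor at \<open>A i\<close> and keeps the
  one at \<open>B i\<close>. These are the factors of the degree
  \<open>inv (\<sigma> t)\<close>.\<close>

lemma X_transpose: assumes "t \<in> carrier T" shows "\<exists>c. c \<noteq> 0 \<and> transpose_mat (X t) = c \<cdot>\<^sub>m X (inv (\<sigma> t))"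
proof (rule degree_unique)
  note c = Xi[OF assms] X_carrier[OF assms]
  have d: "\<beta> (a i) (inv (\<sigma> t)) = inverse (\<beta> (a i) t)" "\<beta> (b i) (inv (\<sigma> t)) = \<beta> (b i) t"
    if "i < r" for i
  proof -
    have "\<beta> (\<sigma> (a i)) (\<sigma> t) = \<beta> t (a i)" "\<beta> (\<sigma> (b i)) (\<sigma> t) = \<beta> t (b i)"
      using that assms by (intro beta_sigma; simp)+
    thus "\<beta> (a i) (inv (\<sigma> t)) = inverse (\<beta> (a i) t)" "\<beta> (b i) (inv (\<sigma> t)) = \<beta> (b i) t"
      using that assms by (auto simp: beta_inv1 beta_inv2 beta_swap[of "a i" t] beta_swap[of "b i" t])
  qed
  show "has_degree (transpose_mat (X t)) (inv (\<sigma> t))"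
    unfolding has_degree_def
  proof (intro conjI allI impI)
    fix i assume i: "i < r"
    have "A i * X t = \<beta> (a i) t \<cdot>\<^sub>m (X t * A i)" using has_degree_X[OF assms] i by (simp add: has_degree_def)
    hence "transpose_mat (A i * X t) = \<beta> (a i) t \<cdot>\<^sub>m transpose_mat (X t * A i)" by (simp only: transpose_smult_mat)
    hence "transpose_mat (X t) * A i = \<beta> (a i) t \<cdot>\<^sub>m (A i * transpose_mat (X t))"
      using c by (simp add: transpose_mult[of _ N N _ N] A_transpose)
    thus "A i * transpose_mat (X t) = \<beta> (a i) (inv (\<sigma> t)) \<cdot>\<^sub>m (transpose_mat (X t) * A i)"
      using i d assms beta_nz[of "a i" t] by (simp)
    have "B i * X t = \<beta> (b i) t \<cdot>\<^sub>m (X t * B i)" using has_degree_X[OF assms] i by (simp add: has_degree_def)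
    hence "transpose_mat (B i * X t) = \<beta> (b i) t \<cdot>\<^sub>m transpose_mat (X t * B i)" by (simp only: transpose_smult_mat)
    hence "transpose_mat (X t) * transpose_mat (B i) = \<beta> (b i) t \<cdot>\<^sub>m (transpose_mat (B i) * transpose_mat (X t))"
      using c i by (simp add: transpose_mult[of _ N N _ N])
    hence "transpose_mat (X t) * B i = inverse (\<beta> (b i) t) \<cdot>\<^sub>m (B i * transpose_mat (X t))"
      by (rule commute_inverse[of _ N, rotated 5]) (use i c assms B_orthogonal in auto)
    thus "B i * transpose_mat (X t) = \<beta> (b i) (inv (\<sigma> t)) \<cdot>\<^sub>m (transpose_mat (X t) * B i)"
      using i d assms beta_nz[of "b i" t] by (simp)
  next
    have "transpose_mat (X t) * transpose_mat (Xi t) = 1\<^sub>m N" "transpose_mat (Xi t) * transpose_mat (X t) = 1\<^sub>m N"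
      using c by (simp_all add: transpose_mult[of _ N N _ N, symmetric])
    thus "\<exists>P'\<in>carrier_mat N N. transpose_mat (X t) * P' = 1\<^sub>m N \<and> P' * transpose_mat (X t) = 1\<^sub>m N"
      using c by (intro bexI[of _ "transpose_mat (Xi t)"]) auto
  qed (use c in auto)
qed (use assms in auto)

text \<open>The automorphism to be built sends \<open>X t\<close> to \<open>c t\<close> times
  \<open>X (\<alpha> t)\<close>. The cocycle pulled back along \<alpha>, divided by the cocycle
  itself, is symmetric because \<alpha> preserves \<beta>, so it splits.\<close>

lemma automorphism_scalars:
  assumes "\<alpha> \<in> hom T T" "\<And>u v. u \<in> carrier T \<Longrightarrow> v \<in> carrier T \<Longrightarrow> \<beta> (\<alpha> u) (\<alpha> v) = \<beta> u v"
  obtains c where "\<And>u. u \<in> carrier T \<Longrightarrow> c u \<noteq> 0"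
    "\<And>u v. u \<in> carrier T \<Longrightarrow> v \<in> carrier T \<Longrightarrow> bc u v * c (u \<otimes> v) = bc (\<alpha> u) (\<alpha> v) * c u * c v"
proof -
  interpret \<alpha>: group_hom T T \<alpha> by unfold_locales (rule assms(1))
  define d where "d u v = bc (\<alpha> u) (\<alpha> v) / bc u v" for u v
  obtain c where c: "\<And>u. u \<in> carrier T \<Longrightarrow> c u \<noteq> 0"
      "\<And>u v. u \<in> carrier T \<Longrightarrow> v \<in> carrier T \<Longrightarrow> c (u \<otimes> v) = d u v * c u * c v"
  proof (rule symmetric_cocycle_splits[of d])
    fix u v assume uv: "u \<in> carrier T" "v \<in> carrier T"
    show "d u v \<noteq> 0" using uv bc(1) by (simp add: d_def)
    show "d u v = d v u" using uv bc(1) bc_swap[of u v] bc_swap[of "\<alpha> u" "\<alpha> v"] assms(2)[OF uv]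
      by (simp add: d_def)
    fix w assume w: "w \<in> carrier T"
    show "d u v * d (u \<otimes> v) w = d v w * d u (v \<otimes> w)"
      using bc_cocycle[OF uv w] bc_cocycle[of "\<alpha> u" "\<alpha> v" "\<alpha> w"] uv w by (simp add: d_def)
  qed blast
  show ?thesis
    by (rule that[of c]) (use c bc(1) in \<open>auto simp: d_def\<close>)
qed

end

subsection \<open>The Lie algebra psl\<close>

abbreviation mat_span :: "nat \<Rightarrow> 'f::field mat set \<Rightarrow> 'f mat set" where
  "mat_span n S \<equiv> LinearCombinations.module.span class_ring (module_mat TYPE('f) n n) S"

lemma mat_span_induct:
  fixes S :: "'f::field mat set"
  assumes "M \<in> mat_span n S" "S \<subseteq> carrier_mat n n"
    and zero: "P (0\<^sub>m n n)" and base: "\<And>A. A \<in> S \<Longrightarrow> P A"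
    and add: "\<And>A B. A \<in> carrier_mat n n \<Longrightarrow> B \<in> carrier_mat n n \<Longrightarrow> P A \<Longrightarrow> P B \<Longrightarrow> P (A + B)"
    and smult: "\<And>c A. A \<in> carrier_mat n n \<Longrightarrow> P A \<Longrightarrow> P (c \<cdot>\<^sub>m A)"
  shows "M \<in> carrier_mat n n \<and> P M"
proof -
  interpret V: vectorspace "class_ring :: 'f ring" "module_mat TYPE('f) n n" by (rule matrix_vs)
  have "submodule class_ring {A \<in> carrier_mat n n. P A} (module_mat TYPE('f) n n)"
    by (unfold_locales) (use zero add smult in \<open>auto simp: matrix_vs_simps\<close>)
  from V.span_is_subset[OF _ this, of S] show ?thesis using assms(1,2) base by auto
qed

lemma
  fixes S :: "'f::field mat set"
  assumes "S \<subseteq> carrier_mat n n"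
  shows mat_span_carrier: "mat_span n S \<subseteq> carrier_mat n n"
    and mat_span_base: "A \<in> S \<Longrightarrow> A \<in> mat_span n S"
    and mat_span_zero: "0\<^sub>m n n \<in> mat_span n S"
    and mat_span_add: "A \<in> mat_span n S \<Longrightarrow> B \<in> mat_span n S \<Longrightarrow> A + B \<in> mat_span n S"
    and mat_span_smult: "A \<in> mat_span n S \<Longrightarrow> c \<cdot>\<^sub>m A \<in> mat_span n S"
proof -
  interpret V: vectorspace "class_ring :: 'f ring" "module_mat TYPE('f) n n" by (rule matrix_vs)
  have S: "S \<subseteq> carrier (module_mat TYPE('f) n n)" using assms by (simp add: matrix_vs_simps)
  interpret sub: LinearCombinations.submodule "class_ring :: 'f ring" "mat_span n S" "module_mat TYPE('f) n n"
    by (rule V.span_is_submodule[OF S])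
  show "mat_span n S \<subseteq> carrier_mat n n" using sub.subset by (simp add: matrix_vs_simps)
  show "A \<in> S \<Longrightarrow> A \<in> mat_span n S" using V.in_own_span[OF S] by auto
  show "0\<^sub>m n n \<in> mat_span n S" using sub.zero_closed by (simp add: matrix_vs_simps)
  show "A \<in> mat_span n S \<Longrightarrow> B \<in> mat_span n S \<Longrightarrow> A + B \<in> mat_span n S"
    using sub.m_closed by (simp add: matrix_vs_simps)
  show "A \<in> mat_span n S \<Longrightarrow> c \<cdot>\<^sub>m A \<in> mat_span n S"
    using sub.smult_closed by (simp add: matrix_vs_simps)
qed

definition brk :: "'f::comm_ring_1 mat \<Rightarrow> 'f mat \<Rightarrow> 'f mat" where
  "brk A B = A * B - B * A"

lemma brk_carrier [simp]: "A \<in> carrier_mat n n \<Longrightarrow> B \<in> carrier_mat n n \<Longrightarrow> brk A B \<in> carrier_mat n n"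
  unfolding brk_def by (intro minus_carrier_mat mult_carrier_mat)

lemma mat_add_minus_add:
  fixes P Q R S :: "'f::comm_ring_1 mat"
  assumes "P \<in> carrier_mat n m" "Q \<in> carrier_mat n m" "R \<in> carrier_mat n m" "S \<in> carrier_mat n m"
  shows "P + Q - (R + S) = P - R + (Q - S)"
  using assms by auto

lemma brk_add:
  fixes A B C :: "'f::comm_ring_1 mat"
  assumes "A \<in> carrier_mat n n" "B \<in> carrier_mat n n" "C \<in> carrier_mat n n"
  shows "brk (A + B) C = brk A C + brk B C" "brk C (A + B) = brk C A + brk C B"
proof -
  have *: "A * C \<in> carrier_mat n n" "B * C \<in> carrier_mat n n" "C * A \<in> carrier_mat n n" "C * B \<in> carrier_mat n n"
    using assms by auto
  have "(A + B) * C = A * C + B * C" "C * (A + B) = C * A + C * B"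
    using assms by (rule add_mult_distrib_mat, intro mult_add_distrib_mat) (use assms in auto)
  thus "brk (A + B) C = brk A C + brk B C" "brk C (A + B) = brk C A + brk C B"
    unfolding brk_def using * by (simp_all add: mat_add_minus_add[of _ n n])
qed

lemma brk_smult:
  assumes "A \<in> carrier_mat n n" "B \<in> carrier_mat n n"
  shows "brk (c \<cdot>\<^sub>m A) B = c \<cdot>\<^sub>m brk A B" "brk A (c \<cdot>\<^sub>m B) = c \<cdot>\<^sub>m brk A (B :: 'f::comm_ring_1 mat)"
  using assms by (auto simp: brk_def square_smult[of _ n] right_diff_distrib)

lemma smult_minus: "A \<in> carrier_mat n m \<Longrightarrow> B \<in> carrier_mat n m \<Longrightarrow>
    c \<cdot>\<^sub>m (A - B) = c \<cdot>\<^sub>m A - c \<cdot>\<^sub>m (B :: 'f::comm_ring_1 mat)"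
  by (auto simp: right_diff_distrib)

locale psl_algebra =
  fixes n :: nat and ty :: "'f::field itself"
begin

abbreviation sl :: "'f mat set" where "sl \<equiv> commutator_space TYPE('f) n"
abbreviation K :: "'f mat set" where "K \<equiv> psl_kernel TYPE('f) n"
abbreviation cls :: "'f mat \<Rightarrow> 'f mat set" where "cls \<equiv> psl_class n"
abbreviation L where "L \<equiv> psl TYPE('f) n"

lemma gens: "{A * B - B * A | A B. A \<in> carrier_mat n n \<and> B \<in> carrier_mat n n} \<subseteq> (carrier_mat n n :: 'f mat set)"
  by auto

lemma sl_carrier [simp]: "A \<in> sl \<Longrightarrow> A \<in> carrier_mat n n"
  using mat_span_carrier[OF gens] by (auto simp: commutator_space_def)

lemma sl_brk [simp]: "A \<in> carrier_mat n n \<Longrightarrow> B \<in> carrier_mat n n \<Longrightarrow> brk A B \<in> sl"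
  unfolding commutator_space_def brk_def by (rule mat_span_base[OF gens]) auto

lemma sl_zero [simp]: "0\<^sub>m n n \<in> sl"
  unfolding commutator_space_def by (rule mat_span_zero[OF gens])

lemma sl_add [simp]: "A \<in> sl \<Longrightarrow> B \<in> sl \<Longrightarrow> A + B \<in> sl"
  unfolding commutator_space_def by (rule mat_span_add[OF gens])

lemma sl_smult [simp]: "A \<in> sl \<Longrightarrow> c \<cdot>\<^sub>m A \<in> sl"
  unfolding commutator_space_def by (rule mat_span_smult[OF gens])

lemma minus_as_add: "A \<in> carrier_mat n n \<Longrightarrow> B \<in> carrier_mat n n \<Longrightarrow> A - B = A + (-1) \<cdot>\<^sub>m (B :: 'f mat)"
  by auto

lemma sl_induct:
  assumes "M \<in> sl" "P (0\<^sub>m n n)" "\<And>A B. A \<in> carrier_mat n n \<Longrightarrow> B \<in> carrier_mat n n \<Longrightarrow> P (brk A B)"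
    and "\<And>A B. A \<in> carrier_mat n n \<Longrightarrow> B \<in> carrier_mat n n \<Longrightarrow> P A \<Longrightarrow> P B \<Longrightarrow> P (A + B)"
    and "\<And>c A. A \<in> carrier_mat n n \<Longrightarrow> P A \<Longrightarrow> P (c \<cdot>\<^sub>m A)"
  shows "P M"
  using mat_span_induct[OF assms(1)[unfolded commutator_space_def] gens, of P] assms(2-)
  by (auto simp: brk_def)

lemma K_iff: "Z \<in> K \<longleftrightarrow> Z \<in> sl \<and> (\<forall>A\<in>carrier_mat n n. Z * A = A * Z)"
  by (auto simp: psl_kernel_def mat_center_def)

lemma K_carrier [simp]: "Z \<in> K \<Longrightarrow> Z \<in> carrier_mat n n"
  by (simp add: K_iff)

lemma K_zero [simp]: "0\<^sub>m n n \<in> K"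
  by (simp add: K_iff)

lemma K_add [simp]: "Y \<in> K \<Longrightarrow> Z \<in> K \<Longrightarrow> Y + Z \<in> K"
proof -
  assume YZ: "Y \<in> K" "Z \<in> K"
  have "(Y + Z) * A = A * (Y + Z)" if A: "A \<in> carrier_mat n n" for A
  proof -
    have c: "Y \<in> carrier_mat n n" "Z \<in> carrier_mat n n" "Y * A = A * Y" "Z * A = A * Z"
      using YZ A unfolding psl_kernel_def mat_center_def by blast+
    show ?thesis unfolding add_mult_distrib_mat[OF c(1,2) A] mult_add_distrib_mat[OF A c(1,2)] c(3,4) ..
  qed
  thus ?thesis using YZ by (simp add: K_iff)
qed

lemma K_smult [simp]: "Z \<in> K \<Longrightarrow> c \<cdot>\<^sub>m Z \<in> K"
  by (auto simp: K_iff square_smult[of _ n])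

lemma K_minus [simp]: "Y \<in> K \<Longrightarrow> Z \<in> K \<Longrightarrow> Y - Z \<in> K"
  by (simp add: minus_as_add)

lemma cls_def': "cls A = (\<lambda>Z. Z + A) ` K"
  by (auto simp: psl_class_def a_r_coset_def r_coset_def module_mat_simps)

lemma cls_self: "A \<in> carrier_mat n n \<Longrightarrow> A \<in> cls A"
  unfolding cls_def' by (rule image_eqI[of _ _ "0\<^sub>m n n"]) auto

lemma cls_eq_iff:
  assumes "A \<in> carrier_mat n n" "B \<in> carrier_mat n n"
  shows "cls A = cls B \<longleftrightarrow> A - B \<in> K"
proof
  assume "cls A = cls B"
  then obtain Z where "Z \<in> K" "A = Z + B" using cls_self[OF assms(1)] by (auto simp: cls_def')
  moreover from this have "Z \<in> carrier_mat n n" by simp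
  hence "Z + B - B = Z" using assms by auto
  ultimately show "A - B \<in> K" by simp
next
  assume Z: "A - B \<in> K"
  have "Y + A = (Y + (A - B)) + B" if "Y \<in> carrier_mat n n" for Y using that assms by auto
  moreover have "Y + B = (Y - (A - B)) + A" if "Y \<in> carrier_mat n n" for Y using that assms by auto
  ultimately show "cls A = cls B" unfolding cls_def' using Z
    by (intro subset_antisym image_subsetI) (metis K_carrier K_add K_minus image_eqI)+
qed

lemma cls_mem: assumes "A \<in> carrier_mat n n" "C \<in> cls A"
  shows "C \<in> carrier_mat n n" "C - A \<in> K" "cls C = cls A"
proof -
  obtain Z where Z: "Z \<in> K" "C = Z + A" using assms by (auto simp: cls_def')
  have Zc: "Z \<in> carrier_mat n n" using Z by simp
  show C: "C \<in> carrier_mat n n" unfolding Z(2) using assms Zc by simp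
  have "C - A = Z" unfolding Z(2) using assms(1) Zc by auto
  thus *: "C - A \<in> K" using Z by simp
  show "cls C = cls A" using cls_eq_iff C assms * by blast
qed

lemma carrier_L: "carrier L = cls ` sl"
  and zero_L: "\<zero>\<^bsub>L\<^esub> = cls (0\<^sub>m n n)"
proof -
  have "cls (0\<^sub>m n n) = (\<lambda>Z. Z) ` K" unfolding cls_def' by (rule image_cong) (auto dest: K_carrier)
  thus "\<zero>\<^bsub>L\<^esub> = cls (0\<^sub>m n n)" by (simp add: psl_def)
qed (simp add: psl_def)

lemma cls_add:
  assumes "A \<in> carrier_mat n n" "B \<in> carrier_mat n n"
  shows "cls A \<oplus>\<^bsub>L\<^esub> cls B = cls (A + B)"
proof -
  have "cls A \<oplus>\<^bsub>L\<^esub> cls B = {x + y | x y. x \<in> cls A \<and> y \<in> cls B}"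
    by (auto simp: psl_def set_add_def set_mult_def module_mat_simps)
  also have "\<dots> = cls (A + B)"
  proof (intro subset_antisym subsetI)
    fix z assume "z \<in> {x + y | x y. x \<in> cls A \<and> y \<in> cls B}"
    then obtain Y Z where YZ: "Y \<in> K" "Z \<in> K" "z = (Y + A) + (Z + B)" by (auto simp: cls_def')
    have "Y \<in> carrier_mat n n" "Z \<in> carrier_mat n n" using YZ by auto
    hence "z = (Y + Z) + (A + B)" unfolding YZ(3) using assms by auto
    thus "z \<in> cls (A + B)" using YZ by (auto simp: cls_def')
  next
    fix z assume "z \<in> cls (A + B)"
    then obtain Y where Y: "Y \<in> K" "z = Y + (A + B)" by (auto simp: cls_def')
    have "Y \<in> carrier_mat n n" using Y by auto
    hence "z = (Y + A) + B" unfolding Y(2) using assms by auto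
    moreover have "Y + A \<in> cls A" using Y by (auto simp: cls_def')
    ultimately show "z \<in> {x + y | x y. x \<in> cls A \<and> y \<in> cls B}" using cls_self[OF assms(2)] by blast
  qed
  finally show ?thesis .
qed

lemma cls_smult:
  assumes "A \<in> carrier_mat n n"
  shows "c \<odot>\<^bsub>L\<^esub> cls A = cls (c \<cdot>\<^sub>m A)"
proof -
  have "cls (c \<cdot>\<^sub>m C) = cls (c \<cdot>\<^sub>m A)" if "C \<in> cls A" for C
  proof -
    note C = cls_mem[OF assms that]
    have "c \<cdot>\<^sub>m C - c \<cdot>\<^sub>m A = c \<cdot>\<^sub>m (C - A)" using C assms by (simp add: smult_minus)
    thus ?thesis using C assms by (simp add: cls_eq_iff)
  qed
  hence "(\<Union>C\<in>cls A. cls (c \<cdot>\<^sub>m C)) = cls (c \<cdot>\<^sub>m A)" using cls_self[OF assms] by blast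
  thus ?thesis by (simp add: psl_def)
qed

lemma brk_K:
  assumes "Z \<in> K" "A \<in> carrier_mat n n"
  shows "brk Z A = 0\<^sub>m n n" "brk A Z = 0\<^sub>m n n"
proof -
  have "Z * A = A * Z" using assms unfolding psl_kernel_def mat_center_def by blast
  moreover have "A * Z \<in> carrier_mat n n" using assms by simp
  ultimately show "brk Z A = 0\<^sub>m n n" "brk A Z = 0\<^sub>m n n" by (simp_all add: brk_def)
qed

text \<open>Central summands disappear in a bracket, so the bracket of two classes has a well
  defined matrix representative; this collapses the unions in the definition of
  \<open>psl\<close>.\<close>

lemma brk_central:
  assumes "A \<in> carrier_mat n n" "B \<in> carrier_mat n n" "C \<in> cls A" "D \<in> cls B"
  shows "brk C D = brk A B"
proof -
  obtain Y Z where YZ: "Y \<in> K" "C = Y + A" "Z \<in> K" "D = Z + B" using assms by (auto simp: cls_def')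
  have c: "Y \<in> carrier_mat n n" "Z \<in> carrier_mat n n" using YZ by auto
  have "brk C D = brk Y (Z + B) + (brk A Z + brk A B)"
    unfolding YZ(2,4) using assms(1,2) c
    by (simp add: brk_add(1)[of Y n A "Z + B"] brk_add(2)[of Z n B A])
  also have "\<dots> = brk A B" using YZ assms c by (simp add: brk_K)
  finally show ?thesis .
qed

lemma cls_brk:
  assumes "A \<in> carrier_mat n n" "B \<in> carrier_mat n n"
  shows "cls A \<otimes>\<^bsub>L\<^esub> cls B = cls (brk A B)"
proof -
  have "cls (C * D - D * C) = cls (brk A B)" if "C \<in> cls A" "D \<in> cls B" for C D
    using brk_central[OF assms that] by (simp add: brk_def)
  hence "(\<Union>C\<in>cls A. \<Union>D\<in>cls B. cls (C * D - D * C)) = cls (brk A B)"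
    using cls_self[OF assms(1)] cls_self[OF assms(2)] by blast
  thus ?thesis by (simp add: psl_def)
qed

text \<open>Automorphisms of the Lie algebra of all matrices. The realising maps, associative
  automorphisms and minus the transpose, are of this kind, and such maps preserve the commutator
  space and its central part.\<close>

definition lie_auto :: "('f mat \<Rightarrow> 'f mat) \<Rightarrow> bool" where
  "lie_auto \<phi> \<longleftrightarrow> bij_betw \<phi> (carrier_mat n n) (carrier_mat n n) \<and>
     (\<forall>A\<in>carrier_mat n n. \<forall>B\<in>carrier_mat n n. \<phi> (A + B) = \<phi> A + \<phi> B \<and> \<phi> (brk A B) = brk (\<phi> A) (\<phi> B)) \<and>
     (\<forall>c. \<forall>A\<in>carrier_mat n n. \<phi> (c \<cdot>\<^sub>m A) = c \<cdot>\<^sub>m \<phi> A)"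

lemma lie_autoD:
  assumes "lie_auto \<phi>" "A \<in> carrier_mat n n" "B \<in> carrier_mat n n"
  shows "\<phi> A \<in> carrier_mat n n" "\<phi> (A + B) = \<phi> A + \<phi> B" "\<phi> (brk A B) = brk (\<phi> A) (\<phi> B)"
    "\<phi> (c \<cdot>\<^sub>m A) = c \<cdot>\<^sub>m \<phi> A" "\<phi> A = \<phi> B \<longleftrightarrow> A = B"
  using assms by (auto simp: lie_auto_def bij_betw_def inj_on_def)

lemma lie_auto_zero: assumes "lie_auto \<phi>" shows "\<phi> (0\<^sub>m n n) = 0\<^sub>m n n"
proof -
  have z: "0\<^sub>m n n \<in> carrier_mat n n" by simp
  have "\<phi> (0\<^sub>m n n) = \<phi> (0 \<cdot>\<^sub>m 0\<^sub>m n n)" by simp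
  also have "\<dots> = 0 \<cdot>\<^sub>m \<phi> (0\<^sub>m n n)" by (rule lie_autoD(4)[OF assms z z])
  also have "\<dots> = 0\<^sub>m n n" using lie_autoD(1)[OF assms z z] by auto
  finally show ?thesis .
qed

lemma lie_auto_inv:
  assumes "lie_auto \<phi>"
  obtains \<psi> where "lie_auto \<psi>" "\<And>A. A \<in> carrier_mat n n \<Longrightarrow> \<psi> (\<phi> A) = A"
    "\<And>A. A \<in> carrier_mat n n \<Longrightarrow> \<phi> (\<psi> A) = A"
proof -
  let ?C = "carrier_mat n n :: 'f mat set"
  define \<psi> where "\<psi> = inv_into ?C \<phi>"
  have bij: "bij_betw \<phi> ?C ?C" using assms by (simp add: lie_auto_def)
  have i: "\<psi> (\<phi> A) = A" "\<phi> (\<psi> A) = A" "\<psi> A \<in> ?C" if "A \<in> ?C" for A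
    using bij that by (auto simp: \<psi>_def bij_betw_def inv_into_into f_inv_into_f)
  have "lie_auto \<psi>" unfolding lie_auto_def
  proof (intro conjI ballI allI)
    show "bij_betw \<psi> ?C ?C" unfolding \<psi>_def by (rule bij_betw_inv_into[OF bij])
    fix A B assume AB: "A \<in> ?C" "B \<in> ?C"
    show "\<psi> (A + B) = \<psi> A + \<psi> B"
      using AB i lie_autoD[OF assms, of "\<psi> A" "\<psi> B"] by (metis add_carrier_mat)
    show "\<psi> (brk A B) = brk (\<psi> A) (\<psi> B)"
      using AB i lie_autoD[OF assms, of "\<psi> A" "\<psi> B"] by (metis brk_carrier)
  next
    fix c A assume A: "A \<in> ?C"
    show "\<psi> (c \<cdot>\<^sub>m A) = c \<cdot>\<^sub>m \<psi> A"
      using A i lie_autoD(4)[OF assms, of "\<psi> A"] by (metis smult_carrier_mat)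
  qed
  thus ?thesis using i that by blast
qed

lemma lie_auto_sl: assumes "lie_auto \<phi>" "A \<in> sl" shows "\<phi> A \<in> sl"
  using assms(2) by (rule sl_induct) (auto simp: lie_autoD[OF assms(1)] lie_auto_zero[OF assms(1)])

lemma lie_auto_K: assumes "lie_auto \<phi>" "Z \<in> K" shows "\<phi> Z \<in> K"
  unfolding K_iff
proof (intro conjI ballI)
  show "\<phi> Z \<in> sl" using assms lie_auto_sl by (auto simp: K_iff)
  fix B :: "'f mat" assume B: "B \<in> carrier_mat n n"
  obtain \<psi> where \<psi>: "lie_auto \<psi>" "\<And>A. A \<in> carrier_mat n n \<Longrightarrow> \<phi> (\<psi> A) = A" using lie_auto_inv[OF assms(1)] by metis
  have c: "\<psi> B \<in> carrier_mat n n" "Z \<in> carrier_mat n n" using lie_autoD(1)[OF \<psi>(1) B B] assms by auto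
  have "brk Z (\<psi> B) = 0\<^sub>m n n" using assms c by (auto simp: brk_def K_iff)
  hence "brk (\<phi> Z) B = 0\<^sub>m n n" using lie_autoD(3)[OF assms(1) c(2,1)] \<psi>(2)[OF B] lie_auto_zero[OF assms(1)] by simp
  moreover have "\<phi> Z \<in> carrier_mat n n" using lie_autoD(1)[OF assms(1) c(2) c(2)] .
  ultimately have "(\<phi> Z * B - B * \<phi> Z) $$ (i, j) = 0" if "i < n" "j < n" for i j
    using that by (simp add: brk_def)
  thus "\<phi> Z * B = B * \<phi> Z" using B \<open>\<phi> Z \<in> carrier_mat n n\<close>
    by (intro eq_matI) (auto simp del: index_mult_mat(1))
qed

text \<open>Taking images of cosets avoids a choice of representatives; the restriction makes the
  map extensional, as \<open>Bij\<close> demands.\<close>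

definition induced :: "('f mat \<Rightarrow> 'f mat) \<Rightarrow> 'f mat set \<Rightarrow> 'f mat set" where
  "induced \<phi> = (\<lambda>P\<in>carrier L. \<phi> ` P)"

lemma lie_auto_cls:
  assumes "lie_auto \<phi>" "A \<in> carrier_mat n n" shows "\<phi> ` cls A = cls (\<phi> A)"
proof -
  obtain \<psi> where \<psi>: "lie_auto \<psi>" "\<And>A. A \<in> carrier_mat n n \<Longrightarrow> \<phi> (\<psi> A) = A" using lie_auto_inv[OF assms(1)] by metis
  have "\<phi> ` K = K"
  proof (intro subset_antisym subsetI)
    fix Z assume "Z \<in> K" thus "Z \<in> \<phi> ` K" using lie_auto_K[OF \<psi>(1)] \<psi>(2)[of Z] by (metis K_carrier image_eqI)
  qed (use lie_auto_K[OF assms(1)] in auto)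
  hence "cls (\<phi> A) = (\<lambda>Z. Z + \<phi> A) ` \<phi> ` K" unfolding cls_def' by simp
  also have "\<dots> = \<phi> ` cls A" unfolding cls_def' image_image
    by (rule image_cong) (use lie_autoD[OF assms(1)] assms in auto)
  finally show ?thesis by simp
qed

lemma induced_cls: "lie_auto \<phi> \<Longrightarrow> A \<in> sl \<Longrightarrow> induced \<phi> (cls A) = cls (\<phi> A)"
  by (simp add: induced_def carrier_L lie_auto_cls)

lemma induced_automorphism:
  assumes "lie_auto \<phi>" shows "induced \<phi> \<in> alg_automorphisms L"
proof -
  obtain \<psi> where \<psi>: "lie_auto \<psi>" "\<And>A. A \<in> carrier_mat n n \<Longrightarrow> \<psi> (\<phi> A) = A"
    "\<And>A. A \<in> carrier_mat n n \<Longrightarrow> \<phi> (\<psi> A) = A" using lie_auto_inv[OF assms] by metis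
  have mem: "induced \<phi> P \<in> carrier L" if "lie_auto \<phi>" "P \<in> carrier L" for P \<phi>
    using that by (auto simp: carrier_L induced_cls lie_auto_sl)
  have "induced \<psi> (induced \<phi> P) = P" "induced \<phi> (induced \<psi> P) = P" if "P \<in> carrier L" for P
    using that assms \<psi> by (auto simp: carrier_L induced_cls lie_auto_sl)
  hence "bij_betw (induced \<phi>) (carrier L) (carrier L)"
    using mem[OF assms] mem[OF \<psi>(1)] by (intro bij_betw_byWitness[where f' = "induced \<psi>"]) auto
  moreover have "induced \<phi> \<in> extensional (carrier L)" by (simp add: induced_def)
  moreover have "induced \<phi> (P \<oplus>\<^bsub>L\<^esub> Q) = induced \<phi> P \<oplus>\<^bsub>L\<^esub> induced \<phi> Q \<and>
      induced \<phi> (P \<otimes>\<^bsub>L\<^esub> Q) = induced \<phi> P \<otimes>\<^bsub>L\<^esub> induced \<phi> Q"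
    if PQ: "P \<in> carrier L" "Q \<in> carrier L" for P Q
  proof -
    obtain A B where AB: "A \<in> sl" "P = cls A" "B \<in> sl" "Q = cls B" using PQ by (auto simp: carrier_L)
    hence c: "A \<in> carrier_mat n n" "B \<in> carrier_mat n n" by auto
    show ?thesis using c AB(1,3) lie_autoD[OF assms c] lie_autoD(1)[OF assms c(2,1)]
      by (simp add: AB(2,4) cls_add cls_brk induced_cls assms)
  qed
  moreover have "induced \<phi> (c \<odot>\<^bsub>L\<^esub> P) = c \<odot>\<^bsub>L\<^esub> induced \<phi> P" if P: "P \<in> carrier L" for c P
  proof -
    obtain A where A: "A \<in> sl" "P = cls A" using P by (auto simp: carrier_L)
    hence c: "A \<in> carrier_mat n n" by auto
    show ?thesis using c A(1) lie_autoD[OF assms c c]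
      by (simp add: A(2) cls_smult induced_cls assms)
  qed
  ultimately show ?thesis unfolding alg_automorphisms_def Bij_def by blast
qed

end

subsection \<open>The homogeneous basis of the matrix algebra\<close>

locale fine_grading = symplectic_group T \<beta> r a b
  for T :: "('a, 'c) monoid_scheme" (structure) and \<beta> :: "'a \<Rightarrow> 'a \<Rightarrow> 'f::alg_closed_field" and r a b +
  fixes k :: nat
  assumes k_pos: "k \<ge> 1" and char_ne_2: "CHAR('f) \<noteq> 2"
begin

abbreviation n where "n \<equiv> k * N"

sublocale psl_algebra n "TYPE('f)" .

lemma n_eq: "total_size T k r a = n"
  by (simp add: total_size_def N_def)

abbreviation tc where "tc \<equiv> carrier T"
abbreviation Mn :: "'f mat set" where "Mn \<equiv> carrier_mat n n"

definition E where "E i j t = kronecker (matrix_unit k i j) (X t)"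

lemma E_carrier [simp]: "t \<in> tc \<Longrightarrow> E i j t \<in> Mn"
  unfolding E_def by (rule kronecker_carrier) (simp_all add: matrix_unit_def)

lemma index_E:
  assumes "t \<in> tc" "p < n" "q < n"
  shows "E i j t $$ (p, q) = (if p div N = i \<and> q div N = j then X t $$ (p mod N, q mod N) else 0)"
  unfolding E_def using assms div_mod_bounds[of p k N] div_mod_bounds[of q k N]
  by (subst index_kronecker[of _ k k _ N N]) (auto simp: matrix_unit_def)

text \<open>Coordinate with respect to the matrices \<open>E i j t\<close>: the block
  \<open>(i, j)\<close> is paired with \<open>Xi t\<close> under the trace form. The divisor
  \<open>N\<close> comes from \<open>X_dual\<close>.\<close>

definition co :: "nat \<Rightarrow> nat \<Rightarrow> 'a \<Rightarrow> 'f mat \<Rightarrow> 'f" where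
  "co i j t M = (\<Sum>(u, v)\<in>{..<N} \<times> {..<N}. M $$ (i * N + u, j * N + v) * Xi t $$ (v, u)) / of_nat N"

definition comb :: "(nat \<Rightarrow> nat \<Rightarrow> 'a \<Rightarrow> 'f) \<Rightarrow> 'f mat" where
  "comb c = mat n n (\<lambda>(p, q). \<Sum>t\<in>tc. c (p div N) (q div N) t * X t $$ (p mod N, q mod N))"

lemma comb_carrier [simp]: "comb c \<in> Mn"
  by (simp add: comb_def)

lemma co_comb:
  assumes "i < k" "j < k" "t \<in> tc" shows "co i j t (comb c) = c i j t"
proof -
  have "(\<Sum>(u, v)\<in>{..<N} \<times> {..<N}. comb c $$ (i * N + u, j * N + v) * Xi t $$ (v, u)) =
      (\<Sum>(u, v)\<in>{..<N} \<times> {..<N}. \<Sum>s\<in>tc. c i j s * (X s $$ (u, v) * Xi t $$ (v, u)))"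
    by (rule sum.cong) (use assms in \<open>auto simp: comb_def mult_add_less sum_distrib_right mult.assoc\<close>)
  also have "\<dots> = (\<Sum>s\<in>tc. c i j s * (\<Sum>(u, v)\<in>{..<N} \<times> {..<N}. X s $$ (u, v) * Xi t $$ (v, u)))"
    unfolding split_beta by (subst sum.swap) (simp add: sum_distrib_left)
  also have "\<dots> = (\<Sum>s\<in>tc. if s = t then c i j t * of_nat N else 0)"
    by (rule sum.cong) (use assms in \<open>auto simp: X_dual\<close>)
  also have "\<dots> = c i j t * of_nat N" using assms finite_T by simp
  finally show ?thesis using of_nat_N by (simp add: co_def)
qed

lemma comb_co:
  assumes "M \<in> Mn" shows "comb (\<lambda>i j t. co i j t M) = M"
proof (rule eq_matI)
  fix p q assume "p < dim_row M" "q < dim_col M"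
  hence pq: "p < n" "q < n" using assms by auto
  note b = div_mod_bounds[OF pq(1)] div_mod_bounds[OF pq(2)]
  define i j where "i = p div N" and "j = q div N"
  have "(\<Sum>t\<in>tc. co i j t M * X t $$ (p mod N, q mod N)) =
     (\<Sum>t\<in>tc. \<Sum>(u, v)\<in>{..<N} \<times> {..<N}. M $$ (i * N + u, j * N + v) * (X t $$ (p mod N, q mod N) * Xi t $$ (v, u)) / of_nat N)"
    by (rule sum.cong) (simp_all add: co_def sum_divide_distrib sum_distrib_right sum_distrib_left split_beta mult_ac)
  also have "\<dots> = (\<Sum>(u, v)\<in>{..<N} \<times> {..<N}. M $$ (i * N + u, j * N + v) *
      (\<Sum>t\<in>tc. X t $$ (p mod N, q mod N) * Xi t $$ (v, u)) / of_nat N)"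
    unfolding split_beta by (subst sum.swap) (simp add: sum_distrib_left sum_divide_distrib)
  also have "\<dots> = (\<Sum>x\<in>{..<N} \<times> {..<N}. if x = (p mod N, q mod N) then M $$ (i * N + p mod N, j * N + q mod N) else 0)"
    by (rule sum.cong) (use b of_nat_N in \<open>auto simp: X_complete split: if_splits\<close>)
  also have "\<dots> = M $$ (p, q)" using b by (simp add: i_def j_def)
  finally show "comb (\<lambda>i j t. co i j t M) $$ (p, q) = M $$ (p, q)"
    using pq by (simp add: comb_def i_def j_def)
qed (use assms in \<open>auto simp: comb_def\<close>)

lemma comb_cong: "(\<And>i j t. i < k \<Longrightarrow> j < k \<Longrightarrow> t \<in> tc \<Longrightarrow> c i j t = d i j t) \<Longrightarrow> comb c = comb d"
  unfolding comb_def
proof (rule cong_mat, goal_cases)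
  case (3 p q)
  thus ?case using div_mod_bounds[of p k N] div_mod_bounds[of q k N] by (auto intro!: sum.cong)
qed auto

lemma mat_eqI_co:
  assumes "M \<in> Mn" "M' \<in> Mn" "\<And>i j t. i < k \<Longrightarrow> j < k \<Longrightarrow> t \<in> tc \<Longrightarrow> co i j t M = co i j t M'"
  shows "M = M'"
  using trans[OF trans[OF comb_co[OF assms(1), symmetric] comb_cong[OF assms(3)]] comb_co[OF assms(2)]] by blast

lemma E_eq_comb:
  assumes "h < k" "m < k" "s \<in> tc"
  shows "E h m s = comb (\<lambda>i j t. if i = h \<and> j = m \<and> t = s then 1 else 0)"
proof (rule eq_matI)
  fix p q assume "p < dim_row (comb (\<lambda>i j t. if i = h \<and> j = m \<and> t = s then 1 else 0))"
    "q < dim_col (comb (\<lambda>i j t. if i = h \<and> j = m \<and> t = s then 1 else 0))"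
  hence pq: "p < n" "q < n" by (auto simp: comb_def)
  have "(\<Sum>t\<in>tc. (if p div N = h \<and> q div N = m \<and> t = s then 1 else 0) * X t $$ (p mod N, q mod N)) =
      (\<Sum>t\<in>tc. if t = s then E h m s $$ (p, q) else 0)"
    by (rule sum.cong) (use assms pq in \<open>auto simp: index_E\<close>)
  thus "E h m s $$ (p, q) = comb (\<lambda>i j t. if i = h \<and> j = m \<and> t = s then 1 else 0) $$ (p, q)"
    using pq assms finite_T by (simp add: comb_def)
qed (use assms in \<open>auto simp: comb_def carrier_matD[OF E_carrier]\<close>)

lemma co_E:
  assumes "i < k" "j < k" "t \<in> tc" "h < k" "m < k" "s \<in> tc"
  shows "co i j t (E h m s) = (if i = h \<and> j = m \<and> t = s then 1 else 0)"
  using assms by (simp add: E_eq_comb co_comb)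

lemma co_bound:
  assumes "M \<in> Mn" "i < k" "j < k" "u < N" "v < N" shows "i * N + u < dim_row M" "j * N + v < dim_col M"
  using assms by (auto simp: mult_add_less)

lemma co_add:
  assumes "M \<in> Mn" "M' \<in> Mn" "i < k" "j < k"
  shows "co i j t (M + M') = co i j t M + co i j t M'"
proof -
  have "(\<Sum>(u, v)\<in>{..<N} \<times> {..<N}. (M + M') $$ (i * N + u, j * N + v) * Xi t $$ (v, u)) =
    (\<Sum>(u, v)\<in>{..<N} \<times> {..<N}. M $$ (i * N + u, j * N + v) * Xi t $$ (v, u)) +
    (\<Sum>(u, v)\<in>{..<N} \<times> {..<N}. M' $$ (i * N + u, j * N + v) * Xi t $$ (v, u))"
    unfolding sum.distrib[symmetric]
    by (rule sum.cong) (use co_bound[OF assms(2-4)] in \<open>auto simp: distrib_right\<close>)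
  thus ?thesis by (simp add: co_def add_divide_distrib)
qed

lemma co_smult:
  assumes "M \<in> Mn" "i < k" "j < k" shows "co i j t (c \<cdot>\<^sub>m M) = c * co i j t M"
proof -
  have "(\<Sum>(u, v)\<in>{..<N} \<times> {..<N}. (c \<cdot>\<^sub>m M) $$ (i * N + u, j * N + v) * Xi t $$ (v, u)) =
    c * (\<Sum>(u, v)\<in>{..<N} \<times> {..<N}. M $$ (i * N + u, j * N + v) * Xi t $$ (v, u))"
    unfolding sum_distrib_left
    by (rule sum.cong) (use co_bound[OF assms] in \<open>auto simp: mult.assoc\<close>)
  thus ?thesis by (simp add: co_def)
qed

lemma co_minus:
  assumes "M \<in> Mn" "M' \<in> Mn" "i < k" "j < k"
  shows "co i j t (M - M') = co i j t M - co i j t M'"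
  using assms by (simp add: minus_as_add co_add co_smult)

lemma co_zero: assumes "i < k" "j < k" shows "co i j t (0\<^sub>m n n) = 0"
  using co_smult[of "0\<^sub>m n n" i j t 0] assms by simp

text \<open>The case of basis elements is confined to labels occurring in \<open>M\<close>, so that
  homogeneity of \<open>M\<close> is available there.\<close>

lemma co_induct [consumes 1, case_names zero E add]:
  assumes "M \<in> Mn" "P (0\<^sub>m n n)"
    and E: "\<And>i j t c. i < k \<Longrightarrow> j < k \<Longrightarrow> t \<in> tc \<Longrightarrow> co i j t M \<noteq> 0 \<Longrightarrow> P (c \<cdot>\<^sub>m E i j t)"
    and add: "\<And>M1 M2. M1 \<in> Mn \<Longrightarrow> M2 \<in> Mn \<Longrightarrow> P M1 \<Longrightarrow> P M2 \<Longrightarrow> P (M1 + M2)"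
  shows "P M"
proof -
  define part where "part S = comb (\<lambda>i j t. if (i, j, t) \<in> S then co i j t M else 0)" for S
  have "P (part S)" if "finite S" "S \<subseteq> {..<k} \<times> {..<k} \<times> tc" for S
    using that
  proof (induct S rule: finite_induct)
    case empty
    have "part {} = 0\<^sub>m n n" by (rule mat_eqI_co) (auto simp: part_def co_comb co_zero)
    thus ?case using assms(2) by simp
  next
    case (insert x S)
    obtain i j t where x: "x = (i, j, t)" by (cases x)
    hence ijt: "i < k" "j < k" "t \<in> tc" using insert by auto
    have eq: "part (insert x S) = co i j t M \<cdot>\<^sub>m E i j t + part S"
      by (rule mat_eqI_co) (use ijt insert(2) x in \<open>auto simp: part_def co_comb co_add co_smult co_E\<close>)
    show ?case
    proof (cases "co i j t M = 0")
      case True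
      hence "part (insert x S) = part S"
        by (intro mat_eqI_co) (use ijt x in \<open>auto simp: part_def co_comb\<close>)
      thus ?thesis using insert by simp
    next
      case False
      thus ?thesis unfolding eq using insert ijt by (intro add E) (auto simp: part_def)
    qed
  qed
  from this[of "{..<k} \<times> {..<k} \<times> tc"] have "P (part ({..<k} \<times> {..<k} \<times> tc))" using finite_T by simp
  also have "part ({..<k} \<times> {..<k} \<times> tc) = comb (\<lambda>i j t. co i j t M)"
    unfolding part_def by (rule comb_cong) auto
  finally show ?thesis using comb_co[OF assms(1)] by simp
qed

lemma E_mult:
  assumes "i < k" "j < k" "h < k" "m < k" "t \<in> tc" "s \<in> tc"
  shows "E i j t * E h m s = (if j = h then bc t s \<cdot>\<^sub>m E i m (t \<otimes> s) else 0\<^sub>m n n)"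
proof -
  have "matrix_unit k i j * matrix_unit k h m = (if j = h then matrix_unit k i m else 0\<^sub>m k k :: 'f mat)"
  proof (rule eq_matI)
    fix p q assume "p < dim_row (if j = h then matrix_unit k i m else 0\<^sub>m k k :: 'f mat)"
      "q < dim_col (if j = h then matrix_unit k i m else 0\<^sub>m k k :: 'f mat)"
    hence pq: "p < k" "q < k" by (auto simp: matrix_unit_def split: if_splits)
    have "(matrix_unit k i j * matrix_unit k h m :: 'f mat) $$ (p, q) =
        (\<Sum>s<k. (if p = i \<and> s = j then 1 else 0) * (if s = h \<and> q = m then 1 else 0))"
      using pq by (subst index_mult_mat_sum[of _ k k _ k]) (auto simp: matrix_unit_def)
    also have "\<dots> = (\<Sum>s<k. if s = j then (if p = i \<and> q = m \<and> j = h then 1 else 0) else 0)"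
      by (rule sum.cong) auto
    also have "\<dots> = (if p = i \<and> q = m \<and> j = h then 1 else 0)" using assms by simp
    finally show "(matrix_unit k i j * matrix_unit k h m :: 'f mat) $$ (p, q) =
        (if j = h then matrix_unit k i m else 0\<^sub>m k k) $$ (p, q)"
      using pq by (simp add: matrix_unit_def)
  qed (auto simp: matrix_unit_def)
  hence "E i j t * E h m s = kronecker (if j = h then matrix_unit k i m else 0\<^sub>m k k) (X t * X s)"
    unfolding E_def using assms by (subst kronecker_mult[of _ k k _ N N _ k _ N]) (auto simp: matrix_unit_def)
  also have "X t * X s = bc t s \<cdot>\<^sub>m X (t \<otimes> s)" using assms bc by blast
  also have "kronecker (if j = h then matrix_unit k i m else 0\<^sub>m k k) \<dots> =
      (if j = h then bc t s \<cdot>\<^sub>m E i m (t \<otimes> s) else 0\<^sub>m n n)"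
    unfolding kronecker_smult_right E_def using assms
    by (auto intro!: eq_matI simp: kronecker_def carrier_matD[OF X_carrier] div_mod_bounds)
  finally show ?thesis .
qed

lemma co_one: assumes "i < k" "j < k" "t \<in> tc" shows "co i j t (1\<^sub>m n) = (if i = j \<and> t = \<one> then 1 else 0)"
proof -
  have "1\<^sub>m n $$ (i * N + u, j * N + v) * Xi t $$ (v, u) =
      (if i = j then X \<one> $$ (u, v) * Xi t $$ (v, u) else 0)" if "u < N" "v < N" for u v
  proof -
    have "i * N + u = j * N + v \<longleftrightarrow> i = j \<and> u = v"
    proof
      assume eq: "i * N + u = j * N + v"
      hence "(i * N + u) div N = (j * N + v) div N" "(i * N + u) mod N = (j * N + v) mod N" by simp_all
      thus "i = j \<and> u = v" using that by auto
    qed simp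
    thus ?thesis using that assms by (auto simp: mult_add_less X_one)
  qed
  hence "(\<Sum>(u, v)\<in>{..<N} \<times> {..<N}. 1\<^sub>m n $$ (i * N + u, j * N + v) * Xi t $$ (v, u)) =
     (\<Sum>(u, v)\<in>{..<N} \<times> {..<N}. if i = j then X \<one> $$ (u, v) * Xi t $$ (v, u) else 0)"
    by (intro sum.cong) auto
  also have "\<dots> = (if i = j \<and> t = \<one> then of_nat N else 0)"
    using X_dual[of \<one> t] assms by (cases "i = j") auto
  finally show ?thesis using of_nat_N by (simp add: co_def)
qed

lemma K_scalar:
  assumes "Z \<in> K" shows "\<exists>c. Z = c \<cdot>\<^sub>m 1\<^sub>m n"
proof (rule scalar_mat_from_units)
  show Z: "Z \<in> Mn" using assms by simp
  fix u p v q assume b: "u < n" "p < n" "v < n" "q < n"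
  define U :: "'f mat" where "U = mat n n (\<lambda>x. if x = (p, q) then 1 else 0)"
  have U: "U \<in> Mn" by (simp add: U_def)
  have "Z * U = U * Z" using assms U unfolding psl_kernel_def mat_center_def by blast
  hence "(Z * U) $$ (u, v) = (U * Z) $$ (u, v)" by simp
  moreover have "(Z * U) $$ (u, v) = (\<Sum>w<n. if w = p then (if v = q then Z $$ (u, p) else 0) else 0)"
    unfolding index_mult_mat_sum[OF Z U b(1,3)] by (rule sum.cong) (use b in \<open>auto simp: U_def\<close>)
  moreover have "(U * Z) $$ (u, v) = (\<Sum>w<n. if w = q then (if u = p then Z $$ (q, v) else 0) else 0)"
    unfolding index_mult_mat_sum[OF U Z b(1,3)] by (rule sum.cong) (use b in \<open>auto simp: U_def\<close>)
  ultimately show "(if v = q then Z $$ (u, p) else 0) = (if u = p then Z $$ (q, v) else 0)"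
    using b by simp
qed

text \<open>Two representatives differ by a scalar matrix, and the identity matrix has coordinates
  only at the labels \<open>(i, i, \<one>)\<close>, all equal to 1. So only these coordinates are
  ambiguous, by a common shift.\<close>

lemma cls_cong_co:
  assumes "M \<in> Mn" "M' \<in> Mn" "cls M = cls M'"
  obtains c where "\<And>i j t. i < k \<Longrightarrow> j < k \<Longrightarrow> t \<in> tc \<Longrightarrow>
    co i j t M = co i j t M' + (if i = j \<and> t = \<one> then c else 0)"
proof -
  have "M - M' \<in> K" using assms by (simp add: cls_eq_iff)
  then obtain c where c: "M - M' = c \<cdot>\<^sub>m 1\<^sub>m n" using K_scalar by blast
  have "co i j t M - co i j t M' = (if i = j \<and> t = \<one> then c else 0)" if "i < k" "j < k" "t \<in> tc" for i j t
  proof -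
    have "co i j t M - co i j t M' = co i j t (c \<cdot>\<^sub>m 1\<^sub>m n)"
      unfolding c[symmetric] by (rule co_minus[symmetric, OF assms(1,2) that(1,2)])
    also have "\<dots> = c * co i j t (1\<^sub>m n)" by (rule co_smult) (use that in auto)
    finally show ?thesis using co_one[OF that] by (simp split: if_splits)
  qed
  hence "co i j t M = (if i = j \<and> t = \<one> then c else 0) + co i j t M'" if "i < k" "j < k" "t \<in> tc" for i j t
    using that by (simp only: diff_eq_eq)
  thus ?thesis by (intro that[of c]) (simp only: add.commute)
qed

lemma cls_co_eq:
  assumes "M \<in> Mn" "M' \<in> Mn" "cls M = cls M'" "i < k" "j < k" "t \<in> tc" "i \<noteq> j \<or> t \<noteq> \<one>"
  shows "co i j t M = co i j t M'"
proof -
  obtain c where "\<And>i j t. i < k \<Longrightarrow> j < k \<Longrightarrow> t \<in> tc \<Longrightarrow>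
    co i j t M = co i j t M' + (if i = j \<and> t = \<one> then c else 0)" using cls_cong_co[OF assms(1-3)] by blast
  from this[OF assms(4-6)] show ?thesis using assms(7) by auto
qed

subsection \<open>The components of the grading\<close>

lemma two_nz: "(2::'f) \<noteq> 0"
proof
  assume "(2::'f) = 0"
  hence "of_nat 2 = (0::'f)" by simp
  hence "CHAR('f) dvd 2" by (simp only: of_nat_eq_0_iff_char_dvd)
  hence "CHAR('f) = 1 \<or> CHAR('f) = 2" by (metis two_is_prime_nat prime_nat_iff)
  thus False using char_ne_2 CHAR_not_1[where 'a = 'f] by simp
qed

lemma E_sl_off:
  assumes "i < k" "j < k" "t \<in> tc" "i \<noteq> j" shows "E i j t \<in> sl"
proof -
  have "brk (E i i \<one>) (E i j t) = E i j t" using assms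
    by (simp add: brk_def E_mult bc_one1 minus_as_add)
  thus ?thesis using sl_brk[of "E i i \<one>" "E i j t"] assms by simp
qed

text \<open>Choose \<open>w\<close> with \<open>\<beta> t w \<noteq> 1\<close> and factor
  \<open>t\<close> as \<open>w \<otimes> s\<close>; then \<open>X w\<close> and \<open>X s\<close>
  do not commute, and their commutator is a nonzero multiple of \<open>X t\<close>.\<close>

lemma E_sl_diag:
  assumes "i < k" "t \<in> tc" "t \<noteq> \<one>" shows "E i i t \<in> sl"
proof -
  obtain w where w: "w \<in> tc" "\<beta> t w \<noteq> 1" using beta_witness assms by metis
  define s where "s = inv w \<otimes> t"
  have s: "s \<in> tc" "w \<otimes> s = t" using w assms by (auto simp: s_def T.m_assoc[symmetric])
  hence sw: "s \<otimes> w = t" using w T.m_comm by metis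
  have "\<beta> w s = \<beta> w t" using w s assms by (simp add: s_def beta_mult2 beta_inv2)
  hence *: "\<beta> w s \<noteq> 1" using w assms beta_eq_1_sym by metis
  have "brk (E i i w) (E i i s) = (bc w s - bc s w) \<cdot>\<^sub>m E i i t"
    unfolding brk_def using assms w s sw by (auto simp: E_mult left_diff_distrib)
  hence "E i i t = inverse (bc w s - bc s w) \<cdot>\<^sub>m brk (E i i w) (E i i s)"
    using bc_swap[of w s] bc(1)[of s w] * w s(1) by simp
  thus ?thesis using w s by (metis sl_smult sl_brk E_carrier)
qed

lemma bc_inv: assumes "t \<in> tc" shows "bc (inv t) t = bc t (inv t)"
  using bc_swap[of t "inv t"] assms by (simp add: beta_inv2)

abbreviation deg where "deg i j t \<equiv> unit_degree T k i t j"

lemma deg_eq: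
  assumes "i < k" "j < k" "t \<in> tc"
  shows "deg i j t = (t, frag_of i - frag_of j)"
proof -
  have "inv\<^bsub>G_tilde T k\<^esub> (\<one>, frag_of j) = (\<one>, - frag_of j)"
    unfolding G_tilde_def using assms
    by (subst inv_DirProd) (auto simp: T.is_group)
  thus ?thesis unfolding unit_degree_def using assms
    by (simp add: G_tilde_def DirProd_def free_Abelian_group_def)
qed

text \<open>Equality of degrees: in \<open>g_i t g_j^-1\<close> the indices are lost exactly when
  they coincide, so for fixed \<open>t\<close> the labels \<open>(i, i, t)\<close> share one degree,
  while off the diagonal each label has its own.\<close>

definition same where "same i j t i' j' t' \<longleftrightarrow> t = t' \<and> (i = i' \<and> j = j' \<or> i = j \<and> i' = j')"

lemma frag_diff_eq: "frag_of i - frag_of j = frag_of i' - frag_of (j' :: nat) \<longleftrightarrow> i = i' \<and> j = j' \<or> i = j \<and> i' = j'"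
proof
  assume eq: "frag_of i - frag_of j = frag_of i' - frag_of j'"
  have lk: "Poly_Mapping.lookup (frag_of i - frag_of j) x = Poly_Mapping.lookup (frag_of i' - frag_of j') x" for x
    using eq by simp
  show "i = i' \<and> j = j' \<or> i = j \<and> i' = j'"
    using lk[of i] lk[of j] lk[of i'] lk[of j'] by (auto simp: lookup_minus lookup_frag_of split: if_splits)
qed auto

lemma deg_eq_iff:
  assumes "i < k" "j < k" "t \<in> tc" "i' < k" "j' < k" "t' \<in> tc"
  shows "deg i j t = deg i' j' t' \<longleftrightarrow> same i j t i' j' t'"
  using assms by (simp add: deg_eq same_def frag_diff_eq)

abbreviation \<Gamma> where "\<Gamma> \<equiv> Gamma_A_I T \<beta> k r a b"

definition Hom where
  "Hom i j t = {M \<in> Mn. \<forall>i'<k. \<forall>j'<k. \<forall>t'\<in>tc. \<not> same i j t i' j' t' \<longrightarrow> co i' j' t' M = 0}"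

definition Cmp where "Cmp i j t = cls ` (Hom i j t \<inter> sl)"

text \<open>Expansion in the basis turns the span into vanishing of the coordinates of all other
  degrees. This is also right for \<open>g\<close> outside the support, where both sides contain
  only 0.\<close>

lemma Gamma_M_eq:
  "Gamma_M T \<beta> k r a b g = {M \<in> Mn. \<forall>i<k. \<forall>j<k. \<forall>t\<in>tc. deg i j t \<noteq> g \<longrightarrow> co i j t M = 0}"
proof -
  define S where "S = {E i j t | i t j. i < k \<and> j < k \<and> t \<in> tc \<and> deg i j t = g}"
  have S: "S \<subseteq> Mn" by (auto simp: S_def)
  have eq: "Gamma_M T \<beta> k r a b g = mat_span n S"
    by (simp add: Gamma_M_def n_eq S_def E_def)
  show ?thesis unfolding eq
  proof (intro subset_antisym subsetI CollectI)
    fix M assume "M \<in> mat_span n S"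
    thus "M \<in> Mn \<and> (\<forall>i<k. \<forall>j<k. \<forall>t\<in>tc. deg i j t \<noteq> g \<longrightarrow> co i j t M = 0)"
      by (rule mat_span_induct[OF _ S]) (auto simp: co_zero co_add co_smult S_def co_E)
  next
    fix M assume "M \<in> {M \<in> Mn. \<forall>i<k. \<forall>j<k. \<forall>t\<in>tc. deg i j t \<noteq> g \<longrightarrow> co i j t M = 0}"
    hence M: "M \<in> Mn" "\<And>i j t. i < k \<Longrightarrow> j < k \<Longrightarrow> t \<in> tc \<Longrightarrow> co i j t M \<noteq> 0 \<Longrightarrow> deg i j t = g" by auto
    from M(1) show "M \<in> mat_span n S"
    proof (induct rule: co_induct)
      case (E i j t c)
      thus ?case using M(2)[of i j t] by (intro mat_span_smult[OF S] mat_span_base[OF S]) (auto simp: S_def)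
    qed (use mat_span_zero[OF S] mat_span_add[OF S] in auto)
  qed
qed

lemma Gamma_deg:
  assumes "i < k" "j < k" "t \<in> tc" shows "\<Gamma> (deg i j t) = Cmp i j t"
proof -
  have "Gamma_M T \<beta> k r a b (deg i j t) = Hom i j t"
    unfolding Gamma_M_eq Hom_def using assms by (auto simp: deg_eq_iff same_def)
  thus ?thesis by (simp add: Gamma_A_I_def Cmp_def n_eq)
qed

lemma zero_mem_Hom [simp]: "0\<^sub>m n n \<in> Hom i j t"
  by (auto simp: Hom_def co_zero)

abbreviation components where "components \<equiv> grading_components L (G_tilde_0 T k) \<Gamma>"

lemma components_eq:
  "components = {Cmp i j t | i j t. i < k \<and> j < k \<and> t \<in> tc \<and> Cmp i j t \<noteq> {\<zero>\<^bsub>L\<^esub>}}"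
proof (intro subset_antisym subsetI)
  fix C assume "C \<in> components"
  then obtain g where g: "C = \<Gamma> g" "\<Gamma> g \<noteq> {\<zero>\<^bsub>L\<^esub>}" by (auto simp: grading_components_def)
  have "\<exists>i j t. i < k \<and> j < k \<and> t \<in> tc \<and> deg i j t = g"
  proof (rule ccontr)
    assume *: "\<nexists>i j t. i < k \<and> j < k \<and> t \<in> tc \<and> deg i j t = g"
    have "M = 0\<^sub>m n n" if "M \<in> Gamma_M T \<beta> k r a b g" for M
      by (rule mat_eqI_co) (use that * in \<open>auto simp: Gamma_M_eq co_zero\<close>)
    hence "Gamma_M T \<beta> k r a b g \<inter> sl = {0\<^sub>m n n}" by (auto simp: Gamma_M_eq co_zero)
    hence "\<Gamma> g = {\<zero>\<^bsub>L\<^esub>}" by (simp add: Gamma_A_I_def n_eq zero_L)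
    thus False using g by simp
  qed
  thus "C \<in> {Cmp i j t | i j t. i < k \<and> j < k \<and> t \<in> tc \<and> Cmp i j t \<noteq> {\<zero>\<^bsub>L\<^esub>}}"
    using g Gamma_deg by fastforce
next
  fix C assume "C \<in> {Cmp i j t | i j t. i < k \<and> j < k \<and> t \<in> tc \<and> Cmp i j t \<noteq> {\<zero>\<^bsub>L\<^esub>}}"
  then obtain i j t where C: "i < k" "j < k" "t \<in> tc" "C = Cmp i j t" "C \<noteq> {\<zero>\<^bsub>L\<^esub>}" by blast
  have "deg i j t \<in> carrier (G_tilde T k)"
    using C keys_diff[of "frag_of i" "frag_of j"] by (auto simp: deg_eq G_tilde_def)
  hence "deg i j t \<in> carrier (G_tilde_0 T k)"
    unfolding G_tilde_0_def carrier_subgroup_generated using C(1-3) by (intro generate.incl) blast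
  thus "C \<in> components"
    unfolding grading_components_def C(4) Gamma_deg[OF C(1-3), symmetric]
    using C(5) by (intro CollectI exI[of _ "deg i j t"]) (simp add: C(4) Gamma_deg[OF C(1-3)])
qed

lemma Cmp_same: assumes "same i j t i' j' t'" shows "Cmp i j t = Cmp i' j' t'"
proof -
  have "same i j t x y z \<longleftrightarrow> same i' j' t' x y z" for x y z
    using assms by (auto simp: same_def)
  thus ?thesis by (simp add: Cmp_def Hom_def)
qed

lemma Cmp_nonzero_element:
  assumes "Cmp i j t \<noteq> {\<zero>\<^bsub>L\<^esub>}"
  obtains M where "M \<in> Hom i j t" "M \<in> sl" "M \<notin> K"
proof -
  have "cls (0\<^sub>m n n) \<in> Cmp i j t" by (auto simp: Cmp_def)
  then obtain M where M: "M \<in> Hom i j t" "M \<in> sl" "cls M \<noteq> cls (0\<^sub>m n n)"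
    using assms by (auto simp: Cmp_def zero_L)
  moreover have "M - 0\<^sub>m n n = M" using M(2)[THEN sl_carrier] by auto
  ultimately show ?thesis using that[of M] cls_eq_iff[of M "0\<^sub>m n n"] sl_carrier[of M] by auto
qed

text \<open>Of two distinct degrees at least one is not that of the identity matrix. All coordinates
  of a representative in that degree survive in the class, but they vanish for the other
  representative.\<close>

lemma Cmp_disjoint:
  assumes "i < k" "j < k" "t \<in> tc" "i' < k" "j' < k" "t' \<in> tc"
    and "u \<in> Cmp i j t" "u \<in> Cmp i' j' t'" "u \<noteq> \<zero>\<^bsub>L\<^esub>"
  shows "same i j t i' j' t'"
proof (rule ccontr)
  assume ns: "\<not> same i j t i' j' t'"
  obtain M M' where M: "M \<in> Hom i j t" "M \<in> sl" "u = cls M" "M' \<in> Hom i' j' t'" "M' \<in> sl" "u = cls M'"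
    using assms by (auto simp: Cmp_def)
  hence c: "M \<in> Mn" "M' \<in> Mn" "cls M = cls M'" by auto
  have *: False if "P \<in> Hom x y z" "P' \<in> Hom x' y' z'" "P \<in> Mn" "P' \<in> Mn" "cls P = cls P'"
    "cls P \<noteq> \<zero>\<^bsub>L\<^esub>" "\<not> same x y z x' y' z'" "\<not> same x y z x x \<one>" for P P' x y z x' y' z'
  proof -
    have "co i j t P = 0" if ijt: "i < k" "j < k" "t \<in> tc" for i j t
    proof (cases "same x y z i j t")
      case True
      hence "\<not> same x' y' z' i j t" using \<open>\<not> same x y z x' y' z'\<close> by (auto simp: same_def)
      hence "co i j t P' = 0" using \<open>P' \<in> Hom x' y' z'\<close> ijt by (auto simp: Hom_def)
      moreover have "i \<noteq> j \<or> t \<noteq> \<one>" using True \<open>\<not> same x y z x x \<one>\<close> by (auto simp: same_def)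
      ultimately show ?thesis using cls_co_eq[OF \<open>P \<in> Mn\<close> \<open>P' \<in> Mn\<close> \<open>cls P = cls P'\<close> ijt] by simp
    next
      case False thus ?thesis using \<open>P \<in> Hom x y z\<close> ijt by (auto simp: Hom_def)
    qed
    hence "P = 0\<^sub>m n n" by (intro mat_eqI_co \<open>P \<in> Mn\<close>) (auto simp: co_zero)
    thus False using \<open>cls P \<noteq> \<zero>\<^bsub>L\<^esub>\<close> by (simp add: zero_L)
  qed
  show False
  proof (cases "same i j t i i \<one>")
    case True
    hence "\<not> same i' j' t' i' i' \<one>" "\<not> same i' j' t' i j t" using ns by (auto simp: same_def)
    thus False using *[OF M(4) M(1) c(2,1) c(3)[symmetric]] M(6) assms(9) by blast
  next
    case False
    thus False using *[OF M(1) M(4) c _ ns] M(3) assms(9) by blast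
  qed
qed

lemma Cmp_inject:
  assumes "i < k" "j < k" "t \<in> tc" "i' < k" "j' < k" "t' \<in> tc"
    and eq: "Cmp i j t = Cmp i' j' t'" and nz: "Cmp i j t \<noteq> {\<zero>\<^bsub>L\<^esub>}"
  shows "same i j t i' j' t'"
proof -
  have "cls (0\<^sub>m n n) \<in> Cmp i j t" by (auto simp: Cmp_def)
  then obtain u where "u \<in> Cmp i j t" "u \<noteq> \<zero>\<^bsub>L\<^esub>"
    using nz by (metis empty_iff singletonI subsetI subset_singletonD)
  thus ?thesis using Cmp_disjoint[OF assms(1-6)] eq by blast
qed

lemma E_mem_Hom:
  assumes "i < k" "j < k" "t \<in> tc" "same i0 j0 t0 i j t" shows "c \<cdot>\<^sub>m E i j t \<in> Hom i0 j0 t0"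
  using assms by (auto simp: Hom_def co_smult co_E)

lemma cls_E_nz:
  assumes "i < k" "j < k" "t \<in> tc" "i \<noteq> j \<or> t \<noteq> \<one>" "c \<noteq> 0" shows "cls (c \<cdot>\<^sub>m E i j t) \<noteq> \<zero>\<^bsub>L\<^esub>"
proof
  assume "cls (c \<cdot>\<^sub>m E i j t) = \<zero>\<^bsub>L\<^esub>"
  hence "co i j t (c \<cdot>\<^sub>m E i j t) = co i j t (0\<^sub>m n n)"
    unfolding zero_L using assms by (intro cls_co_eq) auto
  thus False using assms by (simp add: co_smult co_E co_zero)
qed

lemma Cmp_nz:
  assumes "i < k" "j < k" "t \<in> tc" "i \<noteq> j \<or> t \<noteq> \<one>" shows "Cmp i j t \<noteq> {\<zero>\<^bsub>L\<^esub>}"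
proof -
  have "E i j t \<in> sl" using assms E_sl_off E_sl_diag by (cases "i = j") auto
  moreover have "1 \<cdot>\<^sub>m E i j t \<in> Hom i j t" by (rule E_mem_Hom) (use assms in \<open>auto simp: same_def\<close>)
  ultimately have "cls (1 \<cdot>\<^sub>m E i j t) \<in> Cmp i j t" by (auto simp: Cmp_def)
  thus ?thesis using cls_E_nz[OF assms, of 1] by auto
qed

lemma Cmp_off:
  assumes "i < k" "j < k" "t \<in> tc" "i \<noteq> j"
  shows "Cmp i j t = range (\<lambda>c. cls (c \<cdot>\<^sub>m E i j t))"
proof -
  have same: "same i j t i' j' t' \<longleftrightarrow> i' = i \<and> j' = j \<and> t' = t" for i' j' t'
    using assms by (auto simp: same_def)
  have "M = co i j t M \<cdot>\<^sub>m E i j t" if "M \<in> Hom i j t" for M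
    by (rule mat_eqI_co) (use that assms in \<open>auto simp: Hom_def same co_smult co_E\<close>)
  moreover have "c \<cdot>\<^sub>m E i j t \<in> Hom i j t \<inter> sl" for c
    using E_mem_Hom[OF assms(1-3)] E_sl_off[OF assms] same by auto
  ultimately have "Hom i j t \<inter> sl = range (\<lambda>c. c \<cdot>\<^sub>m E i j t)" by blast
  thus ?thesis unfolding Cmp_def by (simp add: image_image)
qed

end

subsection \<open>Automorphisms permuting the homogeneous basis\<close>

context fine_grading begin

definition lbl where "lbl = {..<k} \<times> {..<k} \<times> tc"

definition EL where "EL x = E (fst x) (fst (snd x)) (snd (snd x))"
definition coL where "coL x = co (fst x) (fst (snd x)) (snd (snd x))"
definition CmpL where "CmpL x = Cmp (fst x) (fst (snd x)) (snd (snd x))"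
definition HomL where "HomL x = Hom (fst x) (fst (snd x)) (snd (snd x))"
definition sameL where
  "sameL x y = same (fst x) (fst (snd x)) (snd (snd x)) (fst y) (fst (snd y)) (snd (snd y))"

lemma L_simps [simp]: "EL (i, j, t) = E i j t" "coL (i, j, t) = co i j t" "CmpL (i, j, t) = Cmp i j t"
  "HomL (i, j, t) = Hom i j t" "sameL (i, j, t) (i', j', t') = same i j t i' j' t'"
  by (simp_all add: EL_def coL_def CmpL_def HomL_def sameL_def)

lemma lbl_iff [simp]: "(i, j, t) \<in> lbl \<longleftrightarrow> i < k \<and> j < k \<and> t \<in> tc"
  by (auto simp: lbl_def)

lemma EL_carrier: "x \<in> lbl \<Longrightarrow> EL x \<in> Mn"
  by (cases x) auto

lemma coL_EL: "x \<in> lbl \<Longrightarrow> y \<in> lbl \<Longrightarrow> coL x (EL y) = (if x = y then 1 else 0)"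
  by (cases x; cases y) (auto simp: co_E)

lemma coL_add: "x \<in> lbl \<Longrightarrow> M \<in> Mn \<Longrightarrow> M' \<in> Mn \<Longrightarrow> coL x (M + M') = coL x M + coL x M'"
  by (cases x) (auto simp: co_add)

lemma coL_smult: "x \<in> lbl \<Longrightarrow> M \<in> Mn \<Longrightarrow> coL x (c \<cdot>\<^sub>m M) = c * coL x M"
  by (cases x) (auto simp: co_smult)

lemma coL_zero: "x \<in> lbl \<Longrightarrow> coL x (0\<^sub>m n n) = 0"
  by (cases x) (auto simp: co_zero)

lemma mat_eqI_coL: "M \<in> Mn \<Longrightarrow> M' \<in> Mn \<Longrightarrow> (\<And>x. x \<in> lbl \<Longrightarrow> coL x M = coL x M') \<Longrightarrow> M = M'"
  using mat_eqI_co[of M M'] by (metis L_simps(2) lbl_iff)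

lemma coL_induct [consumes 1, case_names zero E add]:
  assumes "M \<in> Mn" "P (0\<^sub>m n n)" "\<And>x c. x \<in> lbl \<Longrightarrow> coL x M \<noteq> 0 \<Longrightarrow> P (c \<cdot>\<^sub>m EL x)"
    "\<And>M1 M2. M1 \<in> Mn \<Longrightarrow> M2 \<in> Mn \<Longrightarrow> P M1 \<Longrightarrow> P M2 \<Longrightarrow> P (M1 + M2)"
  shows "P M"
  using assms(1)
proof (induct rule: co_induct)
  case (E i j t c) thus ?case using assms(3)[of "(i, j, t)" c] by simp
qed (use assms in auto)

lemma HomL_iff: "M \<in> HomL x \<longleftrightarrow> M \<in> Mn \<and> (\<forall>y\<in>lbl. \<not> sameL x y \<longrightarrow> coL y M = 0)"
proof -
  have "(\<forall>y\<in>lbl. P y) \<longleftrightarrow> (\<forall>i<k. \<forall>j<k. \<forall>t\<in>tc. P (i, j, t))" for P by (auto simp: lbl_def)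
  thus ?thesis by (cases x) (simp add: Hom_def)
qed

lemma CmpL_eq: "CmpL x = cls ` (HomL x \<inter> sl)"
  by (cases x) (simp add: Cmp_def)

text \<open>Labels are finer than components on the diagonal; preserving \<open>sameL\<close> in
  both directions makes the permutation of labels descend to one of degrees.\<close>

definition label_map :: "(nat \<times> nat \<times> 'a \<Rightarrow> nat \<times> nat \<times> 'a) \<Rightarrow> bool" where
  "label_map m \<longleftrightarrow> bij_betw m lbl lbl \<and> (\<forall>x\<in>lbl. \<forall>y\<in>lbl. sameL (m x) (m y) \<longleftrightarrow> sameL x y)"

lemma label_map_mem: "label_map m \<Longrightarrow> x \<in> lbl \<Longrightarrow> m x \<in> lbl"
  by (auto simp: label_map_def bij_betw_def)

lemma label_map_inj: "label_map m \<Longrightarrow> x \<in> lbl \<Longrightarrow> y \<in> lbl \<Longrightarrow> m x = m y \<longleftrightarrow> x = y"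
  by (auto simp: label_map_def bij_betw_def inj_on_def)

lemma label_map_surj: "label_map m \<Longrightarrow> y \<in> lbl \<Longrightarrow> \<exists>x\<in>lbl. y = m x"
  by (auto simp: label_map_def bij_betw_def)

lemma label_map_same: "label_map m \<Longrightarrow> x \<in> lbl \<Longrightarrow> y \<in> lbl \<Longrightarrow> sameL (m x) (m y) \<longleftrightarrow> sameL x y"
  by (auto simp: label_map_def)

definition moves :: "('f mat \<Rightarrow> 'f mat) \<Rightarrow> (nat \<times> nat \<times> 'a \<Rightarrow> nat \<times> nat \<times> 'a) \<Rightarrow> bool" where
  "moves \<phi> m \<longleftrightarrow> lie_auto \<phi> \<and> label_map m \<and> (\<forall>x\<in>lbl. \<exists>c. c \<noteq> 0 \<and> \<phi> (EL x) = c \<cdot>\<^sub>m EL (m x))"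

text \<open>What remains visible of a label map in \<open>psl\<close>: scalars are lost, and
  diagonal labels with equal third entry cannot be told apart. Labels whose component is zero are
  included.\<close>

definition realizes :: "('f mat set \<Rightarrow> 'f mat set) \<Rightarrow> (nat \<times> nat \<times> 'a \<Rightarrow> nat \<times> nat \<times> 'a) \<Rightarrow> bool" where
  "realizes f m \<longleftrightarrow> (\<forall>x\<in>lbl. f ` CmpL x = CmpL (m x))"

lemma moves_coL:
  assumes "moves \<phi> m" "x \<in> lbl"
  shows "\<exists>c. c \<noteq> 0 \<and> (\<forall>M\<in>Mn. coL (m x) (\<phi> M) = c * coL x M)"
proof -
  have m: "label_map m" and \<phi>: "lie_auto \<phi>" using assms by (auto simp: moves_def)
  note D = lie_autoD[OF \<phi>]
  obtain c where c: "c \<noteq> 0" "\<phi> (EL x) = c \<cdot>\<^sub>m EL (m x)" using assms by (auto simp: moves_def)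
  have "coL (m x) (\<phi> M) = c * coL x M" if "M \<in> Mn" for M
    using that
  proof (induct rule: coL_induct)
    case zero thus ?case using label_map_mem[OF m assms(2)] assms(2) by (simp add: lie_auto_zero[OF \<phi>] coL_zero)
  next
    case (E y d)
    obtain e where e: "\<phi> (EL y) = e \<cdot>\<^sub>m EL (m y)" using assms E by (auto simp: moves_def)
    have eq: "\<phi> (d \<cdot>\<^sub>m EL y) = d \<cdot>\<^sub>m \<phi> (EL y)" using D(4)[OF EL_carrier EL_carrier] E by blast
    show ?case
    proof (cases "x = y")
      case True
      thus ?thesis unfolding eq using c E assms(2) label_map_mem[OF m assms(2)] EL_carrier
        by (simp add: coL_smult coL_EL)
    next
      case False
      thus ?thesis unfolding eq e using E assms(2) label_map_mem[OF m] EL_carrier label_map_inj[OF m assms(2), of y]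
        by (simp add: coL_smult coL_EL)
    qed
  next
    case (add M1 M2)
    have c: "\<phi> M1 \<in> Mn" "\<phi> M2 \<in> Mn" "\<phi> (M1 + M2) = \<phi> M1 + \<phi> M2" using D[OF add(1,2)] D(1)[OF add(2,2)] by auto
    show ?case unfolding c(3) coL_add[OF label_map_mem[OF m assms(2)] c(1,2)] coL_add[OF assms(2) add(1,2)] add(3,4)
      by (simp add: distrib_left)
  qed
  thus ?thesis using c by blast
qed

lemma moves_realizes:
  assumes "moves \<phi> m" shows "realizes (induced \<phi>) m"
  unfolding realizes_def
proof
  fix x assume x: "x \<in> lbl"
  have m: "label_map m" and \<phi>: "lie_auto \<phi>" using assms by (auto simp: moves_def)
  obtain \<psi> where \<psi>: "lie_auto \<psi>" "\<And>A. A \<in> Mn \<Longrightarrow> \<phi> (\<psi> A) = A" using lie_auto_inv[OF \<phi>] by metis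
  have Hom: "\<phi> M \<in> HomL (m x) \<longleftrightarrow> M \<in> HomL x" if M: "M \<in> Mn" for M
  proof -
    have "(\<forall>y\<in>lbl. \<not> sameL (m x) y \<longrightarrow> coL y (\<phi> M) = 0) \<longleftrightarrow>
        (\<forall>y\<in>lbl. \<not> sameL (m x) (m y) \<longrightarrow> coL (m y) (\<phi> M) = 0)"
      using label_map_surj[OF m] label_map_mem[OF m] by metis
    also have "\<dots> \<longleftrightarrow> (\<forall>y\<in>lbl. \<not> sameL x y \<longrightarrow> coL y M = 0)"
      using moves_coL[OF assms] M label_map_same[OF m x] by (metis mult_eq_0_iff)
    finally show ?thesis using M lie_autoD(1)[OF \<phi> M M] by (simp add: HomL_iff)
  qed
  have "\<phi> ` (HomL x \<inter> sl) = HomL (m x) \<inter> sl"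
  proof (intro subset_antisym subsetI)
    fix M assume "M \<in> \<phi> ` (HomL x \<inter> sl)"
    thus "M \<in> HomL (m x) \<inter> sl" using Hom lie_auto_sl[OF \<phi>] by auto
  next
    fix M assume M: "M \<in> HomL (m x) \<inter> sl"
    hence "\<psi> M \<in> sl" "\<phi> (\<psi> M) = M" using \<psi> lie_auto_sl by auto
    thus "M \<in> \<phi> ` (HomL x \<inter> sl)" using M Hom[of "\<psi> M"] by (metis IntE IntI image_eqI sl_carrier)
  qed
  moreover have "induced \<phi> ` cls ` (HomL x \<inter> sl) = cls ` \<phi> ` (HomL x \<inter> sl)"
    unfolding image_image by (rule image_cong) (auto simp: induced_cls[OF \<phi>])
  ultimately show "induced \<phi> ` CmpL x = CmpL (m x)" by (simp add: CmpL_eq)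
qed

lemma lie_auto_comp: assumes "lie_auto \<phi>" "lie_auto \<psi>" shows "lie_auto (\<phi> \<circ> \<psi>)"
  unfolding lie_auto_def
proof (intro conjI ballI allI)
  show "bij_betw (\<phi> \<circ> \<psi>) Mn Mn" using assms by (auto simp: lie_auto_def intro: bij_betw_trans)
  fix A B assume AB: "A \<in> Mn" "B \<in> Mn"
  note D = lie_autoD[OF assms(2) AB] lie_autoD(1)[OF assms(2) AB(2,2)]
  show "(\<phi> \<circ> \<psi>) (A + B) = (\<phi> \<circ> \<psi>) A + (\<phi> \<circ> \<psi>) B"
    "(\<phi> \<circ> \<psi>) (brk A B) = brk ((\<phi> \<circ> \<psi>) A) ((\<phi> \<circ> \<psi>) B)"
    using D(2,3) lie_autoD(2,3)[OF assms(1) D(1) D(6)] by simp_all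
next
  fix c A assume A: "A \<in> Mn"
  note D = lie_autoD[OF assms(2) A A]
  show "(\<phi> \<circ> \<psi>) (c \<cdot>\<^sub>m A) = c \<cdot>\<^sub>m (\<phi> \<circ> \<psi>) A" using D(4) lie_autoD(4)[OF assms(1) D(1,1)] by simp
qed

lemma label_map_comp: assumes "label_map m" "label_map m'" shows "label_map (m \<circ> m')"
  unfolding label_map_def
proof (intro conjI ballI)
  show "bij_betw (m \<circ> m') lbl lbl" using assms by (auto simp: label_map_def intro: bij_betw_trans)
  fix x y assume "x \<in> lbl" "y \<in> lbl"
  thus "sameL ((m \<circ> m') x) ((m \<circ> m') y) = sameL x y"
    using label_map_same[OF assms(2)] label_map_same[OF assms(1)] label_map_mem[OF assms(2)] by simp
qed

lemma moves_comp: assumes "moves \<phi> m" "moves \<psi> m'" shows "moves (\<phi> \<circ> \<psi>) (m \<circ> m')"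
  unfolding moves_def
proof (intro conjI ballI)
  have \<phi>: "lie_auto \<phi>" "label_map m" and \<psi>: "lie_auto \<psi>" "label_map m'" using assms by (auto simp: moves_def)
  show "lie_auto (\<phi> \<circ> \<psi>)" "label_map (m \<circ> m')" using \<phi> \<psi> by (auto intro: lie_auto_comp label_map_comp)
  fix x assume x: "x \<in> lbl"
  obtain c where c: "c \<noteq> 0" "\<psi> (EL x) = c \<cdot>\<^sub>m EL (m' x)" using assms x by (auto simp: moves_def)
  have x': "m' x \<in> lbl" using label_map_mem[OF \<psi>(2) x] .
  obtain d where d: "d \<noteq> 0" "\<phi> (EL (m' x)) = d \<cdot>\<^sub>m EL (m (m' x))" using assms x' by (auto simp: moves_def)
  have "(\<phi> \<circ> \<psi>) (EL x) = c \<cdot>\<^sub>m \<phi> (EL (m' x))" using c lie_autoD(4)[OF \<phi>(1) EL_carrier[OF x'] EL_carrier[OF x']] by simp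
  thus "\<exists>c. c \<noteq> 0 \<and> (\<phi> \<circ> \<psi>) (EL x) = c \<cdot>\<^sub>m EL ((m \<circ> m') x)"
    using c d by (intro exI[of _ "c * d"]) simp
qed

lemma linear_extension_exists:
  fixes c :: "nat \<times> nat \<times> 'a \<Rightarrow> 'f"
  assumes m: "bij_betw m lbl lbl" and c: "\<And>x. x \<in> lbl \<Longrightarrow> c x \<noteq> 0"
  obtains \<phi> where "bij_betw \<phi> Mn Mn" "\<And>M M'. M \<in> Mn \<Longrightarrow> M' \<in> Mn \<Longrightarrow> \<phi> (M + M') = \<phi> M + \<phi> M'"
    "\<And>M d. M \<in> Mn \<Longrightarrow> \<phi> (d \<cdot>\<^sub>m M) = d \<cdot>\<^sub>m \<phi> M" "\<And>x. x \<in> lbl \<Longrightarrow> \<phi> (EL x) = c x \<cdot>\<^sub>m EL (m x)"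
proof -
  define m' where "m' = inv_into lbl m"
  have m': "m' x \<in> lbl" "m (m' x) = x" "m' (m x) = x" "m x \<in> lbl" if "x \<in> lbl" for x
    using m that by (auto simp: m'_def bij_betw_def inv_into_into f_inv_into_f)
  define \<phi> where "\<phi> M = comb (\<lambda>i j t. c (m' (i, j, t)) * coL (m' (i, j, t)) M)" for M
  define \<psi> where "\<psi> M = comb (\<lambda>i j t. inverse (c (i, j, t)) * coL (m (i, j, t)) M)" for M
  have co1: "coL x (\<phi> M) = c (m' x) * coL (m' x) M" if "x \<in> lbl" for x M
    using that by (cases x) (auto simp: \<phi>_def co_comb)
  have co2: "coL x (\<psi> M) = inverse (c x) * coL (m x) M" if "x \<in> lbl" for x M
    using that by (cases x) (auto simp: \<psi>_def co_comb)
  have carr: "\<phi> M \<in> Mn" "\<psi> M \<in> Mn" for M by (auto simp: \<phi>_def \<psi>_def)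
  have "\<psi> (\<phi> M) = M" "\<phi> (\<psi> M) = M" if "M \<in> Mn" for M
    by (rule mat_eqI_coL; use carr that m' c in \<open>simp add: co1 co2\<close>)+
  hence "bij_betw \<phi> Mn Mn" using carr by (intro bij_betw_byWitness[where f' = \<psi>]) auto
  moreover have "\<phi> (M + M') = \<phi> M + \<phi> M'" if "M \<in> Mn" "M' \<in> Mn" for M M'
    by (rule mat_eqI_coL) (use that m' carr in \<open>auto simp: co1 coL_add distrib_left\<close>)
  moreover have "\<phi> (d \<cdot>\<^sub>m M) = d \<cdot>\<^sub>m \<phi> M" if "M \<in> Mn" for d M
    by (rule mat_eqI_coL) (use that m' carr in \<open>auto simp: co1 coL_smult\<close>)
  moreover have "\<phi> (EL x) = c x \<cdot>\<^sub>m EL (m x)" if x: "x \<in> lbl" for x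
  proof (rule mat_eqI_coL)
    show "\<phi> (EL x) \<in> Mn" "c x \<cdot>\<^sub>m EL (m x) \<in> Mn" using x m' carr EL_carrier by auto
    fix y assume y: "y \<in> lbl"
    have "m' y = x \<longleftrightarrow> y = m x" using m' x y by metis
    thus "coL y (\<phi> (EL x)) = coL y (c x \<cdot>\<^sub>m EL (m x))"
      using x y m' EL_carrier by (auto simp: co1 coL_smult coL_EL)
  qed
  ultimately show ?thesis using that by blast
qed

text \<open>
  The label \<open>(i, j, t)\<close> stands for the degree \<open>g\<^sub>i t g\<^sub>j\<^sup>-\<^sup>1\<close>. Since \<open>\<sigma>\<close> is realised by minus
  the transpose, it acts on labels through its action on \<open>T\<close> followed by inversion of the degree.
\<close>

definition lab :: "(nat \<Rightarrow> nat) \<Rightarrow> (nat \<Rightarrow> 'a) \<Rightarrow> ('a \<Rightarrow> 'a) \<Rightarrow> int \<Rightarrow> nat \<times> nat \<times> 'a \<Rightarrow> nat \<times> nat \<times> 'a" where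
  "lab p x \<alpha> \<epsilon> = (\<lambda>(i, j, t). if \<epsilon> = 0 then (p i, p j, x (p i) \<otimes> \<alpha> t \<otimes> inv (x (p j)))
     else (p j, p i, inv (x (p i) \<otimes> \<alpha> (\<sigma> t) \<otimes> inv (x (p j)))))"

abbreviation Aut where "Aut \<equiv> carrier (Aut_form T \<beta>)"

lemma Aut_iff: "\<alpha> \<in> Aut \<longleftrightarrow> \<alpha> \<in> auto T \<and> (\<forall>u\<in>tc. \<forall>v\<in>tc. \<beta> (\<alpha> u) (\<alpha> v) = \<beta> u v)"
  by (simp add: Aut_form_def)

lemma AutD:
  assumes "\<alpha> \<in> Aut"
  shows "\<alpha> \<in> hom T T" "bij_betw \<alpha> tc tc" "\<And>u. u \<in> tc \<Longrightarrow> \<alpha> u \<in> tc"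
    "\<And>u v. u \<in> tc \<Longrightarrow> v \<in> tc \<Longrightarrow> \<beta> (\<alpha> u) (\<alpha> v) = \<beta> u v"
    "\<And>u v. u \<in> tc \<Longrightarrow> v \<in> tc \<Longrightarrow> \<alpha> (u \<otimes> v) = \<alpha> u \<otimes> \<alpha> v"
    "\<alpha> \<one> = \<one>" "\<And>u. u \<in> tc \<Longrightarrow> \<alpha> (inv u) = inv (\<alpha> u)"
proof -
  show h: "\<alpha> \<in> hom T T" "bij_betw \<alpha> tc tc" using assms by (auto simp: Aut_iff auto_def Bij_def)
  interpret \<alpha>: group_hom T T \<alpha> by unfold_locales (rule h(1))
  show "\<And>u. u \<in> tc \<Longrightarrow> \<alpha> u \<in> tc" "\<And>u v. u \<in> tc \<Longrightarrow> v \<in> tc \<Longrightarrow> \<beta> (\<alpha> u) (\<alpha> v) = \<beta> u v"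
    "\<And>u v. u \<in> tc \<Longrightarrow> v \<in> tc \<Longrightarrow> \<alpha> (u \<otimes> v) = \<alpha> u \<otimes> \<alpha> v"
    "\<alpha> \<one> = \<one>" "\<And>u. u \<in> tc \<Longrightarrow> \<alpha> (inv u) = inv (\<alpha> u)"
    using assms by (auto simp: Aut_iff)
qed

lemma id_Aut: "(\<lambda>t\<in>tc. t) \<in> Aut"
  using T.id_in_auto by (simp add: Aut_iff)

lemma label_map_lab0:
  assumes p: "bij_betw p {..<k} {..<k}" and x: "\<And>i. i < k \<Longrightarrow> x i \<in> tc" and \<alpha>: "\<alpha> \<in> Aut"
  shows "label_map (lab p x \<alpha> 0)"
  unfolding label_map_def
proof (intro conjI ballI)
  have pk: "p i < k" "p i = p j \<longleftrightarrow> i = j" if "i < k" "j < k" for i j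
    using p that by (auto simp: bij_betw_def inj_on_def)
  have xp: "x (p i) \<in> tc" if "i < k" for i using pk x that by blast
  have inj\<alpha>: "\<alpha> t = \<alpha> s \<longleftrightarrow> t = s" if "t \<in> tc" "s \<in> tc" for t s
    using AutD(2)[OF \<alpha>] that by (auto simp: bij_betw_def inj_on_def)
  show "bij_betw (lab p x \<alpha> 0) lbl lbl"
  proof (rule bij_betw_imageI)
    show "inj_on (lab p x \<alpha> 0) lbl"
      by (rule inj_onI) (auto simp: lab_def pk inj\<alpha> xp AutD(3)[OF \<alpha>])
    show "lab p x \<alpha> 0 ` lbl = lbl"
    proof (intro subset_antisym subsetI)
      fix y assume "y \<in> lbl"
      then obtain i j t where y: "y = (i, j, t)" "i < k" "j < k" "t \<in> tc" by (cases y) auto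
      obtain i' j' where ij: "i = p i'" "i' < k" "j = p j'" "j' < k" using p y
        by (auto simp: bij_betw_def) (metis imageE lessThan_iff)
      obtain s where s: "s \<in> tc" "\<alpha> s = inv (x i) \<otimes> t \<otimes> x j"
        using AutD(2)[OF \<alpha>] x y by (auto simp: bij_betw_def) (metis T.inv_closed T.m_closed imageE)
      have "x i \<otimes> \<alpha> s \<otimes> inv (x j) = t" using s x y by (simp add: T.m_assoc[symmetric]) (simp add: T.m_assoc)
      hence "lab p x \<alpha> 0 (i', j', s) = y" using y ij by (simp add: lab_def)
      thus "y \<in> lab p x \<alpha> 0 ` lbl" using ij s by (intro image_eqI[of _ _ "(i', j', s)"]) auto
    qed (auto simp: lab_def pk xp AutD(3)[OF \<alpha>])
  qed
  fix y z assume "y \<in> lbl" "z \<in> lbl"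
  \<comment> \<open>For equal indices conjugation by \<open>x (p i)\<close> cancels since
    \<open>T\<close> is abelian, so the image of a diagonal degree does not depend on the
    index.\<close>
  moreover have "x (p i) \<otimes> \<alpha> t \<otimes> inv (x (p i)) = \<alpha> t" if "i < k" "t \<in> tc" for i t
    using xp[OF that(1)] AutD(3)[OF \<alpha> that(2)] by (simp add: T.m_comm[of "x (p i)"] T.m_assoc)
  ultimately show "sameL (lab p x \<alpha> 0 y) (lab p x \<alpha> 0 z) = sameL y z"
    by (cases y; cases z) (auto simp: lab_def same_def pk inj\<alpha> xp AutD(3)[OF \<alpha>])
qed

text \<open>The map is an associative automorphism: rescale \<open>X t\<close> to \<open>c t\<close>
  times \<open>X (\<alpha> t)\<close>, conjugate by a diagonal matrix with blocks
  \<open>X (x (p i))\<close> and permute the blocks. Multiplicativity on the basis reduces to the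
  relation \<open>dd\<close> between the scalars.\<close>

lemma moves_lab0:
  assumes p: "bij_betw p {..<k} {..<k}" and x: "\<And>i. i < k \<Longrightarrow> x i \<in> tc" and \<alpha>: "\<alpha> \<in> Aut"
  obtains \<phi> where "moves \<phi> (lab p x \<alpha> 0)"
proof -
  have lm: "label_map (lab p x \<alpha> 0)" by (rule label_map_lab0[OF p _ \<alpha>]) (rule x)
  have pk: "p i < k" "p i = p j \<longleftrightarrow> i = j" if "i < k" "j < k" for i j
    using p that by (auto simp: bij_betw_def inj_on_def)
  have xp: "x (p i) \<in> tc" if "i < k" for i using pk x that by blast
  note \<alpha>s = AutD[OF \<alpha>]
  obtain c where c: "\<And>u. u \<in> tc \<Longrightarrow> c u \<noteq> 0"
    "\<And>u v. u \<in> tc \<Longrightarrow> v \<in> tc \<Longrightarrow> bc u v * c (u \<otimes> v) = bc (\<alpha> u) (\<alpha> v) * c u * c v"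
    using automorphism_scalars[OF \<alpha>s(1,4)] by blast
  define y where "y i j t = x (p i) \<otimes> \<alpha> t \<otimes> inv (x (p j))" for i j t
  have y: "y i j t \<in> tc" if "i < k" "j < k" "t \<in> tc" for i j t using that xp \<alpha>s by (simp add: y_def)
  have yy: "y i j t \<otimes> y j h s = y i h (t \<otimes> s)" if "i < k" "j < k" "h < k" "t \<in> tc" "s \<in> tc" for i j h t s
  proof -
    have "inv u \<otimes> (u \<otimes> v) = v" if "u \<in> tc" "v \<in> tc" for u v
      using that by (simp add: T.m_assoc[symmetric])
    thus ?thesis using that xp \<alpha>s by (simp add: y_def T.m_assoc)
  qed
  define W where "W i = X (x (p i))" for i
  define V where "V i = Xi (x (p i))" for i
  have WV: "W i \<in> carrier_mat N N" "V i \<in> carrier_mat N N" "V i * W i = 1\<^sub>m N" "W i * V i = 1\<^sub>m N" if "i < k" for i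
    using Xi[OF xp[OF that]] X_carrier[OF xp[OF that]] by (auto simp: W_def V_def)
  have "\<exists>d. d \<noteq> 0 \<and> W i * X (\<alpha> t) * V j = d \<cdot>\<^sub>m X (y i j t)" if "i < k" "j < k" "t \<in> tc" for i j t
  proof -
    note m = xp[OF that(1)] xp[OF that(2)] \<alpha>s(3)[OF that(3)]
    obtain e where e: "e \<noteq> 0" "W j * X (inv (x (p j))) = e \<cdot>\<^sub>m 1\<^sub>m N"
      using bc[of "x (p j)" "inv (x (p j))"] m by (auto simp: W_def X_one)
    have Vc: "V j = inverse e \<cdot>\<^sub>m X (inv (x (p j)))"
    proof -
      have "V j * (W j * X (inv (x (p j)))) = X (inv (x (p j)))"
        using WV[OF that(2)] m by (simp add: square_assoc[of _ N, symmetric] left_mult_one_mat[OF X_carrier])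
      moreover have "V j * (W j * X (inv (x (p j)))) = e \<cdot>\<^sub>m V j"
        unfolding e(2) using WV[OF that(2)] by (simp add: square_smult[of _ N])
      ultimately show ?thesis using e(1) by (metis left_inverse one_smult_mat_eq smult_smult_times)
    qed
    have "W i * X (\<alpha> t) * V j = (bc (x (p i)) (\<alpha> t) * inverse e * bc (x (p i) \<otimes> \<alpha> t) (inv (x (p j)))) \<cdot>\<^sub>m X (y i j t)"
      unfolding Vc using m bc(2)[of "x (p i)" "\<alpha> t"] bc(2)[of "x (p i) \<otimes> \<alpha> t" "inv (x (p j))"]
      by (simp add: W_def square_smult[of _ N] y_def mult_ac)
    moreover have "bc (x (p i)) (\<alpha> t) * inverse e * bc (x (p i) \<otimes> \<alpha> t) (inv (x (p j))) \<noteq> 0"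
      using e(1) bc(1)[of "x (p i)" "\<alpha> t"] bc(1)[of "x (p i) \<otimes> \<alpha> t" "inv (x (p j))"] m by simp
    ultimately show ?thesis by blast
  qed
  then obtain d where d: "\<And>i j t. i < k \<Longrightarrow> j < k \<Longrightarrow> t \<in> tc \<Longrightarrow> d i j t \<noteq> 0"
    "\<And>i j t. i < k \<Longrightarrow> j < k \<Longrightarrow> t \<in> tc \<Longrightarrow> W i * X (\<alpha> t) * V j = d i j t \<cdot>\<^sub>m X (y i j t)"
    by metis
  \<comment> \<open>Computed from the product of \<open>W i * X (\<alpha> t) * V j\<close> and
    \<open>W j * X (\<alpha> s) * V h\<close>, in which the inner pair \<open>V j * W j\<close>
    cancels.\<close>
  have dd: "d i j t * d j h s * bc (y i j t) (y j h s) = bc (\<alpha> t) (\<alpha> s) * d i h (t \<otimes> s)"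
    if b: "i < k" "j < k" "h < k" "t \<in> tc" "s \<in> tc" for i j h t s
  proof (rule X_smult_cancel[of "y i h (t \<otimes> s)"])
    note m = WV[OF b(1)] WV[OF b(2)] WV[OF b(3)] X_carrier[OF \<alpha>s(3)[OF b(4)]] X_carrier[OF \<alpha>s(3)[OF b(5)]]
    have "(d i j t * d j h s * bc (y i j t) (y j h s)) \<cdot>\<^sub>m X (y i h (t \<otimes> s)) =
        (W i * X (\<alpha> t) * V j) * (W j * X (\<alpha> s) * V h)"
      using b d(2) y yy bc(2)[of "y i j t" "y j h s"] by (simp add: square_smult[of _ N] mult_ac)
    also have "\<dots> = W i * X (\<alpha> t) * (V j * W j) * X (\<alpha> s) * V h"
      using m(1,2,5,6,9,10,13,14) by (simp add: square_assoc[of _ N])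
    also have "\<dots> = W i * (X (\<alpha> t) * X (\<alpha> s)) * V h" unfolding m(7)
      using m(1,2,5,6,9,10,13,14) by (simp add: square_assoc[of _ N])
    also have "\<dots> = bc (\<alpha> t) (\<alpha> s) \<cdot>\<^sub>m (W i * X (\<alpha> (t \<otimes> s)) * V h)"
      using b \<alpha>s bc(2)[of "\<alpha> t" "\<alpha> s"] m(1,2,9,10) by (simp add: square_smult[of _ N])
    also have "\<dots> = (bc (\<alpha> t) (\<alpha> s) * d i h (t \<otimes> s)) \<cdot>\<^sub>m X (y i h (t \<otimes> s))" using b d(2) by simp
    finally show "(d i j t * d j h s * bc (y i j t) (y j h s)) \<cdot>\<^sub>m X (y i h (t \<otimes> s)) =
      (bc (\<alpha> t) (\<alpha> s) * d i h (t \<otimes> s)) \<cdot>\<^sub>m X (y i h (t \<otimes> s))" .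
  qed (use b y in auto)
  define e where "e = (\<lambda>(i, j, t). c t * d i j t)"
  have bij: "bij_betw (lab p x \<alpha> 0) lbl lbl" using lm by (simp add: label_map_def)
  have enz: "e z \<noteq> 0" if "z \<in> lbl" for z using that c(1) d(1) by (cases z) (simp add: e_def)
  obtain \<phi> where \<phi>: "bij_betw \<phi> Mn Mn" "\<And>M M'. M \<in> Mn \<Longrightarrow> M' \<in> Mn \<Longrightarrow> \<phi> (M + M') = \<phi> M + \<phi> M'"
    "\<And>M d. M \<in> Mn \<Longrightarrow> \<phi> (d \<cdot>\<^sub>m M) = d \<cdot>\<^sub>m \<phi> M" "\<And>z. z \<in> lbl \<Longrightarrow> \<phi> (EL z) = e z \<cdot>\<^sub>m EL (lab p x \<alpha> 0 z)"
    by (rule linear_extension_exists[OF bij enz]) (blast, rule that)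
  have \<phi>c: "\<phi> M \<in> Mn" if "M \<in> Mn" for M using \<phi>(1) that by (auto simp: bij_betw_def)
  have \<phi>E: "\<phi> (E i j t) = (c t * d i j t) \<cdot>\<^sub>m E (p i) (p j) (y i j t)" if "i < k" "j < k" "t \<in> tc" for i j t
    using \<phi>(4)[of "(i, j, t)"] that by (simp add: lab_def e_def y_def)
  have \<phi>0: "\<phi> (0\<^sub>m n n) = 0\<^sub>m n n"
  proof -
    have "\<phi> (0 \<cdot>\<^sub>m 0\<^sub>m n n) = 0 \<cdot>\<^sub>m \<phi> (0\<^sub>m n n)" by (rule \<phi>(3)) simp
    moreover have "0 \<cdot>\<^sub>m \<phi> (0\<^sub>m n n) = 0\<^sub>m n n" using \<phi>c[of "0\<^sub>m n n"] by auto
    ultimately show ?thesis by simp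
  qed
  have EE: "\<phi> (E i j t * E h q s) = \<phi> (E i j t) * \<phi> (E h q s)"
    if b: "i < k" "j < k" "h < k" "q < k" "t \<in> tc" "s \<in> tc" for i j h q t s
  proof (cases "j = h")
    case True
    have "bc t s * (c (t \<otimes> s) * d i q (t \<otimes> s)) = c t * c s * (bc (\<alpha> t) (\<alpha> s) * d i q (t \<otimes> s))"
      using c(2)[OF b(5,6)] by (simp only: mult.assoc[symmetric]) (simp only: mult_ac)
    also have "\<dots> = c t * d i j t * (c s * d j q s) * bc (y i j t) (y j q s)"
      using dd[of i j q t s, symmetric, OF b(1,2,4,5,6)] by (simp only: mult_ac)
    finally have "bc t s * (c (t \<otimes> s) * d i q (t \<otimes> s)) = c t * d i j t * (c s * d j q s) * bc (y i j t) (y j q s)" .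
    thus ?thesis using b True pk y yy
      by (simp add: E_mult \<phi>E \<phi>(3) square_smult[of _ n] mult_ac)
  next
    case False
    thus ?thesis using b pk y by (simp add: E_mult \<phi>E \<phi>0 square_smult[of _ n])
  qed
  have mult: "\<phi> (M * M') = \<phi> M * \<phi> M'" if "M \<in> Mn" "M' \<in> Mn" for M M'
    using that(1)
  proof (induct rule: coL_induct)
    case zero
    show ?case by (simp add: \<phi>0 left_mult_zero_mat[OF that(2)] left_mult_zero_mat[OF \<phi>c[OF that(2)]])
  next
    case (E z e)
    have z: "EL z \<in> Mn" using E EL_carrier by blast
    have "\<phi> (EL z * M') = \<phi> (EL z) * \<phi> M'" using that(2)
    proof (induct rule: coL_induct)
      case zero
      show ?case by (simp add: \<phi>0 right_mult_zero_mat[OF z] right_mult_zero_mat[OF \<phi>c[OF z]])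
    next
      case (E w f)
      have "\<phi> (EL z * EL w) = \<phi> (EL z) * \<phi> (EL w)"
        using EE \<open>z \<in> lbl\<close> \<open>w \<in> lbl\<close> by (cases z; cases w) auto
      thus ?case using z EL_carrier[OF E(1)] \<phi>c by (simp add: square_smult[of _ n] \<phi>(3))
    next
      case (add M1 M2)
      thus ?case using z \<phi>c[OF z] \<phi>c[of M1] \<phi>c[of M2]
        by (simp add: mult_add_distrib_mat[of _ n n] \<phi>(2))
    qed
    thus ?case using z that(2) \<phi>c by (simp add: square_smult[of _ n] \<phi>(3))
  next
    case (add M1 M2)
    thus ?case using that(2) \<phi>c[OF that(2)] \<phi>c[of M1] \<phi>c[of M2]
      by (simp add: add_mult_distrib_mat[of _ n n] \<phi>(2))
  qed
  have minus: "\<phi> (M - M') = \<phi> M - \<phi> M'" if "M \<in> Mn" "M' \<in> Mn" for M M'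
    using that \<phi>c[OF that(1)] \<phi>c[OF that(2)] by (simp add: minus_as_add \<phi>(2,3))
  have "lie_auto \<phi>" unfolding lie_auto_def brk_def using \<phi>(1-3) mult minus by simp
  moreover have "\<exists>c. c \<noteq> 0 \<and> \<phi> (EL z) = c \<cdot>\<^sub>m EL (lab p x \<alpha> 0 z)" if "z \<in> lbl" for z
    using \<phi>(4)[OF that] enz[OF that] by blast
  ultimately have "moves \<phi> (lab p x \<alpha> 0)" unfolding moves_def using lm by blast
  thus ?thesis by (rule that)
qed

text \<open>Effect of transposition on labels, with the third entry dictated by
  \<open>X_transpose\<close>.\<close>

definition flip_map :: "nat \<times> nat \<times> 'a \<Rightarrow> nat \<times> nat \<times> 'a" where
  "flip_map = (\<lambda>(i, j, t). (j, i, inv (\<sigma> t)))"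

lemma sigma_inj: "s \<in> tc \<Longrightarrow> t \<in> tc \<Longrightarrow> \<sigma> s = \<sigma> t \<longleftrightarrow> s = t"
  by (metis sigma_sigma)

lemma flip_flip: "x \<in> lbl \<Longrightarrow> flip_map (flip_map x) = x"
  by (cases x) (auto simp: flip_map_def)

lemma label_map_flip: "label_map flip_map"
  unfolding label_map_def
proof (intro conjI ballI)
  show "bij_betw flip_map lbl lbl"
    by (rule bij_betw_byWitness[where f' = flip_map]) (auto simp: flip_flip, auto simp: flip_map_def)
  fix x y assume "x \<in> lbl" "y \<in> lbl"
  thus "sameL (flip_map x) (flip_map y) = sameL x y"
    by (cases x; cases y) (auto simp: flip_map_def same_def sigma_inj)
qed

lemma lab1_eq:
  assumes "\<alpha> \<in> Aut" "\<And>i. i < k \<Longrightarrow> p i < k" "\<And>i. i < k \<Longrightarrow> x i \<in> tc" "z \<in> lbl" "\<epsilon> \<noteq> 0"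
  shows "lab p x \<alpha> \<epsilon> z = lab p x \<alpha> 0 (flip_map z)"
proof -
  obtain i j t where z: "z = (i, j, t)" by (cases z)
  have m: "x (p i) \<in> tc" "x (p j) \<in> tc" "\<alpha> (\<sigma> t) \<in> tc" using assms z AutD(3) by auto
  have "inv (x (p i) \<otimes> \<alpha> (\<sigma> t) \<otimes> inv (x (p j))) = x (p j) \<otimes> inv (\<alpha> (\<sigma> t)) \<otimes> inv (x (p i))"
    using m by (simp add: T.inv_mult_group T.m_assoc)
  thus ?thesis using assms z AutD(7)[OF assms(1), of "\<sigma> t"] by (simp add: lab_def flip_map_def)
qed

text \<open>Transposition reverses products, so it respects brackets up to a sign, which the factor
  -1 corrects.\<close>

lemma moves_flip: "moves (\<lambda>M. (-1) \<cdot>\<^sub>m transpose_mat M) flip_map"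
  unfolding moves_def
proof (intro conjI ballI label_map_flip)
  let ?\<phi> = "\<lambda>M :: 'f mat. (-1) \<cdot>\<^sub>m transpose_mat M"
  show "lie_auto ?\<phi>"
    unfolding lie_auto_def
  proof (intro conjI ballI allI)
    have inv: "?\<phi> (?\<phi> M) = M" for M by (simp add: transpose_smult_mat)
    show "bij_betw ?\<phi> Mn Mn" by (rule bij_betw_byWitness[where f' = ?\<phi>]) (use inv in auto)
    fix M M' assume M: "M \<in> Mn" "M' \<in> Mn"
    show "?\<phi> (M + M') = ?\<phi> M + ?\<phi> M'" using M by auto
    have P: "M * M' \<in> Mn" "M' * M \<in> Mn" using M by auto
    have "transpose_mat (P - Q) = transpose_mat P - transpose_mat Q" if "P \<in> Mn" "Q \<in> Mn" for P Q
      using that by auto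
    hence "?\<phi> (brk M M') = (-1) \<cdot>\<^sub>m (transpose_mat M' * transpose_mat M - transpose_mat M * transpose_mat M')"
      unfolding brk_def using P M by (simp add: transpose_mult[of _ n n _ n])
    also have "\<dots> = transpose_mat M * transpose_mat M' - transpose_mat M' * transpose_mat M"
    proof -
      have "(-1) \<cdot>\<^sub>m (P - Q) = Q - P" if "P \<in> Mn" "Q \<in> Mn" for P Q using that by auto
      thus ?thesis using M by simp
    qed
    also have "\<dots> = brk (?\<phi> M) (?\<phi> M')"
      unfolding brk_def using M by (simp add: square_smult[of _ n])
    finally show "?\<phi> (brk M M') = brk (?\<phi> M) (?\<phi> M')" .
  next
    fix c and M :: "'f mat" assume "M \<in> Mn"
    show "?\<phi> (c \<cdot>\<^sub>m M) = c \<cdot>\<^sub>m ?\<phi> M" by (simp add: transpose_smult_mat)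
  qed
  fix z assume "z \<in> lbl"
  then obtain i j t where z: "z = (i, j, t)" "i < k" "j < k" "t \<in> tc" by (cases z) auto
  obtain c where c: "c \<noteq> 0" "transpose_mat (X t) = c \<cdot>\<^sub>m X (inv (\<sigma> t))" using X_transpose z by blast
  have "transpose_mat (E i j t) = kronecker (transpose_mat (matrix_unit k i j)) (transpose_mat (X t))"
    unfolding E_def using z by (intro kronecker_transpose[of _ k k _ N N]) (auto simp: matrix_unit_def)
  also have "transpose_mat (matrix_unit k i j) = (matrix_unit k j i :: 'f mat)"
    by (rule eq_matI) (auto simp: matrix_unit_def)
  finally have "?\<phi> (EL z) = (- c) \<cdot>\<^sub>m EL (flip_map z)"
    using z c by (simp add: kronecker_smult_right E_def flip_map_def)
  thus "\<exists>c. c \<noteq> 0 \<and> ?\<phi> (EL z) = c \<cdot>\<^sub>m EL (flip_map z)" using c by (intro exI[of _ "- c"]) auto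
qed

lemma moves_cong:
  assumes "moves \<phi> m" "\<And>x. x \<in> lbl \<Longrightarrow> m x = m' x" shows "moves \<phi> m'"
proof -
  have "bij_betw m lbl lbl = bij_betw m' lbl lbl" by (rule bij_betw_cong) (use assms in auto)
  thus ?thesis using assms by (auto simp: moves_def label_map_def)
qed

lemma lab_moves:
  assumes "bij_betw p {..<k} {..<k}" "\<And>i. i < k \<Longrightarrow> x i \<in> tc" "\<alpha> \<in> Aut"
  obtains \<phi> where "moves \<phi> (lab p x \<alpha> \<epsilon>)"
proof -
  obtain \<phi> where \<phi>: "moves \<phi> (lab p x \<alpha> 0)" using moves_lab0[of p x \<alpha>] assms by blast
  show ?thesis
  proof (cases "\<epsilon> = 0")
    case False
    have "moves (\<phi> \<circ> (\<lambda>M. (-1) \<cdot>\<^sub>m transpose_mat M)) (lab p x \<alpha> \<epsilon>)"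
      by (rule moves_cong[OF moves_comp[OF \<phi> moves_flip]])
        (use assms False in \<open>auto simp: bij_betw_def intro!: lab1_eq[symmetric]\<close>)
    thus ?thesis using that by blast
  qed (use \<phi> that in auto)
qed

end

subsection \<open>Automorphisms of the grading\<close>

context fine_grading begin

definition gaut where
  "gaut f \<longleftrightarrow> f \<in> alg_automorphisms L \<and> (\<lambda>C. f ` C) ` components = components"

lemma gaut_bij: "gaut f \<Longrightarrow> bij_betw f (carrier L) (carrier L)"
  by (auto simp: gaut_def alg_automorphisms_def Bij_def)

lemma cls_mem_L: "M \<in> sl \<Longrightarrow> cls M \<in> carrier L"
  by (simp add: carrier_L)

lemma gaut_inj: "gaut f \<Longrightarrow> u \<in> carrier L \<Longrightarrow> v \<in> carrier L \<Longrightarrow> f u = f v \<longleftrightarrow> u = v"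
  using gaut_bij[of f] by (auto simp: bij_betw_def inj_on_def)

lemma gaut_closed: "gaut f \<Longrightarrow> u \<in> carrier L \<Longrightarrow> f u \<in> carrier L"
  using gaut_bij[of f] by (auto simp: bij_betw_def)

lemma gaut_mult: "gaut f \<Longrightarrow> u \<in> carrier L \<Longrightarrow> v \<in> carrier L \<Longrightarrow> f (u \<otimes>\<^bsub>L\<^esub> v) = f u \<otimes>\<^bsub>L\<^esub> f v"
  by (auto simp: gaut_def alg_automorphisms_def)

lemma gaut_brk:
  assumes "gaut f" "M \<in> sl" "W \<in> sl" "M' \<in> sl" "W' \<in> sl" "f (cls M) = cls M'" "f (cls W) = cls W'"
  shows "f (cls (brk M W)) = cls (brk M' W')"
  using gaut_mult[OF assms(1), of "cls M" "cls W"] assms by (simp add: carrier_L cls_brk)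

lemma gaut_smult:
  assumes "gaut f" "M \<in> sl" "M' \<in> sl" "f (cls M) = cls M'"
  shows "f (cls (c \<cdot>\<^sub>m M)) = cls (c \<cdot>\<^sub>m M')"
proof -
  have "f (c \<odot>\<^bsub>L\<^esub> cls M) = c \<odot>\<^bsub>L\<^esub> f (cls M)"
    using assms cls_mem_L by (auto simp: gaut_def alg_automorphisms_def)
  thus ?thesis using assms by (simp add: cls_smult)
qed

lemma zero_smult_mat: "M \<in> Mn \<Longrightarrow> 0 \<cdot>\<^sub>m M = 0\<^sub>m n n"
  by auto

lemma gaut_zero: assumes "gaut f" shows "f \<zero>\<^bsub>L\<^esub> = \<zero>\<^bsub>L\<^esub>"
proof -
  obtain M where M: "M \<in> sl" "f (cls (0\<^sub>m n n)) = cls M"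
    using gaut_closed[OF assms cls_mem_L[OF sl_zero]] by (auto simp: carrier_L)
  have "0 \<cdot>\<^sub>m M = 0\<^sub>m n n" using sl_carrier[OF M(1)] by auto
  thus ?thesis using gaut_smult[OF assms sl_zero M, of 0] by (simp add: zero_L)
qed

lemma gaut_eq_zero: "gaut f \<Longrightarrow> u \<in> carrier L \<Longrightarrow> f u = \<zero>\<^bsub>L\<^esub> \<longleftrightarrow> u = \<zero>\<^bsub>L\<^esub>"
  using gaut_zero[of f] gaut_inj[of f u "\<zero>\<^bsub>L\<^esub>"] cls_mem_L[OF sl_zero] by (simp add: zero_L)

lemma components_label:
  "C \<in> components \<longleftrightarrow> (\<exists>x\<in>lbl. C = CmpL x \<and> CmpL x \<noteq> {\<zero>\<^bsub>L\<^esub>})"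
  unfolding components_eq mem_Collect_eq by (simp add: lbl_def Bex_def split_paired_Ex) blast

lemma gaut_label:
  assumes "gaut f" "x \<in> lbl" "CmpL x \<noteq> {\<zero>\<^bsub>L\<^esub>}"
  obtains y where "y \<in> lbl" "f ` CmpL x = CmpL y" "CmpL y \<noteq> {\<zero>\<^bsub>L\<^esub>}"
proof -
  have "CmpL x \<in> components" using assms components_label by blast
  hence "f ` CmpL x \<in> components" using assms(1) by (auto simp: gaut_def)
  then obtain y where "y \<in> lbl" "f ` CmpL x = CmpL y" "CmpL y \<noteq> {\<zero>\<^bsub>L\<^esub>}" unfolding components_label by blast
  thus ?thesis by (rule that)
qed

lemma gaut_label_surj:
  assumes "gaut f" "y \<in> lbl" "CmpL y \<noteq> {\<zero>\<^bsub>L\<^esub>}"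
  obtains x where "x \<in> lbl" "f ` CmpL x = CmpL y" "CmpL x \<noteq> {\<zero>\<^bsub>L\<^esub>}"
proof -
  have "CmpL y \<in> components" using assms components_label by blast
  moreover have "(\<lambda>C. f ` C) ` components = components" using assms(1) by (simp add: gaut_def)
  ultimately have "CmpL y \<in> (\<lambda>C. f ` C) ` components" by simp
  then obtain C where "C \<in> components" "CmpL y = f ` C" by blast
  moreover from this obtain x where "x \<in> lbl" "C = CmpL x" "CmpL x \<noteq> {\<zero>\<^bsub>L\<^esub>}" unfolding components_label by blast
  ultimately show ?thesis using that by simp
qed

text \<open>Components are nonzero by definition, so besides the label map the injectivity of
  \<open>f\<close> enters: it sends nonzero spaces to nonzero spaces and zero spaces to zero
  spaces.\<close>

lemma gaut_of_realizes:
  assumes "f \<in> alg_automorphisms L" "realizes f m" "label_map m" shows "gaut f"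
proof -
  have eq: "f ` CmpL x = CmpL (m x)" "m x \<in> lbl" if "x \<in> lbl" for x
    using that assms label_map_mem by (auto simp: realizes_def)
  have sub: "CmpL x \<subseteq> carrier L" for x by (auto simp: CmpL_eq carrier_L)
  have inj: "inj_on f (carrier L)" using assms by (auto simp: alg_automorphisms_def Bij_def bij_betw_def)
  have z: "\<zero>\<^bsub>L\<^esub> \<in> carrier L" unfolding zero_L by (rule cls_mem_L) simp
  have f0: "f \<zero>\<^bsub>L\<^esub> = \<zero>\<^bsub>L\<^esub>"
  proof -
    have "f (0 \<odot>\<^bsub>L\<^esub> \<zero>\<^bsub>L\<^esub>) = 0 \<odot>\<^bsub>L\<^esub> f \<zero>\<^bsub>L\<^esub>" using assms z by (auto simp: alg_automorphisms_def)
    moreover have "0 \<odot>\<^bsub>L\<^esub> u = \<zero>\<^bsub>L\<^esub>" if "u \<in> carrier L" for u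
    proof -
      obtain M where M: "M \<in> sl" "u = cls M" using \<open>u \<in> carrier L\<close> by (auto simp: carrier_L)
      have "0 \<cdot>\<^sub>m M = 0\<^sub>m n n" using sl_carrier[OF M(1)] by auto
      thus ?thesis using M by (simp add: cls_smult zero_L)
    qed
    moreover have "f \<zero>\<^bsub>L\<^esub> \<in> carrier L" using assms z by (auto simp: alg_automorphisms_def Bij_def bij_betw_def)
    ultimately show ?thesis using z by simp
  qed
  have nz: "f ` CmpL x = {\<zero>\<^bsub>L\<^esub>} \<longleftrightarrow> CmpL x = {\<zero>\<^bsub>L\<^esub>}" for x
  proof
    assume "f ` CmpL x = {\<zero>\<^bsub>L\<^esub>}"
    hence "f ` CmpL x = f ` {\<zero>\<^bsub>L\<^esub>}" using f0 by simp
    thus "CmpL x = {\<zero>\<^bsub>L\<^esub>}" using inj_on_image_eq_iff[OF inj sub, of "{\<zero>\<^bsub>L\<^esub>}"] z by simp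
  qed (use f0 in simp)
  have "(\<lambda>C. f ` C) ` components = components"
  proof (intro subset_antisym subsetI)
    fix C assume "C \<in> (\<lambda>C. f ` C) ` components"
    then obtain D where D: "D \<in> components" "C = f ` D" by blast
    then obtain x where x: "x \<in> lbl" "D = CmpL x" "CmpL x \<noteq> {\<zero>\<^bsub>L\<^esub>}" unfolding components_label by blast
    hence "C = CmpL (m x)" "CmpL (m x) \<noteq> {\<zero>\<^bsub>L\<^esub>}" using D nz[of x] eq[of x] by simp_all
    thus "C \<in> components" unfolding components_label using eq(2)[OF x(1)] by blast
  next
    fix C assume "C \<in> components"
    then obtain y where y: "y \<in> lbl" "C = CmpL y" "CmpL y \<noteq> {\<zero>\<^bsub>L\<^esub>}" unfolding components_label by blast
    obtain x where "x \<in> lbl" "y = m x" using label_map_surj[OF assms(3) y(1)] by blast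
    hence x: "x \<in> lbl" "C = f ` CmpL x" "CmpL x \<noteq> {\<zero>\<^bsub>L\<^esub>}" using y nz[of x] eq[of x] by simp_all
    hence "CmpL x \<in> components" unfolding components_label by blast
    thus "C \<in> (\<lambda>C. f ` C) ` components" using x by blast
  qed
  thus ?thesis using assms(1) by (simp add: gaut_def)
qed

lemma Cmp_carrier: "Cmp i j t \<subseteq> carrier L"
  by (auto simp: Cmp_def carrier_L)

text \<open>Vanishing of the cube of \<open>ad u\<close> for all \<open>u\<close> in the set: a
  condition in terms of brackets only, hence transported by automorphisms. For
  \<open>k \<ge> 2\<close> it separates the components off the diagonal from those on it.\<close>

definition adnil where
  "adnil C \<longleftrightarrow> (\<forall>u\<in>C. \<forall>v\<in>carrier L. u \<otimes>\<^bsub>L\<^esub> (u \<otimes>\<^bsub>L\<^esub> (u \<otimes>\<^bsub>L\<^esub> v)) = \<zero>\<^bsub>L\<^esub>)"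

lemma L_mult_closed: "u \<in> carrier L \<Longrightarrow> v \<in> carrier L \<Longrightarrow> u \<otimes>\<^bsub>L\<^esub> v \<in> carrier L"
  by (auto simp: carrier_L cls_brk)

lemma adnil_image:
  assumes "gaut f" "C \<subseteq> carrier L" shows "adnil (f ` C) \<longleftrightarrow> adnil C"
proof -
  have "adnil (f ` C) \<longleftrightarrow> (\<forall>u\<in>C. \<forall>v\<in>f ` carrier L. f u \<otimes>\<^bsub>L\<^esub> (f u \<otimes>\<^bsub>L\<^esub> (f u \<otimes>\<^bsub>L\<^esub> v)) = \<zero>\<^bsub>L\<^esub>)"
    using gaut_bij[OF assms(1)] by (simp add: adnil_def bij_betw_def)
  also have "\<dots> \<longleftrightarrow> (\<forall>u\<in>C. \<forall>v\<in>carrier L. f (u \<otimes>\<^bsub>L\<^esub> (u \<otimes>\<^bsub>L\<^esub> (u \<otimes>\<^bsub>L\<^esub> v))) = \<zero>\<^bsub>L\<^esub>)"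
    using assms(2) by (simp add: subset_iff gaut_mult[OF assms(1)] L_mult_closed)
  also have "\<dots> \<longleftrightarrow> adnil C"
    using assms(2) by (simp add: subset_iff gaut_eq_zero[OF assms(1)] L_mult_closed adnil_def)
  finally show ?thesis .
qed

text \<open>A representative satisfies \<open>P * P = 0\<close>, which gives
  \<open>(ad P)^2 M = - 2 P M P\<close>; after one more bracket every term contains
  \<open>P * P\<close>.\<close>

lemma adnil_root:
  assumes "i < k" "j < k" "t \<in> tc" "i \<noteq> j" shows "adnil (Cmp i j t)"
  unfolding adnil_def
proof (intro ballI)
  fix u v assume u: "u \<in> Cmp i j t" and v: "v \<in> carrier L"
  obtain c where "u = cls (c \<cdot>\<^sub>m E i j t)" using u Cmp_off[OF assms] by auto
  moreover define P where "P = c \<cdot>\<^sub>m E i j t"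
  ultimately have uP: "u = cls P" by simp
  obtain M where M: "M \<in> sl" "v = cls M" using v by (auto simp: carrier_L)
  have "P \<in> sl" using assms E_sl_off by (auto simp: P_def)
  hence P: "P \<in> Mn" by simp
  have Mc: "M \<in> Mn" using M by simp
  have PP: "P * P = 0\<^sub>m n n" using assms by (simp add: P_def square_smult[of _ n] E_mult)
  define Z where "Z = P * M * P"
  have Z: "Z \<in> Mn" unfolding Z_def by (intro mult_carrier_mat[of _ n n] P Mc)
  have m: "P * M \<in> Mn" "M * P \<in> Mn" using P Mc by auto
  have d: "P * (P * M - M * P) = P * (P * M) - P * (M * P)" "(P * M - M * P) * P = P * M * P - M * P * P"
    using P m by (auto simp: mult_minus_distrib_mat[of _ n n] minus_mult_distrib_mat[of _ n n])
  have "P * (P * M) = (P * P) * M" "M * P * P = M * (P * P)" "P * (M * P) = Z"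
    using P Mc by (simp_all add: square_assoc[of _ n] Z_def)
  hence d': "P * (P * M) = 0\<^sub>m n n" "M * P * P = 0\<^sub>m n n" "P * (M * P) = Z"
    using PP left_mult_zero_mat[OF Mc] right_mult_zero_mat[OF Mc] by simp_all
  have b: "brk P (brk P M) = (-2) \<cdot>\<^sub>m Z"
    unfolding brk_def d d' Z_def[symmetric] using Z by auto
  have "P * Z = (P * P) * (M * P)" "Z * P = P * M * (P * P)" using P Mc by (simp_all add: square_assoc[of _ n] Z_def)
  hence "P * Z = 0\<^sub>m n n" "Z * P = 0\<^sub>m n n" unfolding PP
    using left_mult_zero_mat[OF m(2)] right_mult_zero_mat[OF m(1)] by simp_all
  hence "brk P ((-2) \<cdot>\<^sub>m Z) = 0\<^sub>m n n" unfolding brk_def using P Z by (simp add: square_smult[of _ n])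
  hence "brk P (brk P (brk P M)) = 0\<^sub>m n n" unfolding b .
  thus "u \<otimes>\<^bsub>L\<^esub> (u \<otimes>\<^bsub>L\<^esub> (u \<otimes>\<^bsub>L\<^esub> v)) = \<zero>\<^bsub>L\<^esub>"
    using P Mc by (simp add: uP M(2) cls_brk zero_L)
qed

text \<open>An element of diagonal degree is block diagonal with blocks that are multiples of one
  \<open>X t\<close>, so it acts on each \<open>E h m s\<close> through a single coordinate.\<close>

lemma diag_mult:
  assumes M: "M \<in> Hom i i t" and b: "t \<in> tc" "h < k" "m < k" "s \<in> tc"
  shows "M * E h m s = (co h h t M * bc t s) \<cdot>\<^sub>m E h m (t \<otimes> s)"
    "E h m s * M = (co m m t M * bc s t) \<cdot>\<^sub>m E h m (s \<otimes> t)"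
proof -
  note E = E_carrier[OF b(4), of h m]
  have "M \<in> Mn" using M by (simp add: Hom_def)
  hence "M * E h m s = (co h h t M * bc t s) \<cdot>\<^sub>m E h m (t \<otimes> s) \<and>
    E h m s * M = (co m m t M * bc s t) \<cdot>\<^sub>m E h m (s \<otimes> t)"
  proof (induct rule: co_induct)
    case zero
    show ?case using b left_mult_zero_mat[OF E] right_mult_zero_mat[OF E] by (simp add: co_zero zero_smult_mat)
  next
    case (E i' j' t' c)
    have "same i i t i' j' t'" using E M by (auto simp: Hom_def)
    hence "j' = i'" "t' = t" by (auto simp: same_def)
    thus ?case using E b E_carrier[of "t \<otimes> s" h m] E_carrier[of "s \<otimes> t" h m]
      by (auto simp: square_smult[of _ n] E_mult co_smult co_E zero_smult_mat)
  next
    case (add M1 M2)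
    have "(x + y) \<cdot>\<^sub>m P = x \<cdot>\<^sub>m P + y \<cdot>\<^sub>m (P :: 'f mat)" for x y P by (auto simp: distrib_right)
    thus ?case using add b
      by (simp add: add_mult_distrib_mat[OF add(1,2) E] mult_add_distrib_mat[OF E add(1,2)] co_add distrib_right)
  qed
  thus "M * E h m s = (co h h t M * bc t s) \<cdot>\<^sub>m E h m (t \<otimes> s)"
    "E h m s * M = (co m m t M * bc s t) \<cdot>\<^sub>m E h m (s \<otimes> t)" by auto
qed

lemma brk_diag:
  assumes "M \<in> Hom i i t" "t \<in> tc" "h < k" "m < k" "s \<in> tc"
  shows "brk M (E h m s) = (co h h t M * bc t s - co m m t M * bc s t) \<cdot>\<^sub>m E h m (t \<otimes> s)"
  unfolding brk_def diag_mult[OF assms] using assms by (auto simp: T.m_comm left_diff_distrib)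

text \<open>If \<open>h \<noteq> m\<close>, then \<open>ad M\<close> maps each
  \<open>E h m s\<close> to a multiple of \<open>E h m (t \<otimes> s)\<close>; when these factors
  never vanish, no power of \<open>ad M\<close> kills it. For \<open>t \<noteq> \<one>\<close> the
  element \<open>E 0 0 t\<close> works, for \<open>t = \<one>\<close> a noncentral \<open>M\<close>,
  two of whose diagonal coordinates must differ.\<close>

lemma not_adnil_diag:
  assumes "k \<ge> 2" "i < k" "t \<in> tc" "Cmp i i t \<noteq> {\<zero>\<^bsub>L\<^esub>}" shows "\<not> adnil (Cmp i i t)"
proof
  assume nil: "adnil (Cmp i i t)"
  have key: False if M: "M \<in> Hom i i t" "M \<in> sl" and h: "h < k" "m < k" "h \<noteq> m"
    and nz: "\<And>s. s \<in> tc \<Longrightarrow> co h h t M * bc t s - co m m t M * bc s t \<noteq> 0" for M h m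
  proof -
    have Mc: "M \<in> Mn" using M by simp
    have step: "\<exists>d. d \<noteq> 0 \<and> brk M (c \<cdot>\<^sub>m E h m s) = d \<cdot>\<^sub>m E h m (t \<otimes> s)" if "c \<noteq> 0" "s \<in> tc" for c s
      using that nz[OF that(2)] brk_diag[OF M(1) assms(3) h(1,2) that(2)] Mc
      by (intro exI[of _ "c * (co h h t M * bc t s - co m m t M * bc s t)"]) (simp add: brk_smult[of _ n])
    obtain d1 where d1: "d1 \<noteq> 0" "brk M (1 \<cdot>\<^sub>m E h m \<one>) = d1 \<cdot>\<^sub>m E h m (t \<otimes> \<one>)" using step[of 1 \<one>] by auto
    obtain d2 where d2: "d2 \<noteq> 0" "brk M (d1 \<cdot>\<^sub>m E h m (t \<otimes> \<one>)) = d2 \<cdot>\<^sub>m E h m (t \<otimes> (t \<otimes> \<one>))"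
      using step[of d1 "t \<otimes> \<one>"] d1 assms by auto
    obtain d3 where d3: "d3 \<noteq> 0" "brk M (d2 \<cdot>\<^sub>m E h m (t \<otimes> (t \<otimes> \<one>))) = d3 \<cdot>\<^sub>m E h m (t \<otimes> (t \<otimes> (t \<otimes> \<one>)))"
      using step[of d2 "t \<otimes> (t \<otimes> \<one>)"] d2 assms by auto
    have "cls M \<in> Cmp i i t" using M by (auto simp: Cmp_def)
    moreover have "cls (1 \<cdot>\<^sub>m E h m \<one>) \<in> carrier L" using E_sl_off[OF h(1,2) _ h(3)] by (intro cls_mem_L sl_smult) simp
    ultimately have "cls M \<otimes>\<^bsub>L\<^esub> (cls M \<otimes>\<^bsub>L\<^esub> (cls M \<otimes>\<^bsub>L\<^esub> cls (1 \<cdot>\<^sub>m E h m \<one>))) = \<zero>\<^bsub>L\<^esub>"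
      using nil by (simp add: adnil_def)
    also have "cls M \<otimes>\<^bsub>L\<^esub> (cls M \<otimes>\<^bsub>L\<^esub> (cls M \<otimes>\<^bsub>L\<^esub> cls (1 \<cdot>\<^sub>m E h m \<one>))) = cls (d3 \<cdot>\<^sub>m E h m (t \<otimes> (t \<otimes> (t \<otimes> \<one>))))"
      unfolding d3(2)[symmetric] d2(2)[symmetric] d1(2)[symmetric] using Mc
      by (simp only: cls_brk brk_carrier smult_carrier_mat E_carrier T.one_closed)
    finally show False using cls_E_nz[OF h(1,2), of "t \<otimes> (t \<otimes> (t \<otimes> \<one>))" d3] d3 h assms by simp
  qed
  show False
  proof (cases "t = \<one>")
    case False
    have "1 \<cdot>\<^sub>m E 0 0 t \<in> Hom i i t" using assms by (intro E_mem_Hom) (auto simp: same_def)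
    hence "E 0 0 t \<in> Hom i i t" by simp
    moreover have "E 0 0 t \<in> sl" using E_sl_diag[of 0 t] False assms by simp
    ultimately show False using key[of "E 0 0 t" 0 1] assms bc(1) by (simp add: co_E)
  next
    case True
    obtain M where M: "M \<in> Hom i i t" "M \<in> sl" "M \<notin> K" using Cmp_nonzero_element[OF assms(4)] by blast
    have Mc: "M \<in> Mn" using M by simp
    have "\<exists>h m. h < k \<and> m < k \<and> co h h t M \<noteq> co m m t M"
    proof (rule ccontr)
      assume "\<nexists>h m. h < k \<and> m < k \<and> co h h t M \<noteq> co m m t M"
      hence eq: "co h h t M = co 0 0 t M" if "h < k" for h using that k_pos by (metis le_less_trans less_one not_le zero_less_one)
      have "M = co 0 0 t M \<cdot>\<^sub>m 1\<^sub>m n"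
      proof (rule mat_eqI_co)
        fix h m s assume b: "h < k" "m < k" "s \<in> tc"
        show "co h m s M = co h m s (co 0 0 t M \<cdot>\<^sub>m 1\<^sub>m n)"
          using M(1) b eq[OF b(1)] True by (auto simp: co_smult co_one Hom_def same_def)
      qed (use Mc in auto)
      hence "M * P = P * M" if "P \<in> Mn" for P
        using that by (metis left_mult_one_mat one_carrier_mat right_mult_one_mat square_smult(1) square_smult(2))
      thus False using M K_iff by blast
    qed
    then obtain h m where "h < k" "m < k" "co h h t M \<noteq> co m m t M" by blast
    thus False using key[of M h m] M True by (auto simp: bc_one1 bc_one2)
  qed
qed

text \<open>\<open>adnil\<close> singles out the components off the diagonal, and these are lines,
  so a root element goes to a nonzero multiple of a root element.\<close>

lemma gaut_root:
  assumes "gaut f" "k \<ge> 2" "i < k" "j < k" "t \<in> tc" "i \<noteq> j"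
  obtains i' j' t' c where "i' < k" "j' < k" "t' \<in> tc" "i' \<noteq> j'" "c \<noteq> 0"
    "f ` Cmp i j t = Cmp i' j' t'" "f (cls (E i j t)) = cls (c \<cdot>\<^sub>m E i' j' t')"
proof -
  have nz: "Cmp i j t \<noteq> {\<zero>\<^bsub>L\<^esub>}" using Cmp_nz assms by simp
  obtain y where y: "y \<in> lbl" "f ` Cmp i j t = CmpL y" "CmpL y \<noteq> {\<zero>\<^bsub>L\<^esub>}"
    by (rule gaut_label[OF assms(1), of "(i, j, t)"]) (use assms nz in simp_all)
  obtain i' j' t' where yy: "y = (i', j', t')" by (cases y)
  hence b: "i' < k" "j' < k" "t' \<in> tc" using y by auto
  have "adnil (Cmp i' j' t')" using adnil_root[of i j t] adnil_image[OF assms(1) Cmp_carrier] assms y yy by (metis L_simps(3))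
  hence ne: "i' \<noteq> j'" using not_adnil_diag[OF assms(2) b(1,3)] y yy by auto
  have "1 \<cdot>\<^sub>m E i j t \<in> Hom i j t" using assms by (intro E_mem_Hom) (auto simp: same_def)
  hence "cls (E i j t) \<in> Cmp i j t" using E_sl_off assms by (auto simp: Cmp_def)
  hence "f (cls (E i j t)) \<in> Cmp i' j' t'" using y yy by auto
  then obtain c where c: "f (cls (E i j t)) = cls (c \<cdot>\<^sub>m E i' j' t')" using Cmp_off[OF b ne] by auto
  have "c \<noteq> 0"
  proof
    assume "c = 0"
    hence "c \<cdot>\<^sub>m E i' j' t' = 0\<^sub>m n n" using E_carrier[OF b(3), of i' j'] by auto
    hence "f (cls (E i j t)) = \<zero>\<^bsub>L\<^esub>" using c by (simp add: zero_L)
    hence "cls (1 \<cdot>\<^sub>m E i j t) = \<zero>\<^bsub>L\<^esub>" using gaut_eq_zero[OF assms(1) cls_mem_L[OF E_sl_off]] assms by simp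
    thus False using cls_E_nz[of i j t 1] assms by simp
  qed
  thus ?thesis using that[OF b ne _ _ c] y yy by simp
qed

lemma gaut_root_surj:
  assumes "gaut f" "k \<ge> 2" "i < k" "j < k" "t \<in> tc" "i \<noteq> j"
  obtains i' j' t' where "i' < k" "j' < k" "t' \<in> tc" "i' \<noteq> j'" "f ` Cmp i' j' t' = Cmp i j t"
proof -
  have nz: "Cmp i j t \<noteq> {\<zero>\<^bsub>L\<^esub>}" using Cmp_nz assms by simp
  obtain y where y: "y \<in> lbl" "f ` CmpL y = Cmp i j t" "CmpL y \<noteq> {\<zero>\<^bsub>L\<^esub>}"
    by (rule gaut_label_surj[OF assms(1), of "(i, j, t)"]) (use assms nz in simp_all)
  obtain i' j' t' where yy: "y = (i', j', t')" by (cases y)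
  hence b: "i' < k" "j' < k" "t' \<in> tc" using y by auto
  have "adnil (Cmp i' j' t')" using adnil_root[of i j t] adnil_image[OF assms(1) Cmp_carrier] assms y yy by (metis L_simps(3))
  hence ne: "i' \<noteq> j'" using not_adnil_diag[OF assms(2) b(1,3)] y yy by auto
  thus ?thesis using that b y yy by simp
qed

lemma brk_E:
  assumes "i < k" "j < k" "h < k" "m < k" "t \<in> tc" "s \<in> tc"
  shows "brk (E i j t) (E h m s) = (if j = h then bc t s \<cdot>\<^sub>m E i m (t \<otimes> s) else 0\<^sub>m n n) -
    (if m = i then bc s t \<cdot>\<^sub>m E h j (s \<otimes> t) else 0\<^sub>m n n)"
  unfolding brk_def using assms by (simp add: E_mult)

lemma brk_E_chain:
  assumes "i < k" "j < k" "h < k" "t \<in> tc" "s \<in> tc" "i \<noteq> h"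
  shows "brk (E i j t) (E j h s) = bc t s \<cdot>\<^sub>m E i h (t \<otimes> s)"
  using assms E_carrier[of "t \<otimes> s" i h] by (simp add: brk_E minus_as_add)

text \<open>The delicate case is that of opposite roots, where the bracket is a difference of two
  diagonal terms. It could vanish in \<open>psl\<close> only as a scalar matrix, that is with
  \<open>s = inv t\<close> and \<open>bc t s = - bc s t\<close>; then \<open>bc_inv\<close> gives
  \<open>2 * bc t s = 0\<close>.\<close>

lemma brk_root_zero_iff:
  assumes "i < k" "j < k" "h < k" "m < k" "t \<in> tc" "s \<in> tc" "i \<noteq> j" "h \<noteq> m"
  shows "cls (brk (E i j t) (E h m s)) = \<zero>\<^bsub>L\<^esub> \<longleftrightarrow> j \<noteq> h \<and> i \<noteq> m"
proof
  assume z: "cls (brk (E i j t) (E h m s)) = \<zero>\<^bsub>L\<^esub>"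
  define M where "M = brk (E i j t) (E h m s)"
  have M: "M \<in> Mn" using assms by (simp add: M_def)
  have ts: "t \<otimes> s \<in> tc" "s \<otimes> t = t \<otimes> s" using assms by (auto simp: T.m_comm)
  have coM: "co x y w M = (if j = h \<and> x = i \<and> y = m \<and> w = t \<otimes> s then bc t s else 0) -
      (if m = i \<and> x = h \<and> y = j \<and> w = t \<otimes> s then bc s t else 0)" if "x < k" "y < k" "w \<in> tc" for x y w
    unfolding M_def using assms that ts by (auto simp: brk_E co_minus co_smult co_E co_zero)
  obtain c where c: "\<And>i j t. i < k \<Longrightarrow> j < k \<Longrightarrow> t \<in> tc \<Longrightarrow>
      co i j t M = co i j t (0\<^sub>m n n) + (if i = j \<and> t = \<one> then c else 0)"
    using cls_cong_co[OF M, of "0\<^sub>m n n"] z by (auto simp: M_def zero_L)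
  show "j \<noteq> h \<and> i \<noteq> m"
  proof (rule ccontr)
    assume "\<not> (j \<noteq> h \<and> i \<noteq> m)"
    then consider "j = h" "i \<noteq> m" | "j \<noteq> h" "i = m" | "j = h" "i = m" by blast
    thus False
    proof cases
      case 1
      thus False using coM[of i m "t \<otimes> s"] c[of i m "t \<otimes> s"] assms ts bc(1)[of t s] by (auto simp: co_zero)
    next
      case 2
      thus False using coM[of h j "t \<otimes> s"] c[of h j "t \<otimes> s"] assms ts bc(1)[of s t] by (auto simp: co_zero)
    next
      case 3
      have i: "co i i (t \<otimes> s) M = bc t s" "co j j (t \<otimes> s) M = - bc s t"
        using coM[of i i "t \<otimes> s"] coM[of j j "t \<otimes> s"] 3 assms ts by auto
      show False
      proof (cases "t \<otimes> s = \<one>")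
        case True
        hence s: "s = inv t" using assms T.inv_equality ts by metis
        have "bc t s = - bc s t" using i c[of i i "t \<otimes> s"] c[of j j "t \<otimes> s"] 3 assms ts True by (simp add: co_zero)
        hence "2 * bc t s = 0" using bc_inv[of t] assms by (simp add: s)
        thus False using two_nz bc(1)[of t s] assms by simp
      next
        case False
        thus False using i c[of i i "t \<otimes> s"] 3 assms ts bc(1)[of t s] by (simp add: co_zero)
      qed
    qed
  qed
next
  assume "j \<noteq> h \<and> i \<noteq> m"
  hence "brk (E i j t) (E h m s) = 0\<^sub>m n n" using assms by (auto simp: brk_E)
  thus "cls (brk (E i j t) (E h m s)) = \<zero>\<^bsub>L\<^esub>" by (simp add: zero_L)
qed

lemma cls_E_eq:
  assumes "i < k" "j < k" "t \<in> tc" "i' < k" "j' < k" "t' \<in> tc" "i \<noteq> j \<or> t \<noteq> \<one>" "c \<noteq> 0"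
    and eq: "cls (c \<cdot>\<^sub>m E i j t) = cls (d \<cdot>\<^sub>m E i' j' t')"
  shows "i = i'" "j = j'" "t = t'" "c = d"
proof -
  have "c = (if i = i' \<and> j = j' \<and> t = t' then d else 0)"
    using cls_co_eq[OF _ _ eq assms(1-3,7)] assms by (simp add: co_smult co_E split: if_splits)
  thus "i = i'" "j = j'" "t = t'" "c = d" using assms(8) by (auto split: if_splits)
qed

end

subsection \<open>Grading automorphisms act by the expected permutations\<close>

context fine_grading begin

definition type0 where
  "type0 f \<longleftrightarrow> (\<exists>p x \<alpha>. bij_betw p {..<k} {..<k} \<and> (\<forall>i<k. x i \<in> tc) \<and> \<alpha> \<in> Aut \<and> realizes f (lab p x \<alpha> 0))"

lemma gaut_comp:
  assumes "gaut g" "gaut f" shows "gaut (compose (carrier L) g f)"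
proof -
  have img: "compose (carrier L) g f ` C = g ` f ` C" if "C \<subseteq> carrier L" for C
    using that by (auto simp: compose_def image_image intro!: image_cong)
  have sub: "C \<subseteq> carrier L" if C: "C \<in> components" for C
  proof -
    obtain x where "C = CmpL x" using C unfolding components_label by blast
    thus ?thesis by (auto simp: CmpL_eq carrier_L)
  qed
  have "(\<lambda>C. compose (carrier L) g f ` C) ` components = (\<lambda>C. g ` f ` C) ` components"
    by (rule image_cong) (use img sub in auto)
  also have "\<dots> = (\<lambda>C. g ` C) ` ((\<lambda>C. f ` C) ` components)" by (simp add: image_image)
  also have "\<dots> = components" using assms by (simp add: gaut_def)
  finally have 1: "(\<lambda>C. compose (carrier L) g f ` C) ` components = components" .
  have c: "\<And>u v. u \<in> carrier L \<Longrightarrow> v \<in> carrier L \<Longrightarrow> u \<oplus>\<^bsub>L\<^esub> v \<in> carrier L"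
    "\<And>c u. u \<in> carrier L \<Longrightarrow> c \<odot>\<^bsub>L\<^esub> u \<in> carrier L"
    by (auto simp: carrier_L cls_add cls_smult)
  have "compose (carrier L) g f \<in> Bij (carrier L)"
    using assms by (intro compose_Bij) (auto simp: gaut_def alg_automorphisms_def)
  hence 2: "compose (carrier L) g f \<in> alg_automorphisms L"
    using assms gaut_closed[OF assms(2)]
    by (auto simp: alg_automorphisms_def gaut_def compose_def c L_mult_closed)
  show ?thesis using 1 2 by (simp add: gaut_def)
qed

lemma realizes_comp:
  assumes "realizes g m" "realizes f m'" "\<And>x. x \<in> lbl \<Longrightarrow> m' x \<in> lbl"
  shows "realizes (compose (carrier L) g f) (m \<circ> m')"
  unfolding realizes_def
proof
  fix x assume x: "x \<in> lbl"
  have "compose (carrier L) g f ` CmpL x = g ` f ` CmpL x"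
    by (auto simp: compose_def image_image CmpL_eq carrier_L intro!: image_cong)
  thus "compose (carrier L) g f ` CmpL x = CmpL ((m \<circ> m') x)"
    using assms x by (simp add: realizes_def)
qed

lemma realizes_cong: "realizes f m \<Longrightarrow> (\<And>x. x \<in> lbl \<Longrightarrow> m x = m' x) \<Longrightarrow> realizes f m'"
  by (simp add: realizes_def)

lemma CmpL_image_inj:
  assumes "gaut g" "C \<subseteq> carrier L" "D \<subseteq> carrier L" "g ` C = g ` D" shows "C = D"
  using gaut_bij[OF assms(1)] assms inj_on_image_eq_iff by (metis bij_betw_def)

lemma lab0_mem:
  assumes "\<And>i. i < k \<Longrightarrow> p i < k" "\<And>i. i < k \<Longrightarrow> x i \<in> tc" "\<alpha> \<in> Aut" "z \<in> lbl"
  shows "lab p x \<alpha> 0 z \<in> lbl"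
  using assms AutD(3)[OF assms(3)] by (cases z) (simp add: lab_def)

abbreviation idT where "idT \<equiv> (\<lambda>t\<in>tc. t)"

lemma T_cancel:
  assumes "u \<in> tc" "v \<in> tc"
  shows "inv u \<otimes> (u \<otimes> v) = v" "u \<otimes> (inv u \<otimes> v) = v"
  using assms by (simp_all add: T.m_assoc[symmetric])

lemma T_conj:
  assumes "u \<in> tc" "v \<in> tc" "y \<in> tc" "y' \<in> tc" "s \<in> tc"
  shows "u \<otimes> (inv u \<otimes> y \<otimes> s \<otimes> inv (inv v \<otimes> y')) \<otimes> inv v = y \<otimes> s \<otimes> inv y'"
proof -
  have "inv (inv v \<otimes> y') = inv y' \<otimes> v" using assms by (simp add: T.inv_mult_group)
  hence "inv u \<otimes> y \<otimes> s \<otimes> inv (inv v \<otimes> y') = inv u \<otimes> (y \<otimes> s \<otimes> inv y' \<otimes> v)"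
    using assms by (simp add: T.m_assoc)
  hence "u \<otimes> (inv u \<otimes> y \<otimes> s \<otimes> inv (inv v \<otimes> y')) \<otimes> inv v = y \<otimes> s \<otimes> inv y' \<otimes> v \<otimes> inv v"
    using assms by (simp add: T_cancel)
  also have "\<dots> = y \<otimes> s \<otimes> inv y'" using assms by (simp add: T.m_assoc)
  finally show ?thesis .
qed

text \<open>Composition with a known \<open>g\<close> can be undone: the data for \<open>f\<close>
  are solved from those of the composite, and injectivity of \<open>g\<close> transfers the equality
  of images.\<close>

lemma denormalise:
  assumes g: "gaut g" "realizes g (lab q w idT 0)" and q: "bij_betw q {..<k} {..<k}" and w: "\<And>i. i < k \<Longrightarrow> w i \<in> tc"
    and t0: "type0 (compose (carrier L) g f)" and f: "gaut f"
  shows "type0 f"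
proof -
  obtain p x \<alpha> where p: "bij_betw p {..<k} {..<k}" and x: "\<And>i. i < k \<Longrightarrow> x i \<in> tc" and \<alpha>: "\<alpha> \<in> Aut"
    and r: "realizes (compose (carrier L) g f) (lab p x \<alpha> 0)"
    using t0 by (auto simp: type0_def)
  define q' where "q' = inv_into {..<k} q"
  have q': "bij_betw q' {..<k} {..<k}" unfolding q'_def by (rule bij_betw_inv_into[OF q])
  have qq: "q (q' i) = i" "q' i < k" "q i < k" "p i < k" if "i < k" for i
    using that q q' p bij_betwE by (auto simp: q'_def bij_betw_def f_inv_into_f)
  define p1 where "p1 = q' \<circ> p"
  \<comment> \<open>Solves \<open>w (q m) \<otimes> x1 m = x (q m)\<close>, which accounts for the
    diagonal part of \<open>g\<close>.\<close>
  define x1 where "x1 m = inv (w (q m)) \<otimes> x (q m)" for m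
  have p1: "bij_betw p1 {..<k} {..<k}" unfolding p1_def using p q' by (rule bij_betw_trans)
  have x1: "x1 i \<in> tc" if "i < k" for i using that qq x w by (simp add: x1_def)
  have p1k: "p1 i < k" "q (p1 i) = p i" if "i < k" for i using that qq by (auto simp: p1_def)
  have "realizes f (lab p1 x1 \<alpha> 0)"
    unfolding realizes_def
  proof
    fix z assume z: "z \<in> lbl"
    obtain i j t where zz: "z = (i, j, t)" by (cases z)
    have b: "i < k" "j < k" "t \<in> tc" using z zz by auto
    note m = w[OF qq(4)[OF b(1)]] w[OF qq(4)[OF b(2)]] x[OF qq(4)[OF b(1)]] x[OF qq(4)[OF b(2)]] AutD(3)[OF \<alpha> b(3)]
    have mem: "lab p1 x1 \<alpha> 0 z \<in> lbl" by (rule lab0_mem) (use p1k x1 \<alpha> z in auto)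
    have "w (p i) \<otimes> (inv (w (p i)) \<otimes> x (p i) \<otimes> \<alpha> t \<otimes> inv (inv (w (p j)) \<otimes> x (p j))) \<otimes> inv (w (p j)) =
        x (p i) \<otimes> \<alpha> t \<otimes> inv (x (p j))"
      by (rule T_conj[OF m(1,2,3,4,5)])
    hence "lab q w idT 0 (lab p1 x1 \<alpha> 0 z) = lab p x \<alpha> 0 z"
      using mem b p1k zz by (simp add: lab_def x1_def)
    hence "g ` CmpL (lab p1 x1 \<alpha> 0 z) = CmpL (lab p x \<alpha> 0 z)" using g(2) mem by (simp add: realizes_def)
    also have "\<dots> = compose (carrier L) g f ` CmpL z" using r z by (simp add: realizes_def)
    also have "\<dots> = g ` f ` CmpL z"
      by (auto simp: compose_def image_image CmpL_eq carrier_L intro!: image_cong)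
    finally have eq: "g ` CmpL (lab p1 x1 \<alpha> 0 z) = g ` f ` CmpL z" .
    have sub: "CmpL y \<subseteq> carrier L" for y by (auto simp: CmpL_eq carrier_L)
    have "f ` CmpL z \<subseteq> carrier L" using gaut_closed[OF f] sub by blast
    thus "f ` CmpL z = CmpL (lab p1 x1 \<alpha> 0 z)"
      using CmpL_image_inj[OF g(1) _ sub eq[symmetric]] by blast
  qed
  thus ?thesis unfolding type0_def using p1 x1 \<alpha> by blast
qed

lemma gaut_moves: assumes "moves \<phi> m" shows "gaut (induced \<phi>)" "realizes (induced \<phi>) m"
proof -
  show r: "realizes (induced \<phi>) m" using assms by (rule moves_realizes)
  show "gaut (induced \<phi>)" using assms
    by (intro gaut_of_realizes[OF induced_automorphism r]) (auto simp: moves_def)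
qed

lemma lab_gaut:
  assumes "bij_betw p {..<k} {..<k}" "\<And>i. i < k \<Longrightarrow> x i \<in> tc" "\<alpha> \<in> Aut"
  obtains g where "gaut g" "realizes g (lab p x \<alpha> \<epsilon>)"
proof -
  obtain \<phi> where "moves \<phi> (lab p x \<alpha> \<epsilon>)" by (rule lab_moves[OF assms])
  thus ?thesis using that gaut_moves by blast
qed

lemma gaut_root_elt:
  assumes "gaut f" "k \<ge> 2" "i < k" "j < k" "t \<in> tc" "i \<noteq> j" "i' < k" "j' < k" "t' \<in> tc" "i' \<noteq> j'"
    "f ` Cmp i j t = Cmp i' j' t'"
  shows "\<exists>c. c \<noteq> 0 \<and> f (cls (E i j t)) = cls (c \<cdot>\<^sub>m E i' j' t')"
proof -
  obtain i1 j1 t1 c where *: "i1 < k" "j1 < k" "t1 \<in> tc" "i1 \<noteq> j1" "c \<noteq> 0"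
    "f ` Cmp i j t = Cmp i1 j1 t1" "f (cls (E i j t)) = cls (c \<cdot>\<^sub>m E i1 j1 t1)"
    using gaut_root[OF assms(1-6)] by blast
  have "same i1 j1 t1 i' j' t'" using * assms Cmp_nz[of i1 j1 t1] by (intro Cmp_inject) auto
  hence "i1 = i'" "j1 = j'" "t1 = t'" using * by (auto simp: same_def)
  thus ?thesis using * by blast
qed

lemma brk_opposite_mem:
  assumes "i < k" "j < k" "t \<in> tc" "s \<in> tc"
  shows "brk (E i j t) (E j i s) \<in> Hom i i (t \<otimes> s) \<inter> sl"
proof -
  have ts: "s \<otimes> t = t \<otimes> s" "t \<otimes> s \<in> tc" using assms by (auto simp: T.m_comm)
  have "co h m w (brk (E i j t) (E j i s)) = 0"
    if "h < k" "m < k" "w \<in> tc" "\<not> same i i (t \<otimes> s) h m w" for h m w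
    using that assms ts by (auto simp: brk_E co_minus co_smult co_E same_def)
  thus ?thesis using assms by (auto simp: Hom_def)
qed

lemma brk_smult2:
  assumes "P \<in> Mn" "Q \<in> Mn" shows "brk (c \<cdot>\<^sub>m P) (d \<cdot>\<^sub>m Q) = (c * d) \<cdot>\<^sub>m brk P Q"
  using assms by (simp add: brk_smult[of _ n] mult.commute)

text \<open>The bracket of opposite root elements is a nonzero element of the diagonal component.
  Its image is a multiple of such a bracket again, and components sharing a nonzero element
  coincide.\<close>

lemma gaut_diag_component:
  assumes f: "gaut f" and k: "k \<ge> 2" and b: "i < k" "j < k" "t \<in> tc" "s \<in> tc" "i \<noteq> j"
    and b': "i' < k" "j' < k" "t' \<in> tc" "s' \<in> tc" "i' \<noteq> j'"
    and img: "f ` Cmp i j t = Cmp i' j' t'" "f ` Cmp j i s = Cmp j' i' s'"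
  shows "f ` Cmp i i (t \<otimes> s) = Cmp i' i' (t' \<otimes> s')"
proof -
  obtain c where c: "c \<noteq> 0" "f (cls (E i j t)) = cls (c \<cdot>\<^sub>m E i' j' t')"
    using gaut_root_elt[OF f k b(1-3) b(5) b'(1-3) b'(5) img(1)] by blast
  obtain d where d: "d \<noteq> 0" "f (cls (E j i s)) = cls (d \<cdot>\<^sub>m E j' i' s')"
    using gaut_root_elt[OF f k b(2,1,4) b(5)[symmetric] b'(2,1,4) b'(5)[symmetric] img(2)] by blast
  define u where "u = cls (brk (E i j t) (E j i s))"
  have u: "u \<in> Cmp i i (t \<otimes> s)" using brk_opposite_mem b by (auto simp: u_def Cmp_def)
  have uL: "u \<in> carrier L" using u Cmp_carrier by blast
  have unz: "u \<noteq> \<zero>\<^bsub>L\<^esub>" using brk_root_zero_iff[of i j j i t s] b by (auto simp: u_def)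
  have "f u = cls ((c * d) \<cdot>\<^sub>m brk (E i' j' t') (E j' i' s'))"
    unfolding u_def using gaut_brk[OF f _ _ _ _ c(2) d(2)] E_sl_off b b' by (simp add: brk_smult2)
  moreover have "(c * d) \<cdot>\<^sub>m brk (E i' j' t') (E j' i' s') \<in> Hom i' i' (t' \<otimes> s') \<inter> sl"
    using brk_opposite_mem[of i' j' t' s'] b' by (auto simp: Hom_def co_smult)
  ultimately have fu: "f u \<in> Cmp i' i' (t' \<otimes> s')" by (auto simp: Cmp_def)
  have "Cmp i i (t \<otimes> s) \<noteq> {\<zero>\<^bsub>L\<^esub>}" using u unz by blast
  then obtain y where y: "y \<in> lbl" "f ` Cmp i i (t \<otimes> s) = CmpL y"
    by (rule gaut_label[OF f, of "(i, i, t \<otimes> s)", unfolded L_simps, rotated]) (use b in auto)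
  obtain h m w where yy: "y = (h, m, w)" by (cases y)
  have "same h m w i' i' (t' \<otimes> s')"
    using Cmp_disjoint[of h m w i' i' "t' \<otimes> s'" "f u"] y yy u fu b' unz gaut_eq_zero[OF f uL] by auto
  thus ?thesis using Cmp_same y yy by simp
qed

text \<open>Diagonal components are met by brackets of opposite roots, so the images of root
  components determine theirs. An auxiliary index \<open>h \<noteq> i\<close> is used, with degree
  \<open>\<one>\<close> on the way back.\<close>

lemma realizes_from_roots:
  assumes f: "gaut f" and k: "k \<ge> 2" and p: "bij_betw p {..<k} {..<k}" and x: "\<And>i. i < k \<Longrightarrow> x i \<in> tc" and \<alpha>: "\<alpha> \<in> Aut"
    and roots: "\<And>i j t. i < k \<Longrightarrow> j < k \<Longrightarrow> t \<in> tc \<Longrightarrow> i \<noteq> j \<Longrightarrow>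
      f ` Cmp i j t = Cmp (p i) (p j) (x (p i) \<otimes> \<alpha> t \<otimes> inv (x (p j)))"
  shows "realizes f (lab p x \<alpha> 0)"
  unfolding realizes_def
proof
  fix z assume "z \<in> lbl"
  then obtain i j t where z: "z = (i, j, t)" "i < k" "j < k" "t \<in> tc" by (cases z) auto
  have pk: "p i < k" "p i = p j \<longleftrightarrow> i = j" if "i < k" "j < k" for i j
    using p that by (auto simp: bij_betw_def inj_on_def)
  show "f ` CmpL z = CmpL (lab p x \<alpha> 0 z)"
  proof (cases "i = j")
    case False thus ?thesis using roots z by (simp add: lab_def)
  next
    case True
    obtain h where h: "h < k" "h \<noteq> i"
    proof -
      have "0 < k" "1 < k" using k by auto
      thus ?thesis using that[of 0] that[of 1] by (cases "i = 0") auto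
    qed
    note m = x[OF pk(1)[OF z(2,2)]] x[OF pk(1)[OF h(1,1)]] AutD(3)[OF \<alpha> z(4)]
    have eq: "f ` Cmp i i (t \<otimes> \<one>) = Cmp (p i) (p i) ((x (p i) \<otimes> \<alpha> t \<otimes> inv (x (p h))) \<otimes> (x (p h) \<otimes> \<alpha> \<one> \<otimes> inv (x (p i))))"
      by (rule gaut_diag_component[OF f k z(2) h(1)]) (use z h pk roots m AutD(6)[OF \<alpha>] in auto)
    have "(x (p i) \<otimes> \<alpha> t \<otimes> inv (x (p h))) \<otimes> (x (p h) \<otimes> \<alpha> \<one> \<otimes> inv (x (p i))) = x (p i) \<otimes> \<alpha> t \<otimes> inv (x (p i))"
      using m AutD(6)[OF \<alpha>] by (simp add: T.m_assoc T_cancel)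
    thus ?thesis using eq z True by (simp add: lab_def)
  qed
qed

text \<open>Injectivity follows from preservation of a nondegenerate form, surjectivity from
  finiteness.\<close>

lemma AutI:
  assumes cl: "\<And>t. t \<in> tc \<Longrightarrow> \<alpha> t \<in> tc" and hom: "\<And>s t. s \<in> tc \<Longrightarrow> t \<in> tc \<Longrightarrow> \<alpha> (s \<otimes> t) = \<alpha> s \<otimes> \<alpha> t"
    and pres: "\<And>s t. s \<in> tc \<Longrightarrow> t \<in> tc \<Longrightarrow> \<beta> (\<alpha> s) (\<alpha> t) = \<beta> s t"
  shows "restrict \<alpha> tc \<in> Aut"
proof -
  have inj: "inj_on \<alpha> tc"
  proof (rule inj_onI)
    fix s t assume "s \<in> tc" "t \<in> tc" "\<alpha> s = \<alpha> t"
    thus "s = t" using pres by (intro beta_determines) metis+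
  qed
  hence "bij_betw \<alpha> tc tc" using cl finite_T endo_inj_surj[of tc \<alpha>] by (auto simp: bij_betw_def)
  hence "restrict \<alpha> tc \<in> Bij tc" by (simp add: Bij_def cong: bij_betw_cong)
  moreover have "restrict \<alpha> tc \<in> hom T T" using cl hom by (auto simp: hom_def)
  ultimately show ?thesis using pres cl by (simp add: Aut_iff auto_def)
qed

text \<open>For three distinct indices one of the two products in the bracket is zero. Hence
  \<open>f\<close> is compatible with products, including the scalars \<open>bc\<close>, and not
  merely with commutators.\<close>

lemma gaut_chain:
  assumes f: "gaut f" and b: "i < k" "j < k" "h < k" "t \<in> tc" "s \<in> tc" "i \<noteq> j" "j \<noteq> h" "i \<noteq> h"
    and b': "i' < k" "j' < k" "h' < k" "t' \<in> tc" "s' \<in> tc" "w' \<in> tc" "i' \<noteq> j'" "j' \<noteq> h'" "i' \<noteq> h'"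
    and img: "f (cls (E i j t)) = cls (c \<cdot>\<^sub>m E i' j' t')" "f (cls (E j h s)) = cls (d \<cdot>\<^sub>m E j' h' s')"
      "f (cls (E i h (t \<otimes> s))) = cls (e \<cdot>\<^sub>m E i' h' w')" and nz: "c \<noteq> 0" "d \<noteq> 0" "e \<noteq> 0"
  shows "w' = t' \<otimes> s'" "bc t s * e = c * d * bc t' s'"
proof -
  have "f (cls (brk (E i j t) (E j h s))) = cls (brk (c \<cdot>\<^sub>m E i' j' t') (d \<cdot>\<^sub>m E j' h' s'))"
    using E_sl_off b b' by (intro gaut_brk[OF f _ _ _ _ img(1,2)]) auto
  also have "brk (c \<cdot>\<^sub>m E i' j' t') (d \<cdot>\<^sub>m E j' h' s') = (c * d * bc t' s') \<cdot>\<^sub>m E i' h' (t' \<otimes> s')"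
    using b' by (simp add: brk_smult2 brk_E_chain)
  also have "brk (E i j t) (E j h s) = bc t s \<cdot>\<^sub>m E i h (t \<otimes> s)" using b by (simp add: brk_E_chain)
  also have "f (cls (bc t s \<cdot>\<^sub>m E i h (t \<otimes> s))) = cls (bc t s \<cdot>\<^sub>m (e \<cdot>\<^sub>m E i' h' w'))"
    by (rule gaut_smult[OF f _ _ img(3)]) (use E_sl_off b b' in auto)
  finally have "cls ((bc t s * e) \<cdot>\<^sub>m E i' h' w') = cls ((c * d * bc t' s') \<cdot>\<^sub>m E i' h' (t' \<otimes> s'))" by simp
  from cls_E_eq[OF _ _ _ _ _ _ _ _ this] show "w' = t' \<otimes> s'" "bc t s * e = c * d * bc t' s'"
    using b b' nz bc(1)[of t s] by simp_all
qed

text \<open>Normalising by a diagonal automorphism means that \<open>E 0 j \<one>\<close> is mapped to a multiple of itself.\<close>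

lemma gaut_normalised_large:
  assumes f: "gaut f" and k: "k \<ge> 3"
    and Y: "\<And>i j t. i < k \<Longrightarrow> j < k \<Longrightarrow> t \<in> tc \<Longrightarrow> i \<noteq> j \<Longrightarrow> Y i j t \<in> tc \<and> f ` Cmp i j t = Cmp i j (Y i j t)"
    and norm: "\<And>j. j < k \<Longrightarrow> j \<noteq> 0 \<Longrightarrow> Y 0 j \<one> = \<one>"
  shows "type0 f"
proof -
  have k2: "k \<ge> 2" using k by simp
  have "\<exists>c. c \<noteq> 0 \<and> f (cls (E i j t)) = cls (c \<cdot>\<^sub>m E i j (Y i j t))"
    if "i < k" "j < k" "t \<in> tc" "i \<noteq> j" for i j t
    using gaut_root_elt[OF f k2 that that(1,2) _ that(4)] Y[OF that] by blast
  then obtain c where c: "\<And>i j t. i < k \<Longrightarrow> j < k \<Longrightarrow> t \<in> tc \<Longrightarrow> i \<noteq> j \<Longrightarrow> c i j t \<noteq> 0"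
    "\<And>i j t. i < k \<Longrightarrow> j < k \<Longrightarrow> t \<in> tc \<Longrightarrow> i \<noteq> j \<Longrightarrow> f (cls (E i j t)) = cls (c i j t \<cdot>\<^sub>m E i j (Y i j t))"
    by metis
  have ch: "Y i h (t \<otimes> s) = Y i j t \<otimes> Y j h s \<and> bc t s * c i h (t \<otimes> s) = c i j t * c j h s * bc (Y i j t) (Y j h s)"
    if "i < k" "j < k" "h < k" "t \<in> tc" "s \<in> tc" "i \<noteq> j" "j \<noteq> h" "i \<noteq> h" for i j h t s
    using gaut_chain[OF f that that(1-3) _ _ _ that(6-8) c(2) c(2) c(2)] Y c(1) that by simp
  note chY = ch[THEN conjunct1] and chc = ch[THEN conjunct2]
  define \<alpha> where "\<alpha> = Y 0 1"
  have \<alpha>c: "\<alpha> t \<in> tc" if "t \<in> tc" for t using Y[of 0 1 t] that k by (simp add: \<alpha>_def)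
  \<comment> \<open>The normalised element \<open>E 0 j \<one>\<close> contributes nothing to the
    degree, so prefixing it moves the first index to 0.\<close>
  have jh: "Y j h t = Y 0 h t" if "j < k" "h < k" "t \<in> tc" "j \<noteq> 0" "h \<noteq> 0" "j \<noteq> h" for j h t
    using chY[of 0 j h \<one> t] that norm Y by simp
  have 0: "Y 0 h t = \<alpha> t" if "h < k" "h \<noteq> 0" "t \<in> tc" for h t
  proof (cases "h = 1")
    case False
    have "Y 1 h \<one> = \<one>" using jh[of 1 h \<one>] norm[of h] that False k by simp
    thus ?thesis using chY[of 0 1 h t \<one>] that False k \<alpha>c by (simp add: \<alpha>_def)
  qed (simp add: \<alpha>_def)
  have hom: "\<alpha> (t \<otimes> s) = \<alpha> t \<otimes> \<alpha> s" if "t \<in> tc" "s \<in> tc" for t s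
    using chY[of 0 1 2 t s] 0[of 1 t] 0[of 2 "t \<otimes> s"] jh[of 1 2 s] 0[of 2 s] that k by simp
  have \<alpha>1: "\<alpha> \<one> = \<one>" using norm[of 1] k by (simp add: \<alpha>_def)
  \<comment> \<open>Column 0 is reached by appending the normalised \<open>E 0 h \<one>\<close> with
    a third index \<open>h\<close>.\<close>
  have j0: "Y j 0 t = \<alpha> t" if "j < k" "j \<noteq> 0" "t \<in> tc" for j t
  proof -
    have "\<exists>h<k. h \<noteq> 0 \<and> h \<noteq> j"
      by (rule exI[of _ "if j = 1 then 2 else 1"]) (use k in auto)
    then obtain h where h: "h < k" "h \<noteq> 0" "h \<noteq> j" by blast
    have "Y j h (t \<otimes> \<one>) = Y j 0 t \<otimes> Y 0 h \<one>" by (rule chY) (use h that k in auto)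
    moreover have "Y j h t = \<alpha> t" using jh[of j h t] 0[of h t] h that by simp
    ultimately show ?thesis using norm[OF h(1,2)] that Y[of j 0 t] k by simp
  qed
  have Yall: "Y i j t = \<alpha> t" if "i < k" "j < k" "t \<in> tc" "i \<noteq> j" for i j t
    using that j0 0 jh[of i j t] by (cases "i = 0"; cases "j = 0") auto
  \<comment> \<open>The scalars at the positions \<open>(0, 1)\<close> and \<open>(1, 2)\<close> are
    tied together by \<open>r1\<close>, which makes their product symmetric in \<open>t\<close> and
    \<open>s\<close>. Comparing \<open>r\<close> for both orders then leaves only the ratios of
    \<open>bc\<close>, that is \<beta>.\<close>
  have pres: "\<beta> (\<alpha> t) (\<alpha> s) = \<beta> t s" if t: "t \<in> tc" "s \<in> tc" for t s
  proof -
    have r: "bc t s * c 0 2 (t \<otimes> s) = c 0 1 t * c 1 2 s * bc (\<alpha> t) (\<alpha> s)" if "t \<in> tc" "s \<in> tc" for t s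
      using chc[of 0 1 2 t s] Yall that k by simp
    have r1: "c 0 2 t = c 0 1 t * c 1 2 \<one>" "c 0 2 t = c 0 1 \<one> * c 1 2 t" if "t \<in> tc" for t
      using r[of t \<one>] r[of \<one> t] that \<alpha>1 \<alpha>c by (simp_all add: bc_one1 bc_one2)
    have nz: "c 0 1 \<one> \<noteq> 0" "c 1 2 \<one> \<noteq> 0" "c 0 1 t \<noteq> 0" "c 1 2 s \<noteq> 0" "c 0 2 (t \<otimes> s) \<noteq> 0" "bc t s \<noteq> 0" "bc s t \<noteq> 0"
        "bc (\<alpha> t) (\<alpha> s) \<noteq> 0" "bc (\<alpha> s) (\<alpha> t) \<noteq> 0"
      using c(1) t k bc(1) \<alpha>c by simp_all
    have "c 0 1 t * c 1 2 s * (c 0 1 \<one> * c 1 2 \<one>) = c 0 2 t * c 0 2 s"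
      using r1(1)[OF t(1)] r1(2)[OF t(2)] by simp
    also have "\<dots> = c 0 1 s * c 1 2 t * (c 0 1 \<one> * c 1 2 \<one>)"
      using r1(2)[OF t(1)] r1(1)[OF t(2)] by simp
    finally have e: "c 0 1 t * c 1 2 s = c 0 1 s * c 1 2 t" using nz by simp
    have "\<beta> t s * bc s t * c 0 2 (t \<otimes> s) = c 0 1 t * c 1 2 s * (\<beta> (\<alpha> t) (\<alpha> s) * bc (\<alpha> s) (\<alpha> t))"
      using r[OF t] bc_swap[OF t] bc_swap[OF \<alpha>c[OF t(1)] \<alpha>c[OF t(2)]] by simp
    also have "\<dots> = \<beta> (\<alpha> t) (\<alpha> s) * (bc s t * c 0 2 (s \<otimes> t))" unfolding r[OF t(2,1)] e by simp
    finally have "(\<beta> (\<alpha> t) (\<alpha> s) - \<beta> t s) * (bc s t * c 0 2 (t \<otimes> s)) = 0"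
      using t by (auto simp: T.m_comm[of s t] left_diff_distrib mult.assoc)
    thus ?thesis using nz by simp
  qed
  have A: "restrict \<alpha> tc \<in> Aut" by (rule AutI) (use \<alpha>c hom pres in auto)
  have "realizes f (lab id (\<lambda>_. \<one>) (restrict \<alpha> tc) 0)"
  proof (rule realizes_from_roots[OF f k2 _ _ A])
    fix i j t assume "i < k" "j < k" "t \<in> tc" "i \<noteq> j"
    thus "f ` Cmp i j t = Cmp (id i) (id j) (\<one> \<otimes> restrict \<alpha> tc t \<otimes> inv \<one>)"
      using Y[of i j t] Yall[of i j t] \<alpha>c by simp
  qed auto
  thus ?thesis unfolding type0_def using A by (intro exI[of _ id] exI[of _ "\<lambda>_. \<one>"] exI[of _ "restrict \<alpha> tc"]) auto
qed

text \<open>Compose with a monomial automorphism whose permutation undoes \<open>p\<close> and whose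
  diagonal part removes the degrees of the images of \<open>E 0 j \<one>\<close>.\<close>

lemma normalise:
  assumes f: "gaut f" and p: "bij_betw p {..<k} {..<k}"
    and Y: "\<And>i j t. i < k \<Longrightarrow> j < k \<Longrightarrow> t \<in> tc \<Longrightarrow> i \<noteq> j \<Longrightarrow> Y i j t \<in> tc \<and> f ` Cmp i j t = Cmp (p i) (p j) (Y i j t)"
  obtains g q w Y' where "gaut g" "realizes g (lab q w idT 0)" "bij_betw q {..<k} {..<k}" "\<And>i. i < k \<Longrightarrow> w i \<in> tc"
    "gaut (compose (carrier L) g f)"
    "\<And>i j t. i < k \<Longrightarrow> j < k \<Longrightarrow> t \<in> tc \<Longrightarrow> i \<noteq> j \<Longrightarrow> Y' i j t \<in> tc \<and> compose (carrier L) g f ` Cmp i j t = Cmp i j (Y' i j t)"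
    "\<And>j. j < k \<Longrightarrow> j \<noteq> 0 \<Longrightarrow> Y' 0 j \<one> = \<one>"
proof -
  define q where "q = inv_into {..<k} p"
  have q: "bij_betw q {..<k} {..<k}" unfolding q_def by (rule bij_betw_inv_into[OF p])
  have qp: "q (p i) = i" "p i < k" if "i < k" for i using that p by (auto simp: q_def bij_betw_def)
  \<comment> \<open>Degrees become \<open>w i \<otimes> Y i j t \<otimes> inv (w j)\<close>, which
    dictates these values.\<close>
  define w where "w j = (if j = 0 then \<one> else Y 0 j \<one>)" for j
  have w: "w j \<in> tc" if "j < k" for j using Y[of 0 j \<one>] that k_pos by (auto simp: w_def)
  obtain g where g: "gaut g" "realizes g (lab q w idT 0)" using lab_gaut[OF q _ id_Aut, of w 0] w by blast
  define Y' where "Y' i j t = w i \<otimes> Y i j t \<otimes> inv (w j)" for i j t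
  have Y': "Y' i j t \<in> tc \<and> compose (carrier L) g f ` Cmp i j t = Cmp i j (Y' i j t)"
    if b: "i < k" "j < k" "t \<in> tc" "i \<noteq> j" for i j t
  proof -
    have "compose (carrier L) g f ` Cmp i j t = g ` f ` Cmp i j t"
      using Cmp_carrier[of i j t] by (auto simp: compose_def image_image intro!: image_cong)
    also have "\<dots> = g ` CmpL (p i, p j, Y i j t)" using Y b by simp
    also have "\<dots> = CmpL (lab q w idT 0 (p i, p j, Y i j t))" using bspec[OF g(2)[unfolded realizes_def], of "(p i, p j, Y i j t)"] Y b qp by simp
    also have "\<dots> = Cmp i j (Y' i j t)" using Y b qp by (simp add: lab_def Y'_def)
    finally show ?thesis using Y b w by (simp add: Y'_def)
  qed
  have "Y' 0 j \<one> = \<one>" if "j < k" "j \<noteq> 0" for j using Y[of 0 j \<one>] that w[of j] by (simp add: Y'_def w_def)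
  thus ?thesis using that[OF g q _ gaut_comp[OF g(1) f], of Y'] w Y' by blast
qed

text \<open>
  For \<open>k \<ge> 3\<close>, two root components commute with the same root components exactly if they belong
  to the same pair of indices, so \<open>f\<close> induces a permutation of the pairs. It is induced by a
  permutation of the indices up to swapping the two entries of all pairs.
\<close>

lemma gaut_pairs:
  assumes f: "gaut f" and k: "k \<ge> 3"
  obtains p where "bij_betw p {..<k} {..<k}"
    "(\<forall>i<k. \<forall>j<k. \<forall>t\<in>tc. i \<noteq> j \<longrightarrow> (\<exists>t'\<in>tc. f ` Cmp i j t = Cmp (p i) (p j) t')) \<or>
     (\<forall>i<k. \<forall>j<k. \<forall>t\<in>tc. i \<noteq> j \<longrightarrow> (\<exists>t'\<in>tc. f ` Cmp i j t = Cmp (p j) (p i) t'))"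
proof -
  have k2: "k \<ge> 2" using k by simp
  define R where "R i j \<longleftrightarrow> i < k \<and> j < k \<and> i \<noteq> j" for i j
  have "\<exists>i' j' t' c. R i' j' \<and> t' \<in> tc \<and> c \<noteq> 0 \<and> f ` Cmp i j t = Cmp i' j' t' \<and> f (cls (E i j t)) = cls (c \<cdot>\<^sub>m E i' j' t')"
    if ij: "R i j" and t: "t \<in> tc" for i j t
  proof -
    obtain i' j' t' c where "i' < k" "j' < k" "t' \<in> tc" "i' \<noteq> j'" "c \<noteq> 0"
      "f ` Cmp i j t = Cmp i' j' t'" "f (cls (E i j t)) = cls (c \<cdot>\<^sub>m E i' j' t')"
      by (rule gaut_root[OF f k2, of i j t]) (use ij t in \<open>simp_all add: R_def\<close>)
    thus ?thesis unfolding R_def by blast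
  qed
  then obtain P Q Y c where F: "\<And>i j t. R i j \<Longrightarrow> t \<in> tc \<Longrightarrow> R (P i j t) (Q i j t) \<and> Y i j t \<in> tc \<and> c i j t \<noteq> 0 \<and>
      f ` Cmp i j t = Cmp (P i j t) (Q i j t) (Y i j t) \<and> f (cls (E i j t)) = cls (c i j t \<cdot>\<^sub>m E (P i j t) (Q i j t) (Y i j t))"
    by metis
  \<comment> \<open>By \<open>brk_root_zero_iff\<close> the vanishing of a bracket of root elements
    depends on the index pairs alone, and \<open>f\<close> preserves it.\<close>
  have com: "(j = h \<or> i = m) \<longleftrightarrow> (Q i j t = P h m s \<or> P i j t = Q h m s)"
    if "R i j" "R h m" "t \<in> tc" "s \<in> tc" for i j h m t s
  proof -
    note F1 = F[OF that(1,3)] and F2 = F[OF that(2,4)]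
    have c0: "cls (brk (E i j t) (E h m s)) \<in> carrier L" using that by (intro cls_mem_L sl_brk E_carrier)
    have "f (cls (brk (E i j t) (E h m s))) =
        cls (brk (c i j t \<cdot>\<^sub>m E (P i j t) (Q i j t) (Y i j t)) (c h m s \<cdot>\<^sub>m E (P h m s) (Q h m s) (Y h m s)))"
      using that F1 F2 E_sl_off by (intro gaut_brk[OF f]) (auto simp: R_def)
    also have "\<dots> = cls ((c i j t * c h m s) \<cdot>\<^sub>m brk (E (P i j t) (Q i j t) (Y i j t)) (E (P h m s) (Q h m s) (Y h m s)))"
      using F1 F2 by (simp add: brk_smult2)
    finally have eq: "f (cls (brk (E i j t) (E h m s))) = (c i j t * c h m s) \<odot>\<^bsub>L\<^esub>
        cls (brk (E (P i j t) (Q i j t) (Y i j t)) (E (P h m s) (Q h m s) (Y h m s)))"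
      using F1 F2 by (simp add: cls_smult)
    have sm: "d \<odot>\<^bsub>L\<^esub> cls M = \<zero>\<^bsub>L\<^esub> \<longleftrightarrow> cls M = \<zero>\<^bsub>L\<^esub>" if "d \<noteq> 0" "M \<in> Mn" for d M
    proof
      assume "d \<odot>\<^bsub>L\<^esub> cls M = \<zero>\<^bsub>L\<^esub>"
      hence "d \<cdot>\<^sub>m M - 0\<^sub>m n n \<in> K" using that by (simp add: cls_smult zero_L cls_eq_iff)
      hence "inverse d \<cdot>\<^sub>m (d \<cdot>\<^sub>m M - 0\<^sub>m n n) \<in> K" by (rule K_smult)
      moreover have "inverse d \<cdot>\<^sub>m (d \<cdot>\<^sub>m M - 0\<^sub>m n n) = M - 0\<^sub>m n n" using that by auto
      ultimately show "cls M = \<zero>\<^bsub>L\<^esub>" using that by (simp add: zero_L cls_eq_iff)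
    next
      assume "cls M = \<zero>\<^bsub>L\<^esub>" thus "d \<odot>\<^bsub>L\<^esub> cls M = \<zero>\<^bsub>L\<^esub>" by (simp add: zero_L cls_smult)
    qed
    have "cls (brk (E i j t) (E h m s)) = \<zero>\<^bsub>L\<^esub> \<longleftrightarrow>
        cls (brk (E (P i j t) (Q i j t) (Y i j t)) (E (P h m s) (Q h m s) (Y h m s))) = \<zero>\<^bsub>L\<^esub>"
      using eq sm[of "c i j t * c h m s"] gaut_eq_zero[OF f c0] F1 F2 by simp
    thus ?thesis
      using brk_root_zero_iff[of i j h m t s] brk_root_zero_iff[of "P i j t" "Q i j t" "P h m s" "Q h m s" "Y i j t" "Y h m s"]
        that F1 F2 by (auto simp: R_def)
  qed
  have third: "\<exists>h<k. h \<noteq> x \<and> h \<noteq> y" for x y :: nat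
  proof -
    have "(0 \<noteq> x \<and> 0 \<noteq> y) \<or> (1 \<noteq> x \<and> 1 \<noteq> y) \<or> (2 \<noteq> x \<and> 2 \<noteq> y)" by auto
    moreover have "0 < k" "1 < k" "2 < k" using k by auto
    ultimately show ?thesis by blast
  qed
  have surj: "\<exists>i j t. R i j \<and> t \<in> tc \<and> P i j t = h \<and> Q i j t = m" if hm: "R h m" for h m
  proof -
    have b: "h < k" "m < k" "h \<noteq> m" using hm by (auto simp: R_def)
    obtain i j t where ij: "i < k" "j < k" "t \<in> tc" "i \<noteq> j" "f ` Cmp i j t = Cmp h m \<one>"
      by (rule gaut_root_surj[OF f k2, of h m \<one>]) (use b in simp_all)
    hence R: "R i j" by (simp add: R_def)
    have F': "P i j t < k" "Q i j t < k" "Y i j t \<in> tc" "f ` Cmp i j t = Cmp (P i j t) (Q i j t) (Y i j t)"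
      using F[OF R ij(3)] by (simp_all add: R_def)
    have "same h m \<one> (P i j t) (Q i j t) (Y i j t)"
      by (rule Cmp_inject[OF _ _ _ _ _ _ _ Cmp_nz]) (use b F' ij in simp_all)
    thus ?thesis using R ij b by (auto simp: same_def)
  qed
  \<comment> \<open>Test pairs that start in \<open>y\<close> or end in \<open>x\<close>, with a
    suitable third index as the other entry, show that this relation determines the pair.\<close>
  have sep: "x = x' \<and> y = y'" if "R x y" "R x' y'" "\<And>h m. R h m \<Longrightarrow> (y = h \<or> x = m) \<longleftrightarrow> (y' = h \<or> x' = m)" for x y x' y'
  proof -
    have "y = y'"
    proof (rule ccontr)
      assume ne: "y \<noteq> y'"
      obtain h where "h < k" "h \<noteq> y" "h \<noteq> x'" using third by blast
      thus False using that(3)[of y h] that ne by (auto simp: R_def)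
    qed
    moreover have "x = x'"
    proof (rule ccontr)
      assume ne: "x \<noteq> x'"
      obtain h where "h < k" "h \<noteq> x" "h \<noteq> y'" using third by blast
      thus False using that(3)[of h x] that ne by (auto simp: R_def)
    qed
    ultimately show ?thesis by blast
  qed
  \<comment> \<open>The relation ignores degrees in \<open>T\<close>, so by \<open>sep\<close> the
    image pair cannot depend on them either.\<close>
  have indep: "P i j t = P i j \<one> \<and> Q i j t = Q i j \<one>" if "R i j" "t \<in> tc" for i j t
  proof (rule sep)
    fix h m assume hm: "R h m"
    obtain x y s where "R x y" "s \<in> tc" "P x y s = h" "Q x y s = m" using surj[OF hm] by blast
    thus "(Q i j t = h \<or> P i j t = m) \<longleftrightarrow> (Q i j \<one> = h \<or> P i j \<one> = m)"
      using com[of i j x y t s] com[of i j x y \<one> s] that by simp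
  qed (use F that in auto)
  define A where "A i j = P i j \<one>" for i j
  define B where "B i j = Q i j \<one>" for i j
  have AB: "R (A i j) (B i j)" "P i j t = A i j" "Q i j t = B i j" if "R i j" "t \<in> tc" for i j t
    using F[OF that(1) T.one_closed] indep[OF that] unfolding A_def B_def by blast+
  have com': "(j = h \<or> i = m) \<longleftrightarrow> (B i j = A h m \<or> A i j = B h m)" if "R i j" "R h m" for i j h m
    using com[of i j h m \<one> \<one>] that by (simp add: A_def B_def)
  have inj: "i = i' \<and> j = j'" if "R i j" "R i' j'" "A i j = A i' j'" "B i j = B i' j'" for i j i' j'
    using sep[OF that(1,2)] com'[OF that(1)] com'[OF that(2)] unfolding that(3,4) by blast
  \<comment> \<open>\<open>E i h \<one>\<close> is the bracket of \<open>E i j \<one>\<close> and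
    \<open>E j h \<one>\<close>, so the image pair of \<open>(i, h)\<close> must be composed from
    the two others, in the given order or in the reverse one.\<close>
  have dich: "(B i j = A j h \<and> A i h = A i j \<and> B i h = B j h) \<or> (A i j = B j h \<and> A i h = A j h \<and> B i h = B i j)"
    if "R i j" "R j h" "i \<noteq> h" for i j h
  proof -
    have ih: "R i h" using that by (auto simp: R_def)
    note Fi = F[OF that(1) T.one_closed, folded A_def B_def] and Fj = F[OF that(2) T.one_closed, folded A_def B_def]
      and Fh = F[OF ih T.one_closed, folded A_def B_def]
    define u v w where "u = Y i j \<one>" and "v = Y j h \<one>" and "w = Y i h \<one>"
    define c1 c2 c3 where "c1 = c i j \<one>" and "c2 = c j h \<one>" and "c3 = c i h \<one>"
    have bd: "A i j < k" "B i j < k" "A j h < k" "B j h < k" "A i h < k" "B i h < k"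
      "A i j \<noteq> B i j" "A j h \<noteq> B j h" "A i h \<noteq> B i h" "u \<in> tc" "v \<in> tc" "w \<in> tc" "c1 \<noteq> 0" "c2 \<noteq> 0" "c3 \<noteq> 0"
      using Fi Fj Fh by (auto simp: R_def u_def v_def w_def c1_def c2_def c3_def)
    have ft: "f (cls (E i j \<one>)) = cls (c1 \<cdot>\<^sub>m E (A i j) (B i j) u)" "f (cls (E j h \<one>)) = cls (c2 \<cdot>\<^sub>m E (A j h) (B j h) v)"
      "f (cls (E i h \<one>)) = cls (c3 \<cdot>\<^sub>m E (A i h) (B i h) w)"
      using Fi Fj Fh by (simp_all add: u_def v_def w_def c1_def c2_def c3_def)
    have ik: "i < k" "j < k" "h < k" "i \<noteq> j" "j \<noteq> h" using that by (auto simp: R_def)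
    have sl: "E i j \<one> \<in> sl" "E j h \<one> \<in> sl" "c1 \<cdot>\<^sub>m E (A i j) (B i j) u \<in> sl" "c2 \<cdot>\<^sub>m E (A j h) (B j h) v \<in> sl"
      using ik bd by (simp_all add: E_sl_off)
    have "f (cls (brk (E i j \<one>) (E j h \<one>))) = cls (brk (c1 \<cdot>\<^sub>m E (A i j) (B i j) u) (c2 \<cdot>\<^sub>m E (A j h) (B j h) v))"
      by (rule gaut_brk[OF f sl ft(1,2)])
    also have "brk (E i j \<one>) (E j h \<one>) = E i h \<one>" using ik that(3) by (simp add: brk_E_chain bc_one1)
    finally have eq: "cls (c3 \<cdot>\<^sub>m E (A i h) (B i h) w) =
        cls ((c1 * c2) \<cdot>\<^sub>m brk (E (A i j) (B i j) u) (E (A j h) (B j h) v))"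
      using bd by (simp add: brk_smult2 ft)
    have "co (A i h) (B i h) w (c3 \<cdot>\<^sub>m E (A i h) (B i h) w) =
        co (A i h) (B i h) w ((c1 * c2) \<cdot>\<^sub>m brk (E (A i j) (B i j) u) (E (A j h) (B j h) v))"
      by (rule cls_co_eq[OF _ _ eq]) (use bd in simp_all)
    hence "co (A i h) (B i h) w (brk (E (A i j) (B i j) u) (E (A j h) (B j h) v)) \<noteq> 0"
      using bd by (auto simp: co_smult co_E)
    thus ?thesis using bd
      by (simp add: brk_E co_minus) (auto simp: co_smult co_E co_zero split: if_splits)
  qed
  have ty: "(A i j = A i h \<and> B i h = B j h \<and> B i j = A j h) \<or> (B i j = B i h \<and> A i h = A j h \<and> A i j = B j h \<and> A i j \<noteq> A i h \<and> B i h \<noteq> B j h)"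
    if "R i j" "R j h" "i \<noteq> h" for i j h
  proof -
    have ih: "R i h" "R j i" using that by (auto simp: R_def)
    have "\<not> (A i j = A i h \<and> B i j = B i h)" "\<not> (A i h = A j h \<and> B i h = B j h)"
      using inj[OF that(1) ih(1)] inj[OF ih(1) that(2)] that by (auto simp: R_def)
    thus ?thesis using dich[OF that] by metis
  qed
  \<comment> \<open>The orientation at \<open>i\<close>, \<open>j\<close>, \<open>h\<close>: it
    holds if the first index governs the first entry of the image pair. \<open>D1\<close> to
    \<open>D3\<close> are the moves by which \<open>D012\<close> shows that the orientation is the
    same everywhere.\<close>
  define D where "D i j h \<longleftrightarrow> A i j = A i h" for i j h
  have D1: "D i j h \<longleftrightarrow> D i h j" for i j h by (auto simp: D_def)
  have D2: "D i j h \<longleftrightarrow> D j i h" if "R i j" "R j h" "i \<noteq> h" for i j h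
  proof -
    have s: "R j i" "R i h" "j \<noteq> h" using that by (auto simp: R_def)
    show ?thesis using ty[OF that] ty[OF s] unfolding D_def by metis
  qed
  have D3: "D i j h \<longleftrightarrow> D i j m" if "R i j" "R j h" "i \<noteq> h" "R j m" "i \<noteq> m" for i j h m
  proof (cases "h = m")
    case False
    have s: "R i h" "R h m" "R i m" "R h j" using that False by (auto simp: R_def)
    have "\<not> (A i j = A i m \<and> B i j = B i m)" "\<not> (A i j = A i h \<and> B i j = B i h)" "\<not> (A i h = A i m \<and> B i h = B i m)"
      using inj[OF that(1) s(3)] inj[OF that(1) s(1)] inj[OF s(1,3)] that False by (auto simp: R_def)
    thus ?thesis using ty[OF that(1,2,3)] ty[OF that(1,4,5)] ty[OF s(1,2) that(5)] unfolding D_def by metis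
  qed simp
  have D012: "D i j h \<longleftrightarrow> D 0 1 2" if "R i j" "R j h" "i \<noteq> h" for i j h
  proof -
    define G where "G i j \<longleftrightarrow> (\<exists>h<k. h \<noteq> i \<and> h \<noteq> j \<and> D i j h)" for i j
    have G: "D i j h \<longleftrightarrow> G i j" if "R i j" "R j h" "i \<noteq> h" for i j h
    proof
      assume "D i j h" thus "G i j" unfolding G_def using that by (auto simp: R_def)
    next
      assume "G i j"
      then obtain m where "m < k" "m \<noteq> i" "m \<noteq> j" "D i j m" by (auto simp: G_def)
      thus "D i j h" using D3[OF that, of m] that by (auto simp: R_def)
    qed
    have G1: "G i j \<longleftrightarrow> G i h" if "R i j" "R i h" for i j h
    proof (cases "j = h")
      case False
      thus ?thesis using G[of i j h] G[of i h j] D1[of i j h] that by (auto simp: R_def)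
    qed simp
    have G2: "G i j \<longleftrightarrow> G j i" if "R i j" for i j
    proof -
      obtain h where "h < k" "h \<noteq> i" "h \<noteq> j" using third by blast
      thus ?thesis using G[of i j h] G[of j i h] D2[of i j h] that by (auto simp: R_def)
    qed
    have "G i j \<longleftrightarrow> G 0 1"
    proof (cases "i = 0")
      case True thus ?thesis using G1[of 0 j 1] \<open>R i j\<close> k by (auto simp: R_def)
    next
      case False
      have "G i j \<longleftrightarrow> G i 0" "G i 0 \<longleftrightarrow> G 0 i" "G 0 i \<longleftrightarrow> G 0 1"
        using G1[of i j 0] G2[of i 0] G1[of 0 i 1] \<open>R i j\<close> False k by (auto simp: R_def)
      thus ?thesis by blast
    qed
    thus ?thesis using G[OF that] G[of 0 1 2] k by (auto simp: R_def)
  qed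
  \<comment> \<open>Any index other than \<open>i\<close> may serve as partner; taking 0 or 1 only
    avoids \<open>i\<close> itself.\<close>
  define p where "p i = (if D 0 1 2 then A i else B i) (if i = 0 then 1 else 0)" for i
  have pA: "A i j = p i \<and> B i j = p j" if "D 0 1 2" "R i j" for i j
  proof -
    have const: "A x y = A x z" if "R x y" "R x z" for x y z
      using D012[of x y z] that \<open>D 0 1 2\<close> by (cases "y = z") (auto simp: R_def D_def)
    have A: "A x y = p x" if "R x y" for x y
      using const[of x y "if x = 0 then 1 else 0"] that k \<open>D 0 1 2\<close> by (auto simp: R_def p_def)
    obtain h where h: "h < k" "h \<noteq> i" "h \<noteq> j" using third by blast
    have "D i j h" using D012[of i j h] h that by (auto simp: R_def)
    hence "B i j = A j h" using ty[of i j h] h that by (auto simp: D_def R_def)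
    thus ?thesis using A[of i j] A[of j h] h that by (auto simp: R_def)
  qed
  have pB: "A i j = p j \<and> B i j = p i" if "\<not> D 0 1 2" "R i j" for i j
  proof -
    have const: "B x y = B x z" if "R x y" "R x z" for x y z
      using D012[of x y z] ty[of x y z] that \<open>\<not> D 0 1 2\<close> by (cases "y = z") (auto simp: R_def D_def)
    have B: "B x y = p x" if "R x y" for x y
      using const[of x y "if x = 0 then 1 else 0"] that k \<open>\<not> D 0 1 2\<close> by (auto simp: R_def p_def)
    obtain h where h: "h < k" "h \<noteq> i" "h \<noteq> j" using third by blast
    have "\<not> D i j h" using D012[of i j h] h that by (auto simp: R_def)
    hence "A i j = B j h" using ty[of i j h] h that by (auto simp: D_def R_def)
    thus ?thesis using B[of i j] B[of j h] h that by (auto simp: R_def)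
  qed
  have Rp: "p i < k \<and> (R i j \<longrightarrow> p i \<noteq> p j)" if i: "i < k" for i j
  proof -
    have pm: "p x < k \<and> p y < k \<and> p x \<noteq> p y" if "R x y" for x y
      using pA[OF _ that] pB[OF _ that] AB(1)[OF that T.one_closed] by (cases "D 0 1 2") (auto simp: R_def)
    obtain h where "h < k" "h \<noteq> i" using third by blast
    thus ?thesis using pm[of i h] pm[of i j] i by (auto simp: R_def)
  qed
  have inj_p: "inj_on p {..<k}"
  proof (rule inj_onI, rule ccontr)
    fix i j assume "i \<in> {..<k}" "j \<in> {..<k}" "p i = p j" "i \<noteq> j"
    thus False using Rp[of i j] by (auto simp: R_def)
  qed
  have bij: "bij_betw p {..<k} {..<k}"
    using inj_p Rp endo_inj_surj[of "{..<k}" p] by (auto simp: bij_betw_def)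
  have img: "\<exists>t'\<in>tc. f ` Cmp i j t = Cmp (A i j) (B i j) t'" if "i < k" "j < k" "t \<in> tc" "i \<noteq> j" for i j t
    using F[of i j t] AB(2,3)[of i j t] that by (auto simp: R_def)
  show ?thesis
  proof (rule that[OF bij], cases "D 0 1 2")
    case True
    show "(\<forall>i<k. \<forall>j<k. \<forall>t\<in>tc. i \<noteq> j \<longrightarrow> (\<exists>t'\<in>tc. f ` Cmp i j t = Cmp (p i) (p j) t')) \<or>
     (\<forall>i<k. \<forall>j<k. \<forall>t\<in>tc. i \<noteq> j \<longrightarrow> (\<exists>t'\<in>tc. f ` Cmp i j t = Cmp (p j) (p i) t'))"
      using img pA[OF True] by (intro disjI1) (simp add: R_def)
  next
    case False
    show "(\<forall>i<k. \<forall>j<k. \<forall>t\<in>tc. i \<noteq> j \<longrightarrow> (\<exists>t'\<in>tc. f ` Cmp i j t = Cmp (p i) (p j) t')) \<or>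
     (\<forall>i<k. \<forall>j<k. \<forall>t\<in>tc. i \<noteq> j \<longrightarrow> (\<exists>t'\<in>tc. f ` Cmp i j t = Cmp (p j) (p i) t'))"
      using img pB[OF False] by (intro disjI2) (simp add: R_def)
  qed
qed

definition flip where "flip = induced (\<lambda>M. (-1) \<cdot>\<^sub>m transpose_mat M)"

lemma flip: "gaut flip" "realizes flip flip_map"
  unfolding flip_def using gaut_moves[OF moves_flip] by auto

lemma comp_flip_image:
  assumes "i < k" "j < k" "t \<in> tc"
  shows "compose (carrier L) f flip ` Cmp i j t = f ` Cmp j i (inv (\<sigma> t))"
proof -
  have "compose (carrier L) f flip ` Cmp i j t = f ` flip ` CmpL (i, j, t)"
    using Cmp_carrier[of i j t] by (auto simp: compose_def image_image intro!: image_cong)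
  also have "flip ` CmpL (i, j, t) = CmpL (j, i, inv (\<sigma> t))"
    using bspec[OF flip(2)[unfolded realizes_def], of "(i, j, t)"] assms by (simp add: flip_map_def)
  finally show ?thesis by simp
qed

lemma gaut_type_large:
  assumes f: "gaut f" and k: "k \<ge> 3" shows "type0 f \<or> type0 (compose (carrier L) f flip)"
proof -
  have main: "type0 f" if f: "gaut f" and p: "bij_betw p {..<k} {..<k}"
    and img: "\<And>i j t. i < k \<Longrightarrow> j < k \<Longrightarrow> t \<in> tc \<Longrightarrow> i \<noteq> j \<Longrightarrow> \<exists>t'\<in>tc. f ` Cmp i j t = Cmp (p i) (p j) t'" for f p
  proof -
    obtain Y where Y: "\<And>i j t. i < k \<Longrightarrow> j < k \<Longrightarrow> t \<in> tc \<Longrightarrow> i \<noteq> j \<Longrightarrow> Y i j t \<in> tc \<and> f ` Cmp i j t = Cmp (p i) (p j) (Y i j t)"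
      using img by metis
    obtain g q w Y' where g: "gaut g" "realizes g (lab q w idT 0)" "bij_betw q {..<k} {..<k}" "\<And>i. i < k \<Longrightarrow> w i \<in> tc"
      "gaut (compose (carrier L) g f)"
      "\<And>i j t. i < k \<Longrightarrow> j < k \<Longrightarrow> t \<in> tc \<Longrightarrow> i \<noteq> j \<Longrightarrow> Y' i j t \<in> tc \<and> compose (carrier L) g f ` Cmp i j t = Cmp i j (Y' i j t)"
      "\<And>j. j < k \<Longrightarrow> j \<noteq> 0 \<Longrightarrow> Y' 0 j \<one> = \<one>"
      using normalise[OF f p Y] by blast
    have "type0 (compose (carrier L) g f)" by (rule gaut_normalised_large[OF g(5) k g(6,7)])
    thus ?thesis using denormalise[OF g(1-4) _ f] by blast
  qed
  obtain p where p: "bij_betw p {..<k} {..<k}"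
    "(\<forall>i<k. \<forall>j<k. \<forall>t\<in>tc. i \<noteq> j \<longrightarrow> (\<exists>t'\<in>tc. f ` Cmp i j t = Cmp (p i) (p j) t')) \<or>
     (\<forall>i<k. \<forall>j<k. \<forall>t\<in>tc. i \<noteq> j \<longrightarrow> (\<exists>t'\<in>tc. f ` Cmp i j t = Cmp (p j) (p i) t'))"
    using gaut_pairs[OF f k] by blast
  from p(2) show ?thesis
  proof
    assume "\<forall>i<k. \<forall>j<k. \<forall>t\<in>tc. i \<noteq> j \<longrightarrow> (\<exists>t'\<in>tc. f ` Cmp i j t = Cmp (p i) (p j) t')"
    thus ?thesis using main[OF f p(1)] by blast
  next
    assume *: "\<forall>i<k. \<forall>j<k. \<forall>t\<in>tc. i \<noteq> j \<longrightarrow> (\<exists>t'\<in>tc. f ` Cmp i j t = Cmp (p j) (p i) t')"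
    have "type0 (compose (carrier L) f flip)"
    proof (rule main[OF gaut_comp[OF f flip(1)] p(1)])
      fix i j t assume b: "i < k" "j < k" "t \<in> tc" "i \<noteq> j"
      show "\<exists>t'\<in>tc. compose (carrier L) f flip ` Cmp i j t = Cmp (p i) (p j) t'"
        using *[rule_format, of j i "inv (\<sigma> t)"] comp_flip_image[OF b(1-3), of f] b by simp
    qed
    thus ?thesis by blast
  qed
qed

end

section \<open>Group-theoretic tools for at most two blocks\<close>

context symplectic_group begin

lemma two_subgroups:
  assumes "\<And>t. t \<in> carrier T \<Longrightarrow> P t \<or> Q t"
    and P: "\<And>s t. s \<in> carrier T \<Longrightarrow> t \<in> carrier T \<Longrightarrow> P s \<Longrightarrow> P t \<Longrightarrow> P (s \<otimes> t)" "\<And>t. t \<in> carrier T \<Longrightarrow> P t \<Longrightarrow> P (inv t)"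
    and Q: "\<And>s t. s \<in> carrier T \<Longrightarrow> t \<in> carrier T \<Longrightarrow> Q s \<Longrightarrow> Q t \<Longrightarrow> Q (s \<otimes> t)" "\<And>t. t \<in> carrier T \<Longrightarrow> Q t \<Longrightarrow> Q (inv t)"
  shows "(\<forall>t\<in>carrier T. P t) \<or> (\<forall>t\<in>carrier T. Q t)"
proof (rule ccontr)
  assume "\<not> ?thesis"
  then obtain s t where st: "s \<in> carrier T" "\<not> P s" "t \<in> carrier T" "\<not> Q t" by blast
  hence "Q s" "P t" using assms(1) by blast+
  have "P (s \<otimes> t) \<or> Q (s \<otimes> t)" using assms(1) st by simp
  thus False
  proof
    assume "P (s \<otimes> t)"
    hence "P (s \<otimes> t \<otimes> inv t)" using P \<open>P t\<close> st by blast
    thus False using st by (simp add: T.m_assoc)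
  next
    assume "Q (s \<otimes> t)"
    hence "Q (inv s \<otimes> (s \<otimes> t))" using Q \<open>Q s\<close> st by blast
    thus False using st by (simp add: T.m_assoc[symmetric])
  qed
qed

text \<open>\<open>two_subgroups\<close> is applied twice, to the second variable for each fixed
  first one and then to the first variable.\<close>

lemma bichar_sign:
  assumes cl: "\<And>t. t \<in> carrier T \<Longrightarrow> \<alpha> t \<in> carrier T"
    and hom: "\<And>s t. s \<in> carrier T \<Longrightarrow> t \<in> carrier T \<Longrightarrow> \<alpha> (s \<otimes> t) = \<alpha> s \<otimes> \<alpha> t"
    and dich: "\<And>s t. s \<in> carrier T \<Longrightarrow> t \<in> carrier T \<Longrightarrow> \<beta> (\<alpha> s) (\<alpha> t) = \<beta> s t \<or> \<beta> (\<alpha> s) (\<alpha> t) = \<beta> t s"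
  shows "(\<forall>s\<in>carrier T. \<forall>t\<in>carrier T. \<beta> (\<alpha> s) (\<alpha> t) = \<beta> s t) \<or> (\<forall>s\<in>carrier T. \<forall>t\<in>carrier T. \<beta> (\<alpha> s) (\<alpha> t) = \<beta> t s)"
proof -
  interpret \<alpha>: group_hom T T \<alpha> by unfold_locales (auto simp: hom_def cl hom)
  have "(\<forall>t\<in>carrier T. \<beta> (\<alpha> s) (\<alpha> t) = \<beta> s t) \<or> (\<forall>t\<in>carrier T. \<beta> (\<alpha> s) (\<alpha> t) = \<beta> t s)" if "s \<in> carrier T" for s
    by (rule two_subgroups) (use dich that in \<open>auto simp: beta_mult1 beta_mult2 beta_inv1 beta_inv2 hom\<close>)
  thus ?thesis
    by (intro two_subgroups) (auto simp: beta_mult1 beta_mult2 beta_inv1 beta_inv2 hom)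
qed

text \<open>Pigeonhole on the kernels of three characters. If \<open>x = \<beta> w u\<close> has
  \<open>x * x \<noteq> 1\<close>, then 1, \<open>x\<close> and \<open>x * x\<close> are distinct.
  One of the other two characters kills \<open>w\<close>; choosing \<open>y\<close> outside its
  kernel, each of \<open>y\<close>, \<open>w \<otimes> y\<close> and
  \<open>w \<otimes> (w \<otimes> y)\<close> must lie in one of the two remaining kernels, which
  leaves room for only two of these powers.\<close>

lemma three_perps_cover:
  assumes uv: "u \<in> carrier T" "v \<in> carrier T" "v \<noteq> \<one>" "u \<otimes> v \<noteq> \<one>"
    and cov: "\<And>w. w \<in> carrier T \<Longrightarrow> \<beta> w u = 1 \<or> \<beta> w v = 1 \<or> \<beta> w u * \<beta> w v = 1"
    and w: "w \<in> carrier T"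
  shows "\<beta> w u * \<beta> w u = 1"
proof (rule ccontr)
  assume ne: "\<beta> w u * \<beta> w u \<noteq> 1"
  define x where "x = \<beta> w u"
  have x: "x \<noteq> 0" "x \<noteq> 1" "x * x \<noteq> 1" using ne uv w by (auto simp: x_def)
  have cov2: "x * c = 1 \<or> \<beta> w v * d = 1 \<or> x * c * (\<beta> w v * d) = 1"
      "x * x * c = 1 \<or> \<beta> w v * \<beta> w v * d = 1 \<or> x * x * c * (\<beta> w v * \<beta> w v * d) = 1"
      "c = 1 \<or> d = 1 \<or> c * d = 1" "c \<noteq> 0" "d \<noteq> 0"
    if "y \<in> carrier T" "c = \<beta> y u" "d = \<beta> y v" for y c d
    using cov[of "w \<otimes> y"] cov[of "w \<otimes> (w \<otimes> y)"] cov[of y] that uv w by (auto simp: beta_mult1 x_def mult.assoc)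
  consider "\<beta> w v = 1" | "\<beta> w v = inverse x" using cov[OF w] x by (auto simp: x_def inverse_unique)
  thus False
  proof cases
    case 1
    obtain y where y: "y \<in> carrier T" "\<beta> y v \<noteq> 1" using beta_witness[OF uv(2,3)] beta_eq_1_sym uv by metis
    define c d where "c = \<beta> y u" and "d = \<beta> y v"
    have e: "c = 1 \<or> c * d = 1" "x * c = 1 \<or> x * (c * d) = 1" "x * (x * c) = 1 \<or> x * (x * (c * d)) = 1"
      using cov2[OF y(1), of c d] y(2) 1 by (auto simp: c_def d_def mult.assoc)
    show False
    proof (cases "c = 1")
      case True
      hence "x * d = 1" using e(2) x by simp
      thus False using e(3) True x by simp
    next
      case False
      hence cd: "c * d = 1" using e(1) by simp
      hence "x * c = 1" using e(2) x by simp
      thus False using e(3) cd x by simp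
    qed
  next
    case 2
    obtain y where y: "y \<in> carrier T" "\<beta> y (u \<otimes> v) \<noteq> 1"
      using beta_witness[OF _ uv(4)] beta_eq_1_sym uv by (metis T.m_closed)
    define c d where "c = \<beta> y u" and "d = \<beta> y v"
    have cd: "c * d \<noteq> 1" using y uv by (simp add: beta_mult2 c_def d_def)
    have h: "x * c * (inverse x * d) = c * d" "x * x * c * (inverse x * inverse x * d) = c * d"
      "inverse x * d = 1 \<longleftrightarrow> d = x" "inverse x * inverse x * d = 1 \<longleftrightarrow> d = x * x"
      using x(1) by (auto simp: field_simps)
    have e: "x * c = 1 \<or> d = x" "x * (x * c) = 1 \<or> d = x * x" "c = 1 \<or> d = 1"
      using cov2[OF y(1), of c d] cd unfolding 2 h by (auto simp: c_def d_def mult.assoc)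
    show False
    proof (cases "c = 1")
      case True thus False using e(1,2) x by auto
    next
      case False
      hence "d = 1" using e(3) by simp
      hence "x * c = 1" using e(1) x by auto
      thus False using e(2) x \<open>d = 1\<close> by auto
    qed
  qed
qed

text \<open>Clearing denominators gives the factorisation
  \<open>(z' - z) * (1 - z * z') = 0\<close>. It recovers values of \<beta> up to inversion from
  expressions symmetric under inversion.\<close>

lemma add_inverse_eq:
  assumes "z \<noteq> 0" "z' \<noteq> 0" "z + inverse z = z' + inverse (z' :: 'f)"
  shows "z' = z \<or> z' = inverse z"
proof -
  have "z * z * z' + z' = z' * z' * z + z" using assms by (simp add: field_simps)
  hence "(z' - z) * (1 - z * z') = 0" by (simp add: algebra_simps)
  thus ?thesis using assms by (auto simp: inverse_unique)
qed

end

context fine_grading begin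

text \<open>If \<alpha> reverses \<beta>, then the map sending \<open>t\<close> to
  \<open>\<alpha> (inv (\<sigma> t))\<close> preserves it, since \<sigma> reverses \<beta> as well,
  and this is the map obtained after composing with \<open>flip\<close>.\<close>

lemma type_from_alpha:
  assumes f: "gaut f" and k: "k \<le> 2"
    and cl: "\<And>t. t \<in> tc \<Longrightarrow> \<alpha> t \<in> tc" and hom: "\<And>s t. s \<in> tc \<Longrightarrow> t \<in> tc \<Longrightarrow> \<alpha> (s \<otimes> t) = \<alpha> s \<otimes> \<alpha> t"
    and dich: "\<And>s t. s \<in> tc \<Longrightarrow> t \<in> tc \<Longrightarrow> \<beta> (\<alpha> s) (\<alpha> t) = \<beta> s t \<or> \<beta> (\<alpha> s) (\<alpha> t) = \<beta> t s"
    and img: "\<And>i j t. i < k \<Longrightarrow> j < k \<Longrightarrow> t \<in> tc \<Longrightarrow> i \<noteq> j \<or> k = 1 \<Longrightarrow> f ` Cmp i j t = Cmp i j (\<alpha> t)"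
  shows "type0 f \<or> type0 (compose (carrier L) f flip)"
proof -
  have main: "type0 f" if f: "gaut f" and p: "bij_betw p {..<k} {..<k}" and A: "restrict \<alpha> tc \<in> Aut"
    and img: "\<And>i j t. i < k \<Longrightarrow> j < k \<Longrightarrow> t \<in> tc \<Longrightarrow> i \<noteq> j \<or> k = 1 \<Longrightarrow> f ` Cmp i j t = Cmp (p i) (p j) (\<alpha> t)" for f p \<alpha>
  proof -
    have cl: "\<alpha> t \<in> tc" if "t \<in> tc" for t using AutD(3)[OF A that] that by simp
    have "realizes f (lab p (\<lambda>_. \<one>) (restrict \<alpha> tc) 0)"
    proof (cases "k = 1")
      case True
      show ?thesis unfolding realizes_def
      proof
        fix z assume "z \<in> lbl"
        then obtain i j t where z: "z = (i, j, t)" "i < k" "j < k" "t \<in> tc" by (cases z) auto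
        have "f ` Cmp i j t = Cmp (p i) (p j) (\<alpha> t)" by (rule img[OF z(2-4)]) (simp add: True)
        thus "f ` CmpL z = CmpL (lab p (\<lambda>_. \<one>) (restrict \<alpha> tc) 0 z)"
          using z cl by (simp add: lab_def)
      qed
    next
      case False
      hence k2: "k \<ge> 2" using k_pos by simp
      show ?thesis by (rule realizes_from_roots[OF f k2 p _ A]) (use img cl in auto)
    qed
    thus ?thesis unfolding type0_def using p A
      by (intro exI[of _ p] exI[of _ "\<lambda>_. \<one>"] exI[of _ "restrict \<alpha> tc"]) auto
  qed
  interpret \<alpha>: group_hom T T \<alpha> by unfold_locales (auto simp: hom_def cl hom)
  consider "\<forall>s\<in>tc. \<forall>t\<in>tc. \<beta> (\<alpha> s) (\<alpha> t) = \<beta> s t" | "\<forall>s\<in>tc. \<forall>t\<in>tc. \<beta> (\<alpha> s) (\<alpha> t) = \<beta> t s"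
    using bichar_sign[of \<alpha>] cl hom dich by blast
  thus ?thesis
  proof cases
    case 1
    have "restrict \<alpha> tc \<in> Aut" by (rule AutI) (use cl hom 1 in auto)
    hence "type0 f" by (rule main[OF f bij_betw_id]) (simp add: img)
    thus ?thesis ..
  next
    case 2
    define \<gamma> where "\<gamma> t = \<alpha> (inv (\<sigma> t))" for t
    have A: "restrict \<gamma> tc \<in> Aut"
    proof (rule AutI)
      show "\<gamma> t \<in> tc" if "t \<in> tc" for t using that cl by (simp add: \<gamma>_def)
      fix s t assume st: "s \<in> tc" "t \<in> tc"
      show "\<gamma> (s \<otimes> t) = \<gamma> s \<otimes> \<gamma> t" using st by (simp add: \<gamma>_def T.inv_mult_group hom T.m_comm)
      show "\<beta> (\<gamma> s) (\<gamma> t) = \<beta> s t" using st 2 beta_sigma[of t s] by (simp add: \<gamma>_def beta_inv1 beta_inv2)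
    qed
    \<comment> \<open>\<open>flip\<close> exchanges the two indices of a label, which off the
      diagonal for \<open>k = 2\<close> amounts to the transposition of 0 and 1.\<close>
    define p where "p i = (if k = 1 then i else 1 - i)" for i :: nat
    have pp: "p (p i) = i" "p i < k" if "i < k" for i using that k by (auto simp: p_def)
    have p: "bij_betw p {..<k} {..<k}" by (rule bij_betw_byWitness[where f' = p]) (use pp in auto)
    have "type0 (compose (carrier L) f flip)"
    proof (rule main[OF gaut_comp[OF f flip(1)] p A])
      fix i j t assume b: "i < k" "j < k" "t \<in> tc" "i \<noteq> j \<or> k = 1"
      have "p i = j" "p j = i" using b k by (auto simp: p_def)
      moreover have "f ` Cmp j i (inv (\<sigma> t)) = Cmp j i (\<alpha> (inv (\<sigma> t)))" using b by (intro img) auto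
      ultimately show "compose (carrier L) f flip ` Cmp i j t = Cmp (p i) (p j) (\<gamma> t)"
        using comp_flip_image[OF b(1-3), of f] by (simp add: \<gamma>_def)
    qed
    thus ?thesis by blast
  qed
qed

text \<open>
  For \<open>k = 2\<close> the triple brackets of the root elements show that the normalised action on \<open>\<D>\<close> is
  a Jordan automorphism, which preserves \<open>\<beta> u v + inverse (\<beta> u v)\<close>.
\<close>

lemma gaut_normalised_two:
  assumes f: "gaut f" and k: "k = 2"
    and Y: "\<And>i j t. i < k \<Longrightarrow> j < k \<Longrightarrow> t \<in> tc \<Longrightarrow> i \<noteq> j \<Longrightarrow> Y i j t \<in> tc \<and> f ` Cmp i j t = Cmp i j (Y i j t)"
    and norm: "Y 0 1 \<one> = \<one>"
  shows "type0 f \<or> type0 (compose (carrier L) f flip)"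
proof -
  have k2: "k \<ge> 2" "0 < k" "1 < k" using k by auto
  define \<alpha> where "\<alpha> = Y 0 1"
  define \<gamma> where "\<gamma> = Y 1 0"
  have cl: "\<alpha> t \<in> tc" "\<gamma> t \<in> tc" "f ` Cmp 0 1 t = Cmp 0 1 (\<alpha> t)" "f ` Cmp 1 0 t = Cmp 1 0 (\<gamma> t)" if "t \<in> tc" for t
    using Y[of 0 1 t] Y[of 1 0 t] that k2 by (auto simp: \<alpha>_def \<gamma>_def)
  have \<alpha>1: "\<alpha> \<one> = \<one>" using norm by (simp add: \<alpha>_def)
  have diag: "f ` Cmp 0 0 (t \<otimes> s) = Cmp 0 0 (\<alpha> t \<otimes> \<gamma> s)" if "t \<in> tc" "s \<in> tc" for t s
    by (rule gaut_diag_component[OF f k2(1)]) (use k2 cl[OF that(1)] cl[OF that(2)] that in simp_all)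
  \<comment> \<open>The diagonal component depends only on the product of the two degrees, so
    splitting it as \<open>t \<otimes> s\<close> and as
    \<open>\<one> \<otimes> (t \<otimes> s)\<close> gives the same image.\<close>
  have dd: "\<alpha> t \<otimes> \<gamma> s = \<gamma> (t \<otimes> s)" if "t \<in> tc" "s \<in> tc" for t s
  proof -
    have nz: "Cmp 0 0 (t \<otimes> s) \<noteq> {\<zero>\<^bsub>L\<^esub>}"
    proof
      assume z: "Cmp 0 0 (t \<otimes> s) = {\<zero>\<^bsub>L\<^esub>}"
      have "cls (brk (E 0 1 t) (E 1 0 s)) \<in> Cmp 0 0 (t \<otimes> s)"
        using brk_opposite_mem[of 0 1 t s] that k2 by (auto simp: Cmp_def)
      thus False using z brk_root_zero_iff[of 0 1 1 0 t s] that k2 by simp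
    qed
    have eq: "Cmp 0 0 (\<alpha> t \<otimes> \<gamma> s) = Cmp 0 0 (\<gamma> (t \<otimes> s))"
      using diag[OF that] diag[of \<one> "t \<otimes> s"] that \<alpha>1 cl by simp
    have nz': "Cmp 0 0 (\<alpha> t \<otimes> \<gamma> s) \<noteq> {\<zero>\<^bsub>L\<^esub>}"
    proof
      assume "Cmp 0 0 (\<alpha> t \<otimes> \<gamma> s) = {\<zero>\<^bsub>L\<^esub>}"
      hence "f ` Cmp 0 0 (t \<otimes> s) = f ` {\<zero>\<^bsub>L\<^esub>}" using diag[OF that] gaut_zero[OF f] by simp
      hence "Cmp 0 0 (t \<otimes> s) = {\<zero>\<^bsub>L\<^esub>}"
        using CmpL_image_inj[OF f Cmp_carrier] cls_mem_L[OF sl_zero] by (simp add: zero_L)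
      thus False using nz by simp
    qed
    have "same (0::nat) 0 (\<alpha> t \<otimes> \<gamma> s) (0::nat) 0 (\<gamma> (t \<otimes> s))"
      by (rule Cmp_inject[OF _ _ _ _ _ _ eq nz']) (use k2 that cl(1)[OF that(1)] cl(2) in simp_all)
    thus ?thesis by (simp add: same_def)
  qed
  have "\<exists>c. c \<noteq> 0 \<and> f (cls (E 0 1 t)) = cls (c \<cdot>\<^sub>m E 0 1 (\<alpha> t))" if "t \<in> tc" for t
    by (rule gaut_root_elt[OF f k2(1)]) (use that k2 cl[OF that] in simp_all)
  then obtain c where c: "\<And>t. t \<in> tc \<Longrightarrow> c t \<noteq> 0" "\<And>t. t \<in> tc \<Longrightarrow> f (cls (E 0 1 t)) = cls (c t \<cdot>\<^sub>m E 0 1 (\<alpha> t))" by metis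
  have "\<exists>d. d \<noteq> 0 \<and> f (cls (E 1 0 t)) = cls (d \<cdot>\<^sub>m E 1 0 (\<gamma> t))" if "t \<in> tc" for t
    by (rule gaut_root_elt[OF f k2(1)]) (use that k2 cl[OF that] in simp_all)
  then obtain d where d: "\<And>t. t \<in> tc \<Longrightarrow> d t \<noteq> 0" "\<And>t. t \<in> tc \<Longrightarrow> f (cls (E 1 0 t)) = cls (d t \<cdot>\<^sub>m E 1 0 (\<gamma> t))" by metis
  \<comment> \<open>Structure constant of the Jordan triple product \<open>u v w + w v u\<close>,
    which is what a double bracket of root elements sees.\<close>
  define J where "J u v w = bc u v * bc (u \<otimes> v) w + bc v u * bc w (v \<otimes> u)" for u v w
  have trip: "brk (brk (E 0 1 u) (E 1 0 v)) (E 0 1 w) = J u v w \<cdot>\<^sub>m E 0 1 (u \<otimes> v \<otimes> w)"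
    if "u \<in> tc" "v \<in> tc" "w \<in> tc" for u v w
  proof -
    define M where "M = brk (E 0 1 u) (E 1 0 v)"
    have vu: "v \<otimes> u = u \<otimes> v" using that by (simp add: T.m_comm)
    have M: "M \<in> Hom 0 0 (u \<otimes> v)" using brk_opposite_mem[of 0 1 u v] that k2 by (simp add: M_def)
    have "co 0 0 (u \<otimes> v) M = bc u v" "co 1 1 (u \<otimes> v) M = - bc v u"
      using that k2 by (simp_all add: M_def brk_E co_minus co_smult co_E vu)
    thus ?thesis
      using brk_diag[OF M, of 0 1 w] that k2 by (simp add: M_def J_def vu)
  qed
  have sl: "E 0 1 t \<in> sl" "E 1 0 t \<in> sl" if "t \<in> tc" for t using E_sl_off that k2 by simp_all
  have eq: "\<alpha> (u \<otimes> v \<otimes> w) = \<alpha> u \<otimes> \<gamma> v \<otimes> \<alpha> w \<and> J u v w * c (u \<otimes> v \<otimes> w) = c u * d v * c w * J (\<alpha> u) (\<gamma> v) (\<alpha> w)"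
    if t: "u \<in> tc" "v \<in> tc" "w \<in> tc" and nz: "J u v w \<noteq> 0" for u v w
  proof -
    note m = cl(1)[OF t(1)] cl(2)[OF t(2)] cl(1)[OF t(3)]
    have "f (cls (brk (E 0 1 u) (E 1 0 v))) = cls (brk (c u \<cdot>\<^sub>m E 0 1 (\<alpha> u)) (d v \<cdot>\<^sub>m E 1 0 (\<gamma> v)))"
      using sl t m by (intro gaut_brk[OF f _ _ _ _ c(2) d(2)]) auto
    hence "f (cls (brk (brk (E 0 1 u) (E 1 0 v)) (E 0 1 w))) =
        cls (brk (brk (c u \<cdot>\<^sub>m E 0 1 (\<alpha> u)) (d v \<cdot>\<^sub>m E 1 0 (\<gamma> v))) (c w \<cdot>\<^sub>m E 0 1 (\<alpha> w)))"
      using sl t m by (intro gaut_brk[OF f _ _ _ _ _ c(2)]) auto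
    also have "brk (brk (c u \<cdot>\<^sub>m E 0 1 (\<alpha> u)) (d v \<cdot>\<^sub>m E 1 0 (\<gamma> v))) (c w \<cdot>\<^sub>m E 0 1 (\<alpha> w)) =
        (c u * d v * c w * J (\<alpha> u) (\<gamma> v) (\<alpha> w)) \<cdot>\<^sub>m E 0 1 (\<alpha> u \<otimes> \<gamma> v \<otimes> \<alpha> w)"
      using trip[OF m] m by (simp add: brk_smult2)
    also have "brk (brk (E 0 1 u) (E 1 0 v)) (E 0 1 w) = J u v w \<cdot>\<^sub>m E 0 1 (u \<otimes> v \<otimes> w)" by (rule trip[OF t])
    also have "f (cls (J u v w \<cdot>\<^sub>m E 0 1 (u \<otimes> v \<otimes> w))) = cls (J u v w \<cdot>\<^sub>m (c (u \<otimes> v \<otimes> w) \<cdot>\<^sub>m E 0 1 (\<alpha> (u \<otimes> v \<otimes> w))))"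
      using sl t cl by (intro gaut_smult[OF f _ _ c(2)]) auto
    finally have e: "cls ((J u v w * c (u \<otimes> v \<otimes> w)) \<cdot>\<^sub>m E 0 1 (\<alpha> (u \<otimes> v \<otimes> w))) =
        cls ((c u * d v * c w * J (\<alpha> u) (\<gamma> v) (\<alpha> w)) \<cdot>\<^sub>m E 0 1 (\<alpha> u \<otimes> \<gamma> v \<otimes> \<alpha> w))" by simp
    from cls_E_eq[OF _ _ _ _ _ _ _ _ e] show ?thesis using t m cl k2 nz c(1)[of "u \<otimes> v \<otimes> w"] by simp
  qed
  \<comment> \<open>The triple product of unit elements has coefficient 2, which is nonzero by the
    assumption on the characteristic.\<close>
  have \<gamma>1: "\<gamma> \<one> = \<one>"
  proof -
    have "J \<one> \<one> \<one> \<noteq> 0" using two_nz by (simp add: J_def bc_one1)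
    thus ?thesis using eq[of \<one> \<one> \<one>] \<alpha>1 cl by simp
  qed
  have \<alpha>\<gamma>: "\<gamma> t = \<alpha> t" if "t \<in> tc" for t using dd[of t \<one>] that \<gamma>1 cl by simp
  have hom: "\<alpha> (s \<otimes> t) = \<alpha> s \<otimes> \<alpha> t" if "s \<in> tc" "t \<in> tc" for s t using dd[of s t] that \<alpha>\<gamma> by simp
  have cd1: "c \<one> * d \<one> = 1"
  proof -
    have "J \<one> \<one> \<one> = 2" by (simp add: J_def bc_one1)
    hence "2 * c \<one> = c \<one> * d \<one> * c \<one> * 2" using eq[of \<one> \<one> \<one>] two_nz \<alpha>1 \<gamma>1 by simp
    hence "2 * c \<one> * (c \<one> * d \<one> - 1) = 0" by (simp add: algebra_simps)
    thus ?thesis using two_nz c(1)[of \<one>] by simp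
  qed
  have J1: "J \<one> v \<one> = 2" if "v \<in> tc" for v using that by (simp add: J_def bc_one1 bc_one2)
  have dv: "c v = c \<one> * c \<one> * d v" if "v \<in> tc" for v
  proof -
    have "2 * c v = c \<one> * d v * c \<one> * 2" using eq[of \<one> v \<one>] J1[OF that] J1[of "\<alpha> v"] two_nz that \<alpha>1 \<alpha>\<gamma> cl by simp
    hence "2 * (c v - c \<one> * c \<one> * d v) = 0" by (simp add: algebra_simps)
    thus ?thesis using two_nz by simp
  qed
  \<comment> \<open>With \<open>z = \<beta> u v\<close>, reordering the matrices turns
    \<open>u u v\<close> and \<open>v u u\<close> into \<open>z\<close> and \<open>inverse z\<close>
    times \<open>u v u\<close>. The triple products giving \<open>u v u\<close>, \<open>u u\<close>
    and \<open>u u v + v u u\<close> yield \<open>e1\<close>, \<open>e2\<close> and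
    \<open>e3\<close>, from which all scalars can be eliminated.\<close>
  have dich: "\<beta> (\<alpha> u) (\<alpha> v) = \<beta> u v \<or> \<beta> (\<alpha> u) (\<alpha> v) = \<beta> v u" if uv: "u \<in> tc" "v \<in> tc" for u v
  proof -
    note m = cl(1)[OF uv(1)] cl(1)[OF uv(2)]
    have sq: "bc x x * bc (x \<otimes> x) y = \<beta> x y * (bc x y * bc (x \<otimes> y) x) \<and> bc x x * bc y (x \<otimes> x) = inverse (\<beta> x y) * (bc x y * bc (x \<otimes> y) x)
        \<and> bc y x * bc x (y \<otimes> x) = bc x y * bc (x \<otimes> y) x" if "x \<in> tc" "y \<in> tc" for x y
    proof -
      have "bc x x * bc (x \<otimes> x) y = bc x y * bc x (x \<otimes> y)" using bc_cocycle[of x x y] that by simp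
      moreover have "bc x (x \<otimes> y) = \<beta> x y * bc (x \<otimes> y) x" using bc_swap[of x "x \<otimes> y"] that by (simp add: beta_mult2)
      moreover have "bc x x * bc y (x \<otimes> x) = bc y x * bc (y \<otimes> x) x" using bc_cocycle[of y x x] that by simp
      moreover have "bc y x = inverse (\<beta> x y) * bc x y" using bc_swap[of x y] that by simp
      moreover have "bc y x * bc x (y \<otimes> x) = bc x y * bc (x \<otimes> y) x" using bc_cocycle[of x y x] that by simp
      moreover have "y \<otimes> x = x \<otimes> y" using that by (simp add: T.m_comm)
      ultimately show ?thesis by (simp only: mult_ac)
    qed
    have uu: "u \<otimes> u \<in> tc" "u \<otimes> v \<otimes> u = u \<otimes> u \<otimes> v" using uv by (auto simp: T.m_ac)
    define a a' z z' where "a = bc u v * bc (u \<otimes> v) u" and "a' = bc (\<alpha> u) (\<alpha> v) * bc (\<alpha> u \<otimes> \<alpha> v) (\<alpha> u)"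
      and "z = \<beta> u v" and "z' = \<beta> (\<alpha> u) (\<alpha> v)"
    have nz: "a \<noteq> 0" "a' \<noteq> 0" "z \<noteq> 0" "z' \<noteq> 0" "bc u u \<noteq> 0" "bc (\<alpha> u) (\<alpha> u) \<noteq> 0" "c (u \<otimes> u \<otimes> v) \<noteq> 0" "c \<one> \<noteq> 0" "d \<one> \<noteq> 0"
      using uv m uu bc(1) c(1) d(1) by (simp_all add: a_def a'_def z_def z'_def)
    have s: "bc u u * bc (u \<otimes> u) v = z * a" "bc u u * bc v (u \<otimes> u) = inverse z * a" "bc v u * bc u (v \<otimes> u) = a"
      and s': "bc (\<alpha> u) (\<alpha> u) * bc (\<alpha> u \<otimes> \<alpha> u) (\<alpha> v) = z' * a'" "bc (\<alpha> u) (\<alpha> u) * bc (\<alpha> v) (\<alpha> u \<otimes> \<alpha> u) = inverse z' * a'"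
        "bc (\<alpha> v) (\<alpha> u) * bc (\<alpha> u) (\<alpha> v \<otimes> \<alpha> u) = a'"
      using sq[OF uv] sq[OF m] by (simp_all add: a_def a'_def z_def z'_def)
    have Ju: "J u v u = 2 * a" "J (\<alpha> u) (\<alpha> v) (\<alpha> u) = 2 * a'"
      using s(3) s'(3) by (simp_all add: J_def a_def a'_def)
    hence e1: "a * c (u \<otimes> u \<otimes> v) = c u * d v * c u * a'"
      using eq[of u v u] uv uu nz two_nz \<alpha>\<gamma> by simp
    have Juu: "J u \<one> u = 2 * bc u u" "J (\<alpha> u) \<one> (\<alpha> u) = 2 * bc (\<alpha> u) (\<alpha> u)"
      using uv m by (simp_all add: J_def bc_one1 bc_one2)
    hence e2: "bc u u * c (u \<otimes> u) = c u * d \<one> * c u * bc (\<alpha> u) (\<alpha> u)"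
      using eq[of u \<one> u] uv nz two_nz \<gamma>1 by simp
    have J3: "J (u \<otimes> u) \<one> v = bc (u \<otimes> u) v + bc v (u \<otimes> u)" "J (\<alpha> u \<otimes> \<alpha> u) \<one> (\<alpha> v) = bc (\<alpha> u \<otimes> \<alpha> u) (\<alpha> v) + bc (\<alpha> v) (\<alpha> u \<otimes> \<alpha> u)"
      using uv m by (simp_all add: J_def bc_one1 bc_one2)
    have J3': "bc u u * J (u \<otimes> u) \<one> v = (z + inverse z) * a" "bc (\<alpha> u) (\<alpha> u) * J (\<alpha> u \<otimes> \<alpha> u) \<one> (\<alpha> v) = (z' + inverse z') * a'"
      unfolding J3 using s s' by (simp_all add: distrib_left distrib_right)
    show ?thesis
    proof (cases "J (u \<otimes> u) \<one> v = 0")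
      case False
      have e3: "J (u \<otimes> u) \<one> v * c (u \<otimes> u \<otimes> v) = c (u \<otimes> u) * d \<one> * c v * J (\<alpha> u \<otimes> \<alpha> u) \<one> (\<alpha> v)"
        using eq[of "u \<otimes> u" \<one> v] uv False \<gamma>1 hom by simp
      have "(z + inverse z) * (a * c (u \<otimes> u \<otimes> v)) * bc (\<alpha> u) (\<alpha> u) =
          (bc u u * J (u \<otimes> u) \<one> v) * c (u \<otimes> u \<otimes> v) * bc (\<alpha> u) (\<alpha> u)" using J3' by simp
      also have "\<dots> = bc u u * (J (u \<otimes> u) \<one> v * c (u \<otimes> u \<otimes> v)) * bc (\<alpha> u) (\<alpha> u)" by simp
      also have "\<dots> = (bc u u * c (u \<otimes> u)) * d \<one> * c v * (bc (\<alpha> u) (\<alpha> u) * J (\<alpha> u \<otimes> \<alpha> u) \<one> (\<alpha> v))"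
        unfolding e3 by (simp add: mult_ac)
      also have "\<dots> = c u * d \<one> * c u * bc (\<alpha> u) (\<alpha> u) * d \<one> * (c \<one> * c \<one> * d v) * ((z' + inverse z') * a')"
        unfolding e2 J3'(2) using dv[OF uv(2)] by simp
      also have "\<dots> = (c \<one> * d \<one>) * (c \<one> * d \<one>) * (c u * d v * c u * a') * (z' + inverse z') * bc (\<alpha> u) (\<alpha> u)"
        by (simp add: mult_ac)
      also have "\<dots> = (z' + inverse z') * (a * c (u \<otimes> u \<otimes> v)) * bc (\<alpha> u) (\<alpha> u)"
        unfolding cd1 e1 by simp
      finally have "z + inverse z = z' + inverse z'" using nz by simp
      thus ?thesis using add_inverse_eq[of z z'] nz beta_swap[OF uv] by (simp add: z_def z'_def)
    next
      \<comment> \<open>The triple product vanishes, so no scalar relation is available. Instead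
        \<open>f\<close> sends 0 to 0, which forces the image product to vanish too.\<close>
      case True
      hence zz: "z + inverse z = 0" using J3'(1) nz by simp
      have "z' + inverse z' = 0"
      proof (rule ccontr)
        assume ne: "z' + inverse z' \<noteq> 0"
        have "f (cls (brk (brk (E 0 1 (u \<otimes> u)) (E 1 0 \<one>)) (E 0 1 v))) =
            cls (brk (brk (c (u \<otimes> u) \<cdot>\<^sub>m E 0 1 (\<alpha> (u \<otimes> u))) (d \<one> \<cdot>\<^sub>m E 1 0 (\<gamma> \<one>))) (c v \<cdot>\<^sub>m E 0 1 (\<alpha> v)))"
          using sl uv m cl by (intro gaut_brk[OF f _ _ _ _ gaut_brk[OF f _ _ _ _ c(2) d(2)] c(2)]) auto
        also have "brk (brk (c (u \<otimes> u) \<cdot>\<^sub>m E 0 1 (\<alpha> (u \<otimes> u))) (d \<one> \<cdot>\<^sub>m E 1 0 (\<gamma> \<one>))) (c v \<cdot>\<^sub>m E 0 1 (\<alpha> v)) =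
            (c (u \<otimes> u) * d \<one> * c v * J (\<alpha> u \<otimes> \<alpha> u) \<one> (\<alpha> v)) \<cdot>\<^sub>m E 0 1 (\<alpha> u \<otimes> \<alpha> u \<otimes> \<one> \<otimes> \<alpha> v)"
          using trip[of "\<alpha> u \<otimes> \<alpha> u" \<one> "\<alpha> v"] m hom uv \<gamma>1 by (simp add: brk_smult2)
        also have "brk (brk (E 0 1 (u \<otimes> u)) (E 1 0 \<one>)) (E 0 1 v) = 0\<^sub>m n n"
          using trip[of "u \<otimes> u" \<one> v] True uv by (simp add: zero_smult_mat)
        finally have "cls ((c (u \<otimes> u) * d \<one> * c v * J (\<alpha> u \<otimes> \<alpha> u) \<one> (\<alpha> v)) \<cdot>\<^sub>m E 0 1 (\<alpha> u \<otimes> \<alpha> u \<otimes> \<one> \<otimes> \<alpha> v)) = \<zero>\<^bsub>L\<^esub>"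
          using gaut_zero[OF f] by (simp add: zero_L)
        moreover have "J (\<alpha> u \<otimes> \<alpha> u) \<one> (\<alpha> v) \<noteq> 0" using J3'(2) ne nz by auto
        ultimately show False using cls_E_nz[of 0 1 "\<alpha> u \<otimes> \<alpha> u \<otimes> \<one> \<otimes> \<alpha> v" "c (u \<otimes> u) * d \<one> * c v * J (\<alpha> u \<otimes> \<alpha> u) \<one> (\<alpha> v)"]
          k2 m uv c(1) d(1) by simp
      qed
      thus ?thesis using zz add_inverse_eq[of z z'] nz beta_swap[OF uv] by (simp add: z_def z'_def)
    qed
  qed
  show ?thesis
  proof (rule type_from_alpha[OF f _ cl(1) hom dich])
    fix i j t assume b: "i < k" "j < k" "t \<in> tc" "i \<noteq> j \<or> k = 1"
    hence "i = 0 \<and> j = 1 \<or> i = 1 \<and> j = 0" using k by auto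
    thus "f ` Cmp i j t = Cmp i j (\<alpha> t)" using cl(3,4)[OF b(3)] \<alpha>\<gamma>[OF b(3)] by (elim disjE) simp_all
  qed (use k in auto)
qed

text \<open>For \<open>k = 2\<close> two root elements commute exactly when they have the same index
  pair, so the image of \<open>E 0 1 \<one>\<close> fixes the permutation for all root
  components.\<close>

lemma gaut_type_two:
  assumes f: "gaut f" and k: "k = 2" shows "type0 f \<or> type0 (compose (carrier L) f flip)"
proof -
  have k2: "k \<ge> 2" "0 < k" "1 < k" using k by auto
  obtain a' b' w c where r: "a' < k" "b' < k" "w \<in> tc" "a' \<noteq> b'" "f ` Cmp 0 1 \<one> = Cmp a' b' w" "c \<noteq> 0"
    "f (cls (E 0 1 \<one>)) = cls (c \<cdot>\<^sub>m E a' b' w)"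
    by (rule gaut_root[OF f k2(1), of 0 1 \<one>]) (use k2 in simp_all)
  define p where "p i = (if i = 0 then a' else b')" for i :: nat
  have pk: "p i < k" "p i \<noteq> p j \<longleftrightarrow> i \<noteq> j" if "i < k" "j < k" for i j using that r k by (auto simp: p_def)
  have p: "bij_betw p {..<k} {..<k}"
    using endo_inj_surj[of "{..<k}" p] pk by (auto simp: bij_betw_def inj_on_def)
  have "\<exists>t'. t' \<in> tc \<and> f ` Cmp i j t = Cmp (p i) (p j) t'" if b: "i < k" "j < k" "t \<in> tc" "i \<noteq> j" for i j t
  proof -
    obtain x y s e where s: "x < k" "y < k" "s \<in> tc" "x \<noteq> y" "f ` Cmp i j t = Cmp x y s" "e \<noteq> 0"
      "f (cls (E i j t)) = cls (e \<cdot>\<^sub>m E x y s)"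
      by (rule gaut_root[OF f k2(1) b]) simp_all
    have "f (cls (brk (E 0 1 \<one>) (E i j t))) = cls (brk (c \<cdot>\<^sub>m E a' b' w) (e \<cdot>\<^sub>m E x y s))"
      using E_sl_off b s r k2 by (intro gaut_brk[OF f _ _ _ _ r(7) s(7)]) auto
    hence eq: "f (cls (brk (E 0 1 \<one>) (E i j t))) = cls ((c * e) \<cdot>\<^sub>m brk (E a' b' w) (E x y s))"
      using r s by (simp add: brk_smult2)
    have "x = p i \<and> y = p j"
    proof (cases "i = 0 \<and> j = 1")
      case True
      hence "cls (brk (E 0 1 \<one>) (E i j t)) = \<zero>\<^bsub>L\<^esub>" using brk_root_zero_iff[of 0 1 i j \<one> t] b k2 by simp
      hence "cls ((c * e) \<cdot>\<^sub>m brk (E a' b' w) (E x y s)) = \<zero>\<^bsub>L\<^esub>" using eq gaut_zero[OF f] by simp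
      moreover have "inverse (c * e) \<odot>\<^bsub>L\<^esub> \<zero>\<^bsub>L\<^esub> = \<zero>\<^bsub>L\<^esub>" by (simp add: zero_L cls_smult)
      ultimately have "inverse (c * e) \<odot>\<^bsub>L\<^esub> cls ((c * e) \<cdot>\<^sub>m brk (E a' b' w) (E x y s)) = \<zero>\<^bsub>L\<^esub>" by simp
      hence "cls (brk (E a' b' w) (E x y s)) = \<zero>\<^bsub>L\<^esub>" using r s by (simp add: cls_smult del: inverse_mult_distrib)
      hence "b' \<noteq> x \<and> a' \<noteq> y" using brk_root_zero_iff[of a' b' x y w s] r s by simp
      thus ?thesis using True r s k by (auto simp: p_def)
    next
      case False
      hence ij: "i = 1" "j = 0" using b k by auto
      hence "cls (brk (E 0 1 \<one>) (E i j t)) \<noteq> \<zero>\<^bsub>L\<^esub>" using brk_root_zero_iff[of 0 1 i j \<one> t] b k2 by simp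
      moreover have "cls (brk (E 0 1 \<one>) (E i j t)) \<in> carrier L" using b by (intro cls_mem_L sl_brk) auto
      ultimately have nz: "cls ((c * e) \<cdot>\<^sub>m brk (E a' b' w) (E x y s)) \<noteq> \<zero>\<^bsub>L\<^esub>" using eq gaut_eq_zero[OF f] by metis
      have "cls (brk (E a' b' w) (E x y s)) \<noteq> \<zero>\<^bsub>L\<^esub>"
      proof
        assume z: "cls (brk (E a' b' w) (E x y s)) = \<zero>\<^bsub>L\<^esub>"
        have "(c * e) \<odot>\<^bsub>L\<^esub> \<zero>\<^bsub>L\<^esub> = \<zero>\<^bsub>L\<^esub>" by (simp add: zero_L cls_smult)
        hence "(c * e) \<odot>\<^bsub>L\<^esub> cls (brk (E a' b' w) (E x y s)) = \<zero>\<^bsub>L\<^esub>" using z by simp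
        thus False using nz r s by (simp add: cls_smult)
      qed
      hence "b' = x \<or> a' = y" using brk_root_zero_iff[of a' b' x y w s] r s by simp
      thus ?thesis using ij r s k by (auto simp: p_def)
    qed
    thus ?thesis using s by blast
  qed
  then obtain Y where Y: "\<And>i j t. i < k \<Longrightarrow> j < k \<Longrightarrow> t \<in> tc \<Longrightarrow> i \<noteq> j \<Longrightarrow> Y i j t \<in> tc \<and> f ` Cmp i j t = Cmp (p i) (p j) (Y i j t)"
    by metis
  obtain g q w Y' where g: "gaut g" "realizes g (lab q w idT 0)" "bij_betw q {..<k} {..<k}" "\<And>i. i < k \<Longrightarrow> w i \<in> tc"
    "gaut (compose (carrier L) g f)"
    "\<And>i j t. i < k \<Longrightarrow> j < k \<Longrightarrow> t \<in> tc \<Longrightarrow> i \<noteq> j \<Longrightarrow> Y' i j t \<in> tc \<and> compose (carrier L) g f ` Cmp i j t = Cmp i j (Y' i j t)"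
    "\<And>j. j < k \<Longrightarrow> j \<noteq> 0 \<Longrightarrow> Y' 0 j \<one> = \<one>"
    using normalise[OF f p Y] by blast
  have "Y' 0 1 \<one> = \<one>" using g(7)[of 1] k2 by simp
  with gaut_normalised_two[OF g(5) k g(6)]
  have "type0 (compose (carrier L) g f) \<or> type0 (compose (carrier L) (compose (carrier L) g f) flip)" by blast
  \<comment> \<open>Normalising on the left and flipping on the right do not interfere, so the
    normalisation can be removed in both alternatives.\<close>
  moreover have "compose (carrier L) (compose (carrier L) g f) flip = compose (carrier L) g (compose (carrier L) f flip)"
    by (rule ext) (simp add: compose_def gaut_closed[OF flip(1)])
  ultimately show ?thesis
    using denormalise[OF g(1-4) _ f] denormalise[OF g(1-4) _ gaut_comp[OF f flip(1)]] by auto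
qed

end

context fine_grading begin

text \<open>
  For \<open>k = 1\<close> the double bracket with \<open>X v\<close> and \<open>X (inv v)\<close> scales \<open>X u\<close> by \<open>Q (\<beta> u v)\<close> times a factor
  depending on \<open>v\<close> only, where \<open>Q z = (1 - z) * (1 - inverse z)\<close>. Hence \<open>Q (\<beta> u v)\<close> and its analogue for
  the images differ by a constant \<open>\<mu>\<close> depending on \<open>v\<close>, and \<open>Q (z\<^sup>2) = Q z * (4 - Q z)\<close>, applied to
  \<open>u\<close> and its square, forces \<open>\<mu> = 1\<close>.
\<close>

lemma gaut_type_one:
  assumes f: "gaut f" and k: "k = 1" and n2: "\<not> elementary_2_group T"
  shows "type0 f \<or> type0 (compose (carrier L) f flip)"
proof -
  have k0: "0 < k" using k by simp
  define e where "e = E 0 0"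
  have ec: "e t \<in> Mn" "t \<noteq> \<one> \<Longrightarrow> e t \<in> sl" if "t \<in> tc" for t using that E_sl_diag k0 by (auto simp: e_def)
  \<comment> \<open>With one block the identity degree contains only scalar matrices, which die in
    \<open>psl\<close>. Hence \<open>\<tau> \<one> = \<one>\<close> is a choice consistent with
    \<open>f\<close>.\<close>
  have C1: "Cmp 0 0 \<one> = {\<zero>\<^bsub>L\<^esub>}"
  proof (rule ccontr)
    assume "Cmp 0 0 \<one> \<noteq> {\<zero>\<^bsub>L\<^esub>}"
    then obtain M where M: "M \<in> Hom 0 0 \<one>" "M \<in> sl" "M \<notin> K" by (rule Cmp_nonzero_element)
    have Mc: "M \<in> Mn" using M by simp
    have "M = co 0 0 \<one> M \<cdot>\<^sub>m 1\<^sub>m n"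
    proof (rule mat_eqI_co)
      fix i j t assume b: "i < k" "j < k" "t \<in> tc"
      hence "i = 0" "j = 0" using k by simp_all
      thus "co i j t M = co i j t (co 0 0 \<one> M \<cdot>\<^sub>m 1\<^sub>m n)"
        using M(1) b by (auto simp: co_smult co_one Hom_def same_def)
    qed (use Mc in simp_all)
    hence "M * P = P * M" if "P \<in> Mn" for P
      using that by (metis left_mult_one_mat one_carrier_mat right_mult_one_mat square_smult(1) square_smult(2))
    thus False using M K_iff by blast
  qed
  have "\<exists>t'. t' \<in> tc \<and> (t \<noteq> \<one> \<longrightarrow> t' \<noteq> \<one>) \<and> (t = \<one> \<longrightarrow> t' = \<one>) \<and> f ` Cmp 0 0 t = Cmp 0 0 t'" if t: "t \<in> tc" for t
  proof (cases "t = \<one>")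
    case True
    thus ?thesis using C1 gaut_zero[OF f] by (intro exI[of _ \<one>]) simp
  next
    case False
    obtain y where y: "y \<in> lbl" "f ` Cmp 0 0 t = CmpL y" "CmpL y \<noteq> {\<zero>\<^bsub>L\<^esub>}"
      by (rule gaut_label[OF f, of "(0, 0, t)"]) (use False t k0 Cmp_nz[of 0 0 t] in simp_all)
    obtain i j s where ijs: "y = (i, j, s)" by (cases y)
    hence "i < k" "j < k" "s \<in> tc" using y(1) by simp_all
    hence s: "i = 0" "j = 0" "s \<in> tc" using k by simp_all
    have "s \<noteq> \<one>" using y(3) ijs C1 s by auto
    thus ?thesis using y(2) ijs s False by auto
  qed
  then obtain \<tau> where \<tau>: "\<And>t. t \<in> tc \<Longrightarrow> \<tau> t \<in> tc" "\<And>t. t \<in> tc \<Longrightarrow> t \<noteq> \<one> \<Longrightarrow> \<tau> t \<noteq> \<one>" "\<tau> \<one> = \<one>"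
    "\<And>t. t \<in> tc \<Longrightarrow> f ` Cmp 0 0 t = Cmp 0 0 (\<tau> t)"
    by (metis T.one_closed)
  have "\<exists>c. c \<noteq> 0 \<and> f (cls (e t)) = cls (c \<cdot>\<^sub>m e (\<tau> t))" if t: "t \<in> tc" "t \<noteq> \<one>" for t
  proof -
    have "1 \<cdot>\<^sub>m E 0 0 t \<in> Hom 0 0 t" using t k0 by (intro E_mem_Hom) (auto simp: same_def)
    hence mem: "cls (e t) \<in> Cmp 0 0 t" using ec t by (auto simp: Cmp_def e_def)
    hence "f (cls (e t)) \<in> Cmp 0 0 (\<tau> t)" using \<tau>(4)[OF t(1)] by blast
    then obtain M where M: "M \<in> Hom 0 0 (\<tau> t)" "M \<in> sl" "f (cls (e t)) = cls M" by (auto simp: Cmp_def)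
    have Mc: "M \<in> Mn" using M by simp
    have "M = co 0 0 (\<tau> t) M \<cdot>\<^sub>m e (\<tau> t)" unfolding e_def
    proof (rule mat_eqI_co)
      fix i j s assume b: "i < k" "j < k" "s \<in> tc"
      hence "i = 0" "j = 0" using k by simp_all
      thus "co i j s M = co i j s (co 0 0 (\<tau> t) M \<cdot>\<^sub>m E 0 0 (\<tau> t))"
        using M(1) b \<tau>(1)[OF t(1)] by (auto simp: co_smult co_E Hom_def same_def)
    qed (use Mc \<tau>(1)[OF t(1)] in simp_all)
    then obtain c where c: "M = c \<cdot>\<^sub>m e (\<tau> t)" by blast
    have "c \<noteq> 0"
    proof
      assume "c = 0"
      hence "f (cls (e t)) = \<zero>\<^bsub>L\<^esub>" using M(3) c ec(1)[OF \<tau>(1)[OF t(1)]] by (simp add: zero_smult_mat zero_L)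
      hence "cls (1 \<cdot>\<^sub>m E 0 0 t) = \<zero>\<^bsub>L\<^esub>"
        using gaut_eq_zero[OF f cls_mem_L[OF ec(2)[OF t]]] by (simp add: e_def)
      thus False using cls_E_nz[of 0 0 t 1] t k0 by simp
    qed
    thus ?thesis using M(3) c by blast
  qed
  then obtain c where c: "\<And>t. t \<in> tc \<Longrightarrow> t \<noteq> \<one> \<Longrightarrow> c t \<noteq> 0"
    "\<And>t. t \<in> tc \<Longrightarrow> t \<noteq> \<one> \<Longrightarrow> f (cls (e t)) = cls (c t \<cdot>\<^sub>m e (\<tau> t))" by metis
  \<comment> \<open>Structure constant of the commutator. It vanishes exactly for commuting degrees,
    about whose product a single bracket says nothing.\<close>
  define D where "D u v = bc u v - bc v u" for u v
  have brk_e: "brk (e u) (e v) = D u v \<cdot>\<^sub>m e (u \<otimes> v)" if "u \<in> tc" "v \<in> tc" for u v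
  proof -
    have "brk (e u) (e v) = bc u v \<cdot>\<^sub>m e (u \<otimes> v) - bc v u \<cdot>\<^sub>m e (u \<otimes> v)"
      unfolding e_def using that k0 by (simp add: brk_E T.m_comm[of v u])
    thus ?thesis by (auto simp: D_def left_diff_distrib)
  qed
  have D: "D u v = (1 - inverse (\<beta> u v)) * bc u v" "D u v = 0 \<longleftrightarrow> \<beta> u v = 1" if "u \<in> tc" "v \<in> tc" for u v
  proof -
    show 1: "D u v = (1 - inverse (\<beta> u v)) * bc u v"
      using bc_swap[OF that(2,1)] beta_swap[OF that] that by (simp add: D_def left_diff_distrib)
    show "D u v = 0 \<longleftrightarrow> \<beta> u v = 1" unfolding 1 using bc(1)[OF that] by (auto simp: inverse_eq_1_iff)
  qed
  have ne: "u \<noteq> \<one>" "v \<noteq> \<one>" "u \<otimes> v \<noteq> \<one>" if "u \<in> tc" "v \<in> tc" "\<beta> u v \<noteq> 1" for u v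
  proof -
    show "u \<noteq> \<one>" "v \<noteq> \<one>" using that by auto
    show "u \<otimes> v \<noteq> \<one>"
    proof
      assume "u \<otimes> v = \<one>"
      hence "\<beta> (u \<otimes> v) v = 1" using that by simp
      thus False using that by (simp add: beta_mult1)
    qed
  qed
  have fbrk: "f (cls (D u v \<cdot>\<^sub>m e (u \<otimes> v))) = cls ((c u * c v * D (\<tau> u) (\<tau> v)) \<cdot>\<^sub>m e (\<tau> u \<otimes> \<tau> v))"
    if t: "u \<in> tc" "v \<in> tc" "u \<noteq> \<one>" "v \<noteq> \<one>" for u v
  proof -
    have "f (cls (brk (e u) (e v))) = cls (brk (c u \<cdot>\<^sub>m e (\<tau> u)) (c v \<cdot>\<^sub>m e (\<tau> v)))"
      using t ec \<tau> by (intro gaut_brk[OF f _ _ _ _ c(2) c(2)]) auto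
    thus ?thesis using t \<tau>(1) ec(1) by (simp add: brk_e brk_smult2)
  qed
  have mul: "\<beta> (\<tau> u) (\<tau> v) \<noteq> 1 \<and> \<tau> (u \<otimes> v) = \<tau> u \<otimes> \<tau> v \<and> D u v * c (u \<otimes> v) = c u * c v * D (\<tau> u) (\<tau> v)"
    if t: "u \<in> tc" "v \<in> tc" and z: "\<beta> u v \<noteq> 1" for u v
  proof -
    note n = ne[OF t z]
    have uv: "u \<otimes> v \<in> tc" using t by simp
    have "f (cls (D u v \<cdot>\<^sub>m e (u \<otimes> v))) = cls (D u v \<cdot>\<^sub>m (c (u \<otimes> v) \<cdot>\<^sub>m e (\<tau> (u \<otimes> v))))"
      by (rule gaut_smult[OF f _ _ c(2)[OF uv n(3)]]) (use ec uv n \<tau> in auto)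
    hence eq: "cls ((D u v * c (u \<otimes> v)) \<cdot>\<^sub>m E 0 0 (\<tau> (u \<otimes> v))) = cls ((c u * c v * D (\<tau> u) (\<tau> v)) \<cdot>\<^sub>m E 0 0 (\<tau> u \<otimes> \<tau> v))"
      using fbrk[OF t n(1,2)] by (simp add: e_def)
    have nz: "D u v * c (u \<otimes> v) \<noteq> 0" using D(2)[OF t] z c(1)[OF uv n(3)] by simp
    have *: "\<tau> (u \<otimes> v) = \<tau> u \<otimes> \<tau> v" "D u v * c (u \<otimes> v) = c u * c v * D (\<tau> u) (\<tau> v)"
      using cls_E_eq(3,4)[OF k0 k0 \<tau>(1)[OF uv] k0 k0 _ disjI2[OF \<tau>(2)[OF uv n(3)]] nz eq] \<tau>(1) t by blast+
    thus ?thesis using nz D(2)[of "\<tau> u" "\<tau> v"] \<tau>(1) t by auto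
  qed
  have com: "\<beta> (\<tau> u) (\<tau> v) = 1" if t: "u \<in> tc" "v \<in> tc" and z: "\<beta> u v = 1" for u v
  proof (cases "u = \<one> \<or> v = \<one>")
    case True thus ?thesis using \<tau> t by auto
  next
    case False
    have "D u v = 0" using D(2)[OF t] z by simp
    hence "cls ((c u * c v * D (\<tau> u) (\<tau> v)) \<cdot>\<^sub>m E 0 0 (\<tau> u \<otimes> \<tau> v)) = \<zero>\<^bsub>L\<^esub>"
      using fbrk[OF t] False gaut_zero[OF f] ec t by (simp add: zero_smult_mat zero_L e_def)
    moreover have "cls ((c u * c v * D (\<tau> u) (\<tau> v)) \<cdot>\<^sub>m E 0 0 (\<tau> u \<otimes> \<tau> v)) \<noteq> \<zero>\<^bsub>L\<^esub>" if "\<beta> (\<tau> u) (\<tau> v) \<noteq> 1"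
      using that False c(1) t D(2)[of "\<tau> u" "\<tau> v"] \<tau>(1) k0 ne(3)[of "\<tau> u" "\<tau> v"] by (intro cls_E_nz) auto
    ultimately show ?thesis by blast
  qed
  \<comment> \<open>\<open>v\<close> and \<open>inv v\<close> commute, so their product cannot be
    tested directly; it is inserted behind an element \<open>u\<close> that does not commute with
    \<open>v\<close>.\<close>
  have tinv: "\<tau> (inv v) = inv (\<tau> v)" if v: "v \<in> tc" for v
  proof (cases "v = \<one>")
    case False
    obtain u where u: "u \<in> tc" "\<beta> u v \<noteq> 1" using beta_witness[OF v False] beta_eq_1_sym v by metis
    have "\<beta> (u \<otimes> v) (inv v) \<noteq> 1" using u v by (simp add: beta_mult1 beta_inv2)
    hence "\<tau> (u \<otimes> v \<otimes> inv v) = \<tau> u \<otimes> \<tau> v \<otimes> \<tau> (inv v)" using mul[of "u \<otimes> v" "inv v"] mul[OF u(1) v u(2)] u v by simp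
    moreover have "u \<otimes> v \<otimes> inv v = u" using u v by (simp add: T.m_assoc)
    ultimately have "\<tau> u \<otimes> (\<tau> v \<otimes> \<tau> (inv v)) = \<tau> u" using \<tau>(1) u v by (simp add: T.m_assoc)
    hence "\<tau> v \<otimes> \<tau> (inv v) = \<one>" using \<tau>(1) u v by (metis T.inv_closed T.l_cancel_one' T.m_closed T.r_cancel_one)
    thus ?thesis using \<tau>(1) v by (metis T.inv_closed T.inv_equality T.m_comm)
  qed (use \<tau> in simp)
  define Q where "Q z = (1 - z) * (1 - inverse z)" for z :: 'f
  have lam: "\<exists>\<mu>. \<mu> \<noteq> 0 \<and> (\<forall>u\<in>tc. Q (\<beta> u v) = \<mu> * Q (\<beta> (\<tau> u) (\<tau> v)))" if v: "v \<in> tc" "v \<noteq> \<one>" for v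
  proof -
    define g where "g v = bc v (inv v)" for v
    define \<mu> where "\<mu> = c v * c (inv v) * g (\<tau> v) / g v"
    have iv: "inv v \<in> tc" "inv v \<noteq> \<one>" using v T.inv_eq_1_iff by auto
    \<comment> \<open>Bracketing with \<open>e y\<close> and then with \<open>e (inv y)\<close>
      returns to degree \<open>x\<close>, and the cocycle identity leaves
      \<open>bc y (inv y)\<close> as the only factor besides \<open>Q\<close>.\<close>
    have DD: "D x y * D (x \<otimes> y) (inv y) = Q (\<beta> x y) * g y" if "x \<in> tc" "y \<in> tc" for x y
    proof -
      have "x \<otimes> (y \<otimes> inv y) = x" using that by simp
      hence "bc x y * bc (x \<otimes> y) (inv y) = g y" using bc_cocycle[of x y "inv y"] that by (simp add: g_def bc_one2)
      moreover have "D x y = (1 - inverse (\<beta> x y)) * bc x y" by (rule D(1)[OF that])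
      moreover have "D (x \<otimes> y) (inv y) = (1 - \<beta> x y) * bc (x \<otimes> y) (inv y)"
        using D(1)[of "x \<otimes> y" "inv y"] that by (simp add: beta_mult1 beta_inv2)
      ultimately show ?thesis by (simp add: Q_def)
    qed
    have "Q (\<beta> u v) = \<mu> * Q (\<beta> (\<tau> u) (\<tau> v))" if u: "u \<in> tc" for u
    proof (cases "\<beta> u v = 1")
      case True thus ?thesis using com[OF u v(1)] by (simp add: Q_def)
    next
      case False
      have z2: "\<beta> (u \<otimes> v) (inv v) \<noteq> 1" using False u v by (simp add: beta_mult1 beta_inv2)
      have m1: "\<tau> (u \<otimes> v) = \<tau> u \<otimes> \<tau> v" "D u v * c (u \<otimes> v) = c u * c v * D (\<tau> u) (\<tau> v)"
        using mul[OF u v(1) False] by auto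
      have "u \<otimes> v \<otimes> inv v = u" using u v by (simp add: T.m_assoc)
      hence m2: "D (u \<otimes> v) (inv v) * c u = c (u \<otimes> v) * c (inv v) * D (\<tau> u \<otimes> \<tau> v) (inv (\<tau> v))"
        using mul[OF _ iv(1) z2] u v m1 tinv by simp
      have nz: "c u \<noteq> 0" "c (u \<otimes> v) \<noteq> 0" "g v \<noteq> 0" using ne[OF u v(1) False] c(1) u v iv bc(1) by (auto simp: g_def)
      have "Q (\<beta> u v) * g v * (c u * c (u \<otimes> v)) = (D u v * c (u \<otimes> v)) * (D (u \<otimes> v) (inv v) * c u)"
        using DD[OF u v(1)] by (simp add: mult_ac)
      also have "\<dots> = c v * c (inv v) * (D (\<tau> u) (\<tau> v) * D (\<tau> u \<otimes> \<tau> v) (inv (\<tau> v))) * (c u * c (u \<otimes> v))"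
        unfolding m1 m2 by (simp add: mult_ac)
      also have "D (\<tau> u) (\<tau> v) * D (\<tau> u \<otimes> \<tau> v) (inv (\<tau> v)) = Q (\<beta> (\<tau> u) (\<tau> v)) * g (\<tau> v)"
        using DD \<tau>(1) u v by simp
      finally have "Q (\<beta> u v) * g v = c v * c (inv v) * (Q (\<beta> (\<tau> u) (\<tau> v)) * g (\<tau> v))" using nz by simp
      thus ?thesis using nz by (simp add: \<mu>_def field_simps)
    qed
    moreover have "\<mu> \<noteq> 0" using c(1)[OF v] c(1)[OF iv] bc(1) v iv \<tau>(1) by (simp add: \<mu>_def g_def)
    ultimately show ?thesis by blast
  qed
  have Q0: "Q z = 0 \<longleftrightarrow> z = 1" for z by (auto simp: Q_def)
  have Qsq: "Q (z * z) = Q z * (4 - Q z)" if "z \<noteq> 0" for z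
    using that by (simp add: Q_def field_simps)
  \<comment> \<open>Comparing \<open>Q\<close> at \<open>z\<close> and \<open>z * z\<close> needs
    some \<open>z = \<beta> x v\<close> with \<open>z * z \<noteq> 1\<close>. If
    \<open>v \<otimes> v = \<one>\<close> there is none, but then all values in question are 1 or
    -1.\<close>
  have dich: "\<beta> (\<tau> u) (\<tau> v) = \<beta> u v \<or> \<beta> (\<tau> u) (\<tau> v) = \<beta> v u" if u: "u \<in> tc" and v: "v \<in> tc" for u v
  proof (cases "v \<otimes> v = \<one>")
    case True
    hence "inv v = v" using v T.inv_equality by blast
    hence "inv (\<tau> v) = \<tau> v" using tinv[OF v] by simp
    have self_inv: "w * w = 1" if "w = inverse w" "w \<noteq> 0" for w :: 'f using that by (metis right_inverse)
    have "\<beta> u v = inverse (\<beta> u v)" using u v \<open>inv v = v\<close> beta_inv2[of u v] by simp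
    hence sq: "\<beta> u v * \<beta> u v = 1" by (rule self_inv) (use u v in simp)
    have "\<beta> (\<tau> u) (\<tau> v) = inverse (\<beta> (\<tau> u) (\<tau> v))"
      using u v \<tau>(1) \<open>inv (\<tau> v) = \<tau> v\<close> beta_inv2[of "\<tau> u" "\<tau> v"] by simp
    hence sq': "\<beta> (\<tau> u) (\<tau> v) * \<beta> (\<tau> u) (\<tau> v) = 1" by (rule self_inv) (use u v \<tau>(1) in simp)
    show ?thesis
    proof (cases "\<beta> u v = 1")
      case True thus ?thesis using com[OF u v] by simp
    next
      case False
      hence "\<beta> (\<tau> u) (\<tau> v) \<noteq> 1" using mul[OF u v] by simp
      thus ?thesis using sq sq' False by (metis square_eq_1_iff)
    qed
  next
    case False
    have v1: "v \<noteq> \<one>" using False by auto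
    obtain \<mu> where l: "\<mu> \<noteq> 0" "\<And>u. u \<in> tc \<Longrightarrow> Q (\<beta> u v) = \<mu> * Q (\<beta> (\<tau> u) (\<tau> v))" using lam[OF v v1] by blast
    have "v \<otimes> v \<in> tc" using v by simp
    from beta_witness[OF this False] obtain x where x: "x \<in> tc" "\<beta> x (v \<otimes> v) \<noteq> 1"
      using beta_eq_1_sym v by (metis T.m_closed)
    define z z' where "z = \<beta> x v" and "z' = \<beta> (\<tau> x) (\<tau> v)"
    have "z * z \<noteq> 1" using x(2) beta_mult2[OF x(1) v v] by (simp only: z_def not_False_eq_True)
    hence zz: "z * z \<noteq> 1" "z \<noteq> 1" "z \<noteq> 0" "z' \<noteq> 0"
      using beta_nz[OF x(1) v] beta_nz[OF \<tau>(1)[OF x(1)] \<tau>(1)[OF v]] by (auto simp only: z_def z'_def mult_1_left)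
    \<comment> \<open>\<open>x\<close> commutes with itself, so the rule for
      \<open>\<tau> (x \<otimes> x)\<close> comes from computing the image of
      \<open>x \<otimes> x \<otimes> v\<close> in two ways.\<close>
    have "\<beta> x (x \<otimes> v) \<noteq> 1" using zz x v by (simp add: beta_mult2 z_def)
    hence "\<tau> (x \<otimes> (x \<otimes> v)) = \<tau> x \<otimes> (\<tau> x \<otimes> \<tau> v)" using mul[of x "x \<otimes> v"] mul[of x v] zz x v by (simp add: z_def)
    moreover have "\<beta> (x \<otimes> x) v \<noteq> 1" using zz x v by (simp add: beta_mult1 z_def)
    hence "\<tau> (x \<otimes> x \<otimes> v) = \<tau> (x \<otimes> x) \<otimes> \<tau> v" using mul[of "x \<otimes> x" v] x v by simp
    ultimately have "\<tau> (x \<otimes> x) \<otimes> \<tau> v = \<tau> x \<otimes> \<tau> x \<otimes> \<tau> v" using x v \<tau>(1) by (simp add: T.m_assoc)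
    hence "\<tau> (x \<otimes> x) = \<tau> x \<otimes> \<tau> x" using x v \<tau>(1) by (metis T.m_closed T.right_cancel)
    hence "Q (z * z) = \<mu> * Q (z' * z')" using l(2)[of "x \<otimes> x"] x v \<tau>(1) by (simp add: beta_mult1 z_def z'_def)
    hence "Q z * (4 - Q z) = \<mu> * Q z' * (4 - Q z')" using Qsq zz by simp
    moreover have lz: "Q z = \<mu> * Q z'" using l(2)[OF x(1)] by (simp add: z_def z'_def)
    moreover have "Q z \<noteq> 0" using Q0 zz by simp
    ultimately have "Q z = Q z'" by simp
    hence "\<mu> = 1" using lz \<open>Q z \<noteq> 0\<close> by simp
    hence "Q (\<beta> u v) = Q (\<beta> (\<tau> u) (\<tau> v))" using l(2)[OF u] by simp
    moreover have "w + inverse w = 2 - Q w" if "w \<noteq> 0" for w using that by (simp add: Q_def field_simps)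
    ultimately have "\<beta> u v + inverse (\<beta> u v) = \<beta> (\<tau> u) (\<tau> v) + inverse (\<beta> (\<tau> u) (\<tau> v))" using u v \<tau>(1) by simp
    thus ?thesis using add_inverse_eq[of "\<beta> u v" "\<beta> (\<tau> u) (\<tau> v)"] u v \<tau>(1) beta_swap[OF u v] by simp
  qed
  have inj: "inj_on \<tau> tc"
  proof (rule inj_onI)
    fix s t assume st: "s \<in> tc" "t \<in> tc" "\<tau> s = \<tau> t"
    have "f ` Cmp 0 0 s = f ` Cmp 0 0 t" using \<tau>(4) st by simp
    hence eq: "Cmp 0 0 s = Cmp 0 0 t" by (rule CmpL_image_inj[OF f Cmp_carrier Cmp_carrier])
    show "s = t"
    proof (cases "s = \<one>")
      case True thus ?thesis using st \<tau>(2)[of t] \<tau>(3) by metis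
    next
      case False
      have "same (0::nat) 0 s (0::nat) 0 t" by (rule Cmp_inject[OF _ _ _ _ _ _ eq Cmp_nz]) (use st k0 False in simp_all)
      thus ?thesis by (simp add: same_def)
    qed
  qed
  hence surj: "\<tau> ` tc = tc" using endo_inj_surj[OF finite_T _ inj] \<tau>(1) by auto
  \<comment> \<open>For commuting \<open>u\<close> and \<open>v\<close>, an element \<open>w\<close>
    commuting with none of \<open>u\<close>, \<open>v\<close>, \<open>u \<otimes> v\<close> reduces
    the claim to noncommuting products. Without such a \<open>w\<close>,
    \<open>three_perps_cover\<close> makes all values involved 1 or -1; there \<open>dich\<close>
    means preservation, and nondegeneracy concludes.\<close>
  have hom: "\<tau> (u \<otimes> v) = \<tau> u \<otimes> \<tau> v" if u: "u \<in> tc" and v: "v \<in> tc" for u v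
  proof -
    consider "\<beta> u v \<noteq> 1" | "u = \<one> \<or> v = \<one>" | "u \<otimes> v = \<one>" | "\<beta> u v = 1" "u \<noteq> \<one>" "v \<noteq> \<one>" "u \<otimes> v \<noteq> \<one>" by blast
    thus ?thesis
    proof cases
      case 1 thus ?thesis using mul[OF u v] by simp
    next
      case 2 thus ?thesis using u v \<tau> by auto
    next
      case 3
      hence "v = inv u" using u v by (metis T.inv_equality T.m_comm)
      thus ?thesis using tinv[OF u] u \<tau> by simp
    next
      case 4
      show ?thesis
      proof (cases "\<exists>w\<in>tc. \<beta> w u \<noteq> 1 \<and> \<beta> w v \<noteq> 1 \<and> \<beta> w u * \<beta> w v \<noteq> 1")
        case True
        then obtain w where w: "w \<in> tc" "\<beta> w u \<noteq> 1" "\<beta> w v \<noteq> 1" "\<beta> w u * \<beta> w v \<noteq> 1" by blast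
        have n: "\<beta> v w \<noteq> 1" "\<beta> u (v \<otimes> w) \<noteq> 1" "\<beta> (u \<otimes> v) w \<noteq> 1"
          using w u v 4(1) beta_eq_1_sym[of w "u \<otimes> v"] beta_eq_1_sym[of w u] beta_eq_1_sym[of w v] by (auto simp: beta_mult2)
        have "\<tau> (u \<otimes> v) \<otimes> \<tau> w = \<tau> (u \<otimes> v \<otimes> w)" using mul[OF _ w(1) n(3)] u v by simp
        also have "\<dots> = \<tau> (u \<otimes> (v \<otimes> w))" using u v w by (simp add: T.m_assoc)
        also have "\<dots> = \<tau> u \<otimes> \<tau> v \<otimes> \<tau> w" using mul[OF u _ n(2)] mul[OF v w(1) n(1)] u v w \<tau>(1) by (simp add: T.m_assoc)
        finally show ?thesis using u v w \<tau>(1) by (metis T.m_closed T.right_cancel)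
      next
        case False
        have s1: "\<beta> w u * \<beta> w u = 1" if "w \<in> tc" for w
          by (rule three_perps_cover[OF u v 4(3,4) _ that]) (use False in blast)
        have s2: "\<beta> w v * \<beta> w v = 1" if "w \<in> tc" for w
          by (rule three_perps_cover[OF v u 4(2) _ _ that]) (use False 4 u v in \<open>auto simp: T.m_comm mult.commute\<close>)
        have pres: "\<beta> (\<tau> w) (\<tau> x) = \<beta> w x" if "w \<in> tc" "x \<in> tc" "\<beta> w x * \<beta> w x = 1" for w x
        proof -
          have "inverse (\<beta> w x) = \<beta> w x" using that(3) by (rule inverse_unique)
          thus ?thesis using dich[OF that(1,2)] beta_swap[OF that(1,2)] by auto
        qed
        show ?thesis
        proof (rule beta_determines)
          fix x assume "x \<in> tc"
          then obtain w where w: "w \<in> tc" "x = \<tau> w" using surj by blast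
          have "\<beta> w (u \<otimes> v) * \<beta> w (u \<otimes> v) = (\<beta> w u * \<beta> w u) * (\<beta> w v * \<beta> w v)"
            using w u v by (simp add: beta_mult2 mult_ac)
          hence s3: "\<beta> w (u \<otimes> v) * \<beta> w (u \<otimes> v) = 1" using s1[OF w(1)] s2[OF w(1)] by simp
          have "\<beta> (\<tau> w) (\<tau> (u \<otimes> v)) = \<beta> (\<tau> w) (\<tau> u) * \<beta> (\<tau> w) (\<tau> v)"
            using pres[OF w(1) u s1[OF w(1)]] pres[OF w(1) v s2[OF w(1)]] pres[OF w(1) _ s3] u v w by (simp add: beta_mult2)
          hence "\<beta> (\<tau> w) (\<tau> (u \<otimes> v)) = \<beta> (\<tau> w) (\<tau> u \<otimes> \<tau> v)" using w u v \<tau>(1) by (simp add: beta_mult2)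
          thus "\<beta> (\<tau> (u \<otimes> v)) x = \<beta> (\<tau> u \<otimes> \<tau> v) x"
            using w u v \<tau>(1) beta_swap[of "\<tau> w"] by (metis T.m_closed)
        qed (use u v \<tau>(1) in auto)
      qed
    qed
  qed
  show ?thesis
  proof (rule type_from_alpha[OF f _ \<tau>(1) hom dich])
    fix i j t assume b: "i < k" "j < k" "t \<in> tc" "i \<noteq> j \<or> k = 1"
    hence "i = 0" "j = 0" using k by simp_all
    thus "f ` Cmp i j t = Cmp i j (\<tau> t)" using \<tau>(4)[OF b(3)] by simp
  qed (use k in auto)
qed

lemma gaut_type:
  assumes "gaut f" "elementary_2_group T \<Longrightarrow> k \<ge> 3"
  shows "type0 f \<or> type0 (compose (carrier L) f flip)"
proof -
  consider "k = 1" | "k = 2" | "k \<ge> 3" using k_pos by linarith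
  thus ?thesis
    using gaut_type_one[OF assms(1)] gaut_type_two[OF assms(1)] gaut_type_large[OF assms(1)] assms(2) by cases auto
qed

text \<open>\<open>flip\<close> acts on labels as an involution, so if its composite with
  \<open>f\<close> is described by \<open>\<epsilon> = 0\<close>, then \<open>f\<close> is described
  by \<open>\<epsilon> = 1\<close>.\<close>

lemma gaut_realizes_lab:
  assumes f: "gaut f" and e2: "elementary_2_group T \<Longrightarrow> k \<ge> 3"
  obtains p x \<alpha> \<epsilon> where "bij_betw p {..<k} {..<k}" "\<And>i. i < k \<Longrightarrow> x i \<in> tc" "\<alpha> \<in> Aut" "\<epsilon> \<in> {0, 1}" "realizes f (lab p x \<alpha> \<epsilon>)"
  using gaut_type[OF assms]
proof
  assume "type0 f"
  then obtain p x \<alpha> where "bij_betw p {..<k} {..<k}" "\<And>i. i < k \<Longrightarrow> x i \<in> tc" "\<alpha> \<in> Aut"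
    "realizes f (lab p x \<alpha> 0)" by (auto simp: type0_def)
  thus ?thesis using that by blast
next
  assume "type0 (compose (carrier L) f flip)"
  then obtain p x \<alpha> where h: "bij_betw p {..<k} {..<k}" "\<And>i. i < k \<Longrightarrow> x i \<in> tc" "\<alpha> \<in> Aut"
    "realizes (compose (carrier L) f flip) (lab p x \<alpha> 0)" by (auto simp: type0_def)
  have pk: "p i < k" if "i < k" for i using h(1) that by (auto simp: bij_betw_def)
  have "realizes f (lab p x \<alpha> 1)"
    unfolding realizes_def
  proof
    fix z assume z: "z \<in> lbl"
    have fz: "flip_map z \<in> lbl" using label_map_mem[OF label_map_flip z] .
    have "f ` CmpL z = compose (carrier L) f flip ` CmpL (flip_map z)"
      using z by (cases z) (simp add: flip_map_def comp_flip_image)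
    also have "\<dots> = CmpL (lab p x \<alpha> 0 (flip_map z))" using h(4) fz by (simp add: realizes_def)
    also have "lab p x \<alpha> 0 (flip_map z) = lab p x \<alpha> 1 z" by (rule lab1_eq[symmetric]) (use h pk z in auto)
    finally show "f ` CmpL z = CmpL (lab p x \<alpha> 1 z)" .
  qed
  from that[OF h(1,2,3) _ this] show ?thesis by simp
qed

end

subsection \<open>The Weyl group\<close>

context symplectic_group begin

text \<open>Curried form of \<open>Aut_bar_act\<close>: the map on \<open>T\<close> by which the
  pair acts.\<close>

definition twist where "twist \<alpha> \<epsilon> t = \<alpha> (sigma_act T r a b \<epsilon> t)"

text \<open>An element of \<open>T\<^sup>k\<^sup>-\<^sup>1\<close>, extended by \<open>\<one>\<close>, represents its class in \<open>T\<^sup>k/T\<close>.\<close>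

definition pad :: "nat \<Rightarrow> (nat \<Rightarrow> 'a) \<Rightarrow> nat \<Rightarrow> 'a" where
  "pad k x i = (if i < k then x i else \<one>)"

lemma pad_mem: "x \<in> carrier (group_power T (k - 1)) \<Longrightarrow> 0 < i \<Longrightarrow> pad k x i \<in> carrier T"
  by (auto simp: pad_def group_power_def PiE_iff)

lemma power_identification_eq:
  assumes "x \<in> carrier (group_power T (k - 1))"
  shows "power_identification T k x = (\<lambda>t. \<lambda>i\<in>{1..k}. t \<otimes> pad k x i) ` carrier T"
  unfolding power_identification_def diagonal_def r_coset_def
  by (auto simp: group_power_def pad_def image_image cong: restrict_cong)

lemma power_identification_inj:
  assumes "x \<in> carrier (group_power T (k - 1))" "y \<in> carrier (group_power T (k - 1))" "k \<ge> 1"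
    "power_identification T k x = power_identification T k y"
  shows "x = y"
proof -
  have "(\<lambda>i\<in>{1..k}. \<one> \<otimes> pad k x i) \<in> power_identification T k y"
    unfolding assms(4)[symmetric] power_identification_eq[OF assms(1)] by (rule imageI) simp
  then obtain t where t: "t \<in> carrier T" "(\<lambda>i\<in>{1..k}. \<one> \<otimes> pad k x i) = (\<lambda>i\<in>{1..k}. t \<otimes> pad k y i)"
    unfolding power_identification_eq[OF assms(2)] by blast
  have eq: "pad k x i = t \<otimes> pad k y i" if "i \<in> {1..k}" for i
    using fun_cong[OF t(2), of i] that pad_mem[OF assms(1), of i] by simp
  have "t = \<one>" using eq[of k] assms(3) t(1) by (simp add: pad_def)
  hence "x i = y i" if "i \<in> {1..k - 1}" for i
    using eq[of i] that pad_mem[OF assms(2), of i] by (auto simp: pad_def split: if_splits)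
  thus ?thesis using assms(1,2) unfolding group_power_def carrier_product_group by (intro PiE_ext) auto
qed

text \<open>The action on \<open>T^k/T\<close> is computed on the representative with last
  coordinate \<open>\<one>\<close>. After acting the last coordinate is \<open>y k\<close>, and
  dividing by it restores the normal form.\<close>

lemma reduced_power_act_eq:
  assumes x: "x \<in> carrier (group_power T (k - 1))" and k: "k \<ge> 1" and \<pi>: "\<pi> permutes {1..k}"
    and A: "twist \<alpha> \<epsilon> \<in> hom T T" "twist \<alpha> \<epsilon> ` carrier T = carrier T"
  defines "y \<equiv> \<lambda>i. twist \<alpha> \<epsilon> (pad k x (inv_into UNIV \<pi> i))"
  shows "reduced_power_act T k r a b (\<pi>, \<alpha>, \<epsilon>) x = (\<lambda>i\<in>{1..k - 1}. y i \<otimes> inv (y k))" (is "_ = ?z")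
    and "reduced_power_act T k r a b (\<pi>, \<alpha>, \<epsilon>) x \<in> carrier (group_power T (k - 1))"
proof -
  interpret A: group_hom T T "twist \<alpha> \<epsilon>" by unfold_locales (rule A)
  have \<pi>i: "inv_into UNIV \<pi> i \<in> {1..k}" if "i \<in> {1..k}" for i
    using permutes_in_image[OF permutes_inv[OF \<pi>]] that by simp
  have xm: "pad k x (inv_into UNIV \<pi> i) \<in> carrier T" if "i \<in> {1..k}" for i
    using pad_mem[OF x, of "inv_into UNIV \<pi> i"] \<pi>i[OF that] by simp
  have ym: "y i \<in> carrier T" if "i \<in> {1..k}" for i unfolding y_def using xm[OF that] by simp
  have yk: "y k \<in> carrier T" using ym k by simp
  have z: "?z \<in> carrier (group_power T (k - 1))"
    unfolding group_power_def carrier_product_group using ym yk by auto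
  have pz: "t \<otimes> pad k ?z i = t \<otimes> inv (y k) \<otimes> y i" if "t \<in> carrier T" "i \<in> {1..k}" for t i
  proof (cases "i < k")
    case True
    moreover have "i \<in> {1..k - 1}" using True that by auto
    ultimately show ?thesis using that ym[of i] yk by (simp add: pad_def T.m_ac)
  next
    case False
    hence "i = k" using that by simp
    thus ?thesis using that yk by (simp add: pad_def T.m_assoc)
  qed
  have act: "power_act T k r a b (\<pi>, \<alpha>, \<epsilon>) (\<lambda>i\<in>{1..k}. t \<otimes> pad k x i) = (\<lambda>i\<in>{1..k}. twist \<alpha> \<epsilon> t \<otimes> y i)"
    if t: "t \<in> carrier T" for t
  proof
    fix i
    show "power_act T k r a b (\<pi>, \<alpha>, \<epsilon>) (\<lambda>i\<in>{1..k}. t \<otimes> pad k x i) i = (\<lambda>i\<in>{1..k}. twist \<alpha> \<epsilon> t \<otimes> y i) i"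
    proof (cases "i \<in> {1..k}")
      case True
      hence "power_act T k r a b (\<pi>, \<alpha>, \<epsilon>) (\<lambda>i\<in>{1..k}. t \<otimes> pad k x i) i =
          twist \<alpha> \<epsilon> (t \<otimes> pad k x (inv_into UNIV \<pi> i))"
        using \<pi>i[OF True] by (simp add: power_act_def Aut_bar_act_def twist_def)
      also have "\<dots> = twist \<alpha> \<epsilon> t \<otimes> y i" using A.hom_mult[OF t xm[OF True]] by (simp add: y_def)
      finally show ?thesis using True by simp
    qed (auto simp: power_act_def)
  qed
  have eq: "power_act T k r a b (\<pi>, \<alpha>, \<epsilon>) ` power_identification T k x = power_identification T k ?z"
  proof -
    have "power_act T k r a b (\<pi>, \<alpha>, \<epsilon>) ` power_identification T k x = (\<lambda>t. \<lambda>i\<in>{1..k}. twist \<alpha> \<epsilon> t \<otimes> y i) ` carrier T"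
      unfolding power_identification_eq[OF x] image_image by (rule image_cong[OF refl]) (rule act)
    also have "\<dots> = (\<lambda>t. \<lambda>i\<in>{1..k}. t \<otimes> y i) ` (twist \<alpha> \<epsilon> ` carrier T)" by (simp add: image_image)
    \<comment> \<open>Both sides are all of \<open>T\<close>; running through it shifted by
      \<open>inv (y k)\<close> passes to the normalised representative of the class.\<close>
    also have "twist \<alpha> \<epsilon> ` carrier T = (\<lambda>t. t \<otimes> inv (y k)) ` carrier T"
    proof -
      have "t \<in> (\<lambda>t. t \<otimes> inv (y k)) ` carrier T" if "t \<in> carrier T" for t
        using that yk by (intro image_eqI[of _ _ "t \<otimes> y k"]) (auto simp: T.m_assoc)
      thus ?thesis unfolding A(2) using yk by auto
    qed
    also have "(\<lambda>t. \<lambda>i\<in>{1..k}. t \<otimes> y i) ` \<dots> = power_identification T k ?z"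
      unfolding power_identification_eq[OF z] image_image
      by (intro image_cong[OF refl] restrict_ext) (simp only: pz)
    finally show ?thesis .
  qed
  have inj: "inj_on (power_identification T k) (carrier (group_power T (k - 1)))"
    by (rule inj_onI) (rule power_identification_inj[OF _ _ k])
  show "reduced_power_act T k r a b (\<pi>, \<alpha>, \<epsilon>) x = ?z"
    unfolding reduced_power_act_def eq by (rule inv_into_f_f[OF inj z])
  thus "reduced_power_act T k r a b (\<pi>, \<alpha>, \<epsilon>) x \<in> carrier (group_power T (k - 1))" using z by simp
qed

end

context fine_grading begin

lemma twist_simps: "twist \<alpha> 0 t = \<alpha> t" "\<epsilon> \<noteq> 0 \<Longrightarrow> twist \<alpha> \<epsilon> t = \<alpha> (\<sigma> t)"
  by (simp_all add: twist_def sigma_act_def)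

lemma twist_Aut:
  assumes "\<alpha> \<in> Aut"
  shows "twist \<alpha> \<epsilon> \<in> hom T T" "twist \<alpha> \<epsilon> ` tc = tc"
proof -
  note A = AutD[OF assms]
  show "twist \<alpha> \<epsilon> \<in> hom T T"
    by (cases "\<epsilon> = 0") (auto simp: hom_def twist_simps A)
  have "\<sigma> ` tc = tc"
  proof (intro subset_antisym subsetI)
    fix t assume "t \<in> tc"
    thus "t \<in> \<sigma> ` tc" by (intro image_eqI[of _ _ "\<sigma> t"]) simp_all
  qed auto
  thus "twist \<alpha> \<epsilon> ` tc = tc"
    using bij_betw_imp_surj_on[OF A(2)] by (cases "\<epsilon> = 0") (simp_all add: twist_simps flip: image_image[of \<alpha> \<sigma>])
qed

lemma lab_twist: "lab p x \<alpha> \<epsilon> (i, j, t) =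
    (if \<epsilon> = 0 then (p i, p j, x (p i) \<otimes> twist \<alpha> \<epsilon> t \<otimes> inv (x (p j)))
     else (p j, p i, inv (x (p i) \<otimes> twist \<alpha> \<epsilon> t \<otimes> inv (x (p j)))))"
  by (simp add: lab_def twist_simps)

text \<open>A factor \<open>w\<close> common to all diagonal entries cancels, which is why labels
  depend only on classes in \<open>T^k/T\<close>.\<close>

lemma T_shift:
  assumes "u \<in> tc" "v \<in> tc" "u' \<in> tc" "v' \<in> tc" "s \<in> tc" "w \<in> tc"
  shows "u \<otimes> u' \<otimes> w \<otimes> s \<otimes> inv (v \<otimes> v' \<otimes> w) = u \<otimes> (u' \<otimes> s \<otimes> inv v') \<otimes> inv v"
proof -
  have "u \<otimes> u' \<otimes> w \<otimes> s \<otimes> inv (v \<otimes> v' \<otimes> w) = u \<otimes> (u' \<otimes> s \<otimes> inv v') \<otimes> inv v \<otimes> (w \<otimes> inv w)"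
    using assms by (simp only: T.inv_mult T.m_ac T.m_closed T.inv_closed)
  thus ?thesis using assms by simp
qed

text \<open>The rule for composing label maps is that of the semidirect product, up to a factor
  \<open>w\<close> common to all entries of \<open>x''\<close>; it leaves room for renormalising the
  last coordinate. Two inversions of degrees cancel, whence the sum modulo 2.\<close>

lemma lab_comp:
  assumes \<alpha>: "\<alpha> \<in> Aut" "\<alpha>' \<in> Aut" and \<epsilon>: "\<epsilon> \<in> {0, 1}" "\<epsilon>' \<in> {0, 1}"
    and p: "\<And>i. i < k \<Longrightarrow> p i < k" "\<And>i. i < k \<Longrightarrow> p' i < k"
    and x: "\<And>i. i < k \<Longrightarrow> x i \<in> tc" "\<And>i. i < k \<Longrightarrow> x' i \<in> tc" and w: "w \<in> tc"
    and x'': "\<And>i. i < k \<Longrightarrow> x'' (p i) = x (p i) \<otimes> twist \<alpha> \<epsilon> (x' i) \<otimes> w"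
    and \<alpha>'': "\<And>t. t \<in> tc \<Longrightarrow> \<alpha>'' t = twist \<alpha> \<epsilon> (\<alpha>' (sigma_act T r a b \<epsilon> t))"
    and z: "z \<in> lbl"
  shows "lab (p \<circ> p') x'' \<alpha>'' ((\<epsilon> + \<epsilon>') mod 2) z = lab p x \<alpha> \<epsilon> (lab p' x' \<alpha>' \<epsilon>' z)"
proof -
  obtain i j t where z: "z = (i, j, t)" "i < k" "j < k" "t \<in> tc" using z by (cases z) auto
  interpret A: group_hom T T "twist \<alpha> \<epsilon>" by unfold_locales (rule twist_Aut[OF \<alpha>(1)])
  have tw: "twist \<alpha>'' ((\<epsilon> + \<epsilon>') mod 2) t = twist \<alpha> \<epsilon> (twist \<alpha>' \<epsilon>' t)"
    using \<epsilon> z(4) \<alpha>'' by (auto simp: twist_def sigma_act_def)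
  interpret A': group_hom T T "twist \<alpha>' \<epsilon>'" by unfold_locales (rule twist_Aut[OF \<alpha>(2)])
  define s u v u' v' where "s = twist \<alpha>' \<epsilon>' t" and "u = x (p (p' i))" and "v = x (p (p' j))"
    and "u' = x' (p' i)" and "v' = x' (p' j)"
  have m: "s \<in> tc" "u \<in> tc" "v \<in> tc" "u' \<in> tc" "v' \<in> tc" using z p x by (simp_all add: s_def u_def v_def u'_def v'_def)
  note m = m w
  define q where "q = u' \<otimes> s \<otimes> inv v'"
  define y where "y = twist \<alpha> \<epsilon> q"
  have q: "q \<in> tc" and y: "y \<in> tc" using m by (simp_all add: q_def y_def)
  have iy: "twist \<alpha> \<epsilon> (inv q) = inv y" unfolding y_def by (rule A.hom_inv[OF q])
  have inner: "x' (p' i) \<otimes> twist \<alpha>' \<epsilon>' t \<otimes> inv (x' (p' j)) = q" by (simp add: q_def s_def u'_def v'_def)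
  have "x'' (p (p' i)) \<otimes> twist \<alpha> \<epsilon> s \<otimes> inv (x'' (p (p' j))) =
      u \<otimes> twist \<alpha> \<epsilon> u' \<otimes> w \<otimes> twist \<alpha> \<epsilon> s \<otimes> inv (v \<otimes> twist \<alpha> \<epsilon> v' \<otimes> w)"
    using z p x'' by (simp add: u_def v_def u'_def v'_def)
  also have "\<dots> = u \<otimes> (twist \<alpha> \<epsilon> u' \<otimes> twist \<alpha> \<epsilon> s \<otimes> inv (twist \<alpha> \<epsilon> v')) \<otimes> inv v"
    by (rule T_shift) (use m in auto)
  also have "\<dots> = u \<otimes> y \<otimes> inv v" using m by (simp add: y_def q_def)
  finally have outer: "x'' (p (p' i)) \<otimes> twist \<alpha> \<epsilon> (twist \<alpha>' \<epsilon>' t) \<otimes> inv (x'' (p (p' j))) = u \<otimes> y \<otimes> inv v"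
    by (simp add: s_def)
  have swap: "inv (u \<otimes> y \<otimes> inv v) = v \<otimes> inv y \<otimes> inv u" "inv (v \<otimes> inv y \<otimes> inv u) = u \<otimes> y \<otimes> inv v"
    using m y by (simp_all add: T.inv_mult_group T.m_assoc)
  have L: "lab (p \<circ> p') x'' \<alpha>'' ((\<epsilon> + \<epsilon>') mod 2) z = (if (\<epsilon> + \<epsilon>') mod 2 = 0 then (p (p' i), p (p' j), u \<otimes> y \<otimes> inv v)
      else (p (p' j), p (p' i), v \<otimes> inv y \<otimes> inv u))"
    unfolding z(1) lab_twist tw o_apply outer swap ..
  have R: "lab p' x' \<alpha>' \<epsilon>' z = (if \<epsilon>' = 0 then (p' i, p' j, q) else (p' j, p' i, inv q))"
    unfolding z(1) lab_twist inner ..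
  have h1: "lab p x \<alpha> \<epsilon> (p' i, p' j, q) = (if \<epsilon> = 0 then (p (p' i), p (p' j), u \<otimes> y \<otimes> inv v)
      else (p (p' j), p (p' i), v \<otimes> inv y \<otimes> inv u))"
    unfolding lab_twist y_def[symmetric] u_def[symmetric] v_def[symmetric] swap ..
  have h2: "lab p x \<alpha> \<epsilon> (p' j, p' i, inv q) = (if \<epsilon> = 0 then (p (p' j), p (p' i), v \<otimes> inv y \<otimes> inv u)
      else (p (p' i), p (p' j), u \<otimes> y \<otimes> inv v))"
    unfolding lab_twist iy u_def[symmetric] v_def[symmetric] swap ..
  have "lab p x \<alpha> \<epsilon> (lab p' x' \<alpha>' \<epsilon>' z) =
      (if (\<epsilon> = 0) = (\<epsilon>' = 0) then (p (p' i), p (p' j), u \<otimes> y \<otimes> inv v) else (p (p' j), p (p' i), v \<otimes> inv y \<otimes> inv u))"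
    unfolding R if_distrib[of "lab p x \<alpha> \<epsilon>"] h1 h2 by simp
  moreover have "(\<epsilon> + \<epsilon>') mod 2 = 0 \<longleftrightarrow> (\<epsilon> = 0) = (\<epsilon>' = 0)" using \<epsilon> by auto
  ultimately show ?thesis using L by simp
qed

text \<open>Labels of identity degree are treated apart because their component may be zero; the
  last claim says that no other label is sent there.\<close>

lemma lab_shape:
  assumes \<alpha>: "\<alpha> \<in> Aut" and p: "bij_betw p {..<k} {..<k}" and x: "\<And>i. i < k \<Longrightarrow> x i \<in> tc"
    and b: "i < k" "j < k" "t \<in> tc" and lab: "lab p x \<alpha> \<epsilon> (i, j, t) = (h, q, s)"
  shows "h < k" "q < k" "s \<in> tc" "h = q \<longleftrightarrow> i = j" "i \<noteq> j \<or> t \<noteq> \<one> \<Longrightarrow> h \<noteq> q \<or> s \<noteq> \<one>"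
proof -
  interpret A: group_hom T T "twist \<alpha> \<epsilon>" by unfold_locales (rule twist_Aut[OF \<alpha>])
  have pk: "p i < k" "p j < k" "p i = p j \<longleftrightarrow> i = j"
    using b bij_betwE[OF p] inj_on_eq_iff[OF bij_betw_imp_inj_on[OF p]] by simp_all
  define y where "y = x (p i) \<otimes> twist \<alpha> \<epsilon> t \<otimes> inv (x (p j))"
  note m = x[OF pk(1)] x[OF pk(2)] A.hom_closed[OF b(3)]
  have y: "y \<in> tc" unfolding y_def using m by (intro T.m_closed T.inv_closed)
  have hqs: "(h, q, s) = (if \<epsilon> = 0 then (p i, p j, y) else (p j, p i, inv y))"
    using lab unfolding lab_twist y_def by (rule sym)
  show "h < k" "q < k" "s \<in> tc" "h = q \<longleftrightarrow> i = j" using hqs pk y by (auto split: if_splits)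
  assume nz: "i \<noteq> j \<or> t \<noteq> \<one>"
  show "h \<noteq> q \<or> s \<noteq> \<one>"
  proof (rule ccontr)
    assume n: "\<not> ?thesis"
    hence ij: "i = j" using \<open>h = q \<longleftrightarrow> i = j\<close> by simp
    have "y = twist \<alpha> \<epsilon> t" unfolding y_def ij using m(2,3) by (simp add: T.m_comm[of "x (p j)"] T.m_assoc)
    moreover have "y = s \<or> inv y = s" using hqs by (auto split: if_splits)
    hence "y = \<one>" using n T.inv_eq_1_iff[OF y] by auto
    ultimately have "twist \<alpha> \<epsilon> t = twist \<alpha> \<epsilon> \<one>" using A.hom_one by simp
    moreover have "inj_on (twist \<alpha> \<epsilon>) tc"
      by (rule eq_card_imp_inj_on[OF finite_T]) (simp add: twist_Aut(2)[OF \<alpha>])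
    ultimately have "t = \<one>" using inj_onD b(3) T.one_closed by metis
    thus False using nz ij by simp
  qed
qed

text \<open>Off the diagonal, or for \<open>k = 1\<close>, a nonzero component determines its label,
  so both maps agree there. If the signs differed, then \<open>k \<le> 2\<close> and one twist would
  be the inverse of the other, although one preserves and the other reverses \<beta>; hence \<beta>
  would be symmetric and \<open>T\<close> an elementary 2-group. The condition on the last entry
  selects one representative of each class in \<open>T^k/T\<close>.\<close>

lemma lab_faithful:
  assumes e2: "elementary_2_group T \<Longrightarrow> k \<ge> 3"
    and \<alpha>: "\<alpha> \<in> Aut" "\<alpha>' \<in> Aut" and \<epsilon>: "\<epsilon> \<in> {0, 1}" "\<epsilon>' \<in> {0, 1}"
    and p: "bij_betw p {..<k} {..<k}" "bij_betw p' {..<k} {..<k}"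
    and x: "\<And>i. i < k \<Longrightarrow> x i \<in> tc" "\<And>i. i < k \<Longrightarrow> x' i \<in> tc"
    and norm: "x (k - 1) = \<one>" "x' (k - 1) = \<one>"
    and f: "realizes f (lab p x \<alpha> \<epsilon>)" "realizes f (lab p' x' \<alpha>' \<epsilon>')"
  shows "\<epsilon> = \<epsilon>'" "\<alpha> = \<alpha>'" "\<And>i. i < k \<Longrightarrow> p i = p' i" "\<And>i. i < k \<Longrightarrow> x i = x' i"
proof -
  have k0: "0 < k" "k - 1 < k" using k_pos by auto
  have pk: "p i < k" "p i = p j \<longleftrightarrow> i = j" "p' i < k" "p' i = p' j \<longleftrightarrow> i = j" if "i < k" "j < k" for i j
    using that bij_betwE[OF p(1)] bij_betwE[OF p(2)] inj_on_eq_iff[OF bij_betw_imp_inj_on[OF p(1)]]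
      inj_on_eq_iff[OF bij_betw_imp_inj_on[OF p(2)]] by simp_all
  have tw: "twist \<alpha> \<epsilon> t \<in> tc" "twist \<alpha>' \<epsilon>' t \<in> tc" if "t \<in> tc" for t
    by (rule hom_in_carrier[OF twist_Aut(1)[OF \<alpha>(1)] that], rule hom_in_carrier[OF twist_Aut(1)[OF \<alpha>(2)] that])
  have tw1: "twist \<alpha> \<epsilon> \<one> = \<one>" "twist \<alpha>' \<epsilon>' \<one> = \<one>"
    using AutD(6) \<alpha> by (simp_all add: twist_def sigma_act_def)
  have conj: "y \<otimes> t \<otimes> inv y = t" if "y \<in> tc" "t \<in> tc" for y t
    using that by (simp add: T.m_comm[of y t] T.m_assoc)
  have eq: "lab p x \<alpha> \<epsilon> (i, j, t) = lab p' x' \<alpha>' \<epsilon>' (i, j, t)"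
    if b: "i < k" "j < k" "t \<in> tc" "i \<noteq> j \<or> k = 1" for i j t
  proof -
    note xm = x(1)[OF pk(1)[OF b(1,2)]] x(1)[OF pk(1)[OF b(2,1)]] x(2)[OF pk(3)[OF b(1,2)]] x(2)[OF pk(3)[OF b(2,1)]]
    show ?thesis
    proof (cases "i = j \<and> t = \<one>")
      case True
      have "p i = p' i" using pk[OF b(1,1)] b(4) True by auto
      moreover have "j = i" "t = \<one>" using True by auto
      ultimately show ?thesis using xm(2,4) unfolding lab_twist by (simp only: tw1) simp
    next
      case False
      define z where "z = lab p x \<alpha> \<epsilon> (i, j, t)"
      define z' where "z' = lab p' x' \<alpha>' \<epsilon>' (i, j, t)"
      obtain h q s h' q' s' where zz: "z = (h, q, s)" "z' = (h', q', s')" by (metis prod_cases3)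
      have m: "h < k" "q < k" "s \<in> tc" "h = q \<longleftrightarrow> i = j" "h \<noteq> q \<or> s \<noteq> \<one>"
        using lab_shape[of \<alpha> p x i j t \<epsilon> h q s] \<alpha>(1) p(1) x(1) b(1-3) False zz(1) unfolding z_def by blast+
      have m': "h' < k" "q' < k" "s' \<in> tc" "h' = q' \<longleftrightarrow> i = j"
        using lab_shape[of \<alpha>' p' x' i j t \<epsilon>' h' q' s'] \<alpha>(2) p(2) x(2) b(1-3) zz(2) unfolding z'_def by blast+
      have l: "(i, j, t) \<in> lbl" using b by simp
      have im: "f ` Cmp i j t = Cmp h q s" "f ` Cmp i j t = Cmp h' q' s'"
        using f[unfolded realizes_def, THEN bspec, OF l] zz by (simp_all add: z_def z'_def)
      have "same h q s h' q' s'"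
        by (rule Cmp_inject[OF m(1-3) m'(1-3) _ Cmp_nz[OF m(1-3,5)]]) (use im in simp)
      hence "z = z'" using zz m m' b(4) by (auto simp: same_def)
      thus ?thesis by (simp add: z_def z'_def)
    qed
  qed
  have last: "0 \<noteq> k - 1 \<or> k = 1" using k_pos by auto
  have tc_eq: "u = u' \<and> twist \<alpha> \<epsilon> t = twist \<alpha>' \<epsilon>' t"
    if "t \<in> tc" "\<epsilon> = \<epsilon>'" "i < k" "j < k" "i \<noteq> j \<or> k = 1" and u: "u = x (p i) \<otimes> inv (x (p j))" "u' = x' (p' i) \<otimes> inv (x' (p' j))"
    for t i j u u'
  proof -
    note xm = x(1)[OF pk(1)[OF that(3,4)]] x(1)[OF pk(1)[OF that(4,3)]] x(2)[OF pk(3)[OF that(3,4)]] x(2)[OF pk(3)[OF that(4,3)]]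
    have cm: "x (p i) \<otimes> s \<otimes> inv (x (p j)) = u \<otimes> s" "x' (p' i) \<otimes> s \<otimes> inv (x' (p' j)) = u' \<otimes> s" if "s \<in> tc" for s
      using xm that u by (simp_all add: T.m_ac)
    have um: "u \<in> tc" "u' \<in> tc" using xm u by auto
    have *: "u \<otimes> twist \<alpha> \<epsilon> s = u' \<otimes> twist \<alpha>' \<epsilon>' s" if s: "s \<in> tc" for s
    proof -
      have "lab p x \<alpha> \<epsilon> (i, j, s) = lab p' x' \<alpha>' \<epsilon>' (i, j, s)" using eq s \<open>i < k\<close> \<open>j < k\<close> \<open>i \<noteq> j \<or> k = 1\<close> by blast
      thus ?thesis unfolding lab_twist cm[OF tw(1)[OF s]] cm[OF tw(2)[OF s]]
        using \<open>\<epsilon> = \<epsilon>'\<close> um tw[OF s] by (auto split: if_splits)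
    qed
    have "u = u'" using *[OF T.one_closed] tw1 um by simp
    thus ?thesis using *[OF \<open>t \<in> tc\<close>] um tw[OF \<open>t \<in> tc\<close>] by simp
  qed
  show \<epsilon>eq: "\<epsilon> = \<epsilon>'"
  proof (rule ccontr)
    assume ne: "\<epsilon> \<noteq> \<epsilon>'"
    hence e: "\<epsilon> = 0 \<and> \<epsilon>' \<noteq> 0 \<or> \<epsilon> \<noteq> 0 \<and> \<epsilon>' = 0" using \<epsilon> by auto
    have cross: "p i = p' j \<and> p j = p' i" if "i < k" "j < k" "i \<noteq> j \<or> k = 1" for i j
      using eq[OF that(1,2) T.one_closed that(3)] e by (auto simp: lab_twist)
    \<comment> \<open>With crossed indices \<open>p 0\<close> would be the value of
      \<open>p'\<close> at both 1 and 2, against injectivity.\<close>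
    have "\<not> k \<ge> 3"
    proof
      assume "k \<ge> 3"
      hence "p' 1 = p' 2" using cross[of 0 1] cross[of 0 2] by simp
      thus False using pk[of 1 2] \<open>k \<ge> 3\<close> by simp
    qed
    hence ne2: "\<not> elementary_2_group T" using e2 by blast
    define i j where "i = (0::nat)" and "j = k - 1"
    have b: "i < k" "j < k" "i \<noteq> j \<or> k = 1" using k0 last by (auto simp: i_def j_def)
    define u u' where "u = x (p i) \<otimes> inv (x (p j))" and "u' = x' (p' i) \<otimes> inv (x' (p' j))"
    note xm = x(1)[OF pk(1)[OF b(1,2)]] x(1)[OF pk(1)[OF b(2,1)]] x(2)[OF pk(3)[OF b(1,2)]] x(2)[OF pk(3)[OF b(2,1)]]
    have cm: "x (p i) \<otimes> s \<otimes> inv (x (p j)) = u \<otimes> s" "x' (p' i) \<otimes> s \<otimes> inv (x' (p' j)) = u' \<otimes> s" if "s \<in> tc" for s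
      using xm that by (simp_all add: u_def u'_def T.m_ac)
    have um: "u \<in> tc" "u' \<in> tc" using xm by (auto simp: u_def u'_def)
    have *: "u \<otimes> twist \<alpha> \<epsilon> s = inv (u' \<otimes> twist \<alpha>' \<epsilon>' s)" if s: "s \<in> tc" for s
    proof -
      have "u \<otimes> twist \<alpha> \<epsilon> s = inv (u' \<otimes> twist \<alpha>' \<epsilon>' s) \<or> inv (u \<otimes> twist \<alpha> \<epsilon> s) = u' \<otimes> twist \<alpha>' \<epsilon>' s"
        using eq[OF b(1,2) s b(3)] e unfolding lab_twist cm[OF tw(1)[OF s]] cm[OF tw(2)[OF s]] by auto
      thus ?thesis using um tw[OF s] by (metis T.inv_inv T.m_closed)
    qed
    have "u = inv u'" using *[OF T.one_closed] tw1 um by simp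
    hence inv_tw: "twist \<alpha> \<epsilon> s = inv (twist \<alpha>' \<epsilon>' s)" if "s \<in> tc" for s
      using *[OF that] um tw[OF that] by (simp add: T.inv_mult)
    have sq: "\<beta> s t = \<beta> t s" if st: "s \<in> tc" "t \<in> tc" for s t
    proof -
      have pres: "\<beta> (twist \<gamma> 0 s) (twist \<gamma> 0 t) = \<beta> s t" "\<eta> \<noteq> 0 \<Longrightarrow> \<beta> (twist \<gamma> \<eta> s) (twist \<gamma> \<eta> t) = \<beta> t s"
        if "\<gamma> \<in> Aut" for \<gamma> and \<eta> :: int
        using AutD(4)[OF that] st beta_sigma by (simp_all add: twist_simps)
      have "\<beta> (twist \<alpha> \<epsilon> s) (twist \<alpha> \<epsilon> t) = \<beta> (twist \<alpha>' \<epsilon>' s) (twist \<alpha>' \<epsilon>' t)"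
        using inv_tw st tw by (simp add: beta_inv1 beta_inv2)
      thus ?thesis using e pres[OF \<alpha>(1)] pres[OF \<alpha>(2)] by auto
    qed
    have "t \<otimes> t = \<one>" if t: "t \<in> tc" for t
    proof (rule ccontr)
      assume "t \<otimes> t \<noteq> \<one>"
      then obtain y where y: "y \<in> tc" "\<beta> (t \<otimes> t) y \<noteq> 1" using beta_nondeg t by (metis T.m_closed)
      have "\<beta> t y = inverse (\<beta> t y)" using sq[OF t y(1)] beta_swap[OF t y(1)] by simp
      hence "\<beta> t y * \<beta> t y = 1" using beta_nz[OF t y(1)] by (metis right_inverse)
      thus False using y t by (simp add: beta_mult1)
    qed
    thus False using ne2 by (simp add: elementary_2_group_def)
  qed
  show peq: "p i = p' i" if "i < k" for i
  proof (cases "k = 1")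
    case True
    thus ?thesis using pk(1,3)[OF that that] by simp
  next
    case False
    define j where "j = (if i = 0 then 1 else 0 :: nat)"
    have "j < k" "i \<noteq> j" using False k_pos by (auto simp: j_def)
    thus ?thesis using eq[OF that _ T.one_closed, of j] \<epsilon>eq by (auto simp: lab_twist split: if_splits)
  qed
  have tweq: "twist \<alpha> \<epsilon> t = twist \<alpha>' \<epsilon> t" if "t \<in> tc" for t
    using tc_eq[OF that \<epsilon>eq k0(1) k0(2) last refl refl] \<epsilon>eq by simp
  show "\<alpha> = \<alpha>'"
  proof (rule extensionalityI)
    show "\<alpha> \<in> extensional tc" "\<alpha>' \<in> extensional tc" using \<alpha> by (auto simp: Aut_iff auto_def Bij_def)
    fix t assume t: "t \<in> tc"
    show "\<alpha> t = \<alpha>' t"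
    proof (cases "\<epsilon> = 0")
      case True
      thus ?thesis using tweq[OF t] by (simp add: twist_simps)
    next
      case False
      thus ?thesis using tweq[of "\<sigma> t"] t by (simp add: twist_simps)
    qed
  qed
  show "x i = x' i" if "i < k" for i
  proof (cases "i = k - 1")
    case False
    have "i \<in> p ` {..<k}" "k - 1 \<in> p ` {..<k}" unfolding bij_betw_imp_surj_on[OF p(1)] using that k0 by simp_all
    then obtain h q where hq: "h < k" "p h = i" "q < k" "p q = k - 1" by (elim imageE) auto
    have "h \<noteq> q \<or> k = 1" using hq False by auto
    from tc_eq[OF T.one_closed \<epsilon>eq hq(1,3) this refl refl] show ?thesis
      using hq peq[OF hq(1)] peq[OF hq(3)] norm x[OF that] by simp
  next
    case True
    show ?thesis unfolding True norm ..
  qed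
qed

end

section \<open>The semidirect product acting on labels\<close>

context fine_grading begin

abbreviation S where
  "S \<equiv> semidirect (group_power T (k - 1)) (sym_group k \<times>\<times> Aut_bar T \<beta> r a b) (reduced_power_act T k r a b)"

text \<open>Permutations and powers in the statement are indexed by \<open>{1..k}\<close> and labels
  by \<open>{..<k}\<close>, hence the shifts by one. Padding with \<open>\<one>\<close> picks a
  representative in \<open>T^k\<close>.\<close>

definition act where
  "act = (\<lambda>(x, \<pi>, \<alpha>, \<epsilon>). lab (\<lambda>i. \<pi> (Suc i) - 1) (\<lambda>i. pad k x (Suc i)) \<alpha> \<epsilon>)"

lemma S_carrier: "(x, \<pi>, \<alpha>, \<epsilon>) \<in> carrier S \<longleftrightarrow>
    x \<in> carrier (group_power T (k - 1)) \<and> \<pi> permutes {1..k} \<and> \<alpha> \<in> Aut \<and> \<epsilon> \<in> {0, 1}"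
  by (auto simp: semidirect_def sym_group_def Aut_bar_def carrier_integer_mod_group simp del: carrier_product_group)

lemma S_mult:
  assumes "\<alpha> \<in> Aut" "\<alpha>'' \<in> Aut" "\<alpha>'' = (\<lambda>t\<in>tc. sigma_act T r a b \<epsilon> (\<alpha>' (sigma_act T r a b \<epsilon> t)))"
  shows "(x, \<pi>, \<alpha>, \<epsilon>) \<otimes>\<^bsub>S\<^esub> (x', \<pi>', \<alpha>', \<epsilon>') =
    ((\<lambda>i\<in>{1..k - 1}. x i \<otimes> reduced_power_act T k r a b (\<pi>, \<alpha>, \<epsilon>) x' i), \<pi> \<circ> \<pi>', compose tc \<alpha> \<alpha>'', (\<epsilon> + \<epsilon>') mod 2)"
  using assms by (simp add: semidirect_def Aut_bar_def sym_group_def group_power_def product_group_def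
    Aut_form_def AutoGroup_def BijGroup_def auto_def)

lemma S_one: "\<one>\<^bsub>S\<^esub> = ((\<lambda>i\<in>{1..k - 1}. \<one>), id, (\<lambda>t\<in>tc. t), 0)"
  by (simp add: semidirect_def Aut_bar_def sym_group_def group_power_def product_group_def
    Aut_form_def AutoGroup_def BijGroup_def DirProd_def)

lemma shifted_perm:
  assumes "\<pi> permutes {1..k}"
  shows "bij_betw (\<lambda>i. \<pi> (Suc i) - 1) {..<k} {..<k}" "\<And>i. i < k \<Longrightarrow> Suc (\<pi> (Suc i) - 1) = \<pi> (Suc i)"
    "\<And>i. i < k \<Longrightarrow> \<pi> (Suc i) \<in> {1..k}"
proof -
  show m: "\<pi> (Suc i) \<in> {1..k}" if "i < k" for i
    using permutes_in_image[OF assms, of "Suc i"] that by simp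
  show s: "Suc (\<pi> (Suc i) - 1) = \<pi> (Suc i)" if "i < k" for i using m[OF that] by simp
  have inj: "inj_on (\<lambda>i. \<pi> (Suc i) - 1) {..<k}"
  proof (rule inj_onI)
    fix i j assume ij: "i \<in> {..<k}" "j \<in> {..<k}" "\<pi> (Suc i) - 1 = \<pi> (Suc j) - 1"
    hence "\<pi> (Suc i) = \<pi> (Suc j)" using s[of i] s[of j] by simp
    thus "i = j" using permutes_inj[OF assms] by (simp add: inj_eq)
  qed
  moreover have "(\<lambda>i. \<pi> (Suc i) - 1) ` {..<k} \<subseteq> {..<k}" using m by fastforce
  ultimately show "bij_betw (\<lambda>i. \<pi> (Suc i) - 1) {..<k} {..<k}"
    using endo_inj_surj[of "{..<k}"] by (simp add: bij_betw_def)
qed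

lemma S_mult_carrier:
  assumes s: "s \<in> carrier S" and s': "s' \<in> carrier S"
  shows "s \<otimes>\<^bsub>S\<^esub> s' \<in> carrier S" "\<And>z. z \<in> lbl \<Longrightarrow> act (s \<otimes>\<^bsub>S\<^esub> s') z = act s (act s' z)"
proof -
  obtain x \<pi> \<alpha> \<epsilon> where e: "s = (x, \<pi>, \<alpha>, \<epsilon>)" by (metis prod_cases4)
  obtain x' \<pi>' \<alpha>' \<epsilon>' where e': "s' = (x', \<pi>', \<alpha>', \<epsilon>')" by (metis prod_cases4)
  have h: "x \<in> carrier (group_power T (k - 1))" "\<pi> permutes {1..k}" "\<alpha> \<in> Aut" "\<epsilon> \<in> {0, 1}"
    using s unfolding e S_carrier by blast+
  have h': "x' \<in> carrier (group_power T (k - 1))" "\<pi>' permutes {1..k}" "\<alpha>' \<in> Aut" "\<epsilon>' \<in> {0, 1}"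
    using s' unfolding e' S_carrier by blast+
  define \<gamma> where "\<gamma> t = sigma_act T r a b \<epsilon> (\<alpha>' (sigma_act T r a b \<epsilon> t))" for t
  \<comment> \<open>Conjugation by \<sigma> reverses \<beta> twice and so keeps isometries.\<close>
  have \<gamma>: "restrict \<gamma> tc \<in> Aut"
    by (rule AutI) (cases "\<epsilon> = 0"; simp add: \<gamma>_def sigma_act_def AutD[OF h'(3)] beta_sigma)+
  have \<gamma>c: "\<gamma> t \<in> tc" if "t \<in> tc" for t using AutD(3)[OF \<gamma> that] that by simp
  have \<alpha>\<gamma>: "compose tc \<alpha> (restrict \<gamma> tc) \<in> Aut"
    unfolding compose_def using AutD[OF h(3)] AutD[OF \<gamma>] by (intro AutI) simp_all
  define y where "y i = twist \<alpha> \<epsilon> (pad k x' (inv_into UNIV \<pi> i))" for i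
  note R = reduced_power_act_eq[OF h'(1) k_pos h(2) twist_Aut[OF h(3)], of \<epsilon>, folded y_def]
  define x'' where "x'' = (\<lambda>i\<in>{1..k - 1}. x i \<otimes> reduced_power_act T k r a b (\<pi>, \<alpha>, \<epsilon>) x' i)"
  have x'': "x'' \<in> carrier (group_power T (k - 1))"
    using h(1) R(2) unfolding x''_def group_power_def carrier_product_group by (simp add: PiE_iff)
  have m: "s \<otimes>\<^bsub>S\<^esub> s' = (x'', \<pi> \<circ> \<pi>', compose tc \<alpha> (restrict \<gamma> tc), (\<epsilon> + \<epsilon>') mod 2)"
    unfolding e e' x''_def by (rule S_mult[OF h(3) \<gamma>]) (rule restrict_ext, simp add: \<gamma>_def)
  have "(\<epsilon> + \<epsilon>') mod 2 \<in> {0, 1}" using h(4) h'(4) by auto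
  thus "s \<otimes>\<^bsub>S\<^esub> s' \<in> carrier S"
    unfolding m S_carrier using x'' \<alpha>\<gamma> permutes_compose[OF h'(2) h(2)] by blast
  fix z assume z: "z \<in> lbl"
  note P = shifted_perm[OF h(2)] and P' = shifted_perm[OF h'(2)]
  let ?p = "\<lambda>i. \<pi> (Suc i) - 1" and ?p' = "\<lambda>i. \<pi>' (Suc i) - 1"
  have yk: "y k \<in> tc" "inv (y k) \<in> tc"
  proof -
    have "inv_into UNIV \<pi> k \<in> {1..k}" using permutes_in_image[OF permutes_inv[OF h(2)], of k] k_pos by simp
    thus "y k \<in> tc" unfolding y_def using hom_in_carrier[OF twist_Aut(1)[OF h(3)] pad_mem[OF h'(1)]] by simp
    thus "inv (y k) \<in> tc" by simp
  qed
  have act_eq: "act (s \<otimes>\<^bsub>S\<^esub> s') z =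
      lab (?p \<circ> ?p') (\<lambda>i. pad k x'' (Suc i)) (compose tc \<alpha> (restrict \<gamma> tc)) ((\<epsilon> + \<epsilon>') mod 2) z"
  proof -
    obtain i j t where "z = (i, j, t)" "i < k" "j < k" using z by (cases z) auto
    thus ?thesis unfolding m using P'(2) by (simp add: act_def lab_def)
  qed
  also have "\<dots> = lab ?p (\<lambda>i. pad k x (Suc i)) \<alpha> \<epsilon> (lab ?p' (\<lambda>i. pad k x' (Suc i)) \<alpha>' \<epsilon>' z)"
  \<comment> \<open>The common factor is \<open>inv (y k)\<close>, by which
    \<open>reduced_power_act\<close> renormalises the last coordinate.\<close>
  proof (rule lab_comp[OF h(3) h'(3) h(4) h'(4) _ _ _ _ yk(2) _ _ z])
    show "?p i < k" "?p' i < k" if "i < k" for i using P(3)[OF that] P'(3)[OF that] by auto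
    show "pad k x (Suc i) \<in> tc" "pad k x' (Suc i) \<in> tc" if "i < k" for i
      using pad_mem[OF h(1)] pad_mem[OF h'(1)] by simp_all
    show "compose tc \<alpha> (restrict \<gamma> tc) t = twist \<alpha> \<epsilon> (\<alpha>' (sigma_act T r a b \<epsilon> t))" if "t \<in> tc" for t
      using that by (simp add: compose_def twist_def \<gamma>_def)
    fix i assume i: "i < k"
    define l where "l = \<pi> (Suc i)"
    have l: "l \<in> {1..k}" "Suc (?p i) = l" using P(2,3)[OF i] by (auto simp: l_def)
    have yl: "y l = twist \<alpha> \<epsilon> (pad k x' (Suc i))"
      unfolding y_def l_def using permutes_inverses(2)[OF h(2)] by simp
    have ylc: "y l \<in> tc" unfolding yl using hom_in_carrier[OF twist_Aut(1)[OF h(3)] pad_mem[OF h'(1)]] by simp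
    have "pad k x'' l = pad k x l \<otimes> y l \<otimes> inv (y k)"
    proof (cases "l < k")
      case True
      hence "l \<in> {1..k - 1}" using l by auto
      moreover have "x l \<in> tc" using pad_mem[OF h(1), of l] True l by (simp add: pad_def)
      ultimately show ?thesis using True ylc yk by (simp add: pad_def x''_def R(1) T.m_assoc)
    next
      case False
      hence "l = k" using l by simp
      thus ?thesis using yk by (simp add: pad_def)
    qed
    thus "pad k x'' (Suc (?p i)) = pad k x (Suc (?p i)) \<otimes> twist \<alpha> \<epsilon> (pad k x' (Suc i)) \<otimes> inv (y k)"
      unfolding l(2) yl .
  qed
  finally show "act (s \<otimes>\<^bsub>S\<^esub> s') z = act s (act s' z)" by (simp add: e e' act_def)
qed

lemma act_one: "z \<in> lbl \<Longrightarrow> act \<one>\<^bsub>S\<^esub> z = z"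
proof -
  have "pad k (\<lambda>i\<in>{1..k - 1}. \<one>) (Suc i) = \<one>" for i by (auto simp: pad_def)
  thus "z \<in> lbl \<Longrightarrow> act \<one>\<^bsub>S\<^esub> z = z" unfolding S_one act_def by (cases z) (simp add: lab_def)
qed

lemma act_mem:
  assumes "s \<in> carrier S" "z \<in> lbl" shows "act s z \<in> lbl"
proof -
  obtain x \<pi> \<alpha> \<epsilon> where e: "s = (x, \<pi>, \<alpha>, \<epsilon>)" by (metis prod_cases4)
  have h: "x \<in> carrier (group_power T (k - 1))" "\<pi> permutes {1..k}" "\<alpha> \<in> Aut"
    using assms(1) unfolding e S_carrier by blast+
  obtain i j t where z: "z = (i, j, t)" "i < k" "j < k" "t \<in> tc" using assms(2) by (cases z) auto
  obtain h' q s' where l: "act s z = (h', q, s')" by (metis prod_cases3)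
  show ?thesis using lab_shape(1-3)[OF h(3) shifted_perm(1)[OF h(2)] _ z(2-4) l[unfolded e act_def z(1) prod.case]]
    pad_mem[OF h(1)] unfolding l by simp
qed

lemma act_faithful:
  assumes e2: "elementary_2_group T \<Longrightarrow> k \<ge> 3"
    and s: "s \<in> carrier S" "s' \<in> carrier S" and f: "realizes f (act s)" "realizes f (act s')"
  shows "s = s'"
proof -
  obtain x \<pi> \<alpha> \<epsilon> where e: "s = (x, \<pi>, \<alpha>, \<epsilon>)" by (metis prod_cases4)
  obtain x' \<pi>' \<alpha>' \<epsilon>' where e': "s' = (x', \<pi>', \<alpha>', \<epsilon>')" by (metis prod_cases4)
  have h: "x \<in> carrier (group_power T (k - 1))" "\<pi> permutes {1..k}" "\<alpha> \<in> Aut" "\<epsilon> \<in> {0, 1}"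
    using s(1) unfolding e S_carrier by blast+
  have h': "x' \<in> carrier (group_power T (k - 1))" "\<pi>' permutes {1..k}" "\<alpha>' \<in> Aut" "\<epsilon>' \<in> {0, 1}"
    using s(2) unfolding e' S_carrier by blast+
  define p q u v where "p = (\<lambda>i. \<pi> (Suc i) - 1)" and "q = (\<lambda>i. \<pi>' (Suc i) - 1)"
    and "u = (\<lambda>i. pad k x (Suc i))" and "v = (\<lambda>i. pad k x' (Suc i))"
  note defs = p_def q_def u_def v_def
  have "u i \<in> tc" "v i \<in> tc" for i using pad_mem[OF h(1)] pad_mem[OF h'(1)] by (simp_all add: defs)
  moreover have "u (k - 1) = \<one>" "v (k - 1) = \<one>" using k_pos by (simp_all add: defs pad_def)
  moreover have "bij_betw p {..<k} {..<k}" "bij_betw q {..<k} {..<k}"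
    using shifted_perm(1)[OF h(2)] shifted_perm(1)[OF h'(2)] by (simp_all add: defs)
  moreover have "realizes f (lab p u \<alpha> \<epsilon>)" "realizes f (lab q v \<alpha>' \<epsilon>')" using f by (simp_all add: e e' act_def defs)
  ultimately have F: "\<epsilon> = \<epsilon>'" "\<alpha> = \<alpha>'" "\<And>i. i < k \<Longrightarrow> p i = q i" "\<And>i. i < k \<Longrightarrow> u i = v i"
    using lab_faithful[of \<alpha> \<alpha>' \<epsilon> \<epsilon>' p q u v f] e2 h(3,4) h'(3,4) by blast+
  have "\<pi> i = \<pi>' i" for i
  proof (cases "i \<in> {1..k}")
    case True
    then obtain j where j: "i = Suc j" "j < k" by (cases i) auto
    have "\<pi> i - 1 = \<pi>' i - 1" using F(3)[OF j(2)] by (simp add: j(1) defs)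
    thus ?thesis using shifted_perm(2)[OF h(2) j(2)] shifted_perm(2)[OF h'(2) j(2)] j(1) by metis
  next
    case False
    thus ?thesis using permutes_not_in[OF h(2) False] permutes_not_in[OF h'(2) False] by simp
  qed
  moreover have "x = x'"
  proof (rule PiE_ext[OF h(1)[unfolded group_power_def carrier_product_group] h'(1)[unfolded group_power_def carrier_product_group]])
    fix i assume i: "i \<in> {1..k - 1}"
    then obtain j where j: "i = Suc j" "j < k" "i < k" by (cases i) auto
    show "x i = x' i" using F(4)[OF j(2)] j by (simp add: pad_def defs)
  qed
  ultimately show ?thesis using F(1,2) unfolding e e' by auto
qed

lemma act_gaut:
  assumes "s \<in> carrier S" obtains f where "gaut f" "realizes f (act s)"
proof -
  obtain x \<pi> \<alpha> \<epsilon> where e: "s = (x, \<pi>, \<alpha>, \<epsilon>)" by (metis prod_cases4)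
  have h: "x \<in> carrier (group_power T (k - 1))" "\<pi> permutes {1..k}" "\<alpha> \<in> Aut"
    using assms unfolding e S_carrier by blast+
  have pm: "pad k x (Suc i) \<in> tc" for i using pad_mem[OF h(1)] by simp
  obtain f where "gaut f" "realizes f (lab (\<lambda>i. \<pi> (Suc i) - 1) (\<lambda>i. pad k x (Suc i)) \<alpha> \<epsilon>)"
    by (rule lab_gaut[OF shifted_perm(1)[OF h(2)] pm h(3)])
  thus ?thesis using that by (simp add: e act_def)
qed

text \<open>Multiplying all diagonal entries by the inverse of the last one leaves the label map
  unchanged, by \<open>T_shift\<close>, and brings the data into the normal form used by
  \<open>act\<close>.\<close>

lemma gaut_act:
  assumes f: "gaut f" and e2: "elementary_2_group T \<Longrightarrow> k \<ge> 3"
  obtains s where "s \<in> carrier S" "realizes f (act s)"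
proof -
  obtain p x \<alpha> \<epsilon> where h: "bij_betw p {..<k} {..<k}" "\<And>i. i < k \<Longrightarrow> x i \<in> tc" "\<alpha> \<in> Aut" "\<epsilon> \<in> {0, 1}"
    "realizes f (lab p x \<alpha> \<epsilon>)"
    using gaut_realizes_lab[OF f e2] by blast
  have pk: "p i < k" if "i < k" for i using bij_betwE[OF h(1)] that by simp
  define w where "w = inv (x (k - 1))"
  have w: "w \<in> tc" using h(2) k_pos by (simp add: w_def)
  define \<pi> where "\<pi> i = (if i \<in> {1..k} then Suc (p (i - 1)) else i)" for i
  define y where "y = (\<lambda>i\<in>{1..k - 1}. x (i - 1) \<otimes> w)"
  have \<pi>: "\<pi> permutes {1..k}"
  proof (rule bij_imp_permutes)
    have "inj_on \<pi> {1..k}"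
    proof (rule inj_onI)
      fix i j assume ij: "i \<in> {1..k}" "j \<in> {1..k}" "\<pi> i = \<pi> j"
      hence "p (i - 1) = p (j - 1)" by (simp add: \<pi>_def)
      hence "i - 1 = j - 1" using inj_on_eq_iff[OF bij_betw_imp_inj_on[OF h(1)], of "i - 1" "j - 1"] ij by auto
      thus "i = j" using ij by auto
    qed
    moreover have "\<pi> ` {1..k} \<subseteq> {1..k}" using pk by (auto simp: \<pi>_def Suc_le_eq)
    ultimately show "bij_betw \<pi> {1..k} {1..k}" using endo_inj_surj[of "{1..k}" \<pi>] by (simp add: bij_betw_def)
  qed (auto simp: \<pi>_def)
  have y: "y \<in> carrier (group_power T (k - 1))"
    unfolding group_power_def carrier_product_group y_def using h(2) w by auto
  have py: "pad k y (Suc i) = x i \<otimes> w" if "i < k" for i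
  proof (cases "Suc i < k")
    case True
    thus ?thesis by (auto simp: pad_def y_def)
  next
    case False
    hence "k = Suc i" using that by simp
    thus ?thesis using h(2)[OF that] by (simp add: pad_def w_def)
  qed
  have "realizes f (act (y, \<pi>, \<alpha>, \<epsilon>))"
  proof (rule realizes_cong[OF h(5)])
    fix z assume "z \<in> lbl"
    then obtain i j t where z: "z = (i, j, t)" "i < k" "j < k" "t \<in> tc" by (cases z) auto
    have \<pi>i: "\<pi> (Suc i) - 1 = p i" "\<pi> (Suc j) - 1 = p j" using z by (simp_all add: \<pi>_def)
    have "twist \<alpha> \<epsilon> t \<in> tc" by (rule hom_in_carrier[OF twist_Aut(1)[OF h(3)] z(4)])
    hence shift: "x (p i) \<otimes> w \<otimes> twist \<alpha> \<epsilon> t \<otimes> inv (x (p j) \<otimes> w) = x (p i) \<otimes> twist \<alpha> \<epsilon> t \<otimes> inv (x (p j))"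
      using T_shift[of "x (p i)" "x (p j)" \<one> \<one> "twist \<alpha> \<epsilon> t" w] h(2)[OF pk[OF z(2)]] h(2)[OF pk[OF z(3)]] w by simp
    show "lab p x \<alpha> \<epsilon> z = act (y, \<pi>, \<alpha>, \<epsilon>) z"
      unfolding z(1) act_def prod.case lab_twist \<pi>i py[OF pk[OF z(2)]] py[OF pk[OF z(3)]] shift ..
  qed
  moreover have "(y, \<pi>, \<alpha>, \<epsilon>) \<in> carrier S" unfolding S_carrier using y \<pi> h(3,4) by blast
  ultimately show ?thesis using that by blast
qed

end

section \<open>The isomorphism with the Weyl group\<close>

context fine_grading begin

abbreviation G where "G \<equiv> grading_aut_group L (G_tilde_0 T k) \<Gamma>"

lemma G_carrier: "carrier G = Collect gaut"
  by (rule Set.set_eqI) (simp add: grading_aut_group_def gaut_def)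

lemma gaut_Bij: "gaut f \<Longrightarrow> f \<in> Bij (carrier L)"
  by (simp add: gaut_def alg_automorphisms_def)

lemma G_mult: "gaut f \<Longrightarrow> gaut g \<Longrightarrow> f \<otimes>\<^bsub>G\<^esub> g = compose (carrier L) f g"
  using gaut_Bij by (simp add: grading_aut_group_def BijGroup_def)

lemma component_subset: "C \<in> components \<Longrightarrow> C \<subseteq> carrier L"
  by (auto simp: components_label CmpL_eq carrier_L)

lemma gaut_fixing:
  assumes "f \<in> alg_automorphisms L" "\<And>C. C \<in> components \<Longrightarrow> f ` C = C" shows "gaut f"
  unfolding gaut_def using assms by (simp cong: image_cong)

lemma id_alg: "(\<lambda>v\<in>carrier L. v) \<in> alg_automorphisms L"
  by (auto simp: alg_automorphisms_def id_Bij L_mult_closed) (auto simp: carrier_L cls_add cls_smult)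

lemma gaut_inv:
  assumes f: "gaut f" shows "gaut (\<lambda>v\<in>carrier L. inv_into (carrier L) f v)"
proof -
  define g where "g = (\<lambda>v\<in>carrier L. inv_into (carrier L) f v)"
  have gB: "g \<in> Bij (carrier L)" unfolding g_def by (rule restrict_inv_into_Bij[OF gaut_Bij[OF f]])
  have gc: "g v \<in> carrier L" "f (g v) = v" "g (f v) = v" if "v \<in> carrier L" for v
    using that gaut_bij[OF f] by (auto simp: g_def bij_betw_def inv_into_into f_inv_into_f)
  have L: "\<And>u v. u \<in> carrier L \<Longrightarrow> v \<in> carrier L \<Longrightarrow> u \<oplus>\<^bsub>L\<^esub> v \<in> carrier L"
    "\<And>c u. u \<in> carrier L \<Longrightarrow> c \<odot>\<^bsub>L\<^esub> u \<in> carrier L"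
    by (auto simp: carrier_L cls_add cls_smult)
  have fm: "f (x \<oplus>\<^bsub>L\<^esub> y) = f x \<oplus>\<^bsub>L\<^esub> f y" "f (c \<odot>\<^bsub>L\<^esub> x) = c \<odot>\<^bsub>L\<^esub> f x" "f (x \<otimes>\<^bsub>L\<^esub> y) = f x \<otimes>\<^bsub>L\<^esub> f y"
    if "x \<in> carrier L" "y \<in> carrier L" for x y c
    using f that by (auto simp: gaut_def alg_automorphisms_def)
  have "g (x \<oplus>\<^bsub>L\<^esub> y) = g x \<oplus>\<^bsub>L\<^esub> g y" "g (c \<odot>\<^bsub>L\<^esub> x) = c \<odot>\<^bsub>L\<^esub> g x" "g (x \<otimes>\<^bsub>L\<^esub> y) = g x \<otimes>\<^bsub>L\<^esub> g y"
    if xy: "x \<in> carrier L" "y \<in> carrier L" for x y c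
  proof -
    note c = gc(1)[OF xy(1)] gc(1)[OF xy(2)]
    show "g (x \<oplus>\<^bsub>L\<^esub> y) = g x \<oplus>\<^bsub>L\<^esub> g y" using gc(3)[OF L(1)[OF c]] fm(1)[OF c] gc(2)[OF xy(1)] gc(2)[OF xy(2)] by simp
    show "g (c \<odot>\<^bsub>L\<^esub> x) = c \<odot>\<^bsub>L\<^esub> g x" using gc(3)[OF L(2)[OF c(1)]] fm(2)[OF c(1,1)] gc(2)[OF xy(1)] by simp
    show "g (x \<otimes>\<^bsub>L\<^esub> y) = g x \<otimes>\<^bsub>L\<^esub> g y"
      using gc(3)[OF L_mult_closed[OF c]] fm(3)[OF c] gc(2)[OF xy(1)] gc(2)[OF xy(2)] by simp
  qed
  hence alg: "g \<in> alg_automorphisms L" using gB by (simp add: alg_automorphisms_def)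
  have gf: "g ` f ` C = C" if "C \<in> components" for C
  proof -
    have "C \<subseteq> carrier L" by (rule component_subset[OF that])
    thus ?thesis using gc(3) by (force simp: image_image)
  qed
  have "(\<lambda>C. g ` C) ` components = (\<lambda>C. g ` C) ` (\<lambda>C. f ` C) ` components" using f by (simp add: gaut_def)
  also have "\<dots> = components" using gf by (simp add: image_image cong: image_cong)
  finally have "(\<lambda>C. g ` C) ` components = components" .
  thus ?thesis using alg unfolding gaut_def g_def by blast
qed

lemma G_group: "group G"
proof -
  have "subgroup (Collect gaut) (BijGroup (carrier L))"
  proof (rule subgroup.intro)
    show "Collect gaut \<subseteq> carrier (BijGroup (carrier L))" using gaut_Bij by (auto simp: BijGroup_def)
    fix f g assume fg: "f \<in> Collect gaut" "g \<in> Collect gaut"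
    thus "f \<otimes>\<^bsub>BijGroup (carrier L)\<^esub> g \<in> Collect gaut" using gaut_comp gaut_Bij by (simp add: BijGroup_def)
  next
    have "(\<lambda>v. if v \<in> carrier L then v else undefined) ` C = C" if "C \<in> components" for C
      using component_subset[OF that] by force
    thus "\<one>\<^bsub>BijGroup (carrier L)\<^esub> \<in> Collect gaut"
      using gaut_fixing[OF id_alg] by (simp add: BijGroup_def restrict_def)
  next
    fix f assume "f \<in> Collect gaut"
    thus "inv\<^bsub>BijGroup (carrier L)\<^esub> f \<in> Collect gaut" using gaut_inv gaut_Bij by (simp add: inv_BijGroup)
  qed
  from subgroup.subgroup_is_group[OF this group_BijGroup] have "group (BijGroup (carrier L)\<lparr>carrier := carrier G\<rparr>)"
    unfolding G_carrier .
  thus ?thesis by (simp add: grading_aut_group_def)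
qed

text \<open>First isomorphism theorem for the map sending a grading automorphism to the element of
  \<open>S\<close> that it realises; existence comes from \<open>gaut_act\<close>, uniqueness from
  \<open>act_faithful\<close>. Its kernel consists of the automorphisms fixing every component,
  which is the stabiliser.\<close>

lemma weyl_group_iso:
  assumes e2: "elementary_2_group T \<Longrightarrow> k \<ge> 3"
  shows "weyl_group L (G_tilde_0 T k) \<Gamma> \<cong> S"
proof -
  interpret G: group G by (rule G_group)
  define h where "h f = (SOME s. s \<in> carrier S \<and> realizes f (act s))" for f
  have h: "h f \<in> carrier S" "realizes f (act (h f))" if f: "gaut f" for f
  proof -
    obtain s where "s \<in> carrier S" "realizes f (act s)" using gaut_act[OF f e2] by blast
    hence "\<exists>s. s \<in> carrier S \<and> realizes f (act s)" by blast
    from someI_ex[OF this] show "h f \<in> carrier S" "realizes f (act (h f))" unfolding h_def by blast+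
  qed
  have hI: "h f = s" if "gaut f" "s \<in> carrier S" "realizes f (act s)" for f s
    using act_faithful[OF e2 h(1)[OF that(1)] that(2) h(2)[OF that(1)] that(3)] .
  have one: "\<one>\<^bsub>S\<^esub> \<in> carrier S"
    unfolding S_one S_carrier using id_Aut by (auto simp: group_power_def permutes_id)
  have hmult: "h (f \<otimes>\<^bsub>G\<^esub> g) = h f \<otimes>\<^bsub>S\<^esub> h g" if "gaut f" "gaut g" for f g
  proof (rule hI)
    show "gaut (f \<otimes>\<^bsub>G\<^esub> g)" using that gaut_comp by (simp add: G_mult)
    show "h f \<otimes>\<^bsub>S\<^esub> h g \<in> carrier S" using that h(1) by (intro S_mult_carrier)
    have "realizes (compose (carrier L) f g) (act (h f) \<circ> act (h g))"
      using that h act_mem by (intro realizes_comp) auto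
    thus "realizes (f \<otimes>\<^bsub>G\<^esub> g) (act (h f \<otimes>\<^bsub>S\<^esub> h g))"
      unfolding G_mult[OF that] by (rule realizes_cong) (simp only: o_apply S_mult_carrier(2)[OF h(1)[OF that(1)] h(1)[OF that(2)]])
  qed
  have hom: "h \<in> hom G S" unfolding hom_def G_carrier using h(1) hmult by auto
  have img: "h ` carrier G = carrier S"
  proof (intro subset_antisym subsetI)
    fix s assume s: "s \<in> carrier S"
    then obtain f where "gaut f" "realizes f (act s)" using act_gaut by blast
    thus "s \<in> h ` carrier G" using hI[OF _ s] by (intro image_eqI[of _ _ f]) (auto simp: G_carrier)
  qed (use h(1) G_carrier in auto)
  have ker: "h f = \<one>\<^bsub>S\<^esub> \<longleftrightarrow> (\<forall>C\<in>components. f ` C = C)" if f: "gaut f" for f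
  proof
    assume "h f = \<one>\<^bsub>S\<^esub>"
    hence "realizes f (\<lambda>z. z)" using realizes_cong[OF h(2)[OF f]] act_one by simp
    hence fx: "f ` CmpL x = CmpL x" if "x \<in> lbl" for x using that by (simp add: realizes_def)
    show "\<forall>C\<in>components. f ` C = C"
    proof
      fix C assume "C \<in> components"
      then obtain x where "x \<in> lbl" "C = CmpL x" unfolding components_label by blast
      thus "f ` C = C" using fx by simp
    qed
  next
    assume fixed: "\<forall>C\<in>components. f ` C = C"
    have "realizes f (act \<one>\<^bsub>S\<^esub>)" unfolding realizes_def
    proof
      fix z assume z: "z \<in> lbl"
      have "f ` CmpL z = CmpL z"
      \<comment> \<open>Zero spaces are not among the components but are covered by
        \<open>realizes\<close>, so they are treated separately.\<close>
      proof (cases "CmpL z = {\<zero>\<^bsub>L\<^esub>}")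
        case True thus ?thesis using gaut_zero[OF f] by simp
      next
        case False
        have "CmpL z \<in> components" unfolding components_label by (rule bexI[OF _ z]) (simp only: False simp_thms)
        thus ?thesis using fixed by simp
      qed
      thus "f ` CmpL z = CmpL (act \<one>\<^bsub>S\<^esub> z)" using act_one[OF z] by simp
    qed
    thus "h f = \<one>\<^bsub>S\<^esub>" by (rule hI[OF f one])
  qed
  have kernel: "kernel G S h = grading_stab L (G_tilde_0 T k) \<Gamma>"
    unfolding kernel_def grading_stab_def G_carrier using ker gaut_fixing by (auto simp: gaut_def)
  have "h \<one>\<^bsub>G\<^esub> = \<one>\<^bsub>S\<^esub>"
  proof -
    have "\<one>\<^bsub>G\<^esub> \<in> carrier G" by simp
    hence "gaut \<one>\<^bsub>G\<^esub>" unfolding G_carrier by simp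
    moreover have "\<one>\<^bsub>G\<^esub> ` C = C" if "C \<in> components" for C
    proof -
      have "\<one>\<^bsub>G\<^esub> = (\<lambda>v\<in>carrier L. v)" by (simp add: grading_aut_group_def BijGroup_def)
      moreover have "(\<lambda>v\<in>carrier L. v) ` C = (\<lambda>v. v) ` C"
        by (rule image_cong) (use component_subset[OF that] in auto)
      ultimately show ?thesis by simp
    qed
    ultimately show ?thesis using ker by simp
  qed
  \<comment> \<open>The group axioms for \<open>S\<close> are not verified from its formulas:
    \<open>S\<close> is the image of a group under a map compatible with multiplication.\<close>
  hence "group S" using G.hom_imp_img_group[OF hom] img by (simp add: semidirect_def)
  then interpret group_hom G S h
    using hom by (intro group_hom.intro group_hom_axioms.intro G.group_axioms)
  show ?thesis using FactGroup_iso[OF img] unfolding weyl_group_def kernel .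
qed

end

theorem theorem4p6:
  fixes T :: "('a, 'c) monoid_scheme"
    and \<beta> :: "'a \<Rightarrow> 'a \<Rightarrow> 'f::alg_closed_field"
    and n k r :: nat
    and a b :: "nat \<Rightarrow> 'a"
  assumes "CHAR('f) \<noteq> 2"
    and "n \<ge> 3"
    and "CHAR('f) = 3 \<Longrightarrow> n \<ge> 4"
    and "comm_group T"
    and "finite (carrier T)"
    and "nondegenerate_alternating_bicharacter T \<beta>"
    and "symplectic_basis T \<beta> r a b"
    and "k \<ge> 1"
    and "real k * sqrt (real (card (carrier T))) = real n"
    and "elementary_2_group T \<Longrightarrow> k \<ge> 3"
  shows "weyl_group (psl TYPE('f) n) (G_tilde_0 T k) (Gamma_A_I T \<beta> k r a b) \<cong>
    semidirect (group_power T (k - 1)) (sym_group k \<times>\<times> Aut_bar T \<beta> r a b)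
      (reduced_power_act T k r a b)"
proof -
  interpret T: comm_group T by fact
  interpret fine_grading T \<beta> r a b k by unfold_locales fact+
  \<comment> \<open>The product \<open>N\<close> of the orders of the \<open>a i\<close> is the
    square root of the order of \<open>T\<close>, so the given size is \<open>k * N\<close>.\<close>
  have "real (k * N) = real n" using assms(9) by (simp add: card_T real_sqrt_mult)
  hence "n = k * N" by (simp only: of_nat_eq_iff)
  thus ?thesis using weyl_group_iso[OF assms(10)] by simp
qed

end
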